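(* Let $n\ge2$, let $\mathbb F\supseteq\mathbb R$ be a real closed field with an order-compatible valuation $\upsilon$ (assumed to be $-\log|\cdot|$ if $\mathbb F=\mathbb R$), and let $\rho:\pi_1(S)\to\mathrm{PSL}(n,\mathbb F)$ be $\mathbb F$-positive. Then for every $k=1,\dots,n-1$ there exists a geodesic current $\mu^k_\rho$ on $S$ such that for every $e\ne\gamma\in\pi_1(S)$ $$i(\mu^k_\rho,\gamma)=L_k(\rho(\gamma)).$$ The current $\mu_\rho^k$ is non-zero if and only if there exists $\gamma\in\pi_1(S)$ with $\upsilon(|\mathrm{tr}(\rho(\gamma))|)<0$.
   Context: **Surface.** $S$ is a closed, connected, oriented surface of genus $g\ge 2$ with an auxiliary hyperbolic structure, universal cover $\tilde S\cong\mathbb H^2$ and circle at infinity $\partial_\infty\tilde S\cong\mathbb S^1$, cyclically ordered (clockwise) and acted on by $\pi_1(S)$. $\mathrm{Fix}(S)\subseteq\partial_\infty\tilde S$ is the set of fixed points of non-trivial elements of $\pi_1(S)$. **Geodesic currents.** Let $\mathcal G$ be the space of unoriented, unparametrized geodesics of $\tilde S$. A geodesic current on $S$ is a locally finite, $\pi_1(S)$-invariant, regular Borel measure on $\mathcal G$. The intersection form is $i(\mu,\eta)=(\mu\times\eta)(\mathcal G^{(2)}/\pi_1(S))$, where $\mathcal G^{(2)}\subseteq\mathcal G\times\mathcal G$ is the set of pairs of transversely intersecting geodesics. A non-trivial $\gamma\in\pi_1(S)$ is viewed as the geodesic current given by the sum of Dirac masses at the lifts of the closed geodesic it represents (counted with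 multiplicity $m$ if $\gamma$ is an $m$-th power of a primitive element). **Valuations and lengths.** A valuation on $\mathbb F$ is a map $\upsilon:\mathbb F\to\mathbb R\cup\{\infty\}$ such that $e^{-\upsilon}$ is a (multiplicative) norm satisfying the triangle inequality; it is order-compatible if $0<x\le y$ implies $\upsilon(x)\ge\upsilon(y)$. $\mathrm{PSL}(n,\mathbb F)$ is $\mathrm{SL}(n,\mathbb F)$ modulo its centre; $|\mathrm{tr}(g)|$ for $g\in\mathrm{PSL}(n,\mathbb F)$ is the absolute value of the trace of a lift to $\mathrm{SL}(n,\mathbb F)$. For an $\mathbb F$-positive $\rho$ and $\gamma\neq e$, some lift of $g=\rho(\gamma)$ to $\mathrm{SL}(n,\mathbb F)$ has eigenvalues $\lambda_1(g)>\dots>\lambda_n(g)>0$ in $\mathbb F$, and the $k$-length is $$L_k(g)=-\sum_{j=1}^k\upsilon(\lambda_j(g))+\sum_{j=n-k+1}^n\upsilon(\lambda_j(g)).$$ **Flags.** A (full) flag in $\mathbb F^n$ is $E=(E^{(1)}\subset\dots\subset E^{(n-1)})$ with $\dim E^{(a)}=a$; put $E^{(0)}=0$, $E^{(n)}=\mathbb F^n$. A $k$-tuple $(E_1,\dots,E_k)$ of flags is transverse if $E_1^{(a_1)}+\dots+E_k^{(a_k)}=\mathbb F^n$ whenever $a_i\in\{0,\dots,n\}$ and $\sum a_i=n$. For a flag $E$ choose non-zero $e^{(a)}\in\bigwedge^aE^{(a)}\subseteq\bigwedge^a\mathbb F^n$ (similarly $f^{(a)},g^{(a)},h^{(a)}$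 for $F,G,H$). For a transverse triple and integers $a,b,c\ge1$ with $a+b+c=n$, $$T_{abc}(E,F,G)=\frac{e^{(a+1)}\wedge f^{(b)}\wedge g^{(c-1)}}{e^{(a-1)}\wedge f^{(b)}\wedge g^{(c+1)}}\cdot\frac{e^{(a)}\wedge f^{(b-1)}\wedge g^{(c+1)}}{e^{(a)}\wedge f^{(b+1)}\wedge g^{(c-1)}}\cdot\frac{e^{(a-1)}\wedge f^{(b+1)}\wedge g^{(c)}}{e^{(a+1)}\wedge f^{(b-1)}\wedge g^{(c)}}.$$ For a transverse quadruple and $1\le a\le n-1$, $$D_a(E,F,G,H)=-\frac{e^{(a)}\wedge f^{(n-a-1)}\wedge g^{(1)}}{e^{(a)}\wedge f^{(n-a-1)}\wedge h^{(1)}}\cdot\frac{e^{(a-1)}\wedge f^{(n-a)}\wedge h^{(1)}}{e^{(a-1)}\wedge f^{(n-a)}\wedge g^{(1)}}.$$ A triple of flags is positive if it is transverse and all its triple ratios are positive. A quadruple $(E,F,G,H)$ is positive if it is transverse, $(E,F,G)$ and $(E,G,H)$ are positive, and all $D_a(E,G,F,H)$ are positive. **$\mathbb F$-positive representations.** A map from $\mathrm{Fix}(S)$ to the set $\mathrm{Flag}(\mathbb F^n)$ of flags is positive if it sends every triple, resp. quadruple, of distinct points in clockwise cyclic order to a positive triple, resp. quadruple. $\rho$ is $\mathbb F$-positive if there is a (not necessarily continuous) $\rho$-equivariant positive map $\mathrm{Fix}(S)\to\mathrm{Flag}(\mathbb F^n)$. *)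

theory Defs
  imports
    "HOL-Analysis.Analysis"
    "HOL-Algebra.Coset"
    "HOL-Algebra.Bij"
begin

section \<open>Closed hyperbolic surfaces\<close>

text \<open>
  The universal cover with its hyperbolic structure is the Poincare disc \<open>ball 0 1\<close>, its circle at
  infinity is \<open>sphere 0 1\<close>.  Orientation-preserving isometries are the Moebius transformations
  coming from \<open>SU(1,1)\<close>.  They are taken as extensional functions on the closed disc (where their
  denominator does not vanish), so that they live in the group \<open>BijGroup (cball 0 1)\<close>.
\<close>

definition SU11 :: "(complex \<times> complex) set" where
  "SU11 = {(a, b). (cmod a)\<^sup>2 - (cmod b)\<^sup>2 = 1}"

definition moebius_disc :: "complex \<times> complex \<Rightarrow> complex \<Rightarrow> complex" where
  "moebius_disc = (\<lambda>(a, b). \<lambda>z \<in> cball 0 1. (a * z + b) / (cnj b * z + cnj a))"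

definition disc_isometries :: "(complex \<Rightarrow> complex) set" where
  "disc_isometries = moebius_disc ` SU11"

text \<open>
  A closed, connected, oriented surface with a hyperbolic structure is \<open>ball 0 1\<close> modulo a group
  of orientation-preserving isometries acting freely, properly discontinuously and cocompactly;
  the group is the fundamental group in its deck action.  By Gauss-Bonnet such a quotient has
  genus at least 2, and by uniformization every closed surface of genus at least 2 with a
  hyperbolic structure arises in this way.
\<close>

definition closed_surface_group :: "(complex \<Rightarrow> complex) set \<Rightarrow> bool" where
  "closed_surface_group \<Gamma> \<longleftrightarrow>
     subgroup \<Gamma> (BijGroup (cball 0 1)) \<and> \<Gamma> \<subseteq> disc_isometries \<and>
     (\<forall>f\<in>\<Gamma>. (\<exists>z\<in>ball 0 1. f z = z) \<longrightarrow> f = \<one>\<^bsub>BijGroup (cball 0 1)\<^esub>) \<and>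
     (\<forall>K. compact K \<and> K \<subseteq> ball 0 1 \<longrightarrow> finite {f \<in> \<Gamma>. f ` K \<inter> K \<noteq> {}}) \<and>
     (\<exists>K. compact K \<and> K \<subseteq> ball 0 1 \<and> (\<Union>f\<in>\<Gamma>. f ` K) = ball 0 1)"

definition pi1 :: "(complex \<Rightarrow> complex) set \<Rightarrow> (complex \<Rightarrow> complex) monoid" where
  "pi1 \<Gamma> = (BijGroup (cball 0 1))\<lparr>carrier := \<Gamma>\<rparr>"

definition Fix :: "(complex \<Rightarrow> complex) set \<Rightarrow> complex set" where
  "Fix \<Gamma> = {x \<in> sphere 0 1. \<exists>f\<in>\<Gamma>. f \<noteq> \<one>\<^bsub>pi1 \<Gamma>\<^esub> \<and> f x = x}"

definition clockwise3 :: "complex \<Rightarrow> complex \<Rightarrow> complex \<Rightarrow> bool" where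
  "clockwise3 x y z \<longleftrightarrow>
     (\<exists>r s t::real. x = cis r \<and> y = cis s \<and> z = cis t \<and> r > s \<and> s > t \<and> t > r - 2 * pi)"

definition clockwise4 :: "complex \<Rightarrow> complex \<Rightarrow> complex \<Rightarrow> complex \<Rightarrow> bool" where
  "clockwise4 x y z w \<longleftrightarrow>
     (\<exists>r s t u::real. x = cis r \<and> y = cis s \<and> z = cis t \<and> w = cis u \<and>
        r > s \<and> s > t \<and> t > u \<and> u > r - 2 * pi)"

section \<open>Geodesic currents and the intersection form\<close>

text \<open>Complete geodesics are the images of the diameter \<open>(-1, 1)\<close> under isometries.\<close>

definition geodesic_of :: "complex \<times> complex \<Rightarrow> complex set" where
  "geodesic_of p = moebius_disc p ` complex_of_real ` {-1<..<1}"

definition geodesics :: "complex set set" where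
  "geodesics = geodesic_of ` SU11"

text \<open>
  The isometry group acts transitively on unoriented geodesics; the space of geodesics carries the
  quotient topology (equivalently, that of unordered pairs of distinct points of the circle).
\<close>

definition geodesic_space :: "complex set topology" where
  "geodesic_space = topology (\<lambda>U. U \<subseteq> geodesics \<and>
     openin (top_of_set SU11) {p \<in> SU11. geodesic_of p \<in> U})"

lemma openin_geodesic_space:
  "openin geodesic_space U \<longleftrightarrow>
     U \<subseteq> geodesics \<and> openin (top_of_set SU11) {p \<in> SU11. geodesic_of p \<in> U}"
proof -
  have eq: "{p \<in> SU11. geodesic_of p \<in> V} = SU11 \<inter> geodesic_of -` V" for V by blast
  have "istopology (\<lambda>U. U \<subseteq> geodesics \<and> openin (top_of_set SU11) (SU11 \<inter> geodesic_of -` U))"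
    unfolding istopology_def
  proof (intro conjI allI impI)
    fix S T
    assume S: "S \<subseteq> geodesics \<and> openin (top_of_set SU11) (SU11 \<inter> geodesic_of -` S)"
      and T: "T \<subseteq> geodesics \<and> openin (top_of_set SU11) (SU11 \<inter> geodesic_of -` T)"
    have "SU11 \<inter> geodesic_of -` (S \<inter> T) =
        (SU11 \<inter> geodesic_of -` S) \<inter> (SU11 \<inter> geodesic_of -` T)" by blast
    then show "openin (top_of_set SU11) (SU11 \<inter> geodesic_of -` (S \<inter> T))"
      using openin_Int[OF conjunct2[OF S] conjunct2[OF T]] by (simp only:)
    show "S \<inter> T \<subseteq> geodesics" using S by blast
  next
    fix \<K>
    assume K: "\<forall>V\<in>\<K>. V \<subseteq> geodesics \<and> openin (top_of_set SU11) (SU11 \<inter> geodesic_of -` V)"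
    have "openin (top_of_set SU11) (\<Union>V\<in>\<K>. SU11 \<inter> geodesic_of -` V)"
      by (rule openin_Union) (use K in blast)
    moreover have "(\<Union>V\<in>\<K>. SU11 \<inter> geodesic_of -` V) = SU11 \<inter> geodesic_of -` \<Union>\<K>" by blast
    ultimately show "openin (top_of_set SU11) (SU11 \<inter> geodesic_of -` \<Union>\<K>)" by (simp only:)
    show "\<Union>\<K> \<subseteq> geodesics" using K by blast
  qed
  then show ?thesis by (simp only: geodesic_space_def eq topology_inverse')
qed

lemma topspace_geodesic_space: "topspace geodesic_space = geodesics"
proof (rule subset_antisym)
  show "topspace geodesic_space \<subseteq> geodesics"
    using openin_topspace[of geodesic_space] by (simp only: openin_geodesic_space)
  have "{p \<in> SU11. geodesic_of p \<in> geodesics} = SU11" by (auto simp: geodesics_def)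
  then have "openin geodesic_space geodesics"
    by (simp only: openin_geodesic_space openin_subtopology_self subset_refl simp_thms)
  then show "geodesics \<subseteq> topspace geodesic_space" by (rule openin_subset)
qed

definition geodesic_borel :: "complex set measure" where
  "geodesic_borel = sigma geodesics {U. openin geodesic_space U}"

definition geodesic_current :: "(complex \<Rightarrow> complex) set \<Rightarrow> complex set measure \<Rightarrow> bool" where
  "geodesic_current \<Gamma> \<mu> \<longleftrightarrow>
     sets \<mu> = sets geodesic_borel \<and>
     (\<forall>l\<in>geodesics. \<exists>U. openin geodesic_space U \<and> l \<in> U \<and> emeasure \<mu> U < \<infinity>) \<and>
     (\<forall>f\<in>\<Gamma>. \<forall>B\<in>sets \<mu>. emeasure \<mu> ((`) f ` B) = emeasure \<mu> B) \<and>
     (\<forall>B\<in>sets \<mu>. emeasure \<mu> B = (INF U\<in>{U. openin geodesic_space U \<and> B \<subseteq> U}. emeasure \<mu> U) \<and>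
        emeasure \<mu> B = (SUP K\<in>{K. compactin geodesic_space K \<and> K \<subseteq> B}. emeasure \<mu> K))"

text \<open>Two distinct geodesics of the hyperbolic plane that meet do so in one point, transversely.\<close>

definition transverse_pairs :: "(complex set \<times> complex set) set" where
  "transverse_pairs = {(l, m). l \<in> geodesics \<and> m \<in> geodesics \<and> l \<noteq> m \<and> l \<inter> m \<noteq> {}}"

definition pair_orbit ::
  "(complex \<Rightarrow> complex) set \<Rightarrow> complex set \<times> complex set \<Rightarrow> (complex set \<times> complex set) set" where
  "pair_orbit \<Gamma> = (\<lambda>(l, m). (\<lambda>f. (f ` l, f ` m)) ` \<Gamma>)"

text \<open>
  The group acts freely and properly discontinuously on \<open>transverse_pairs\<close>, and an invariant
  measure there descends to the measure on the quotient (not the push-forward) that gives the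
  image of a Borel set \<open>B\<close> on which the projection is injective the mass of \<open>B\<close>.  The mass of a
  set \<open>A\<close> of orbits is thus that of a Borel section over \<open>A\<close>, the largest such \<open>B\<close> over \<open>A\<close>.
\<close>

definition quotient_measure ::
  "(complex \<Rightarrow> complex) set \<Rightarrow> (complex set \<times> complex set) measure
    \<Rightarrow> (complex set \<times> complex set) set measure" where
  "quotient_measure \<Gamma> M =
     measure_of (pair_orbit \<Gamma> ` transverse_pairs)
       {A. A \<subseteq> pair_orbit \<Gamma> ` transverse_pairs \<and> \<Union>A \<in> sets M}
       (\<lambda>A. SUP B\<in>{B \<in> sets M. B \<subseteq> \<Union>A \<and> inj_on (pair_orbit \<Gamma>) B}. emeasure M B)"

definition intersection_form ::
  "(complex \<Rightarrow> complex) set \<Rightarrow> complex set measure \<Rightarrow> complex set measure \<Rightarrow> ennreal" where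
  "intersection_form \<Gamma> \<mu> \<eta> =
     emeasure (quotient_measure \<Gamma> (\<mu> \<Otimes>\<^sub>M \<eta>)) (pair_orbit \<Gamma> ` transverse_pairs)"

definition primitive_elt :: "(complex \<Rightarrow> complex) set \<Rightarrow> (complex \<Rightarrow> complex) \<Rightarrow> bool" where
  "primitive_elt \<Gamma> c \<longleftrightarrow>
     c \<in> \<Gamma> \<and> c \<noteq> \<one>\<^bsub>pi1 \<Gamma>\<^esub> \<and> (\<forall>d\<in>\<Gamma>. \<forall>m::nat. c = d [^]\<^bsub>pi1 \<Gamma>\<^esub> m \<longrightarrow> m = 1)"

definition power_multiplicity :: "(complex \<Rightarrow> complex) set \<Rightarrow> (complex \<Rightarrow> complex) \<Rightarrow> nat" where
  "power_multiplicity \<Gamma> c = (THE m. \<exists>d. primitive_elt \<Gamma> d \<and> c = d [^]\<^bsub>pi1 \<Gamma>\<^esub> m)"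

text \<open>
  The closed geodesic represented by \<open>c\<close> is the projection of the axis of \<open>c\<close>, the unique
  geodesic invariant under \<open>c\<close>; its lifts are the axes of the conjugates of \<open>c\<close>.
\<close>

definition geodesic_lifts ::
  "(complex \<Rightarrow> complex) set \<Rightarrow> (complex \<Rightarrow> complex) \<Rightarrow> complex set set" where
  "geodesic_lifts \<Gamma> c =
     {l \<in> geodesics. \<exists>d\<in>\<Gamma>. (d \<otimes>\<^bsub>pi1 \<Gamma>\<^esub> c \<otimes>\<^bsub>pi1 \<Gamma>\<^esub> inv\<^bsub>pi1 \<Gamma>\<^esub> d) ` l = l}"

definition curve_current ::
  "(complex \<Rightarrow> complex) set \<Rightarrow> (complex \<Rightarrow> complex) \<Rightarrow> complex set measure" where
  "curve_current \<Gamma> c =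
     scale_measure (of_nat (power_multiplicity \<Gamma> c))
       (distr (count_space (geodesic_lifts \<Gamma> c)) geodesic_borel (\<lambda>l. l))"

section \<open>Real closed valued fields\<close>

class real_closed_field = linordered_field +
  assumes nonneg_is_square: "0 \<le> x \<Longrightarrow> \<exists>y. x = y * y"
    and odd_degree_root: "odd m \<Longrightarrow> c m \<noteq> 0 \<Longrightarrow> \<exists>x. (\<Sum>i\<le>m. c i * x ^ i) = 0"

definition valuation_norm :: "('f \<Rightarrow> ereal) \<Rightarrow> 'f \<Rightarrow> real" where
  "valuation_norm \<upsilon> x = (if \<upsilon> x = \<infinity> then 0 else exp (- real_of_ereal (\<upsilon> x)))"

definition valuation :: "('f::field \<Rightarrow> ereal) \<Rightarrow> bool" where
  "valuation \<upsilon> \<longleftrightarrow>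
     (\<forall>x. \<upsilon> x \<noteq> -\<infinity>) \<and>
     (\<forall>x. valuation_norm \<upsilon> x = 0 \<longleftrightarrow> x = 0) \<and>
     (\<forall>x y. valuation_norm \<upsilon> (x * y) = valuation_norm \<upsilon> x * valuation_norm \<upsilon> y) \<and>
     (\<forall>x y. valuation_norm \<upsilon> (x + y) \<le> valuation_norm \<upsilon> x + valuation_norm \<upsilon> y)"

definition order_compatible :: "('f::linordered_field \<Rightarrow> ereal) \<Rightarrow> bool" where
  "order_compatible \<upsilon> \<longleftrightarrow> (\<forall>x y. 0 < x \<and> x \<le> y \<longrightarrow> \<upsilon> x \<ge> \<upsilon> y)"

section \<open>The projective special linear group and lengths\<close>

definition SL :: "('f::field ^ 'n::finite ^ 'n) monoid" where
  "SL = \<lparr>carrier = {A. det A = 1}, mult = (**), one = mat 1\<rparr>"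

definition SL_center :: "('f::field ^ 'n::finite ^ 'n) set" where
  "SL_center = {A \<in> carrier SL. \<forall>B\<in>carrier SL. A ** B = B ** A}"

definition PSL :: "('f::field ^ 'n::finite ^ 'n) set monoid" where
  "PSL = SL Mod SL_center"

text \<open>
  An element of \<open>PSL\<close> is a coset, and its members are its lifts to \<open>SL\<close>.  Over an ordered field
  two lifts differ at most by a sign, so the choice of lift is immaterial for \<open>abs_trace\<close>.
\<close>

definition abs_trace :: "('f::linordered_field ^ 'n::finite ^ 'n) set \<Rightarrow> 'f" where
  "abs_trace g = \<bar>trace (SOME A. A \<in> g)\<bar>"

definition is_pos_spectrum :: "('f::linordered_field ^ 'n::finite ^ 'n) set \<Rightarrow> 'f list \<Rightarrow> bool" where
  "is_pos_spectrum g ls \<longleftrightarrow>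
     length ls = CARD('n) \<and> sorted_wrt (>) ls \<and> (\<forall>l\<in>set ls. l > 0) \<and>
     (\<exists>A\<in>g. \<forall>l\<in>set ls. \<exists>v. v \<noteq> 0 \<and> A *v v = l *s v)"

definition pos_eigenvalue :: "('f::linordered_field ^ 'n::finite ^ 'n) set \<Rightarrow> nat \<Rightarrow> 'f" where
  "pos_eigenvalue g j = (THE ls. is_pos_spectrum g ls) ! (j - 1)"

definition k_length ::
  "('f::linordered_field \<Rightarrow> ereal) \<Rightarrow> nat \<Rightarrow> ('f ^ 'n::finite ^ 'n) set \<Rightarrow> ereal" where
  "k_length \<upsilon> k g =
     - (\<Sum>j=1..k. \<upsilon> (pos_eigenvalue g j)) +
       (\<Sum>j=CARD('n)-k+1..CARD('n). \<upsilon> (pos_eigenvalue g j))"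

section \<open>Flags and positivity\<close>

text \<open>
  A flag is indexed by all natural numbers, with \<open>E 0 = {0}\<close> and \<open>E a\<close> the whole space for
  \<open>a \<ge> n\<close>, so that equality of flags is equality of functions.
\<close>

definition is_flag :: "(nat \<Rightarrow> ('f::field ^ 'n::finite) set) \<Rightarrow> bool" where
  "is_flag E \<longleftrightarrow> mono E \<and> (\<forall>a. vec.subspace (E a) \<and> vec.dim (E a) = min a CARD('n))"

definition flag_act ::
  "('f::field ^ 'n::finite ^ 'n) set \<Rightarrow> (nat \<Rightarrow> ('f ^ 'n) set) \<Rightarrow> nat \<Rightarrow> ('f ^ 'n) set" where
  "flag_act g E = (\<lambda>a. (*v) (SOME A. A \<in> g) ` E a)"

definition transverse_flags :: "(nat \<Rightarrow> ('f::field ^ 'n::finite) set) list \<Rightarrow> bool" where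
  "transverse_flags Es \<longleftrightarrow>
     (\<forall>as. length as = length Es \<and> (\<forall>a\<in>set as. a \<le> CARD('n)) \<and> sum_list as = CARD('n) \<longrightarrow>
        {\<Sum>i<length Es. v i | v. \<forall>i<length Es. v i \<in> (Es ! i) (as ! i)} = UNIV)"

text \<open>
  A non-zero element of the top exterior power of \<open>E a\<close> is \<open>v\<^sub>1 \<and> \<dots> \<and> v\<^sub>a\<close> for a basis
  \<open>v\<^sub>1, \<dots>, v\<^sub>a\<close> of \<open>E a\<close>; \<open>flag_basis\<close> chooses one.  The wedge of \<open>n\<close> vectors lies in the
  one-dimensional \<open>n\<close>-th exterior power of the space, which is identified with the field by
  the determinant.  The ordering \<open>coord_pos\<close> of the coordinates only affects the sign of that
  identification, which cancels in all ratios below.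
\<close>

definition flag_basis :: "(nat \<Rightarrow> ('f::field ^ 'n::finite) set) \<Rightarrow> nat \<Rightarrow> ('f ^ 'n) list" where
  "flag_basis E a =
     (SOME vs. length vs = a \<and> distinct vs \<and> set vs \<subseteq> E a \<and> vec.independent (set vs))"

definition coord_pos :: "'n::finite \<Rightarrow> nat" where
  "coord_pos = (SOME f. bij_betw f UNIV {..<CARD('n)})"

definition top_wedge :: "('f::field ^ 'n::finite) list \<Rightarrow> 'f" where
  "top_wedge vs = det (\<chi> i. vs ! coord_pos i)"

definition wedge3 ::
  "(nat \<Rightarrow> ('f::field ^ 'n::finite) set) \<Rightarrow> (nat \<Rightarrow> ('f ^ 'n) set) \<Rightarrow> (nat \<Rightarrow> ('f ^ 'n) set)
    \<Rightarrow> nat \<Rightarrow> nat \<Rightarrow> nat \<Rightarrow> 'f" where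
  "wedge3 E F G a b c = top_wedge (flag_basis E a @ flag_basis F b @ flag_basis G c)"

definition triple_ratio ::
  "nat \<Rightarrow> nat \<Rightarrow> nat \<Rightarrow> (nat \<Rightarrow> ('f::field ^ 'n::finite) set) \<Rightarrow> (nat \<Rightarrow> ('f ^ 'n) set)
    \<Rightarrow> (nat \<Rightarrow> ('f ^ 'n) set) \<Rightarrow> 'f" where
  "triple_ratio a b c E F G =
     wedge3 E F G (a+1) b (c-1) / wedge3 E F G (a-1) b (c+1) *
     (wedge3 E F G a (b-1) (c+1) / wedge3 E F G a (b+1) (c-1)) *
     (wedge3 E F G (a-1) (b+1) c / wedge3 E F G (a+1) (b-1) c)"

definition double_ratio ::
  "nat \<Rightarrow> (nat \<Rightarrow> ('f::field ^ 'n::finite) set) \<Rightarrow> (nat \<Rightarrow> ('f ^ 'n) set)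
    \<Rightarrow> (nat \<Rightarrow> ('f ^ 'n) set) \<Rightarrow> (nat \<Rightarrow> ('f ^ 'n) set) \<Rightarrow> 'f" where
  "double_ratio a E F G H =
     - (wedge3 E F G a (CARD('n)-a-1) 1 / wedge3 E F H a (CARD('n)-a-1) 1 *
        (wedge3 E F H (a-1) (CARD('n)-a) 1 / wedge3 E F G (a-1) (CARD('n)-a) 1))"

definition positive_triple ::
  "(nat \<Rightarrow> ('f::linordered_field ^ 'n::finite) set) \<Rightarrow> (nat \<Rightarrow> ('f ^ 'n) set)
    \<Rightarrow> (nat \<Rightarrow> ('f ^ 'n) set) \<Rightarrow> bool" where
  "positive_triple E F G \<longleftrightarrow>
     transverse_flags [E, F, G] \<and>
     (\<forall>a b c. a \<ge> 1 \<and> b \<ge> 1 \<and> c \<ge> 1 \<and> a + b + c = CARD('n) \<longrightarrow> triple_ratio a b c E F G > 0)"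

definition positive_quadruple ::
  "(nat \<Rightarrow> ('f::linordered_field ^ 'n::finite) set) \<Rightarrow> (nat \<Rightarrow> ('f ^ 'n) set)
    \<Rightarrow> (nat \<Rightarrow> ('f ^ 'n) set) \<Rightarrow> (nat \<Rightarrow> ('f ^ 'n) set) \<Rightarrow> bool" where
  "positive_quadruple E F G H \<longleftrightarrow>
     transverse_flags [E, F, G, H] \<and> positive_triple E F G \<and> positive_triple E G H \<and>
     (\<forall>a\<in>{1..CARD('n)-1}. double_ratio a E G F H > 0)"

definition positive_map ::
  "complex set \<Rightarrow> (complex \<Rightarrow> nat \<Rightarrow> ('f::linordered_field ^ 'n::finite) set) \<Rightarrow> bool" where
  "positive_map X \<xi> \<longleftrightarrow>
     (\<forall>x\<in>X. is_flag (\<xi> x)) \<and>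
     (\<forall>x\<in>X. \<forall>y\<in>X. \<forall>z\<in>X. clockwise3 x y z \<longrightarrow> positive_triple (\<xi> x) (\<xi> y) (\<xi> z)) \<and>
     (\<forall>x\<in>X. \<forall>y\<in>X. \<forall>z\<in>X. \<forall>w\<in>X. clockwise4 x y z w \<longrightarrow>
        positive_quadruple (\<xi> x) (\<xi> y) (\<xi> z) (\<xi> w))"

definition positive_representation ::
  "(complex \<Rightarrow> complex) set
    \<Rightarrow> ((complex \<Rightarrow> complex) \<Rightarrow> ('f::linordered_field ^ 'n::finite ^ 'n) set) \<Rightarrow> bool" where
  "positive_representation \<Gamma> \<rho> \<longleftrightarrow>
     \<rho> \<in> hom (pi1 \<Gamma>) PSL \<and>
     (\<exists>\<xi>. positive_map (Fix \<Gamma>) \<xi> \<and>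
        (\<forall>f\<in>\<Gamma>. \<forall>x\<in>Fix \<Gamma>. \<xi> (f x) = flag_act (\<rho> f) (\<xi> x)))"

end

theory Submission imports Defs "HOL-Real_Asymp.Real_Asymp" begin

text \<open>
  A positive quadruple of flags has generalised cross ratios at least 1: rescaling the flags makes all
  top wedges of their members positive, and the cross ratio telescopes into elementary ones.  Applied
  to the equivariant map, minus the valuation of the cross ratio is a nonnegative, additive,
  \<open>\<Gamma>\<close>-invariant content of boxes in the space of geodesics whose vertices lie in the dense
  countable set \<open>Fix \<Gamma>\<close>.  This content determines a measure, which need not give every box its
  content but is sandwiched by it: open boxes have at most, closed boxes at least their content.
  Over one period of the axis of a group element the cross ratio is the quotient of the products of
  the largest and of the smallest eigenvalues, and comparing many periods with one removes the
  ambiguity of the sandwich.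

  If all lengths vanish the zero current does.  Otherwise the current is nonzero because some
  intersection number is, and a nonzero length forces a trace of negative valuation.
\<close>

section \<open>Flags and their cross ratios\<close>

text \<open>The boundary map may be discontinuous, so countable additivity of the content is not
  guaranteed and no extension theorem applies directly. Instead an interval as long as the content
  of a box is subdivided along with the box by all cuts through the countable vertex set, and
  Lebesgue measure is pushed forward to the limits of the nested cells. Mass on the edge of a box
  may land on either side of it, whence the sandwich; by density of the vertices it still determines
  the measure, and this uniqueness yields invariance under \<open>\<Gamma>\<close>. Geodesics are
  unoriented, but exchanging the endpoints turns \<open>k\<close> into \<open>CARD('n) - k\<close>.
  The content is therefore averaged over both orders; the lengths survive because determinant 1
  gives both orders the same period. The zero current is chosen in the degenerate case so that
  vanishing of the constructed measure is not an issue. The trace criterion then asks that the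
  dimension have norm at most 1: over the reals the degenerate case cannot occur, and any larger
  field has an element above all integers, which bounds the powers of the dimension.\<close>

lemma bij_coord_pos: "bij_betw (coord_pos :: 'n::finite => nat) UNIV {..<CARD('n)}"
proof -
 have "\<exists>f. bij_betw f (UNIV :: 'n set) {..<CARD('n)}"
  using ex_bij_betw_finite_nat[of "UNIV :: 'n set"] by (simp add: atLeast0LessThan)
 thus ?thesis unfolding coord_pos_def by (rule someI_ex)
qed

lemma coord_pos_less: "coord_pos (i :: 'n::finite) < CARD('n)"
 using bij_betwE[OF bij_coord_pos] by blast

lemma ex_coord_pos: "k < CARD('n) ==> \<exists>i::'n::finite. coord_pos i = k"
 using bij_coord_pos[where 'n='n] unfolding bij_betw_def by (metis imageE lessThan_iff)

lemma coord_pos_inj: "coord_pos (i :: 'n::finite) = coord_pos j \<longleftrightarrow> i = j"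
 using bij_coord_pos[where 'n='n] unfolding bij_betw_def inj_on_def by blast

text \<open>Exhibiting one slot as one row of a matrix, with the other rows in \<open>c\<close>
  independent of \<open>v\<close>, makes the row rules of \<open>det\<close> applicable to
  lists.\<close>

lemma top_wedge_at:
 fixes xs ys :: "('f::field ^ 'n::finite) list"
 assumes "length xs + length ys + 1 = CARD('n)"
 obtains k c where "\<And>v. top_wedge (xs @ v # ys) = det (\<chi> i. if i = k then v else c i)"
proof -
 obtain k :: 'n where k: "coord_pos k = length xs"
  using ex_coord_pos[of "length xs", where 'n='n] assms by auto
 define c where "c i = (xs @ 0 # ys) ! coord_pos i" for i :: 'n
 have "(xs @ v # ys) ! coord_pos i = (if i = k then v else c i)" for v i
  using coord_pos_inj[of i k] k by (cases "i = k") (simp_all add: c_def nth_append nth_Cons')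
 hence "top_wedge (xs @ v # ys) = det (\<chi> i. if i = k then v else c i)" for v
  by (simp only: top_wedge_def)
 thus ?thesis by (rule that[of k c])
qed

lemma top_wedge_add:
 fixes xs ys :: "('f::field ^ 'n::finite) list"
 assumes "length xs + length ys + 1 = CARD('n)"
 shows "top_wedge (xs @ (u + v) # ys) = top_wedge (xs @ u # ys) + top_wedge (xs @ v # ys)"
proof -
 obtain k c where "\<And>v. top_wedge (xs @ v # ys) = det (\<chi> i. if i = k then v else c i)"
  using top_wedge_at[OF assms] by blast
 thus ?thesis by (simp only: det_row_add)
qed

lemma top_wedge_scale:
 fixes xs ys :: "('f::field ^ 'n::finite) list"
 assumes "length xs + length ys + 1 = CARD('n)"
 shows "top_wedge (xs @ (a *s u) # ys) = a * top_wedge (xs @ u # ys)"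
proof -
 obtain k c where "\<And>v. top_wedge (xs @ v # ys) = det (\<chi> i. if i = k then v else c i)"
  using top_wedge_at[OF assms] by blast
 thus ?thesis by (simp only: det_row_mul)
qed

lemma top_wedge_diff:
 fixes xs ys :: "('f::field ^ 'n::finite) list"
 assumes "length xs + length ys + 1 = CARD('n)"
 shows "top_wedge (xs @ (u - v) # ys) = top_wedge (xs @ u # ys) - top_wedge (xs @ v # ys)"
 using top_wedge_add[OF assms, of u "(-1) *s v"] top_wedge_scale[OF assms, of "-1" v] by simp

lemma rows_top_wedge:
 fixes vs :: "('f::field ^ 'n::finite) list"
 assumes "length vs = CARD('n)"
 shows "rows (\<chi> i::'n. vs ! coord_pos i) = set vs"
proof -
 have "row i (\<chi> i::'n. vs ! coord_pos i) = vs ! coord_pos i" for i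
  by (simp add: row_def vec_eq_iff)
 hence "rows (\<chi> i::'n. vs ! coord_pos i) = (\<lambda>i::'n. vs ! coord_pos i) ` UNIV"
  by (auto simp: rows_def)
 also have "\<dots> = (!) vs ` {..<CARD('n)}"
  using bij_coord_pos[where 'n='n] unfolding bij_betw_def by (metis image_image)
 also have "\<dots> = set vs" using assms by (auto simp: set_conv_nth)
 finally show ?thesis .
qed

lemma top_wedge_dependent:
 fixes vs :: "('f::field ^ 'n::finite) list"
 assumes "length vs = CARD('n)" "vec.dependent (set vs)"
 shows "top_wedge vs = 0"
 unfolding top_wedge_def using det_dependent_rows rows_top_wedge assms by metis

lemma top_wedge_not_distinct:
 fixes vs :: "('f::field ^ 'n::finite) list"
 assumes "length vs = CARD('n)" "\<not> distinct vs"
 shows "top_wedge vs = 0"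
proof -
 obtain p q where pq: "p < length vs" "q < length vs" "p ~= q" "vs ! p = vs ! q"
  using assms(2) by (auto simp: distinct_conv_nth)
 obtain i j :: 'n where ij: "coord_pos i = p" "coord_pos j = q"
  using ex_coord_pos pq assms(1) by metis
 have "row i (\<chi> i::'n. vs ! coord_pos i) = row j (\<chi> i::'n. vs ! coord_pos i)"
  using ij pq by (simp add: row_def vec_eq_iff)
 moreover have "i ~= j" using ij pq by auto
 ultimately show ?thesis unfolding top_wedge_def by (rule det_identical_rows[rotated])
qed

lemma top_wedge_nonzero:
 fixes vs :: "('f::field ^ 'n::finite) list"
 assumes "length vs = CARD('n)" "vec.span (set vs) = UNIV"
 shows "top_wedge vs ~= 0"
proof -
 let ?A = "\<chi> i::'n. vs ! coord_pos i"
 have "vec.span (rows ?A) = UNIV" using assms rows_top_wedge by metis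
 hence "\<exists>B. B ** ?A = mat 1" unfolding matrix_left_invertible_span_rows_gen .
 hence "invertible ?A" using invertible_def matrix_left_right_inverse by metis
 thus ?thesis unfolding top_wedge_def invertible_det_nz .
qed

lemma top_wedge_nonzeroD:
 fixes vs :: "('f::field ^ 'n::finite) list"
 assumes "length vs = CARD('n)" "top_wedge vs ~= 0"
 shows "distinct vs" "vec.independent (set vs)" "vec.span (set vs) = UNIV"
proof -
 show "distinct vs" "vec.independent (set vs)"
  using top_wedge_not_distinct top_wedge_dependent assms by blast+
 thus "vec.span (set vs) = UNIV"
  using vec.card_eq_dim[of "set vs" UNIV] assms(1) by (auto simp: distinct_card vec.dim_UNIV card_cart_basis)
qed

lemma top_wedge_span_zero:
 fixes xs ys :: "('f::field ^ 'n::finite) list"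
 assumes "length xs + length ys + 1 = CARD('n)" "u \<in> vec.span (set xs \<union> set ys)"
 shows "top_wedge (xs @ u # ys) = 0"
proof (rule ccontr)
 assume nz: "top_wedge (xs @ u # ys) ~= 0"
 have len: "length (xs @ u # ys) = CARD('n)" using assms by simp
 have d: "distinct (xs @ u # ys)" and i: "vec.independent (insert u (set xs \<union> set ys))"
  using top_wedge_nonzeroD[OF len nz] by auto
 hence "u \<notin> set xs \<union> set ys" by auto
 thus False using i assms(2) by (simp add: vec.independent_insert)
qed

lemma top_wedge_span_diff:
 fixes xs ys :: "('f::field ^ 'n::finite) list"
 assumes "length xs + length ys + 1 = CARD('n)" "u - v \<in> vec.span (set xs \<union> set ys)"
 shows "top_wedge (xs @ u # ys) = top_wedge (xs @ v # ys)"
 using top_wedge_span_zero[OF assms] top_wedge_diff[OF assms(1), of u v] by simp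

lemma top_wedge_swap:
 fixes xs ys :: "('f::field ^ 'n::finite) list"
 assumes "length xs + length ys + 2 = CARD('n)"
 shows "top_wedge (xs @ u # v # ys) = - top_wedge (xs @ v # u # ys)"
proof -
 have z: "top_wedge (xs @ w # w # ys) = 0" for w
  using assms by (intro top_wedge_not_distinct) auto
 have a: "top_wedge (xs @ (u + v) # w # ys) = top_wedge (xs @ u # w # ys) + top_wedge (xs @ v # w # ys)" for w
  using top_wedge_add[of xs "w # ys" u v] assms by simp
 have b: "top_wedge (xs @ w # (u + v) # ys) = top_wedge (xs @ w # u # ys) + top_wedge (xs @ w # v # ys)" for w
  using top_wedge_add[of "xs @ [w]" "ys" u v] assms by simp
 show ?thesis using z[of "u + v"] z[of u] z[of v] unfolding a b
  by (simp add: add_eq_0_iff)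
qed

lemma top_wedge_move:
 fixes xs ys :: "('f::field ^ 'n::finite) list"
 assumes "length xs + length ys + length zs + 1 = CARD('n)"
 shows "top_wedge (xs @ u # ys @ zs) = (-1) ^ length ys * top_wedge (xs @ ys @ u # zs)"
 using assms
proof (induction ys arbitrary: xs)
 case (Cons y ys)
 have "top_wedge (xs @ u # (y # ys) @ zs) = - top_wedge ((xs @ [y]) @ u # ys @ zs)"
  using top_wedge_swap[of xs "ys @ zs" u y] Cons.prems by simp
 also have "\<dots> = - ((-1) ^ length ys * top_wedge ((xs @ [y]) @ ys @ u # zs))"
  using Cons.IH[of "xs @ [y]"] Cons.prems by simp
 finally show ?case by simp
qed simp

lemma top_wedge_block_swap:
 fixes xs ys :: "('f::field ^ 'n::finite) list"
 assumes "length xs + length ys + length zs + length ws = CARD('n)"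
 shows "top_wedge (xs @ ys @ zs @ ws) = (-1) ^ (length ys * length zs) * top_wedge (xs @ zs @ ys @ ws)"
 using assms
proof (induction ys arbitrary: xs)
 case (Cons y ys)
 have "top_wedge (xs @ (y # ys) @ zs @ ws) = (-1) ^ (length ys * length zs) * top_wedge (xs @ y # zs @ ys @ ws)"
  using Cons.IH[of "xs @ [y]"] Cons.prems by simp
 also have "top_wedge (xs @ y # zs @ ys @ ws) = (-1) ^ length zs * top_wedge (xs @ zs @ y # ys @ ws)"
  using top_wedge_move[of xs zs "ys @ ws" y] Cons.prems by simp
 finally show ?case by (simp add: power_add mult_ac)
qed simp

lemma top_wedge_map:
 fixes vs :: "('f::field ^ 'n::finite) list"
 assumes "length vs = CARD('n)"
 shows "top_wedge (map ((*v) A) vs) = det A * top_wedge vs"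
proof -
 have "(\<chi> i::'n. map ((*v) A) vs ! coord_pos i) = (\<chi> i::'n. vs ! coord_pos i) ** transpose A"
  using coord_pos_less[where 'n='n] assms
  by (auto simp: vec_eq_iff matrix_matrix_mult_def matrix_vector_mult_def transpose_def mult_ac intro!: sum.cong)
 thus ?thesis unfolding top_wedge_def by (simp add: det_mul mult.commute)
qed

text \<open>Modulo the span of \<open>L\<close> only two dimensions are left, so the wedge with
  \<open>L\<close> is an alternating form \<open>B\<close> on a plane. If it is non-zero, each of
  its values is a 2 by 2 determinant of coordinates times \<open>B x0 y0\<close>, and the relation
  is the classical identity between such minors.\<close>

lemma Pluecker:
 fixes L :: "('f::field ^ 'n::finite) list"
 assumes len: "length L + 2 = CARD('n)"
 shows "top_wedge (L @ [e, g]) * top_wedge (L @ [f, h]) =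
  top_wedge (L @ [e, f]) * top_wedge (L @ [g, h]) + top_wedge (L @ [e, h]) * top_wedge (L @ [f, g])"
proof (cases "\<forall>x y. top_wedge (L @ [x, y]) = 0")
 case False
 define B where "B x y = top_wedge (L @ [x, y])" for x y
 from False obtain x0 y0 where nz: "B x0 y0 ~= 0" by (auto simp: B_def)
 have addl: "B (x + y) z = B x z + B y z" and scl: "B (a *s x) z = a * B x z" for x y z a
  using top_wedge_add[of L "[z]" x y] top_wedge_scale[of L "[z]" a x] len by (simp_all add: B_def)
 have alt: "B x y = - B y x" for x y
  using top_wedge_swap[of L "[]" x y] len by (simp add: B_def)
 have zero: "B x y = 0" if "x \<in> vec.span (set L)" for x y
  using top_wedge_span_zero[of L "[y]" x] len that vec.span_mono[of "set L" "set L \<union> {y}"]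
  by (auto simp: B_def)
 have BB: "B x x = 0" for x
  using top_wedge_not_distinct[of "L @ [x,x]"] len by (simp add: B_def)
 have "vec.span (set (L @ [x0, y0])) = UNIV"
  using top_wedge_nonzeroD(3)[of "L @ [x0, y0]"] nz len by (simp add: B_def)
 hence sp: "vec.span (insert x0 (insert y0 (set L))) = UNIV"
  by (simp add: insert_commute)
 have coord: "\<exists>a b l. v = a *s x0 + (b *s y0 + l) \<and> l \<in> vec.span (set L)" for v
 proof -
  have "v \<in> vec.span (insert x0 (insert y0 (set L)))" using sp by simp
  then obtain a where "v - a *s x0 \<in> vec.span (insert y0 (set L))" by (auto simp: vec.span_insert)
  then obtain b where b: "v - a *s x0 - b *s y0 \<in> vec.span (set L)" by (auto simp: vec.span_insert)
  have "v = a *s x0 + (b *s y0 + (v - a *s x0 - b *s y0))" by (simp add: algebra_simps)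
  thus ?thesis using b by blast
 qed
 have form: "\<exists>a b. \<forall>w. B v w = a * B x0 w + b * B y0 w" for v
 proof -
  obtain a b l where "v = a *s x0 + (b *s y0 + l)" "l \<in> vec.span (set L)" using coord by blast
  hence "B v w = a * B x0 w + b * B y0 w" for w by (simp add: addl scl zero)
  thus ?thesis by blast
 qed
 obtain ae be where e: "\<forall>z. B e z = ae * B x0 z + be * B y0 z" using form by blast
 obtain af bf where f: "\<forall>z. B f z = af * B x0 z + bf * B y0 z" using form by blast
 obtain ag bg where g: "\<forall>z. B g z = ag * B x0 z + bg * B y0 z" using form by blast
 obtain ah bh where h: "\<forall>z. B h z = ah * B x0 z + bh * B y0 z" using form by blast
 have r: "B v w = (a * d - b * c) * B x0 y0"
  if "\<forall>z. B v z = a * B x0 z + b * B y0 z" "\<forall>z. B w z = c * B x0 z + d * B y0 z" for v w a b c d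
 proof -
  have "B x0 w = d * B x0 y0" "B y0 w = - c * B x0 y0"
   unfolding alt[of x0 w] alt[of y0 w] that(2)[rule_format] using BB alt[of y0 x0] by simp_all
  thus ?thesis using that(1) by (simp add: algebra_simps)
 qed
 have "B e g * B f h = B e f * B g h + B e h * B f g"
  unfolding r[OF e g] r[OF f h] r[OF e f] r[OF g h] r[OF e h] r[OF f g] by (simp add: algebra_simps)
 thus ?thesis by (simp add: B_def)
qed simp

text \<open>Each factor may be altered by combinations of vectors that occur elsewhere in the wedge;
  the induction changes one factor at a time and moves it into \<open>q\<close>.\<close>

lemma top_wedge_cong_span:
 fixes p p' r vs :: "('f::field ^ 'n::finite) list"
 assumes "list_all2 (\<lambda>x y. x - y \<in> vec.span S) p p'" "S \<subseteq> set r \<union> set q"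
  and "length q + length p + length r = CARD('n)"
 shows "top_wedge (q @ p @ r) = top_wedge (q @ p' @ r)"
 using assms
proof (induction p p' arbitrary: q rule: list_all2_induct)
 case (Cons x p y p')
 have "x - y \<in> vec.span (set q \<union> set (p @ r))"
  using Cons.hyps(1) Cons.prems(1) vec.span_mono[of S "set q \<union> set (p @ r)"] by auto
 hence "top_wedge (q @ x # p @ r) = top_wedge (q @ y # p @ r)"
  using Cons.prems by (intro top_wedge_span_diff) auto
 also have "\<dots> = top_wedge (q @ y # p' @ r)"
  using Cons.IH[of "q @ [y]"] Cons.prems by auto
 finally show ?case by simp
qed simp

text \<open>One linear map carries \<open>ws\<close> to \<open>vs\<close> and induces the identity
  modulo their common span, so it does not affect the other factors of the wedge. Its determinant is
  the scalar, which is why the scalar does not depend on the context \<open>p\<close>,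
  \<open>r\<close>.\<close>

lemma top_wedge_change_basis_ex:
 fixes vs ws :: "('f::field ^ 'n::finite) list"
 assumes len: "length ws = length vs" and ind: "distinct ws" "vec.independent (set ws)"
  and sp: "vec.span (set vs) = vec.span (set ws)"
 shows "\<exists>c. \<forall>p r. length p + length vs + length r = CARD('n) \<longrightarrow>
  top_wedge (p @ vs @ r) = c * top_wedge (p @ ws @ r)"
proof -
 define B where "B = vec.extend_basis (set ws)"
 have B: "set ws \<subseteq> B" "vec.independent B" "vec.span B = UNIV"
  using ind vec.extend_basis_superset vec.independent_extend_basis vec.span_extend_basis
  by (auto simp: B_def)
 define f where "f x = (if x \<in> set ws then vs ! (THE i. i < length ws \<and> ws ! i = x) else x)" for x
 have f_ws: "f (ws ! i) = vs ! i" if "i < length ws" for i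
 proof -
  have "(THE j. j < length ws \<and> ws ! j = ws ! i) = i"
   using that ind(1) by (auto simp: nth_eq_iff_index_eq)
  thus ?thesis using that by (simp add: f_def)
 qed
 obtain g where g: "Vector_Spaces.linear (*s) (*s) g" "\<And>x. x \<in> B ==> g x = f x"
  using vec.linear_independent_extend[OF B(2), of f] by blast
 have map_ws: "map g ws = vs"
  using f_ws g(2) B(1) len by (intro nth_equalityI) (auto simp: subset_iff)
 have diff: "g x - x \<in> vec.span (set vs)" for x
 proof -
  have "x \<in> vec.span B" using B(3) by simp
  thus ?thesis
  proof (induction rule: vec.span_induct_alt)
   case base
   show ?case using vec.linear_0[OF g(1)] vec.span_zero by simp
  next
   case (step c x y)
   have "g x - x \<in> vec.span (set vs)"
   proof (cases "x \<in> set ws")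
    case True
    then obtain i where i: "i < length ws" "x = ws ! i" by (metis in_set_conv_nth)
    have "g x = vs ! i" using f_ws[OF i(1)] g(2)[of x] B(1) True i(2) by auto
    hence "g x \<in> vec.span (set vs)" using i len by (simp add: vec.span_base)
    moreover have "x \<in> vec.span (set vs)" using True sp by (simp add: vec.span_base)
    ultimately show ?thesis by (rule vec.span_diff)
   next
    case False
    thus ?thesis using g(2)[OF step(1)] vec.span_zero by (simp add: f_def)
   qed
   hence "c *s (g x - x) + (g y - y) \<in> vec.span (set vs)"
    using step by (intro vec.span_add vec.span_scale)
   moreover have "g (c *s x + y) - (c *s x + y) = c *s (g x - x) + (g y - y)"
    using vec.linear_add[OF g(1)] vec.linear_scale[OF g(1)]
    by (simp add: vec.scale_right_diff_distrib add_diff_add)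
   ultimately show ?case by (simp only:)
  qed
 qed
 define A where "A = matrix g"
 have A: "(*v) A = g" using g(1) by (auto simp: A_def matrix_works)
 have "top_wedge (p @ vs @ r) = det A * top_wedge (p @ ws @ r)"
  if l: "length p + length vs + length r = CARD('n)" for p r
 proof -
  have d: "list_all2 (\<lambda>x y. x - y \<in> vec.span (set vs)) (map g q) q" for q
   using diff by (simp add: list_all2_conv_all_nth)
  have "det A * top_wedge (p @ ws @ r) = top_wedge (map g p @ vs @ map g r)"
   using top_wedge_map[of "p @ ws @ r" A] l len map_ws by (simp add: A)
  also have "\<dots> = top_wedge (p @ vs @ map g r)"
   using top_wedge_cong_span[OF d[of p], of "vs @ map g r" "[]"] l by simp
  also have "\<dots> = top_wedge (p @ vs @ r)"
   using top_wedge_cong_span[OF d[of r], of "[]" "p @ vs"] l by simp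
  finally show ?thesis by simp
 qed
 thus ?thesis by blast
qed

lemma independent_complete_list:
 fixes vs :: "('f::field ^ 'n::finite) list"
 assumes "distinct vs" "vec.independent (set vs)"
 obtains r where "length vs + length r = CARD('n)" "top_wedge (vs @ r) ~= 0"
proof -
 define B where "B = vec.extend_basis (set vs)"
 have B: "set vs \<subseteq> B" "vec.independent B" "vec.span B = UNIV"
  using assms vec.extend_basis_superset vec.independent_extend_basis vec.span_extend_basis
  by (auto simp: B_def)
 have fin: "finite B" using B(2) vec.finiteI_independent by blast
 then obtain r where r: "set r = B - set vs" "distinct r" using finite_distinct_list[of "B - set vs"] by auto
 have "card B = CARD('n)" using vec.dim_eq_card[of B UNIV] B by (simp add: vec.dim_UNIV card_cart_basis)
 moreover have s: "set (vs @ r) = B" using r B(1) by auto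
 moreover have "distinct (vs @ r)" using r assms by auto
 ultimately have l: "length (vs @ r) = CARD('n)" using distinct_card by metis
 hence "top_wedge (vs @ r) ~= 0" using top_wedge_nonzero[of "vs @ r"] s B(3) by simp
 thus ?thesis using that l by simp
qed

lemma top_wedge_change_basis:
 fixes vs ws :: "('f::field ^ 'n::finite) list"
 assumes len: "length ws = length vs" and ws: "distinct ws" "vec.independent (set ws)"
  and vs: "distinct vs" "vec.independent (set vs)"
  and sp: "vec.span (set vs) = vec.span (set ws)"
 obtains c where "c ~= 0" "\<And>p r. length p + length vs + length r = CARD('n) ==>
  top_wedge (p @ vs @ r) = c * top_wedge (p @ ws @ r)"
proof -
 obtain c where c: "\<forall>p r. length p + length vs + length r = CARD('n) \<longrightarrow>
  top_wedge (p @ vs @ r) = c * top_wedge (p @ ws @ r)"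
  using top_wedge_change_basis_ex[OF len ws sp] by blast
 \<comment> \<open>Completing \<open>vs\<close> to a basis gives a context in which the wedge is
   non-zero, and this excludes \<open>c = 0\<close>.\<close>
 obtain r where r: "length vs + length r = CARD('n)" "top_wedge (vs @ r) ~= 0"
  using independent_complete_list[OF vs] .
 have "c ~= 0" using c[rule_format, of "[]" r] r by auto
 thus ?thesis using c that by blast
qed

lemma flag_basis:
 fixes E :: "nat => ('f::field ^ 'n::finite) set"
 assumes E: "is_flag E" and a: "a <= CARD('n)"
 shows "length (flag_basis E a) = a" "distinct (flag_basis E a)"
  "vec.independent (set (flag_basis E a))" "vec.span (set (flag_basis E a)) = E a"
proof -
 have sub: "vec.subspace (E a)" and dim: "vec.dim (E a) = a"
  using E a by (auto simp: is_flag_def)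
 obtain B where B: "B \<subseteq> E a" "vec.independent B" "E a \<subseteq> vec.span B" "card B = vec.dim (E a)"
  by (rule vec.basis_exists)
 have "finite B" using B(2) vec.finiteI_independent by blast
 then obtain vs where vs: "set vs = B" "distinct vs" using finite_distinct_list by blast
 hence "length vs = a" using B(4) dim distinct_card[of vs] by simp
 hence "\<exists>vs. length vs = a \<and> distinct vs \<and> set vs \<subseteq> E a \<and> vec.independent (set vs)"
  using B vs by (intro exI[of _ vs]) simp
 hence *: "length (flag_basis E a) = a \<and> distinct (flag_basis E a) \<and>
   set (flag_basis E a) \<subseteq> E a \<and> vec.independent (set (flag_basis E a))"
  unfolding flag_basis_def by (rule someI_ex)
 thus "length (flag_basis E a) = a" "distinct (flag_basis E a)"
  "vec.independent (set (flag_basis E a))" by auto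
 have "vec.dim (E a) <= card (set (flag_basis E a))" using * dim by (simp add: distinct_card)
 hence "E a \<subseteq> vec.span (set (flag_basis E a))"
  using * vec.card_ge_dim_independent[of "set (flag_basis E a)" "E a"] by blast
 moreover have "vec.span (set (flag_basis E a)) \<subseteq> E a" using * sub by (intro vec.span_minimal) auto
 ultimately show "vec.span (set (flag_basis E a)) = E a" by blast
qed

lemma flag_basis_0: "is_flag E ==> flag_basis E 0 = []"
 using flag_basis(1)[of E 0] by simp

text \<open>\<open>flag_basis\<close> is an arbitrary choice. It is traded here for any spanning
  list of the right length at the price of a scalar that is the same in every context and therefore
  cancels in ratios. Independence of \<open>vs\<close> follows by counting dimensions.\<close>

lemma flag_basis_change:
 fixes E :: "nat => ('f::field ^ 'n::finite) set"
 assumes E: "is_flag E" "a <= CARD('n)" and vs: "length vs = a" "vec.span (set vs) = E a"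
 obtains c where "c ~= 0" "\<And>p r. length p + a + length r = CARD('n) ==>
  top_wedge (p @ flag_basis E a @ r) = c * top_wedge (p @ vs @ r)"
proof -
 have d: "vec.dim (vec.span (set vs)) = length vs" using E vs by (simp add: is_flag_def)
 hence c: "card (set vs) = length vs"
  using vec.dim_le_card'[of "set vs"] card_length[of vs] by (simp add: vec.dim_span)
 have "vec.independent (set vs)"
  using d c by (intro vec.card_le_dim_spanning[of "set vs" "vec.span (set vs)"]) (auto simp: vec.span_superset)
 moreover note flag_basis[OF E] card_distinct[OF c] vs
 ultimately obtain c where "c ~= 0" "\<And>p r. length p + length (flag_basis E a) + length r = CARD('n) ==>
  top_wedge (p @ flag_basis E a @ r) = c * top_wedge (p @ vs @ r)"
  using top_wedge_change_basis[of vs "flag_basis E a"] by metis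
 thus ?thesis using that flag_basis(1)[OF E] by simp
qed

lemma flag_span_Suc:
 fixes E :: "nat => ('f::field ^ 'n::finite) set"
 assumes E: "is_flag E" and a: "a < CARD('n)" and S: "vec.span S = E a" and x: "x \<in> E (Suc a)" "x \<notin> E a"
 shows "vec.span (insert x S) = E (Suc a)"
proof (rule vec.subspace_dim_equal[OF vec.subspace_span])
 have sub: "vec.subspace (E a)" and dim: "vec.dim (E a) = min a CARD('n)" and mono: "mono E" for a
  using E by (auto simp: is_flag_def)
 show "vec.subspace (E (Suc a))" by (rule sub)
 show "vec.span (insert x S) \<subseteq> E (Suc a)"
  using x vec.span_superset[of S] monoD[OF mono, of a "Suc a"] S by (intro vec.span_minimal sub) auto
 have "vec.dim (insert x S) = Suc (vec.dim S)" using x(2) S by (simp add: vec.dim_insert)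
 moreover have "vec.dim S = a" using dim[of a] a S vec.dim_span[of S] by simp
 ultimately show "vec.dim (E (Suc a)) <= vec.dim (vec.span (insert x S))"
  using dim[of "Suc a"] by (simp add: vec.dim_span)
qed

text \<open>A single new vector \<open>x\<close> separates consecutive steps of a flag, so wedges
  with neighbouring indices can be written with a common part.\<close>

lemma flag_basis_Suc:
 fixes E :: "nat => ('f::field ^ 'n::finite) set"
 assumes E: "is_flag E" and a: "a < CARD('n)"
 shows "\<exists>c x. \<forall>p r. length p + Suc a + length r = CARD('n) \<longrightarrow>
  top_wedge (p @ flag_basis E (Suc a) @ r) = c * top_wedge (p @ flag_basis E a @ x # r)"
proof -
 have "vec.dim (E a) ~= vec.dim (E (Suc a))" "E a \<subseteq> E (Suc a)" using E a by (auto simp: is_flag_def mono_def)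
 then obtain x where x: "x \<in> E (Suc a)" "x \<notin> E a" by (metis subsetI subset_antisym)
 note b = flag_basis[OF E less_imp_le[OF a]]
 have "length (flag_basis E a @ [x]) = Suc a" "vec.span (set (flag_basis E a @ [x])) = E (Suc a)"
  using flag_span_Suc[OF E a b(4) x] b(1) by simp_all
 from flag_basis_change[OF E Suc_leI[OF a] this] show ?thesis by (metis append.assoc append_Cons append_Nil)
qed

section \<open>The octahedron relation and the signs of wedges of four flags\<close>

definition quad_wedge :: "(nat => ('f::field ^ 'n::finite) set) => (nat => ('f ^ 'n) set) => (nat => ('f ^ 'n) set)
  => (nat => ('f ^ 'n) set) => nat => nat => nat => nat => 'f" where
 "quad_wedge E F G H a b c d = top_wedge (flag_basis E a @ flag_basis F b @ flag_basis G c @ flag_basis H d)"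

text \<open>This is the Pluecker relation for the common part \<open>A @ B @ C @ D\<close> and the
  four vectors \<open>x\<close>, \<open>y\<close>, \<open>z\<close>, \<open>w\<close> by which the
  flags grow. In each of the three products the scalars and the signs from moving these vectors to
  the end multiply to the same \<open>s\<close>.\<close>

lemma octahedron:
 fixes E F G H :: "nat => ('f::field ^ 'n::finite) set"
 assumes fl: "is_flag E" "is_flag F" "is_flag G" "is_flag H" and n: "a + b + c + d + 2 = CARD('n)"
 defines "Q \<equiv> quad_wedge E F G H"
 shows "Q (a+1) b (c+1) d * Q a (b+1) c (d+1) =
  Q (a+1) (b+1) c d * Q a b (c+1) (d+1) + Q (a+1) b c (d+1) * Q a (b+1) (c+1) d"
proof -
 define A B C D where "A = flag_basis E a" and "B = flag_basis F b" and "C = flag_basis G c" and "D = flag_basis H d"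
 have le: "a < CARD('n)" "b < CARD('n)" "c < CARD('n)" "d < CARD('n)" using n by auto
 obtain k1 x where x: "\<forall>p r. length p + Suc a + length r = CARD('n) \<longrightarrow>
  top_wedge (p @ flag_basis E (Suc a) @ r) = k1 * top_wedge (p @ A @ x # r)"
  using flag_basis_Suc[OF fl(1) le(1)] unfolding A_def by blast
 obtain k2 y where y: "\<forall>p r. length p + Suc b + length r = CARD('n) \<longrightarrow>
  top_wedge (p @ flag_basis F (Suc b) @ r) = k2 * top_wedge (p @ B @ y # r)"
  using flag_basis_Suc[OF fl(2) le(2)] unfolding B_def by blast
 obtain k3 z where z: "\<forall>p r. length p + Suc c + length r = CARD('n) \<longrightarrow>
  top_wedge (p @ flag_basis G (Suc c) @ r) = k3 * top_wedge (p @ C @ z # r)"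
  using flag_basis_Suc[OF fl(3) le(3)] unfolding C_def by blast
 obtain k4 w where w: "\<forall>p r. length p + Suc d + length r = CARD('n) \<longrightarrow>
  top_wedge (p @ flag_basis H (Suc d) @ r) = k4 * top_wedge (p @ D @ w # r)"
  using flag_basis_Suc[OF fl(4) le(4)] unfolding D_def by blast
 have l: "length A = a" "length B = b" "length C = c" "length D = d" "length (flag_basis F (Suc b)) = Suc b"
  "length (flag_basis G (Suc c)) = Suc c" "length (flag_basis H (Suc d)) = Suc d"
  using fl le by (auto simp: A_def B_def C_def D_def flag_basis(1))
 let ?L = "A @ B @ C @ D"
 note defs = Q_def quad_wedge_def A_def[symmetric] B_def[symmetric] C_def[symmetric] D_def[symmetric]
 have 1: "Q (a+1) b (c+1) d = k1 * k3 * ((-1) ^ (b+c+d) * (-1) ^ d * top_wedge (?L @ [x,z]))"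
  unfolding defs using x[rule_format, of "[]" "B @ flag_basis G (Suc c) @ D"] z[rule_format, of "A @ x # B" D]
   top_wedge_move[of "A @ x # B @ C" D "[]" z] top_wedge_move[of A "B @ C @ D" "[z]" x] l n by (simp add: add.assoc)
 have 2: "Q a (b+1) c (d+1) = k2 * k4 * ((-1) ^ (c+d) * top_wedge (?L @ [y,w]))"
  unfolding defs using y[rule_format, of A "C @ flag_basis H (Suc d)"] w[rule_format, of "A @ B @ y # C" "[]"]
   top_wedge_move[of "A @ B" "C @ D" "[w]" y] l n by simp
 have 3: "Q (a+1) (b+1) c d = k1 * k2 * ((-1) ^ (b+c+d) * (-1) ^ (c+d) * top_wedge (?L @ [x,y]))"
  unfolding defs using x[rule_format, of "[]" "flag_basis F (Suc b) @ C @ D"] y[rule_format, of "A @ [x]" "C @ D"]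
   top_wedge_move[of "A @ x # B" "C @ D" "[]" y] top_wedge_move[of A "B @ C @ D" "[y]" x] l n by (simp add: add.assoc)
 have 4: "Q a b (c+1) (d+1) = k3 * k4 * ((-1) ^ d * top_wedge (?L @ [z,w]))"
  unfolding defs using z[rule_format, of "A @ B" "flag_basis H (Suc d)"] w[rule_format, of "A @ B @ C @ [z]" "[]"]
   top_wedge_move[of "A @ B @ C" "D" "[w]" z] l n by simp
 have 5: "Q (a+1) b c (d+1) = k1 * k4 * ((-1) ^ (b+c+d) * top_wedge (?L @ [x,w]))"
  unfolding defs using x[rule_format, of "[]" "B @ C @ flag_basis H (Suc d)"] w[rule_format, of "A @ x # B @ C" "[]"]
   top_wedge_move[of A "B @ C @ D" "[w]" x] l n by (simp add: add.assoc)
 have 6: "Q a (b+1) (c+1) d = k2 * k3 * ((-1) ^ (c+d) * (-1) ^ d * top_wedge (?L @ [y,z]))"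
  unfolding defs using y[rule_format, of A "flag_basis G (Suc c) @ D"] z[rule_format, of "A @ B @ [y]" D]
   top_wedge_move[of "A @ B @ y # C" D "[]" z] top_wedge_move[of "A @ B" "C @ D" "[z]" y] l n by simp
 define s where "s = k1 * k2 * k3 * k4 * ((-1) ^ (b+c+d) * (-1) ^ (c+d) * (-1) ^ d)"
 have "Q (a+1) b (c+1) d * Q a (b+1) c (d+1) = s * (top_wedge (?L @ [x,z]) * top_wedge (?L @ [y,w]))"
  "Q (a+1) (b+1) c d * Q a b (c+1) (d+1) = s * (top_wedge (?L @ [x,y]) * top_wedge (?L @ [z,w]))"
  "Q (a+1) b c (d+1) * Q a (b+1) (c+1) d = s * (top_wedge (?L @ [x,w]) * top_wedge (?L @ [y,z]))"
  unfolding 1 2 3 4 5 6 s_def by (simp_all only: mult_ac)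
 thus ?thesis using Pluecker[of ?L x z y w] l n by (simp add: ring_distribs)
qed

text \<open>Positivity of all triple ratios means that the signs of the wedges are a product of signs
 depending on one index each: the signs on the layers \<open>c = 0\<close> and \<open>c = 1\<close> determine the factors,
 and each hexagon carries the identity from the layers \<open>c - 1\<close>, \<open>c\<close> to the layer \<open>c + 1\<close>.\<close>

lemma triple_gauge:
 fixes P :: "nat => nat => nat => 'f::linordered_field"
 assumes nz: "\<And>a b c. a + b + c = N ==> P a b c ~= 0"
  and hex: "\<And>a b c. a \<ge> 1 ==> b \<ge> 1 ==> c \<ge> 1 ==> a + b + c = N ==>
   P (a+1) b (c-1) / P (a-1) b (c+1) * (P a (b-1) (c+1) / P a (b+1) (c-1)) *
   (P (a-1) (b+1) c / P (a+1) (b-1) c) > 0"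
 obtains al be ga :: "nat => 'f"
 where "\<And>a. a <= N ==> al a * al a = 1" "\<And>a. a <= N ==> be a * be a = 1" "\<And>a. a <= N ==> ga a * ga a = 1"
  "\<And>a b c. a + b + c = N ==> sgn (P a b c) = al a * be b * ga c"
proof -
 define s where "s a b c = sgn (P a b c)" for a b c
 have ss: "s a b c * s a b c = 1" if "a + b + c = N" for a b c
  using nz[OF that] by (auto simp: s_def sgn_if)
 have m: "(x * y) * (x * y) = 1" if "x * x = 1" "y * y = 1" for x y :: 'f
  using that by (simp add: mult.assoc mult.left_commute[of y x])
 \<comment> \<open>With \<open>al 0\<close>, \<open>ga 0\<close> and \<open>ga 1\<close> normalised
   to 1, the layers \<open>c = 0\<close> and \<open>c = 1\<close> demand
   \<open>s (Suc i) b 0 = al (Suc i) * be b\<close> and \<open>s i b 1 = al i * be b\<close> for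
   \<open>b = N-1-i\<close>; their quotient is the factor from \<open>al i\<close> to
   \<open>al (Suc i)\<close>. Then \<open>be\<close> is read off the layer \<open>c = 0\<close> and
   \<open>ga\<close> off the edge \<open>a = 0\<close>.\<close>
 define al where "al a = (\<Prod>i<a. s i (N-1-i) 1 * s (Suc i) (N-1-i) 0)" for a
 define be where "be b = al (N-b) * s (N-b) b 0" for b
 define ga where "ga c = be (N-c) * s 0 (N-c) c" for c
 have al2: "al a * al a = 1" if "a <= N" for a
  using that
 proof (induction a)
  case (Suc a)
  thus ?case using ss[of a "N-1-a" 1] ss[of "Suc a" "N-1-a" 0] by (simp add: al_def m)
 qed (simp add: al_def)
 have be2: "be a * be a = 1" if "a <= N" for a
  using that al2[of "N-a"] ss[of "N-a" a 0] by (simp add: be_def m)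
 have ga2: "ga a * ga a = 1" if "a <= N" for a
  using that be2[of "N-a"] ss[of 0 "N-a" a] by (simp add: ga_def m)
 define r where "r a b c = al a * be b * ga c * s a b c" for a b c
 have al0: "al 0 = 1" by (simp add: al_def)
 have ga0: "ga 0 = 1" using ss[of 0 N 0] by (simp add: ga_def be_def al0)
 have c0: "r a b 0 = 1" if "a + b = N" for a b
 proof -
  have "N - b = a" using that by simp
  hence "r a b 0 = (al a * al a) * (s a b 0 * s a b 0)" by (simp add: r_def ga0 be_def)
  thus ?thesis using al2[of a] ss[of a b 0] that by simp
 qed
 have c1: "r a b 1 = 1" if "a + b + 1 = N" for a b
 proof -
  have alS: "al (Suc i) = al i * (s i (N-1-i) 1 * s (Suc i) (N-1-i) 0)" for i by (simp add: al_def)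
  have "ga 1 = (s 0 (N-1) 1 * s 0 (N-1) 1) * (s 1 (N-1) 0 * s 1 (N-1) 0)"
   using that alS[of 0] by (simp add: ga_def be_def al0)
  also have "\<dots> = 1" using that ss[of 0 "N-1" 1] ss[of 1 "N-1" 0] by simp
  finally have g: "ga 1 = 1" .
  have b: "N - b = Suc a" "N - 1 - a = b" using that by auto
  have alS': "al (Suc a) = al a * (s a b 1 * s (Suc a) b 0)" using alS[of a] b by simp
  have "r a b 1 = (al a * al a) * (s a b 1 * s a b 1) * (s (Suc a) b 0 * s (Suc a) b 0)"
   unfolding r_def g be_def b(1) alS' by (simp only: mult_ac mult_1_left mult_1_right)
  also have "\<dots> = 1" using that al2[of a] ss[of a b 1] ss[of "Suc a" b 0] by simp
  finally show ?thesis .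
 qed
 have hexr: "r (a+1) b (c-1) * r (a-1) b (c+1) * (r a (b-1) (c+1) * r a (b+1) (c-1)) *
   (r (a-1) (b+1) c * r (a+1) (b-1) c) = 1" if "a \<ge> 1" "b \<ge> 1" "c \<ge> 1" "a + b + c = N" for a b c
 proof -
  define H where "H = s (a+1) b (c-1) * s (a-1) b (c+1) * (s a (b-1) (c+1) * s a (b+1) (c-1)) *
   (s (a-1) (b+1) c * s (a+1) (b-1) c)"
  define K where "K = al (a+1) * al (a-1) * al a * (be (b+1) * be (b-1) * be b) * (ga (c+1) * ga (c-1) * ga c)"
  have "sgn (P (a+1) b (c-1) / P (a-1) b (c+1) * (P a (b-1) (c+1) / P a (b+1) (c-1)) *
   (P (a-1) (b+1) c / P (a+1) (b-1) c)) = 1"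
   using hex[OF that] by (rule sgn_pos)
  hence "H = 1" by (simp add: H_def s_def sgn_mult divide_inverse)
  moreover have "K * K = 1" unfolding K_def
   using that by (intro m al2 be2 ga2) auto
  moreover have "r (a+1) b (c-1) * r (a-1) b (c+1) * (r a (b-1) (c+1) * r a (b+1) (c-1)) *
   (r (a-1) (b+1) c * r (a+1) (b-1) c) = (K * K) * H"
   unfolding r_def K_def H_def by (simp only: mult_ac)
  ultimately show ?thesis by simp
 qed
 have r1: "\<forall>a b. a + b + c = N \<longrightarrow> r a b c = 1" for c
 proof (induction c rule: less_induct)
  case (less c)
  consider "c = 0" | "c = 1" | c' where "c = Suc c'" "c' \<ge> 1" by (cases c) (auto, metis One_nat_def Suc_leI neq0_conv)
  thus ?case
  proof cases
   case 3
   have "r a b c = 1" if "a + b + c = N" for a b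
    using that
   proof (induction a arbitrary: b)
    case 0
    hence "N - c = b" by simp
    hence "r 0 b c = (be b * be b) * (s 0 b c * s 0 b c)" by (simp add: r_def al0 ga_def)
    thus ?case using be2[of b] ss[of 0 b c] 0 by simp
   next
    \<comment> \<open>The hexagon centred at \<open>(Suc a, b+1, c')\<close> meets the layer
      \<open>c\<close> in two vertices only: the one settled by the induction on \<open>a\<close>
      and the wanted one.\<close>
    case (Suc a)
    have 1: "r a (Suc b) c = 1" using Suc by simp
    have 2: "r (Suc a + 1) (b+1) (c'-1) = 1" "r (Suc a) (b+1+1) (c'-1) = 1"
     "r a (b+1+1) c' = 1" "r (Suc a+1) b c' = 1"
     using less.IH[of "c'-1"] less.IH[of c'] 3 Suc.prems by auto
    show ?case using hexr[of "Suc a" "b+1" c'] 1 2 3 Suc.prems by simp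
   qed
   thus ?thesis by blast
  qed (use c0 c1 in auto)
 qed
 have "sgn (P a b c) = al a * be b * ga c" if "a + b + c = N" for a b c
 proof -
  have "al a * be b * ga c * s a b c = 1" using r1 that by (auto simp: r_def)
  hence "(al a * be b * ga c) * (s a b c * s a b c) = s a b c" by (simp only: mult.assoc[symmetric] mult_1_left)
  thus ?thesis using ss[OF that] by (simp add: s_def)
 qed
 thus ?thesis using that al2 be2 ga2 by blast
qed

text \<open>The faces \<open>d = 0\<close> and \<open>b = 0\<close> come with sign factors of their
  own, which have to be matched along the common edge. The double ratios make the mismatch geometric
  in the index, so that it can be absorbed into the factor of the fourth flag; from the two faces
  positivity then spreads inside by the octahedron relation.\<close>

lemma quad_gauge:
 fixes Q :: "nat => nat => nat => nat => 'f::linordered_field"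
 assumes N: "N \<ge> 1"
  and oct: "\<And>a b c d. a + b + c + d + 2 = N ==> Q (a+1) b (c+1) d * Q a (b+1) c (d+1) =
   Q (a+1) (b+1) c d * Q a b (c+1) (d+1) + Q (a+1) b c (d+1) * Q a (b+1) (c+1) d"
  and sq: "\<And>a. a <= N ==> al a * al a = 1" "\<And>a. a <= N ==> be a * be a = 1" "\<And>a. a <= N ==> ga a * ga a = 1"
  and g: "\<And>a b c. a + b + c = N ==> sgn (Q a b c 0) = al a * be b * ga c"
  and sq': "\<And>a. a <= N ==> al' a * al' a = 1" "\<And>a. a <= N ==> ga' a * ga' a = 1" "\<And>a. a <= N ==> de a * de a = 1"
  and g': "\<And>a c d. a + c + d = N ==> sgn (Q a 0 c d) = al' a * ga' c * de d"
  and dbl: "\<And>a. 1 <= a ==> a <= N - 1 ==>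
   Q a 1 (N-1-a) 0 * Q (a-1) 1 (N-a) 0 * (Q a 0 (N-1-a) 1 * Q (a-1) 0 (N-a) 1) > 0"
 shows "\<exists>al be ga de :: nat => 'f. \<forall>a b c d. a + b + c + d = N \<longrightarrow> al a * be b * ga c * de d * Q a b c d > 0"
proof -
 have m: "(x * y) * (x * y) = 1" if "x * x = 1" "y * y = 1" for x y :: 'f
  using that by (simp add: mult.assoc mult.left_commute[of y x])
 have u: "x * (x * y) = y" if "x * x = 1" for x y :: 'f
  using that by (metis mult.assoc mult.left_neutral)
 have eqI: "x = y" if "x * y = 1" "x * x = 1" for x y :: 'f
  using u[OF that(2), of y] that(1) by simp
 \<comment> \<open>Quotients of the two sets of signs, each sign being its own inverse; on the edge
   \<open>b = d = 0\<close> they compensate each other up to the constant \<open>k\<close>.\<close>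
 define p where "p a = al a * al' a" for a
 define q where "q a = ga a * ga' a" for a
 define k where "k = be 0 * de 0"
 have p2: "p a * p a = 1" and q2: "q a * q a = 1" if "a <= N" for a
  using that sq sq' by (simp_all add: p_def q_def m)
 have k2: "k * k = 1" using sq sq' by (simp add: k_def m)
 have pq: "p a * q (N - a) = k" if "a <= N" for a
 proof -
  have "al a * be 0 * ga (N-a) = al' a * ga' (N-a) * de 0"
   using g[of a 0 "N-a"] g'[of a "N-a" 0] that by simp
  hence "(al a * be 0 * ga (N-a)) * (al' a * ga' (N-a) * de 0) = 1"
   using m[OF m[OF sq'(1)[of a] sq'(2)[of "N-a"]] sq'(3)[of 0]] that by simp
  hence "(p a * q (N-a)) * k = 1" by (simp add: p_def q_def k_def mult_ac)
  thus ?thesis using eqI m[OF p2 q2] that by simp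
 qed
 \<comment> \<open>Here the double ratios enter: for neighbouring \<open>a\<close> they link the
   entries with \<open>b = 1\<close>, \<open>d = 0\<close> to those with \<open>b = 0\<close>,
   \<open>d = 1\<close>.\<close>
 have pq1: "(p (Suc a) * q (N-1-Suc a)) * (p a * q (N-1-a)) = 1" if "Suc a <= N - 1" for a
 proof -
  have e: "N - Suc a = N - 1 - a" "Suc a - 1 = a" by simp_all
  have "sgn (Q (Suc a) 1 (N-1-Suc a) 0 * Q a 1 (N-1-a) 0 * (Q (Suc a) 0 (N-1-Suc a) 1 * Q a 0 (N-1-a) 1)) = 1"
   by (rule sgn_pos, rule dbl[of "Suc a", unfolded e]) (use that in auto)
  hence "(al (Suc a) * be 1 * ga (N-1-Suc a)) * (al a * be 1 * ga (N-1-a)) *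
   ((al' (Suc a) * ga' (N-1-Suc a) * de 1) * (al' a * ga' (N-1-a) * de 1)) = 1"
   using that by (simp only: sgn_mult g g')
  hence "(p (Suc a) * q (N-1-Suc a)) * (p a * q (N-1-a)) * ((be 1 * be 1) * (de 1 * de 1)) = 1"
   by (simp add: p_def q_def mult_ac)
  thus ?thesis using sq(2)[of 1] sq'(3)[of 1] N by simp
 qed
 define r0 where "r0 = p 0 * q (N-1)"
 have r02: "r0 * r0 = 1" unfolding r0_def using p2 q2 by (simp add: m)
 have r: "p a * q (N-1-a) = r0" if "a <= N - 1" for a
  using that
 proof (induction a)
  case (Suc a)
  hence "p (Suc a) * q (N-1-Suc a) = p a * q (N-1-a)"
   using eqI[OF pq1] m[OF p2 q2] by simp
  thus ?case using Suc by simp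
 qed (simp add: r0_def)
 define ep where "ep = r0 * k"
 have ep2: "ep * ep = 1" unfolding ep_def using r02 k2 by (simp add: m)
 have pS: "p (Suc a) = ep * p a" if "Suc a <= N" for a
 proof -
  have "N - 1 - a = N - Suc a" by simp
  hence "q (N - Suc a) = r0 * p a"
   using r[of a] u[OF p2[of a], of "q (N - Suc a)"] that by (simp add: mult.commute)
  moreover have "p (Suc a) = k * q (N - Suc a)"
   using pq[OF that] u[OF q2[of "N - Suc a"], of "p (Suc a)"] by (simp add: mult_ac)
  ultimately show ?thesis by (simp add: ep_def mult_ac)
 qed
 have p: "p a = ep ^ a * p 0" if "a <= N" for a
  using that by (induction a) (simp_all add: pS mult_ac)
 have q: "q c = k * (ep ^ (N - c) * p 0)" if "c <= N" for c
  using pq[of "N - c"] p[of "N-c"] that u[OF p2[of "N - c"], of "q c"] by (simp add: mult.commute)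
 \<comment> \<open>As \<open>a + (N - c) = 2 * a + d\<close> and even powers of \<open>ep\<close>
   are 1, the mismatch is \<open>ep ^ d\<close> up to constants, a function of \<open>d\<close>
   alone.\<close>
 define de' where "de' d = be 0 * k * ep ^ d * de d" for d
 have g'': "sgn (Q a 0 c d) = al a * be 0 * ga c * de' d" if "a + c + d = N" for a c d
 proof -
  have "al' a = p a * al a" "ga' c = q c * ga c"
   using u[OF sq(1)[of a], of "al' a"] u[OF sq(3)[of c], of "ga' c"] that
   by (simp_all add: p_def q_def mult_ac)
  hence "sgn (Q a 0 c d) = (p a * q c) * (al a * ga c * de d)"
   using g'[OF that] by (simp add: mult_ac)
  also have "p a * q c = ep ^ (a + (N - c)) * k * (p 0 * p 0)"
  proof -
   have pa: "p a = ep ^ a * p 0" by (rule p) (use that in simp)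
   have qc: "q c = k * (ep ^ (N - c) * p 0)" by (rule q) (use that in simp)
   show ?thesis unfolding pa qc power_add by (simp only: mult_ac)
  qed
  also have "a + (N - c) = 2 * a + d" using that by simp
  also have "ep ^ (2 * a + d) = ep ^ d" using ep2 by (simp add: power_add power_mult power2_eq_square)
  finally have "sgn (Q a 0 c d) = ep ^ d * k * (al a * ga c * de d)" using p2[of 0] by simp
  also have "\<dots> = (be 0 * be 0) * (ep ^ d * k * (al a * ga c * de d))" using sq(2)[of 0] by simp
  finally show ?thesis by (simp add: de'_def mult_ac)
 qed
 define R where "R a b c d = al a * be b * ga c * de' d * Q a b c d" for a b c d
 have de0: "de' 0 = 1"
 proof -
  have "de' 0 = (be 0 * be 0) * (de 0 * de 0)" by (simp add: de'_def k_def mult_ac)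
  thus ?thesis using sq(2)[of 0] sq'(3)[of 0] by simp
 qed
 have base1: "R a b c 0 > 0" if "a + b + c = N" for a b c
 proof -
  have "R a b c 0 = sgn (Q a b c 0) * Q a b c 0" using g[OF that] by (simp add: R_def de0)
  moreover have "sgn (Q a b c 0) ~= 0"
   using g[OF that] sq(1)[of a] sq(2)[of b] sq(3)[of c] that by auto
  ultimately show ?thesis by (auto simp: sgn_if split: if_splits)
 qed
 have base2: "R a 0 c d > 0" if "a + c + d = N" for a c d
 proof -
  have "R a 0 c d = sgn (Q a 0 c d) * Q a 0 c d" using g''[OF that] by (simp add: R_def)
  moreover have "sgn (Q a 0 c d) ~= 0"
   using g'[OF that] sq'(1)[of a] sq'(2)[of c] sq'(3)[of d] that by auto
  ultimately show ?thesis by (auto simp: sgn_if split: if_splits)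
 qed
 have octR: "R (a+1) b (c+1) d * R a (b+1) c (d+1) =
   R (a+1) (b+1) c d * R a b (c+1) (d+1) + R (a+1) b c (d+1) * R a (b+1) (c+1) d"
  if "a + b + c + d + 2 = N" for a b c d
 proof -
  define K where "K = al (a+1) * al a * (be (b+1) * be b) * (ga (c+1) * ga c) * (de' (d+1) * de' d)"
  have "R (a+1) b (c+1) d * R a (b+1) c (d+1) = K * (Q (a+1) b (c+1) d * Q a (b+1) c (d+1))"
   "R (a+1) (b+1) c d * R a b (c+1) (d+1) = K * (Q (a+1) (b+1) c d * Q a b (c+1) (d+1))"
   "R (a+1) b c (d+1) * R a (b+1) (c+1) d = K * (Q (a+1) b c (d+1) * Q a (b+1) (c+1) d)"
   unfolding R_def K_def by (simp_all only: mult_ac)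
  thus ?thesis using oct[OF that] by (simp add: ring_distribs)
 qed
 \<comment> \<open>Induction on \<open>b + d\<close>: if both are positive, the entry is one of the
   six vertices of an octahedron whose other five have a smaller \<open>b + d\<close>, and the
   relation gives its product with a positive entry as a sum of positive terms.\<close>
 have "\<forall>a b c d. b + d = m \<longrightarrow> a + b + c + d = N \<longrightarrow> R a b c d > 0" for m
 proof (induction m rule: less_induct)
  case (less m)
  have "R a b c d > 0" if bd: "b + d = m" and s: "a + b + c + d = N" for a b c d
  proof (cases "b = 0 \<or> d = 0")
   case True
   thus ?thesis using base1[of a b c] base2[of a c d] s by auto
  next
   case False
   then obtain b' d' where e: "b = b' + 1" "d = d' + 1" by (metis Suc_eq_plus1 not0_implies_Suc)
   have pos: "R (a+1) b' (c+1) d' > 0" "R (a+1) (b'+1) c d' > 0" "R a b' (c+1) (d'+1) > 0"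
    "R (a+1) b' c (d'+1) > 0" "R a (b'+1) (c+1) d' > 0"
    using less.IH[of "b'+d'"] less.IH[of "b'+1+d'"] bd s e by auto
   have "R (a+1) b' (c+1) d' * R a b c d > 0"
    using octR[of a b' c d'] pos e s by (simp add: add_pos_pos)
   thus ?thesis using pos(1) by (simp add: zero_less_mult_iff)
  qed
  thus ?case by blast
 qed
 thus ?thesis unfolding R_def by blast
qed

lemma transverse3_nonzero:
 fixes E F G :: "nat => ('f::field ^ 'n::finite) set"
 assumes tr: "transverse_flags [E, F, G]" and fl: "is_flag E" "is_flag F" "is_flag G" and s: "a + b + c = CARD('n)"
 shows "wedge3 E F G a b c ~= 0"
 unfolding wedge3_def
proof (rule top_wedge_nonzero)
 have le: "a <= CARD('n)" "b <= CARD('n)" "c <= CARD('n)" using s by auto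
 note b = flag_basis[OF fl(1) le(1)] flag_basis[OF fl(2) le(2)] flag_basis[OF fl(3) le(3)]
 let ?L = "flag_basis E a @ flag_basis F b @ flag_basis G c"
 show "length ?L = CARD('n)" using b s by simp
 have "x \<in> vec.span (set ?L)" for x
 proof -
  have "{\<Sum>i<length [E, F, G]. v i | v. \<forall>i<length [E, F, G]. v i \<in> ([E, F, G] ! i) ([a, b, c] ! i)} = UNIV"
   by (rule tr[unfolded transverse_flags_def, rule_format]) (use le s in auto)
  then obtain v where v: "x = (\<Sum>i<length [E, F, G]. v i)" "\<forall>i<length [E, F, G]. v i \<in> ([E, F, G] ! i) ([a, b, c] ! i)" by blast
  have "v 0 \<in> E a" "v 1 \<in> F b" "v 2 \<in> G c" using v(2)[rule_format, of 0] v(2)[rule_format, of 1] v(2)[rule_format, of 2] by simp_all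
  hence "v 0 \<in> vec.span (set ?L)" "v 1 \<in> vec.span (set ?L)" "v 2 \<in> vec.span (set ?L)"
   using b vec.span_mono[of "set (flag_basis E a)" "set ?L"] vec.span_mono[of "set (flag_basis F b)" "set ?L"]
    vec.span_mono[of "set (flag_basis G c)" "set ?L"] by auto
  moreover have "x = v 0 + v 1 + v 2" unfolding v(1) by (simp add: numeral_2_eq_2)
  ultimately show ?thesis by (simp add: vec.span_add)
 qed
 thus "vec.span (set ?L) = UNIV" by blast
qed

lemma positive_triple_gauge:
 fixes E F G :: "nat => ('f::linordered_field ^ 'n::finite) set"
 assumes fl: "is_flag E" "is_flag F" "is_flag G" and pos: "positive_triple E F G"
 obtains al be ga :: "nat => 'f"
 where "\<And>a. a <= CARD('n) ==> al a * al a = 1" "\<And>a. a <= CARD('n) ==> be a * be a = 1"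
  "\<And>a. a <= CARD('n) ==> ga a * ga a = 1"
  "\<And>a b c. a + b + c = CARD('n) ==> sgn (wedge3 E F G a b c) = al a * be b * ga c"
proof (rule triple_gauge[of "CARD('n)" "wedge3 E F G", OF transverse3_nonzero[OF _ fl]])
 fix a b c assume "a \<ge> 1" "b \<ge> 1" "c \<ge> 1" "a + b + c = CARD('n)"
 thus "wedge3 E F G (a+1) b (c-1) / wedge3 E F G (a-1) b (c+1) *
   (wedge3 E F G a (b-1) (c+1) / wedge3 E F G a (b+1) (c-1)) *
   (wedge3 E F G (a-1) (b+1) c / wedge3 E F G (a+1) (b-1) c) > 0"
  using pos by (auto simp: positive_triple_def triple_ratio_def)
qed (use pos that in \<open>auto simp: positive_triple_def\<close>)

lemma positive_quadruple_gauge: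
 fixes E F G H :: "nat => ('f::linordered_field ^ 'n::finite) set"
 assumes fl: "is_flag E" "is_flag F" "is_flag G" "is_flag H" and pos: "positive_quadruple E F G H"
 shows "\<exists>al be ga de :: nat => 'f. \<forall>a b c d. a + b + c + d = CARD('n) \<longrightarrow>
  al a * be b * ga c * de d * quad_wedge E F G H a b c d > 0"
proof -
 obtain al be ga where s1: "\<And>a. a <= CARD('n) ==> al a * al a = 1" "\<And>a. a <= CARD('n) ==> be a * be a = 1"
  "\<And>a. a <= CARD('n) ==> ga a * ga a = 1"
  "\<And>a b c. a + b + c = CARD('n) ==> sgn (wedge3 E F G a b c) = al a * be b * ga c"
  using positive_triple_gauge[OF fl(1,2,3)] pos by (auto simp: positive_quadruple_def)
 obtain al' ga' de where s2: "\<And>a. a <= CARD('n) ==> al' a * al' a = 1" "\<And>a. a <= CARD('n) ==> ga' a * ga' a = 1"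
  "\<And>a. a <= CARD('n) ==> de a * de a = 1"
  "\<And>a b c. a + b + c = CARD('n) ==> sgn (wedge3 E G H a b c) = al' a * ga' b * de c"
  using positive_triple_gauge[OF fl(1,3,4)] pos by (auto simp: positive_quadruple_def)
 let ?Q = "quad_wedge E F G H"
 have w: "wedge3 E F G a b c = ?Q a b c 0" "wedge3 E G H a b c = ?Q a 0 b c" for a b c
  by (simp_all add: wedge3_def quad_wedge_def flag_basis_0 fl)
 \<comment> \<open>The double ratio lists the flags as \<open>E\<close>, \<open>G\<close>,
   \<open>F\<close>, \<open>H\<close>; restoring the order costs \<open>(-1) ^ c\<close>.\<close>
 have wF: "wedge3 E G F a c 1 = (-1) ^ c * ?Q a 1 c 0" if "a + c + 1 = CARD('n)" for a c
  using top_wedge_block_swap[of "flag_basis E a" "flag_basis G c" "flag_basis F 1" "[]"] that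
   flag_basis(1)[OF fl(1), of a] flag_basis(1)[OF fl(2), of 1] flag_basis(1)[OF fl(3), of c]
  by (simp add: wedge3_def quad_wedge_def flag_basis_0 fl)
 show ?thesis
 proof (rule quad_gauge[where al = al and be = be and ga = ga and al' = al' and ga' = ga' and de = de])
  show "1 <= CARD('n)" by (simp add: Suc_leI)
  show "?Q a 1 (CARD('n)-1-a) 0 * ?Q (a-1) 1 (CARD('n)-a) 0 * (?Q a 0 (CARD('n)-1-a) 1 * ?Q (a-1) 0 (CARD('n)-a) 1) > 0"
   if a: "1 <= a" "a <= CARD('n) - 1" for a
  proof -
   define c where "c = CARD('n) - 1 - a"
   have c: "CARD('n) - 1 - a = c" "CARD('n) - a - 1 = c" "CARD('n) - a = Suc c" "a + c + 1 = CARD('n)"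
    "(a - 1) + Suc c + 1 = CARD('n)"
    using a by (auto simp: c_def)
   have "double_ratio a E G F H > 0" using pos a by (auto simp: positive_quadruple_def)
   hence "- ((-1) ^ c * ?Q a 1 c 0 / ?Q a 0 c 1 * (?Q (a-1) 0 (Suc c) 1 / ((-1) ^ Suc c * ?Q (a-1) 1 (Suc c) 0))) > 0"
    unfolding double_ratio_def c(2) unfolding c(3) wF[OF c(4)] wF[OF c(5)] w .
   \<comment> \<open>The exponents \<open>c\<close> and \<open>Suc c\<close> give opposite signs,
     which cancels the minus sign in \<open>double_ratio\<close>.\<close>
   moreover have "- ((-1) ^ c * x1 / y1 * (y2 / ((-1) ^ Suc c * x2))) = x1 / y1 * (y2 / x2)" for x1 x2 y1 y2 :: 'f
    by (cases "even c") simp_all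
   ultimately have p: "?Q a 1 c 0 / ?Q a 0 c 1 * (?Q (a-1) 0 (Suc c) 1 / ?Q (a-1) 1 (Suc c) 0) > 0" by simp
   have "0 < x1 * x2 * (y1 * y2)" if p: "0 < x1 / y1 * (y2 / x2)" for x1 x2 y1 y2 :: 'f
    using p by (auto simp: zero_less_mult_iff zero_less_divide_iff divide_less_0_iff mult_less_0_iff)
   thus ?thesis unfolding c(1) c(3) using p by blast
  qed
 qed (use s1 s2 octahedron[OF fl] in \<open>simp_all add: w\<close>)
qed

section \<open>Generalised cross ratios of flags\<close>

definition wedge2 :: "nat => (nat => ('f::field ^ 'n::finite) set) => (nat => ('f ^ 'n) set) => 'f" where
 "wedge2 k E F = top_wedge (flag_basis E k @ flag_basis F (CARD('n) - k))"

text \<open>The steps of dimension \<open>k\<close> of \<open>E\<close>, \<open>F\<close> are paired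
  with the complementary steps of \<open>G\<close>, \<open>H\<close>. Every chosen basis occurs once
  above and once below the line, so the value depends on the flags only; in dimension 2 with
  \<open>k = 1\<close> it is the projective cross ratio of four lines.\<close>

definition cross_ratio :: "nat => (nat => ('f::field ^ 'n::finite) set) => (nat => ('f ^ 'n) set) =>
  (nat => ('f ^ 'n) set) => (nat => ('f ^ 'n) set) => 'f" where
 "cross_ratio k E F G H = wedge2 k E G * wedge2 k F H / (wedge2 k E H * wedge2 k F G)"

text \<open>The two-dimensional Pluecker relation in the quotient by \<open>E\<^sup>a + F\<^sup>b + G\<^sup>c + H\<^sup>d\<close> makes an elementary
 cross ratio exceed 1, and the general one telescopes into elementary ones by passing from
 \<open>E\<^sup>k\<close> to \<open>F\<^sup>k\<close> and from \<open>G\<close> to \<open>H\<close> one dimension at a time.\<close>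

lemma telescoped_cross_ratio:
 fixes R :: "nat => nat => nat => nat => 'f::linordered_field"
 assumes pos: "\<And>a b c d. a + b + c + d = N ==> R a b c d > 0"
  and el: "\<And>a b c d. a + b + c + d + 2 = N ==>
   R (a+1) b c (d+1) * R a (b+1) (c+1) d <= R (a+1) b (c+1) d * R a (b+1) c (d+1)"
  and N: "k + m = N"
 shows "R k 0 0 m * R 0 k m 0 <= R k 0 m 0 * R 0 k 0 m"
proof -
 have one: "R (a+1) b (m-j) j / R a (b+1) (m-j) j <= R (a+1) b m 0 / R a (b+1) m 0"
  if "a + b + 1 = k" "j <= m" for a b j
  using that(2)
 proof (induction j)
  case (Suc j)
  define c where "c = m - Suc j"
  have c: "m - j = c + 1" "a + b + c + j + 2 = N" using Suc.prems that(1) N by (auto simp: c_def)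
  have "R (a+1) b c (j+1) / R a (b+1) c (j+1) <= R (a+1) b (c+1) j / R a (b+1) (c+1) j"
   using el[OF c(2)] pos[of a "b+1" c "j+1"] pos[of a "b+1" "c+1" j] c(2)
   by (simp add: divide_simps mult.commute)
  thus ?case using Suc c by (simp add: c_def)
 qed simp
 have "R k 0 0 m / R (k-i) i 0 m <= R k 0 m 0 / R (k-i) i m 0" if "i <= k" for i
  using that
 proof (induction i)
  case 0
  thus ?case using pos[of k 0 0 m] pos[of k 0 m 0] N by simp
 next
  case (Suc i)
  define a where "a = k - Suc i"
  have a: "k - i = a + 1" "a + i + 1 = k" using Suc.prems by (auto simp: a_def)
  have p: "R (a+1) i 0 m > 0" "R (a+1) i m 0 > 0" "R a (i+1) 0 m > 0" "R a (i+1) m 0 > 0"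
   "R k 0 0 m > 0" "R k 0 m 0 > 0"
   using a N by (auto intro!: pos)
  have "R k 0 0 m / R (a+1) i 0 m <= R k 0 m 0 / R (a+1) i m 0" using Suc a by simp
  moreover have "R (a+1) i 0 m / R a (i+1) 0 m <= R (a+1) i m 0 / R a (i+1) m 0"
   using one[OF a(2), of m] by simp
  ultimately have "R k 0 0 m / R (a+1) i 0 m * (R (a+1) i 0 m / R a (i+1) 0 m) \<le>
   R k 0 m 0 / R (a+1) i m 0 * (R (a+1) i m 0 / R a (i+1) m 0)"
   using p by (intro mult_mono) (auto intro!: divide_nonneg_nonneg simp: less_imp_le)
  hence "R k 0 0 m / R a (i+1) 0 m <= R k 0 m 0 / R a (i+1) m 0" using p by simp
  thus ?case by (simp add: a_def)
 qed
 from this[of k] have "R k 0 0 m / R 0 k 0 m <= R k 0 m 0 / R 0 k m 0" by simp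
 thus ?thesis using pos[of 0 k 0 m] pos[of 0 k m 0] N by (simp add: divide_simps mult.commute)
qed

lemma wedge2_quad:
 assumes "is_flag E" "is_flag F" "is_flag G" "is_flag H" "k + m = CARD('n)"
 shows "wedge2 k E F = quad_wedge E F G H k m 0 0" "wedge2 k E G = quad_wedge E F G H k 0 m 0"
  "wedge2 k E (H :: nat => ('f::field ^ 'n::finite) set) = quad_wedge E F G H k 0 0 m"
  "wedge2 k F G = quad_wedge E F G H 0 k m 0" "wedge2 k F H = quad_wedge E F G H 0 k 0 m" "wedge2 k G H = quad_wedge E F G H 0 0 k m"
proof -
 have "CARD('n) - k = m" using assms(5) by simp
 thus "wedge2 k E F = quad_wedge E F G H k m 0 0" "wedge2 k E G = quad_wedge E F G H k 0 m 0"
  "wedge2 k E H = quad_wedge E F G H k 0 0 m" "wedge2 k F G = quad_wedge E F G H 0 k m 0"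
  "wedge2 k F H = quad_wedge E F G H 0 k 0 m" "wedge2 k G H = quad_wedge E F G H 0 0 k m"
  by (simp_all add: wedge2_def quad_wedge_def flag_basis_0 assms)
qed

text \<open>After the rescaling all terms of the octahedron relation are positive, and dropping one
  of them is the inequality that telescopes. The rescaling multiplies numerator and denominator by
  the same \<open>u\<close>, so it leaves the cross ratio unchanged.\<close>

lemma cross_ratio_ge_1:
 fixes E F G H :: "nat => ('f::linordered_field ^ 'n::finite) set"
 assumes fl: "is_flag E" "is_flag F" "is_flag G" "is_flag H" and pos: "positive_quadruple E F G H"
  and k: "k <= CARD('n)"
 shows "cross_ratio k E F G H \<ge> 1"
proof -
 define Q where "Q = quad_wedge E F G H"
 obtain al be ga de :: "nat => 'f" where g: "\<And>a b c d. a + b + c + d = CARD('n) ==>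
   al a * be b * ga c * de d * Q a b c d > 0"
  using positive_quadruple_gauge[OF fl pos] unfolding Q_def by blast
 define R where "R a b c d = al a * be b * ga c * de d * Q a b c d" for a b c d
 define m where "m = CARD('n) - k"
 have km: "k + m = CARD('n)" using k by (simp add: m_def)
 have le: "R k 0 0 m * R 0 k m 0 <= R k 0 m 0 * R 0 k 0 m"
 proof (rule telescoped_cross_ratio[OF _ _ km])
  show "R a b c d > 0" if "a + b + c + d = CARD('n)" for a b c d
   using g[OF that] by (simp add: R_def)
  show "R (a+1) b c (d+1) * R a (b+1) (c+1) d <= R (a+1) b (c+1) d * R a (b+1) c (d+1)"
   if "a + b + c + d + 2 = CARD('n)" for a b c d
  proof -
   define K where "K = al (a+1) * al a * (be (b+1) * be b) * (ga (c+1) * ga c) * (de (d+1) * de d)"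
   have "R (a+1) b (c+1) d * R a (b+1) c (d+1) = K * (Q (a+1) b (c+1) d * Q a (b+1) c (d+1))"
    "R (a+1) (b+1) c d * R a b (c+1) (d+1) = K * (Q (a+1) (b+1) c d * Q a b (c+1) (d+1))"
    "R (a+1) b c (d+1) * R a (b+1) (c+1) d = K * (Q (a+1) b c (d+1) * Q a (b+1) (c+1) d)"
    unfolding R_def K_def by (simp_all only: mult_ac)
   hence "R (a+1) b (c+1) d * R a (b+1) c (d+1) =
    R (a+1) (b+1) c d * R a b (c+1) (d+1) + R (a+1) b c (d+1) * R a (b+1) (c+1) d"
    using octahedron[OF fl that] by (simp add: ring_distribs Q_def)
   moreover have "R (a+1) (b+1) c d * R a b (c+1) (d+1) > 0"
    using that by (intro mult_pos_pos) (auto simp: R_def intro!: g)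
   ultimately show ?thesis by simp
  qed
 qed
 have pos4: "R k 0 0 m * R 0 k m 0 > 0" unfolding R_def by (rule mult_pos_pos; rule g) (use km in auto)
 define u where "u = al k * be k * ga m * de m * (al 0 * be 0 * ga 0 * de 0)"
 have RQ: "R k 0 0 m * R 0 k m 0 = u * (Q k 0 0 m * Q 0 k m 0)" "R k 0 m 0 * R 0 k 0 m = u * (Q k 0 m 0 * Q 0 k 0 m)"
  unfolding R_def u_def by (simp_all only: mult_ac)
 have "1 <= (R k 0 m 0 * R 0 k 0 m) / (R k 0 0 m * R 0 k m 0)" using le pos4 by simp
 also have "\<dots> = (Q k 0 m 0 * Q 0 k 0 m) / (Q k 0 0 m * Q 0 k m 0)" using pos4 unfolding RQ by (cases "u = 0") simp_all
 also have "\<dots> = cross_ratio k E F G H" unfolding cross_ratio_def Q_def wedge2_quad[OF fl km] ..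
 finally show ?thesis .
qed

section \<open>Eigenvalues of a matrix with two fixed flags\<close>

definition mat_flag :: "'f::field ^ 'n::finite ^ 'n => (nat => ('f ^ 'n) set) => nat => ('f ^ 'n) set" where
 "mat_flag A E = (\<lambda>a. (*v) A ` E a)"

lemma inj_matrix_det_1:
 fixes A :: "'f::field ^ 'n::finite ^ 'n"
 assumes "det A ~= 0"
 shows "inj ((*v) A)"
 using assms det_nz_iff_inj_gen[OF matrix_vector_mul_linear_gen, of A]
 by (simp add: matrix_of_matrix_vector_mul)

lemma is_flag_mat_flag:
 fixes A :: "'f::field ^ 'n::finite ^ 'n"
 assumes "det A ~= 0" "is_flag E"
 shows "is_flag (mat_flag A E)"
proof -
 have "vec.dim ((*v) A ` E a) = vec.dim (E a)" for a
  using inj_matrix_det_1[OF assms(1)]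
  by (intro vec.dim_image_eq matrix_vector_mul_linear_gen) (auto intro: inj_on_subset)
 thus ?thesis
  using assms(2) unfolding is_flag_def mat_flag_def mono_def
  by (auto intro!: vec.subspace_image image_mono)
qed

lemma top_wedge_scale_list:
 fixes x :: "'i => 'f::field ^ 'n::finite"
 assumes "length p + length is + length r = CARD('n)"
 shows "top_wedge (p @ map (\<lambda>i. c i *s x i) is @ r) = prod_list (map c is) * top_wedge (p @ map x is @ r)"
 using assms
proof (induction "is" arbitrary: p)
 case (Cons i "is")
 have "top_wedge (p @ map (\<lambda>i. c i *s x i) (i # is) @ r) =
  c i * top_wedge ((p @ [x i]) @ map (\<lambda>i. c i *s x i) is @ r)"
  using top_wedge_scale[of p "map (\<lambda>i. c i *s x i) is @ r" "c i" "x i"] Cons.prems by simp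
 also have "\<dots> = c i * (prod_list (map c is) * top_wedge ((p @ [x i]) @ map x is @ r))"
  using Cons.IH[of "p @ [x i]"] Cons.prems by simp
 finally show ?case by simp
qed simp

text \<open>Every wedge acquires \<open>det A\<close> and one scalar per flag, and each of these
  factors occurs equally often in numerator and denominator.\<close>

lemma cross_ratio_mat_flag:
 fixes A :: "'f::field ^ 'n::finite ^ 'n"
 assumes A: "det A ~= 0" and fl: "is_flag E" "is_flag F" "is_flag G" "is_flag H" and k: "k <= CARD('n)"
 shows "cross_ratio k (mat_flag A E) (mat_flag A F) (mat_flag A G) (mat_flag A H) = cross_ratio k E F G H"
proof -
 have ex: "\<exists>c. c ~= 0 \<and> (\<forall>p r. length p + a + length r = CARD('n) \<longrightarrow>
  top_wedge (p @ flag_basis (mat_flag A X) a @ r) = c * top_wedge (p @ map ((*v) A) (flag_basis X a) @ r))"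
  if "is_flag X" "a <= CARD('n)" for X a
 proof -
  have "vec.span (set (map ((*v) A) (flag_basis X a))) = mat_flag A X a"
   using flag_basis(4)[OF that] by (simp add: mat_flag_def vec.linear_span_image[OF matrix_vector_mul_linear_gen])
  thus ?thesis
   using flag_basis_change[OF is_flag_mat_flag[OF A that(1)] that(2), of "map ((*v) A) (flag_basis X a)"]
    flag_basis(1)[OF that] by (metis length_map)
 qed
 define m where "m = CARD('n) - k"
 have m: "m <= CARD('n)" "k + m = CARD('n)" using k by (auto simp: m_def)
 obtain c where c: "\<And>X a. is_flag X ==> a <= CARD('n) ==> c X a ~= 0 \<and> (\<forall>p r. length p + a + length r = CARD('n) \<longrightarrow>
  top_wedge (p @ flag_basis (mat_flag A X) a @ r) = c X a * top_wedge (p @ map ((*v) A) (flag_basis X a) @ r))"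
  using ex by metis
 have w: "wedge2 k (mat_flag A X) (mat_flag A Y) = c X k * c Y m * det A * wedge2 k X Y"
  if "is_flag X" "is_flag Y" for X Y
 proof -
  note l = flag_basis(1)[OF that(1) k] flag_basis(1)[OF that(2) m(1)]
   flag_basis(1)[OF is_flag_mat_flag[OF A that(2)] m(1)]
  have "wedge2 k (mat_flag A X) (mat_flag A Y) =
   c X k * top_wedge (map ((*v) A) (flag_basis X k) @ flag_basis (mat_flag A Y) m)"
   using c[OF that(1) k, THEN conjunct2, rule_format, of "[]" "flag_basis (mat_flag A Y) m"] l m by (simp add: wedge2_def m_def[symmetric])
  also have "\<dots> = c X k * (c Y m * top_wedge (map ((*v) A) (flag_basis X k @ flag_basis Y m)))"
   using c[OF that(2) m(1), THEN conjunct2, rule_format, of "map ((*v) A) (flag_basis X k)" "[]"] l m by simp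
  also have "top_wedge (map ((*v) A) (flag_basis X k @ flag_basis Y m)) = det A * wedge2 k X Y"
   using top_wedge_map[of "flag_basis X k @ flag_basis Y m" A] l m by (simp add: wedge2_def m_def)
  finally show ?thesis by simp
 qed
 show ?thesis unfolding cross_ratio_def w[OF fl(1) fl(3)] w[OF fl(2) fl(4)] w[OF fl(1) fl(4)] w[OF fl(2) fl(3)]
  using c[OF fl(1) k] c[OF fl(2) k] c[OF fl(3) m(1)] c[OF fl(4) m(1)] A by simp
qed

lemma prod_list_upt_split:
 fixes l :: "nat => 'f::comm_monoid_mult"
 assumes "a <= n"
 shows "prod_list (map l [0..<a]) * prod_list (map l [a..<n]) = prod_list (map l [0..<n])"
 using upt_add_eq_append[of 0 a "n - a"] assms by (simp flip: prod_list.append map_append)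

text \<open>The situation at the axis of a group element: \<open>E\<close> and \<open>H\<close> are
  the flags at the attracting and the repelling fixed point, \<open>G\<close> is the flag at a point
  between them and \<open>F\<close> the flag at its image.\<close>

locale fixed_flag_pair =
 fixes A :: "'f::linordered_field ^ 'n::finite ^ 'n"
  and E F G H :: "nat => ('f ^ 'n) set"
 assumes det1: "det A = 1"
  and fl: "is_flag E" "is_flag G" "is_flag H"
  and fixd: "mat_flag A E = E" "mat_flag A H = H" "F = mat_flag A G"
  and pos: "positive_quadruple E F G H"
  and n2: "CARD('n) \<ge> 2"
begin

lemma flF: "is_flag F"
 using is_flag_mat_flag[of A G] fixd(3) fl det1 by simp

abbreviation Q where "Q \<equiv> quad_wedge E F G H"

lemma Q_nonzero: "a + b + c + d = CARD('n) ==> Q a b c d ~= 0"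
 using positive_quadruple_gauge[OF fl(1) flF fl(2,3) pos] by (metis less_irrefl mult_zero_right)

lemma E_Int_H: "a + d = CARD('n) ==> x \<in> E a ==> x \<in> H d ==> x = 0"
proof -
 assume ad: "a + d = CARD('n)" and x: "x \<in> E a" "x \<in> H d"
 hence le: "a <= CARD('n)" "d <= CARD('n)" by auto
 note b = flag_basis[OF fl(1) le(1)] flag_basis[OF fl(3) le(2)]
 let ?e = "flag_basis E a" let ?h = "flag_basis H d"
 have "top_wedge (?e @ ?h) ~= 0" using Q_nonzero[of a 0 0 d] ad by (simp add: quad_wedge_def flag_basis_0 flF fl)
 hence "{x + y |x y. x \<in> E a \<and> y \<in> H d} = UNIV" using top_wedge_nonzeroD(3)[of "?e @ ?h"] b ad by (simp add: vec.span_Un)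
 hence "vec.dim (E a \<inter> H d) = 0"
  using vec.dim_sums_Int[of "E a" "H d"] fl(1,3) ad by (simp add: is_flag_def vec.dim_UNIV card_cart_basis del: vec.dim_eq_0)
 thus ?thesis using x by (auto simp: vec.dim_eq_0)
qed

text \<open>The steps \<open>E (Suc i)\<close> and \<open>H (CARD('n) - i)\<close> meet in a
  non-zero vector by dimension, and both are invariant. Modulo \<open>E i\<close> the image of
  \<open>x\<close> is a multiple of \<open>x\<close>, and the remainder lies in both
  \<open>E i\<close> and \<open>H (CARD('n) - i)\<close>, which are transverse.\<close>

lemma ex_eigenline:
 assumes i: "i < CARD('n)"
 shows "\<exists>x l. x \<in> E (Suc i) \<and> x \<in> H (CARD('n) - i) \<and> x ~= 0 \<and> A *v x = l *s x"
proof -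
 have sub: "vec.subspace (E a)" "vec.subspace (H a)" and dim: "vec.dim (E a) = min a CARD('n)" "vec.dim (H a) = min a CARD('n)" for a
  using fl by (auto simp: is_flag_def)
 have "vec.dim (E (Suc i) \<inter> H (CARD('n) - i)) ~= 0"
  using vec.dim_sums_Int[OF sub(1)[of "Suc i"] sub(2)[of "CARD('n) - i"]] dim i
   vec.dim_subset[of "{x + y |x y. x \<in> E (Suc i) \<and> y \<in> H (CARD('n) - i)}" UNIV]
  by (simp add: vec.dim_UNIV card_cart_basis del: vec.dim_eq_0)
 then obtain x where x: "x \<in> E (Suc i)" "x \<in> H (CARD('n) - i)" "x ~= 0" by (auto simp: vec.dim_eq_0)
 have ai: "i + (CARD('n) - i) = CARD('n)" using i by simp
 hence xE: "x \<notin> E i" using E_Int_H x by blast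
 note b = flag_basis(4)[OF fl(1) less_imp_le[OF i]]
 have "A *v x \<in> E (Suc i)" "A *v x \<in> H (CARD('n) - i)" using fixd(1,2) x unfolding mat_flag_def by (metis imageI)+
 moreover from this have "A *v x \<in> vec.span (insert x (set (flag_basis E i)))" using flag_span_Suc[OF fl(1) i b x(1) xE] by simp
 then obtain l where "A *v x - l *s x \<in> E i" using b by (auto simp: vec.span_insert)
 ultimately have "A *v x - l *s x = 0" using E_Int_H[OF ai] x(2) sub(2) by (meson vec.subspace_diff vec.subspace_scale)
 thus ?thesis using x by (metis eq_iff_diff_eq_0)
qed

definition eb where "eb = (SOME x. \<exists>l. \<forall>i<CARD('n). x i \<in> E (Suc i) \<and> x i \<in> H (CARD('n) - i) \<and> x i ~= 0 \<and> A *v x i = l i *s x i)"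
definition ev where "ev = (SOME l. \<forall>i<CARD('n). A *v eb i = l i *s eb i)"

lemma eb: assumes "i < CARD('n)"
 shows "eb i \<in> E (Suc i)" "eb i \<in> H (CARD('n) - i)" "eb i ~= 0" "A *v eb i = ev i *s eb i"
proof -
 have "\<exists>x l. \<forall>i<CARD('n). x i \<in> E (Suc i) \<and> x i \<in> H (CARD('n) - i) \<and> x i ~= 0 \<and> A *v x i = l i *s x i"
  using ex_eigenline by metis
 hence 1: "\<exists>l. \<forall>i<CARD('n). eb i \<in> E (Suc i) \<and> eb i \<in> H (CARD('n) - i) \<and> eb i ~= 0 \<and> A *v eb i = l i *s eb i"
  unfolding eb_def by (rule someI_ex)
 hence "\<exists>l. \<forall>i<CARD('n). A *v eb i = l i *s eb i" by blast
 hence "\<forall>i<CARD('n). A *v eb i = ev i *s eb i" unfolding ev_def by (rule someI_ex)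
 thus "eb i \<in> E (Suc i)" "eb i \<in> H (CARD('n) - i)" "eb i ~= 0" "A *v eb i = ev i *s eb i" using 1 assms by blast+
qed

lemma span_0: "is_flag U ==> U 0 = {0::'f ^ 'n}"
 using flag_basis(4)[of U 0] flag_basis_0[of U] by simp

lemma span_E: "a <= CARD('n) ==> vec.span (set (map eb [0..<a])) = E a"
proof (induction a)
 case (Suc a)
 hence "eb a \<notin> E a" using E_Int_H[of a "CARD('n) - a" "eb a"] eb(2,3)[of a] by auto
 hence "vec.span (insert (eb a) (set (map eb [0..<a]))) = E (Suc a)"
  using Suc eb(1)[of a] by (intro flag_span_Suc[OF fl(1)]) auto
 thus ?case by (simp add: insert_commute)
qed (simp add: span_0 fl)

lemma span_H: "d <= CARD('n) ==> vec.span (set (map eb [CARD('n) - d..<CARD('n)])) = H d"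
proof (induction d)
 case (Suc d)
 define i where "i = CARD('n) - Suc d"
 have i: "i < CARD('n)" "CARD('n) - d = Suc i" "CARD('n) - i = Suc d" "Suc i + d = CARD('n)" using Suc.prems by (auto simp: i_def)
 have "eb i \<notin> H d" using E_Int_H[of "Suc i" d "eb i"] eb(1,3)[OF i(1)] i(4) by auto
 moreover have "vec.span (set (map eb [Suc i..<CARD('n)])) = H d" using Suc i by simp
 ultimately have "vec.span (insert (eb i) (set (map eb [Suc i..<CARD('n)]))) = H (Suc d)"
  using Suc.prems eb(2)[OF i(1)] i(3) by (intro flag_span_Suc[OF fl(3)]) auto
 thus ?case using i(1) by (simp add: i_def[symmetric] upt_conv_Cons)
qed (simp add: span_0 fl)

lemma top_wedge_eb: "top_wedge (map eb [0..<CARD('n)]) ~= 0"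
proof (rule top_wedge_nonzero)
 have "vec.dim (E CARD('n)) = CARD('n)" "vec.subspace (E CARD('n))" using fl(1) by (auto simp: is_flag_def)
 hence "E CARD('n) = UNIV"
  using vec.subspace_dim_equal[of "E CARD('n)" UNIV] by (simp add: vec.dim_UNIV card_cart_basis)
 thus "vec.span (set (map eb [0..<CARD('n)])) = UNIV" using span_E by simp
qed simp

lemma map_A_eb: "\<forall>i\<in>set is. i < CARD('n) ==> map ((*v) A) (map eb is) = map (\<lambda>i. ev i *s eb i) is"
 using eb(4) by simp

lemma prod_ev: "prod_list (map ev [0..<CARD('n)]) = 1"
proof -
 have m: "map ((*v) A) (map eb [0..<CARD('n)]) = map (\<lambda>i. ev i *s eb i) [0..<CARD('n)]"
  by (rule map_A_eb) auto
 have "prod_list (map ev [0..<CARD('n)]) * top_wedge (map eb [0..<CARD('n)]) = 1 * top_wedge (map eb [0..<CARD('n)])"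
  using top_wedge_map[of "map eb [0..<CARD('n)]" A] top_wedge_scale_list[of "[]" "[0..<CARD('n)]" "[]" ev eb]
  unfolding m by (simp add: det1)
 thus ?thesis using top_wedge_eb by simp
qed

lemma ev_nonzero: "i < CARD('n) ==> ev i ~= 0"
 using prod_ev prod_list_zero_iff[of "map ev [0..<CARD('n)]"] by force

definition ev_low where "ev_low k = prod_list (map ev [0..<k])"
definition ev_high where "ev_high k = prod_list (map ev [CARD('n) - k..<CARD('n)])"

lemma ev_low_high: "k <= CARD('n) ==> ev_low (CARD('n) - k) * ev_high k = 1"
 using prod_list_upt_split[of "CARD('n) - k" "CARD('n)" ev] prod_ev by (simp add: ev_low_def ev_high_def)

text \<open>Applying \<open>A\<close> to all factors leaves the wedge unchanged as
  \<open>det A = 1\<close>; on the top powers of the invariant subspaces \<open>E a\<close> and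
  \<open>H d\<close> it acts by products of eigenvalues.\<close>

lemma top_wedge_between:
 assumes s: "a + length s + d = CARD('n)"
 shows "top_wedge (flag_basis E a @ s @ flag_basis H d) =
  ev_low a * ev_high d * top_wedge (flag_basis E a @ map ((*v) A) s @ flag_basis H d)"
proof -
 have le: "a <= CARD('n)" "d <= CARD('n)" using s by auto
 let ?u = "map eb [0..<a]" and ?v = "map eb [CARD('n) - d..<CARD('n)]"
 obtain c where c: "\<And>p r. length p + a + length r = CARD('n) ==> top_wedge (p @ flag_basis E a @ r) = c * top_wedge (p @ ?u @ r)"
  using flag_basis_change[OF fl(1) le(1) _ span_E[OF le(1)]] by (metis length_map length_upt minus_nat.diff_0)
 obtain k where k: "\<And>p r. length p + d + length r = CARD('n) ==> top_wedge (p @ flag_basis H d @ r) = k * top_wedge (p @ ?v @ r)"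
  using flag_basis_change[OF fl(3) le(2) _ span_H[OF le(2)]] by (metis length_map length_upt diff_diff_cancel le(2))
 have e: "top_wedge (flag_basis E a @ t @ flag_basis H d) = c * k * top_wedge (?u @ t @ ?v)" if "length t = length s" for t
  using c[of "[]" "t @ flag_basis H d"] k[of "?u @ t" "[]"] flag_basis(1)[OF fl(3) le(2)] s le that by simp
 have m: "map ((*v) A) ?u = map (\<lambda>i. ev i *s eb i) [0..<a]" "map ((*v) A) ?v = map (\<lambda>i. ev i *s eb i) [CARD('n) - d..<CARD('n)]"
  by (rule map_A_eb; use le in auto)+
 have "top_wedge (?u @ s @ ?v) = top_wedge (map ((*v) A) ?u @ map ((*v) A) s @ map ((*v) A) ?v)"
  using top_wedge_map[of "?u @ s @ ?v" A] s le det1 by simp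
 also have "\<dots> = ev_low a * (ev_high d * top_wedge (?u @ map ((*v) A) s @ ?v))"
  unfolding m using top_wedge_scale_list[of "[]" "[0..<a]" "map ((*v) A) s @ map (\<lambda>i. ev i *s eb i) [CARD('n) - d..<CARD('n)]" ev eb]
   top_wedge_scale_list[of "?u @ map ((*v) A) s" "[CARD('n) - d..<CARD('n)]" "[]" ev eb] s le
  by (simp add: ev_low_def ev_high_def)
 finally show ?thesis using e[of s] e[of "map ((*v) A) s"] by simp
qed

text \<open>As \<open>F\<close> is the image of \<open>G\<close> under \<open>A\<close>, passing
  from \<open>F\<close> to \<open>G\<close> costs eigenvalues and a scalar \<open>c\<close> for the
  change of basis. One \<open>c\<close> serves all \<open>a\<close>, \<open>d\<close>, which makes
  it cancel in cross ratios.\<close>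

lemma Q_F_G:
 assumes b: "b <= CARD('n)"
 shows "\<exists>c. c ~= 0 \<and> (\<forall>a d. a + b + d = CARD('n) \<longrightarrow> c * Q a 0 b d = ev_low a * ev_high d * Q a b 0 d)"
proof -
 note g = flag_basis[OF fl(2) b]
 have "vec.span (set (map ((*v) A) (flag_basis G b))) = F b"
  using g(4) by (simp add: fixd(3) mat_flag_def vec.linear_span_image[OF matrix_vector_mul_linear_gen])
 then obtain c where c: "c ~= 0" "\<And>p r. length p + b + length r = CARD('n) ==>
  top_wedge (p @ flag_basis F b @ r) = c * top_wedge (p @ map ((*v) A) (flag_basis G b) @ r)"
  using flag_basis_change[OF flF b, of "map ((*v) A) (flag_basis G b)"] g(1) by (metis length_map)
 have "c * Q a 0 b d = ev_low a * ev_high d * Q a b 0 d" if "a + b + d = CARD('n)" for a d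
  using top_wedge_between[of a "flag_basis G b" d] c(2)[of "flag_basis E a" "flag_basis H d"] that g(1)
   flag_basis(1)[OF fl(1), of a] flag_basis(1)[OF fl(3), of d]
  by (simp add: quad_wedge_def flag_basis_0 flF fl)
 thus ?thesis using c(1) by blast
qed

text \<open>The elementary cross ratio of \<open>E, F, G, H\<close> in dimension 2 is \<open>ev a / ev (a + 1)\<close>.\<close>

lemma ev_step:
 assumes a: "a + d + 2 = CARD('n)"
 shows "ev a * ev (a+1) > 0" "\<bar>ev (a+1)\<bar> < \<bar>ev a\<bar>"
proof -
 obtain al be ga de :: "nat => 'f" where ga: "\<And>a b c d. a + b + c + d = CARD('n) ==>
   al a * be b * ga c * de d * Q a b c d > 0"
  using positive_quadruple_gauge[OF fl(1) flF fl(2,3) pos] by blast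
 have "1 <= CARD('n)" using n2 by simp
 then obtain c where c: "c ~= 0" "\<And>a d. a + 1 + d = CARD('n) ==> c * Q a 0 1 d = ev_low a * ev_high d * Q a 1 0 d"
  using Q_F_G by blast
 \<comment> \<open>Determinant 1 turns \<open>ev_low i * ev_high j\<close> into the inverse of the
   one missing eigenvalue \<open>ev i\<close>.\<close>
 have AQ: "Q i 1 0 j = c * ev i * Q i 0 1 j" if ij: "i + j + 1 = CARD('n)" for i j
 proof -
  have "CARD('n) - j = Suc i" "j <= CARD('n)" using ij by auto
  hence "ev_low i * ev i * ev_high j = 1" using ev_low_high[of j] by (simp add: ev_low_def mult.assoc)
  hence "Q i 1 0 j = (ev_low i * ev i * ev_high j) * Q i 1 0 j" by simp
  also have "\<dots> = ev i * (c * Q i 0 1 j)" using c(2)[of i j] ij by (simp add: mult_ac)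
  finally show ?thesis by (simp add: mult_ac)
 qed
 define K where "K = al (a+1) * al a * (be 1 * be 0) * (ga 1 * ga 0) * (de (d+1) * de d)"
 \<comment> \<open>The sign of \<open>Z\<close> is unknown, but it is a common factor:
   \<open>ev a\<close>, \<open>ev (a+1)\<close> and their difference all have the sign of
   \<open>Z\<close>.\<close>
 define Z where "Z = c * K * (Q (a+1) 0 1 d * Q a 0 1 (d+1))"
 have "al (a+1) * be 0 * ga 1 * de d * Q (a+1) 0 1 d * (al a * be 1 * ga 0 * de (d+1) * Q a 1 0 (d+1)) > 0"
  by (rule mult_pos_pos; rule ga) (use a in auto)
 hence p1: "ev a * Z > 0" using AQ[of a "d+1"] a by (simp add: Z_def K_def mult_ac)
 have "al (a+1) * be 1 * ga 0 * de d * Q (a+1) 1 0 d * (al a * be 0 * ga 1 * de (d+1) * Q a 0 1 (d+1)) > 0"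
  by (rule mult_pos_pos; rule ga) (use a in auto)
 hence p2: "ev (a+1) * Z > 0" using AQ[of "a+1" d] a by (simp add: Z_def K_def mult_ac)
 have p3: "al (a+1) * be 0 * ga 0 * de (d+1) * Q (a+1) 0 0 (d+1) * (al a * be 1 * ga 1 * de d * Q a 1 1 d) > 0"
  by (rule mult_pos_pos; rule ga) (use a in auto)
 have oct: "Q (a+1) 0 1 d * Q a 1 0 (d+1) = Q (a+1) 1 0 d * Q a 0 1 (d+1) + Q (a+1) 0 0 (d+1) * Q a 1 1 d"
  using octahedron[OF fl(1) flF fl(2,3), of a 0 0 d] a by simp
 have "K * (Q (a+1) 0 1 d * Q a 1 0 (d+1)) - K * (Q (a+1) 1 0 d * Q a 0 1 (d+1)) > 0"
  using p3 unfolding oct by (simp add: K_def ring_distribs mult_ac)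
 hence p4: "ev a * Z - ev (a+1) * Z > 0"
  using AQ[of a "d+1"] AQ[of "a+1" d] a by (simp add: Z_def mult_ac)
 show "ev a * ev (a+1) > 0" using p1 p2 by (auto simp: zero_less_mult_iff)
 show "\<bar>ev (a+1)\<bar> < \<bar>ev a\<bar>"
  using p1 p2 p4 by (cases "Z > 0") (auto simp: zero_less_mult_iff mult_less_cancel_right)
qed

lemma ev_same_sign: "(\<forall>i<CARD('n). ev i > 0) \<or> (\<forall>i<CARD('n). ev i < 0)"
proof -
 have "ev 0 * ev i > 0" if "i < CARD('n)" for i
  using that
 proof (induction i)
  case 0
  thus ?case using ev_nonzero[of 0] by (simp add: zero_less_mult_iff linorder_neq_iff[symmetric] del: linorder_neq_iff)
 next
  case (Suc i)
  have "i + (CARD('n) - i - 2) + 2 = CARD('n)" using Suc.prems by simp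
  from ev_step(1)[OF this] show ?case using Suc by (auto simp: zero_less_mult_iff)
 qed
 thus ?thesis by (auto simp: zero_less_mult_iff) (meson less_asym)
qed

lemma ev_decreasing: "i < j ==> j < CARD('n) ==> \<bar>ev j\<bar> < \<bar>ev i\<bar>"
proof (induction j)
 case (Suc j)
 have "\<bar>ev (Suc j)\<bar> < \<bar>ev j\<bar>" using ev_step(2)[of j "CARD('n) - j - 2"] Suc.prems by simp
 thus ?case using Suc by (cases "i = j") auto
qed simp

text \<open>Moving \<open>H\<close> to the end costs the same sign in numerator and denominator.
  Then \<open>F\<close> is exchanged for \<open>G\<close> twice, beside \<open>E k\<close> and
  beside \<open>H k\<close>, and the two eigenvalue products remain.\<close>

lemma cross_ratio_period_H:
 assumes km: "k + m = CARD('n)"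
 shows "cross_ratio k H E F G = ev_low k / ev_high k"
proof -
 have le: "m <= CARD('n)" and mn: "CARD('n) - k = m" "CARD('n) - m = k" using km by auto
 obtain c where c: "c ~= 0" "\<And>a d. a + m + d = CARD('n) ==> c * Q a 0 m d = ev_low a * ev_high d * Q a m 0 d"
  using Q_F_G[OF le] by blast
 have sw: "wedge2 k H X = (-1) ^ (k * m) * wedge2 m X H" if "is_flag X" for X
  using top_wedge_block_swap[of "[]" "flag_basis H k" "flag_basis X m" "[]"] km flag_basis(1)[OF fl(3), of k] flag_basis(1)[OF that, of m]
  by (simp add: wedge2_def mn)
 note q = wedge2_quad[OF fl(1) flF fl(2,3)]
 have mk: "m + k = CARD('n)" using km by simp
 have e: "c * Q k 0 m 0 = ev_low k * Q k m 0 0" "c * Q 0 0 m k = ev_high k * Q 0 m 0 k"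
  using c(2)[of k 0] c(2)[of 0 k] km mk by (simp_all add: ev_low_def ev_high_def)
 have nz: "Q k 0 m 0 ~= 0" "Q k m 0 0 ~= 0" "Q 0 0 m k ~= 0" "Q 0 m 0 k ~= 0" using km by (auto intro!: Q_nonzero)
 have l: "ev_low k = c * Q k 0 m 0 / Q k m 0 0" "ev_high k = c * Q 0 0 m k / Q 0 m 0 k" using e nz by simp_all
 show ?thesis unfolding cross_ratio_def sw[OF flF] sw[OF fl(2)] q(5,6)[OF mk] q(1,2)[OF km] l using nz c(1) by (simp add: mult_ac)
qed

text \<open>For the second formula, exchanging the two arguments of \<open>wedge2\<close> turns
  \<open>k\<close> into the complementary dimension \<open>m\<close>, and determinant 1 makes the
  quotient of eigenvalue products the same for \<open>k\<close> and \<open>m\<close>. Hence both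
  orders of the endpoints of a geodesic yield the same period.\<close>

lemma cross_ratio_period:
 assumes k: "k <= CARD('n)"
 shows "cross_ratio k H E F G = ev_low k / ev_high k" "cross_ratio k F G H E = ev_low k / ev_high k"
proof -
 define m where "m = CARD('n) - k"
 have m: "k + m = CARD('n)" "m + k = CARD('n)" "m <= CARD('n)" "CARD('n) - m = k" using k by (auto simp: m_def)
 show "cross_ratio k H E F G = ev_low k / ev_high k" by (rule cross_ratio_period_H[OF m(1)])
 have "wedge2 k X Y = (-1) ^ (k * m) * wedge2 m Y X" if "is_flag X" "is_flag Y" for X Y :: "nat => ('f ^ 'n) set"
  using top_wedge_block_swap[of "[]" "flag_basis X k" "flag_basis Y m" "[]"] m flag_basis(1)[OF that(1), of k] flag_basis(1)[OF that(2), of m]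
  by (simp add: wedge2_def m_def[symmetric])
 hence "cross_ratio k F G H E = cross_ratio m H E F G" by (simp add: cross_ratio_def fl flF mult_ac)
 also have "\<dots> = ev_low m / ev_high m" by (rule cross_ratio_period_H[OF m(2)])
 also have "ev_low m = inverse (ev_high k)" "ev_high m = inverse (ev_low k)"
  using ev_low_high[OF k] ev_low_high[OF m(3)] m by (metis inverse_unique mult.commute m_def)+
 hence "ev_low m / ev_high m = ev_low k / ev_high k" by (simp add: divide_inverse mult.commute)
 finally show "cross_ratio k F G H E = ev_low k / ev_high k" .
qed

end

section \<open>Lifts from PSL to SL, eigenvalues and traces\<close>

lemma SL_center_scalar:
 fixes z :: "'f::linordered_field ^ 'n::finite ^ 'n"
 assumes z: "z \<in> SL_center" and n: "CARD('n) \<ge> 2"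
 shows "z = mat 1 \<or> z = - mat 1"
proof -
 have entries: "(\<forall>k. k ~= i \<longrightarrow> z $ k $ i = 0) \<and> z $ i $ i = z $ j $ j" if ij: "i ~= j" for i j
 proof -
  \<comment> \<open>An elementary matrix, the identity with an extra 1 at \<open>(i, j)\<close>;
    only scalar matrices commute with all of these.\<close>
  define B :: "'f ^ 'n ^ 'n" where "B = (\<chi> k l. (if k = l then 1 else 0) + (if k = i \<and> l = j then 1 else 0))"
  have "B = (\<chi> k. if k = i then row i (mat 1) + 1 *s row j (mat 1) else row k (mat 1))"
   using ij by (auto simp: B_def vec_eq_iff row_def mat_def)
  hence "det B = 1" using det_row_operation[OF ij, of "mat 1" 1] by simp
  hence c: "z ** B = B ** z" using z by (auto simp: SL_center_def SL_def)
  have zB: "(z ** B) $ k $ l = z $ k $ l + (if l = j then z $ k $ i else 0)" for k l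
   by (simp add: matrix_matrix_mult_def B_def ring_distribs sum.distrib if_distrib[of "(*) _"] cong: if_cong)
  have Bz: "(B ** z) $ k $ l = z $ k $ l + (if k = i then z $ j $ l else 0)" for k l
   by (simp add: matrix_matrix_mult_def B_def ring_distribs sum.distrib if_distrib[of "\<lambda>x. x * _"] cong: if_cong)
  have e: "z $ k $ l + (if l = j then z $ k $ i else 0) = z $ k $ l + (if k = i then z $ j $ l else 0)" for k l
   using zB Bz c by metis
  show ?thesis using e[of _ j] e[of i j] by auto
 qed
 obtain i0 j0 :: 'n where i0: "i0 ~= j0"
  using n card_le_Suc0_iff_eq[of "UNIV :: 'n set"] by auto
 define c where "c = z $ i0 $ i0"
 have diag: "z $ i $ i = c" for i using entries[of i0 i] by (cases "i = i0") (auto simp: c_def)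
 have off: "z $ k $ i = 0" if "k ~= i" for k i using entries[of i k] that by auto
 have zc: "z = mat c" using diag off by (auto simp: vec_eq_iff mat_def)
 have "det z = c ^ CARD('n)" using det_diagonal[of z] off diag by simp
 hence "c ^ CARD('n) = 1" using z by (simp add: SL_center_def SL_def)
 hence "\<bar>c\<bar> ^ CARD('n) = 1 ^ CARD('n)" by (simp add: power_abs[symmetric])
 hence "\<bar>c\<bar> = 1" using n by (subst (asm) power_eq_iff_eq_base) auto
 hence "c = 1 \<or> c = - 1" by (simp add: abs_if split: if_splits)
 moreover have "mat (- 1) = (- mat 1 :: 'f ^ 'n ^ 'n)" by (simp add: vec_eq_iff mat_def)
 ultimately show ?thesis using zc by auto
qed

lemma PSL_lifts:
 fixes g :: "('f::linordered_field ^ 'n::finite ^ 'n) set"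
 assumes "g \<in> carrier PSL"
 obtains A where "det A = 1" "g = (\<lambda>z. z ** A) ` SL_center"
proof -
 obtain A where "A \<in> carrier SL" "g = SL_center #>\<^bsub>SL\<^esub> A"
  using assms by (auto simp: PSL_def carrier_FactGroup)
 thus ?thesis using that[of A] by (auto simp: SL_def r_coset_def)
qed

lemma PSL_lift_det:
 fixes g :: "('f::linordered_field ^ 'n::finite ^ 'n) set"
 assumes "g \<in> carrier PSL" "A \<in> g"
 shows "det A = 1"
proof -
 obtain C where "det C = 1" "g = (\<lambda>z. z ** C) ` SL_center" using PSL_lifts[OF assms(1)] .
 thus ?thesis using assms(2) by (auto simp: det_mul SL_center_def SL_def)
qed

lemma PSL_lift_unique:
 fixes g :: "('f::linordered_field ^ 'n::finite ^ 'n) set"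
 assumes "g \<in> carrier PSL" "CARD('n) \<ge> 2" "A \<in> g" "B \<in> g"
 shows "B = A \<or> B = - A"
proof -
 obtain C where C: "g = (\<lambda>z. z ** C) ` SL_center" using PSL_lifts[OF assms(1)] by metis
 obtain z w where zw: "z \<in> SL_center" "w \<in> SL_center" "A = z ** C" "B = w ** C" using assms C by auto
 have m: "(- mat 1) ** C = - C" by (simp add: vec_eq_iff matrix_matrix_mult_def mat_def if_distrib[of "\<lambda>x. - (x * _)"] sum_negf cong: if_cong)
 show ?thesis using SL_center_scalar[OF zw(1) assms(2)] SL_center_scalar[OF zw(2) assms(2)] zw(3,4) m by auto
qed

lemma matrix_neg_mult:
 fixes A B :: "'f::ring_1 ^ 'n::finite ^ 'n"
 shows "(- A) ** B = - (A ** B)" "A ** (- B) = - (A ** B)"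
 by (simp_all add: vec_eq_iff matrix_matrix_mult_def sum_negf)

lemma det_neg: "det (- A :: 'f::comm_ring_1 ^ 'n::finite ^ 'n) = (- 1) ^ CARD('n) * det A"
proof -
 have "- A = (\<chi> i. (- 1) *s (A $ i))" by (simp add: vec_eq_iff)
 thus ?thesis using det_rows_mul[of "\<lambda>_. - 1" "\<lambda>i. A $ i"] by simp
qed

lemma PSL_lift_neg:
 fixes g :: "('f::linordered_field ^ 'n::finite ^ 'n) set"
 assumes "g \<in> carrier PSL" "even CARD('n)" "A \<in> g"
 shows "- A \<in> g"
proof -
 obtain C where C: "g = (\<lambda>z. z ** C) ` SL_center" using PSL_lifts[OF assms(1)] by metis
 then obtain z where z: "z \<in> SL_center" "A = z ** C" using assms(3) by auto
 have "- z \<in> SL_center"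
  using z(1) assms(2) by (auto simp: SL_center_def SL_def det_neg matrix_neg_mult)
 thus ?thesis using C z(2) matrix_neg_mult(1)[of z C] by (metis image_eqI)
qed

lemma PSL_nonempty: "g \<in> carrier (PSL :: ('f::linordered_field ^ 'n::finite ^ 'n) set monoid) ==> (SOME A. A \<in> g) \<in> g"
proof -
 assume g: "g \<in> carrier PSL"
 obtain C where C: "g = (\<lambda>z. z ** C) ` SL_center" using PSL_lifts[OF g] by metis
 have "mat 1 \<in> SL_center" by (simp add: SL_center_def SL_def)
 hence "\<exists>A. A \<in> g" using C by blast
 thus ?thesis by (rule someI_ex)
qed

lemma flag_act_eq: "flag_act g E = mat_flag (SOME A. A \<in> g) E"
 by (simp add: flag_act_def mat_flag_def)

context fixed_flag_pair
begin

definition mu where "mu i = \<bar>ev i\<bar>"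

lemma mu_pos: "i < CARD('n) ==> mu i > 0"
 using ev_nonzero by (simp add: mu_def)

text \<open>All eigenvalues have the same sign. If it is negative, their product being 1 forces an
  even dimension, and then \<open>- A\<close> is a lift as well.\<close>

lemma ex_positive_lift:
 assumes g: "g \<in> carrier PSL" "A \<in> g"
 shows "\<exists>B\<in>g. \<forall>i<CARD('n). B *v eb i = mu i *s eb i"
proof (cases "\<forall>i<CARD('n). ev i > 0")
 case True
 thus ?thesis using g(2) eb(4) by (intro bexI[of _ A]) (simp_all add: mu_def abs_of_pos)
next
 case False
 hence neg: "ev i < 0" if "i < CARD('n)" for i using ev_same_sign that by blast
 have "prod_list (map ev [0..<a]) * (- 1) ^ a > 0" if "a <= CARD('n)" for a
  using that
 proof (induction a)
  case (Suc a)
  have "prod_list (map ev [0..<Suc a]) * (- 1) ^ Suc a = (prod_list (map ev [0..<a]) * (- 1) ^ a) * (- ev a)"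
   by (simp add: mult_ac)
  also have "\<dots> > 0" by (rule mult_pos_pos) (use Suc neg[of a] in simp_all)
  finally show ?case .
 qed simp
 from this[of "CARD('n)"] have "even CARD('n)"
  using prod_ev by (cases "even CARD('n)") auto
 hence "- A \<in> g" using PSL_lift_neg g by blast
 moreover have "(- A) *v x = - (A *v x)" for x
  by (simp add: vec_eq_iff matrix_vector_mult_def sum_negf)
 hence "\<forall>i<CARD('n). (- A) *v eb i = mu i *s eb i"
  using eb(4) neg by (simp add: mu_def abs_of_neg)
 ultimately show ?thesis by blast
qed

text \<open>On the eigenbasis \<open>B - mat l\<close> acts by the factors \<open>m i - l\<close>.
  It is singular, so the product of these factors times the non-zero wedge of the eigenbasis
  vanishes.\<close>

lemma eigenvalue_in_spectrum:
 assumes B: "\<forall>i<CARD('n). B *v eb i = m i *s eb i" and v: "B *v v = l *s v" "v ~= 0"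
 shows "\<exists>i<CARD('n). l = m i"
proof -
 let ?C = "B - mat l"
 have Cx: "?C *v x = B *v x - l *s x" for x
  by (simp add: matrix_vector_mult_diff_rdistrib) (simp add: vec_eq_iff matrix_vector_mult_def mat_def if_distrib[of "\<lambda>x. x * _"] cong: if_cong)
 have "?C *v v = 0" "?C *v 0 = 0" using v Cx by simp_all
 hence "\<not> inj ((*v) ?C)" using v(2) unfolding inj_def by metis
 hence d: "det ?C = 0" using inj_matrix_det_1 by blast
 have "top_wedge (map ((*v) ?C) (map eb [0..<CARD('n)])) = 0"
  using top_wedge_map[of "map eb [0..<CARD('n)]" ?C] d by simp
 moreover have "map ((*v) ?C) (map eb [0..<CARD('n)]) = map (\<lambda>i. (m i - l) *s eb i) [0..<CARD('n)]"
  using B by (simp add: Cx vec.scale_left_diff_distrib)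
 ultimately have "top_wedge (map (\<lambda>i. (m i - l) *s eb i) [0..<CARD('n)]) = 0" by (simp only:)
 hence "prod_list (map (\<lambda>i. m i - l) [0..<CARD('n)]) * top_wedge (map eb [0..<CARD('n)]) = 0"
  using top_wedge_scale_list[of "[]" "[0..<CARD('n)]" "[]" "\<lambda>i. m i - l" eb] by simp
 hence "0 \<in> set (map (\<lambda>i. m i - l) [0..<CARD('n)])"
  using top_wedge_eb by (simp only: mult_eq_0_iff prod_list_zero_iff) blast
 thus ?thesis by auto
qed

text \<open>Uniqueness is what the definite description in \<open>pos_eigenvalue\<close> asks for.
  Every lift is \<open>B\<close> or \<open>- B\<close>, and the eigenvalues of \<open>- B\<close>
  are negative, so a positive list consists of values of \<open>mu\<close>; having the right length
  and being strictly decreasing, it is the list of all of them.\<close>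

lemma pos_spectrum:
 assumes g: "g \<in> carrier PSL" "A \<in> g"
 shows "is_pos_spectrum g ls \<longleftrightarrow> ls = map mu [0..<CARD('n)]"
proof -
 obtain B where B: "B \<in> g" "\<forall>i<CARD('n). B *v eb i = mu i *s eb i" using ex_positive_lift[OF g] by blast
 have dec: "sorted_wrt (>) (map mu [0..<CARD('n)])"
  using ev_decreasing by (simp add: sorted_wrt_iff_nth_less mu_def)
 have ex: "is_pos_spectrum g (map mu [0..<CARD('n)])"
 proof -
  have "\<exists>v. v ~= 0 \<and> B *v v = l *s v" if l: "l \<in> set (map mu [0..<CARD('n)])" for l
  proof -
   obtain i where "i < CARD('n)" "l = mu i" using l by auto
   thus ?thesis using B(2) eb(3)[of i] by (intro exI[of _ "eb i"]) simp
  qed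
  moreover have "\<forall>l\<in>set (map mu [0..<CARD('n)]). l > 0" using mu_pos by auto
  ultimately show ?thesis unfolding is_pos_spectrum_def using dec B(1) by auto
 qed
 moreover have "ls = map mu [0..<CARD('n)]" if ls: "is_pos_spectrum g ls"
 proof -
  obtain C where C: "C \<in> g" "\<forall>l\<in>set ls. \<exists>v. v ~= 0 \<and> C *v v = l *s v"
   using ls by (auto simp: is_pos_spectrum_def)
  have "l \<in> set (map mu [0..<CARD('n)])" if l: "l \<in> set ls" for l
  proof -
   obtain v where v: "v ~= 0" "C *v v = l *s v" using C(2) l by blast
   have lpos: "l > 0" using ls l by (auto simp: is_pos_spectrum_def)
   have "C = B \<or> C = - B" using PSL_lift_unique[OF g(1) n2 B(1) C(1)] .
   thus ?thesis
   proof
    assume "C = B"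
    thus ?thesis using eigenvalue_in_spectrum[OF B(2) v(2)[unfolded \<open>C = B\<close>] v(1)] by auto
   next
    assume "C = - B"
    hence "C *v v = - (B *v v)"
     by (simp add: vec_eq_iff matrix_vector_mult_def sum_negf)
    hence "B *v v = - (l *s v)" using v(2) by (simp add: minus_equation_iff[of "B *v v"])
    hence "B *v v = (- l) *s v" by simp
    then obtain i where "i < CARD('n)" "- l = mu i" using eigenvalue_in_spectrum[OF B(2) _ v(1)] by blast
    thus ?thesis using mu_pos[of i] lpos by simp
   qed
  qed
  hence sub: "set ls \<subseteq> set (map mu [0..<CARD('n)])" by blast
  have sl: "sorted_wrt (<) (rev ls)" "sorted_wrt (<) (rev (map mu [0..<CARD('n)]))"
   using ls dec by (auto simp: is_pos_spectrum_def sorted_wrt_rev)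
  hence "distinct (rev ls)" "distinct (rev (map mu [0..<CARD('n)]))"
   unfolding strict_sorted_iff by blast+
  hence "card (set ls) = CARD('n)" "card (set (map mu [0..<CARD('n)])) = CARD('n)"
   using ls by (simp_all only: is_pos_spectrum_def distinct_rev distinct_card length_map length_upt minus_nat.diff_0)
  hence "set (map mu [0..<CARD('n)]) = set ls"
   using card_subset_eq[OF _ sub] by simp
  hence "rev ls = rev (map mu [0..<CARD('n)])"
   using strict_sorted_equal[OF sl(2,1)] by simp
  thus ?thesis by (simp only: rev_is_rev_conv)
 qed
 ultimately show ?thesis by blast
qed

lemma pos_eigenvalue:
 assumes g: "g \<in> carrier PSL" "A \<in> g" and j: "j \<in> {1..CARD('n)}"
 shows "pos_eigenvalue g j = mu (j - 1)"
proof -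
 have "(THE ls. is_pos_spectrum g ls) = map mu [0..<CARD('n)]" using pos_spectrum[OF g] by simp
 moreover have "j - 1 < CARD('n)" using j by auto
 ultimately show ?thesis by (simp add: pos_eigenvalue_def)
qed

lemma trace_eigenbasis:
 assumes B: "\<forall>i<CARD('n). B *v eb i = m i *s eb i"
 shows "trace B = (\<Sum>i<CARD('n). m i)"
proof -
 define P :: "'f ^ 'n ^ 'n" where "P = (\<chi> i j. eb (coord_pos j) $ i)"
 define D :: "'f ^ 'n ^ 'n" where "D = (\<chi> i j. if i = j then m (coord_pos i) else 0)"
 have "transpose P = (\<chi> i::'n. map eb [0..<CARD('n)] ! coord_pos i)"
  using coord_pos_less[where 'n='n] by (simp add: P_def transpose_def vec_eq_iff)
 hence "det P ~= 0" using top_wedge_eb det_transpose[of P] unfolding top_wedge_def by simp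
 hence "invertible P" by (simp add: invertible_det_nz)
 then obtain P' where P': "P ** P' = mat 1" "P' ** P = mat 1" by (auto simp: invertible_def)
 have "B ** P = P ** D"
 proof -
  have "(B ** P) $ i $ j = (P ** D) $ i $ j" for i j
  proof -
   have "(B ** P) $ i $ j = (B *v eb (coord_pos j)) $ i"
    by (simp add: matrix_matrix_mult_def matrix_vector_mult_def P_def)
   also have "\<dots> = m (coord_pos j) * eb (coord_pos j) $ i" using B coord_pos_less[of j] by simp
   also have "\<dots> = (P ** D) $ i $ j"
    by (simp add: matrix_matrix_mult_def P_def D_def if_distrib[of "(*) _"] mult.commute cong: if_cong)
   finally show ?thesis .
  qed
  thus ?thesis by (simp add: vec_eq_iff)
 qed
 moreover have "B = B ** P ** P'" using P'(1) by (simp add: matrix_mul_assoc[symmetric])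
 ultimately have "B = P ** D ** P'" by simp
 hence "trace B = trace (P ** D ** P')" by simp
 also have "\<dots> = trace (P' ** (P ** D))" by (rule trace_mul_sym)
 also have "P' ** (P ** D) = D" using P'(2) by (simp add: matrix_mul_assoc)
 also have "trace D = (\<Sum>i\<in>UNIV. m (coord_pos (i::'n)))" by (simp add: trace_def D_def)
 also have "\<dots> = (\<Sum>i<CARD('n). m i)" by (rule sum.reindex_bij_betw[OF bij_coord_pos])
 finally show ?thesis .
qed

lemma abs_trace_eq:
 assumes g: "g \<in> carrier PSL" "A \<in> g"
 shows "abs_trace g = (\<Sum>i<CARD('n). mu i)"
proof -
 obtain B where B: "B \<in> g" "\<forall>i<CARD('n). B *v eb i = mu i *s eb i" using ex_positive_lift[OF g] by blast
 have t: "trace B = (\<Sum>i<CARD('n). mu i)" by (rule trace_eigenbasis[OF B(2)])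
 have "(\<Sum>i<CARD('n). mu i) \<ge> 0" using mu_pos by (intro sum_nonneg) (simp add: less_imp_le)
 moreover have "trace (- B) = - trace B" by (simp add: trace_def sum_negf)
 moreover have "(SOME A. A \<in> g) = B \<or> (SOME A. A \<in> g) = - B"
  using PSL_lift_unique[OF g(1) n2 B(1) PSL_nonempty[OF g(1)]] .
 ultimately show ?thesis using t by (auto simp: abs_trace_def)
qed

end

section \<open>Lengths and traces over a valued field\<close>

locale valued =
 fixes \<upsilon> :: "'f::linordered_field => ereal"
 assumes val: "valuation \<upsilon>" and ord: "order_compatible \<upsilon>"
begin

abbreviation nv where "nv \<equiv> valuation_norm \<upsilon>"

lemma nv_nonneg: "nv x \<ge> 0"
 by (simp add: valuation_norm_def)

lemma nv_zero_iff [simp]: "nv x = 0 \<longleftrightarrow> x = 0"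
 using val by (simp add: valuation_def)

lemma nv_0 [simp]: "nv 0 = 0"
 using nv_zero_iff[of 0] by blast

lemma nv_pos: "x ~= 0 ==> nv x > 0"
 using nv_nonneg[of x] nv_zero_iff[of x] by (simp add: less_le)

lemma nv_mult: "nv (x * y) = nv x * nv y"
 using val by (simp add: valuation_def)

lemma nv_1 [simp]: "nv 1 = 1"
 using nv_mult[of 1 1] nv_zero_iff[of 1] by simp

lemma nv_minus [simp]: "nv (- x) = nv x"
proof -
 have "nv (- 1) * nv (- 1) = 1" using nv_mult[of "- 1" "- 1"] by simp
 hence "nv (- 1) = 1" using nv_nonneg[of "- 1"] by (simp add: square_eq_1_iff)
 thus ?thesis using nv_mult[of "- 1" x] by simp
qed

lemma nv_abs [simp]: "nv \<bar>x\<bar> = nv x"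
 by (simp add: abs_if)

lemma nv_divide: "nv (x / y) = nv x / nv y"
proof (cases "y = 0")
 case False
 hence "nv (x / y) * nv y = nv x" using nv_mult[of "x / y" y] by simp
 thus ?thesis using False by (simp add: field_simps)
next
 case True
 thus ?thesis by simp
qed

lemma nv_power: "nv (x ^ m) = nv x ^ m"
 by (induction m) (simp_all add: nv_mult)

lemma val_eq: "x ~= 0 ==> \<upsilon> x = ereal (- ln (nv x))"
proof -
 assume "x ~= 0"
 hence "\<upsilon> x ~= \<infinity>" using nv_zero_iff[of x] by (auto simp: valuation_norm_def)
 moreover have "\<upsilon> x ~= - \<infinity>" using val by (simp add: valuation_def)
 ultimately show ?thesis by (cases "\<upsilon> x") (auto simp: valuation_norm_def)
qed

lemma val_neg_iff: "\<upsilon> x < 0 \<longleftrightarrow> nv x > 1"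
proof (cases "x = 0")
 case True
 hence "nv x = 0" by simp
 hence "\<upsilon> x = \<infinity>" by (auto simp: valuation_norm_def split: if_splits)
 moreover have "\<not> nv x > 1" using \<open>nv x = 0\<close> by linarith
 ultimately show ?thesis by simp
next
 case False
 thus ?thesis using val_eq[of x] nv_pos[of x] by simp
qed

lemma nv_mono: "0 < x ==> x <= y ==> nv x <= nv y"
proof -
 assume a: "0 < x" "x <= y"
 hence "\<upsilon> x \<ge> \<upsilon> y" using ord by (simp add: order_compatible_def)
 hence "ln (nv x) <= ln (nv y)" using a val_eq[of x] val_eq[of y] by simp
 thus ?thesis using nv_pos[of x] nv_pos[of y] a by simp
qed

lemma nv_ge_1: "x \<ge> 1 ==> nv x \<ge> 1"
 using nv_mono[of 1 x] by simp

lemma ln_nv_prod_list: "(\<And>i. i \<in> set is ==> x i ~= 0) ==>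
  ln (nv (prod_list (map x is))) = sum_list (map (\<lambda>i. ln (nv (x i))) is)"
proof (induction "is")
 case (Cons i "is")
 have "prod_list (map x is) ~= 0" using Cons.prems by (auto simp: prod_list_zero_iff)
 thus ?case using Cons nv_pos by (simp add: nv_mult ln_mult)
qed simp

end

locale valued_fixed_flag_pair = fixed_flag_pair A E F G H + valued \<upsilon>
 for \<upsilon> :: "'f::linordered_field => ereal"
  and A :: "'f ^ 'n::finite ^ 'n" and E F G H +
 fixes g :: "('f ^ 'n ^ 'n) set"
 assumes g: "g \<in> carrier PSL" "A \<in> g"
begin

text \<open>By \<open>val_eq\<close> this is minus the valuation of the eigenvalue, which the sign
  of the eigenvalue does not affect.\<close>

definition w where "w i = ln (nv (ev i))"

lemma w_mono: "i <= j ==> j < CARD('n) ==> w j <= w i"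
proof -
 assume ij: "i <= j" "j < CARD('n)"
 have "\<bar>ev j\<bar> <= \<bar>ev i\<bar>" using ij ev_decreasing[of i j] by (cases "i = j") auto
 hence "nv \<bar>ev j\<bar> <= nv \<bar>ev i\<bar>" using ij ev_nonzero by (intro nv_mono) auto
 thus ?thesis using ij nv_pos ev_nonzero by (simp add: w_def)
qed

lemma sum_w: "(\<Sum>i<CARD('n). w i) = 0"
proof -
 have "sum_list (map w [0..<CARD('n)]) = ln (nv (prod_list (map ev [0..<CARD('n)])))"
  using ln_nv_prod_list[of "[0..<CARD('n)]" ev] ev_nonzero by (simp add: w_def[abs_def])
 thus ?thesis using prod_ev by (simp add: interv_sum_list_conv_sum_set_nat atLeast0LessThan)
qed

lemma ln_period:
 assumes k: "k <= CARD('n)"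
 shows "ln (nv (ev_low k / ev_high k)) = (\<Sum>i<k. w i - w (CARD('n) - k + i))"
proof -
 have nz: "ev_low k ~= 0" "ev_high k ~= 0"
  using ev_nonzero k by (auto simp: ev_low_def ev_high_def prod_list_zero_iff)
 have "ln (nv (ev_low k)) = (\<Sum>i<k. w i)"
  unfolding ev_low_def using ln_nv_prod_list[of "[0..<k]" ev] ev_nonzero k
  by (simp add: w_def interv_sum_list_conv_sum_set_nat atLeast0LessThan)
 moreover have "ln (nv (ev_high k)) = (\<Sum>i=CARD('n)-k..<CARD('n). w i)"
  unfolding ev_high_def using ln_nv_prod_list[of "[CARD('n) - k..<CARD('n)]" ev] ev_nonzero k
  by (simp add: w_def interv_sum_list_conv_sum_set_nat)
 moreover have "(\<Sum>i=CARD('n)-k..<CARD('n). w i) = (\<Sum>i<k. w (CARD('n) - k + i))"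
  by (rule sum.reindex_bij_witness[of _ "\<lambda>i. CARD('n) - k + i" "\<lambda>j. j - (CARD('n) - k)"]) (use k in auto)
 ultimately show ?thesis using nz nv_pos by (simp add: nv_divide ln_div sum_subtractf)
qed

lemma k_length_eq:
 assumes k: "k \<in> {1..CARD('n) - 1}"
 shows "k_length \<upsilon> k g = ereal (ln (nv (ev_low k / ev_high k)))"
proof -
 have kn: "k <= CARD('n)" using k by auto
 have v: "\<upsilon> (pos_eigenvalue g j) = ereal (- w (j - 1))" if "j \<in> {1..CARD('n)}" for j
 proof -
  have "j - 1 < CARD('n)" using that by auto
  hence "mu (j - 1) ~= 0" using mu_pos[of "j - 1"] by simp
  thus ?thesis using pos_eigenvalue[OF g that] val_eq[of "mu (j - 1)"] by (simp add: mu_def w_def)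
 qed
 have "(\<Sum>j=1..k. \<upsilon> (pos_eigenvalue g j)) = (\<Sum>j=1..k. ereal (- w (j - 1)))"
  using kn by (intro sum.cong v) auto
 also have "\<dots> = ereal (\<Sum>j=1..k. - w (j - 1))" by simp
 also have "(\<Sum>j=1..k. - w (j - 1)) = (\<Sum>i<k. - w i)"
  by (rule sum.reindex_bij_witness[of _ Suc "\<lambda>j. j - 1"]) auto
 finally have 1: "(\<Sum>j=1..k. \<upsilon> (pos_eigenvalue g j)) = ereal (\<Sum>i<k. - w i)" .
 have "(\<Sum>j=CARD('n)-k+1..CARD('n). \<upsilon> (pos_eigenvalue g j)) = (\<Sum>j=CARD('n)-k+1..CARD('n). ereal (- w (j - 1)))"
  using kn by (intro sum.cong v) auto
 also have "\<dots> = ereal (\<Sum>j=CARD('n)-k+1..CARD('n). - w (j - 1))" by simp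
 also have "(\<Sum>j=CARD('n)-k+1..CARD('n). - w (j - 1)) = (\<Sum>i<k. - w (CARD('n) - k + i))"
  by (rule sum.reindex_bij_witness[of _ "\<lambda>i. Suc (CARD('n) - k + i)" "\<lambda>j. j - Suc (CARD('n) - k)"]) (use kn in auto)
 finally have 2: "(\<Sum>j=CARD('n)-k+1..CARD('n). \<upsilon> (pos_eigenvalue g j)) = ereal (\<Sum>i<k. - w (CARD('n) - k + i))" .
 show ?thesis unfolding k_length_def 1 2 ln_period[OF kn]
  by (simp add: sum_subtractf sum_negf)
qed

text \<open>The period is a sum of non-negative differences
  \<open>w i - w (CARD('n) - k + i)\<close>. If it vanishes, the decreasing \<open>w\<close> is
  constant on each range from \<open>i\<close> to \<open>CARD('n) - k + i\<close>; neighbouring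
  indices always share such a range, so \<open>w\<close> is constant, and its sum is 0.\<close>

lemma w_eq_0:
 assumes k: "k \<in> {1..CARD('n) - 1}" and z: "ln (nv (ev_low k / ev_high k)) = 0" and i: "i < CARD('n)"
 shows "w i = 0"
proof -
 have kn: "k <= CARD('n)" "0 < k" "k < CARD('n)" using k by auto
 have nn: "0 <= w i - w (CARD('n) - k + i)" if "i < k" for i
  using w_mono[of i "CARD('n) - k + i"] that kn by simp
 have "(\<Sum>i<k. w i - w (CARD('n) - k + i)) = 0" using ln_period[OF kn(1)] z by simp
 moreover have "(\<Sum>i<k. w i - w (CARD('n) - k + i)) = 0 \<longleftrightarrow> (\<forall>i\<in>{..<k}. w i - w (CARD('n) - k + i) = 0)"
  by (rule sum_nonneg_eq_0_iff) (use nn in blast)+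
 ultimately have "\<forall>i\<in>{..<k}. w i - w (CARD('n) - k + i) = 0" by blast
 hence "w i - w (CARD('n) - k + i) = 0" if "i < k" for i using that by blast
 hence eq: "w i = w (CARD('n) - k + i)" if "i < k" for i using that by (metis eq_iff_diff_eq_0)
 have step: "w (Suc i) = w i" if "Suc i < CARD('n)" for i
 proof -
  \<comment> \<open>Chosen so that both \<open>i\<close> and \<open>Suc i\<close> lie between
    \<open>j\<close> and \<open>CARD('n) - k + j\<close>.\<close>
  define j where "j = min i (k - 1)"
  have j: "j < k" "j <= i" "Suc i <= CARD('n) - k + j" "CARD('n) - k + j < CARD('n)"
   using kn that by (auto simp: j_def)
  have "w i <= w j" "w (CARD('n) - k + j) <= w (Suc i)" "w (Suc i) <= w i"
   using j that by (auto intro!: w_mono)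
  thus ?thesis using eq[OF j(1)] by linarith
 qed
 have const: "w i = w 0" if "i < CARD('n)" for i
  using that by (induction i) (simp_all add: step)
 have "(\<Sum>i<CARD('n). w i) = (\<Sum>i<CARD('n). w 0)"
  by (rule sum.cong[OF refl], rule const) simp
 hence "w 0 = 0" using sum_w by simp
 thus ?thesis using const[OF i] by simp
qed

lemma period_nonneg:
 assumes k: "k <= CARD('n)"
 shows "ln (nv (ev_low k / ev_high k)) \<ge> 0"
 unfolding ln_period[OF k] using k by (intro sum_nonneg) (simp add: w_mono)

lemma trace_le: "abs_trace g <= of_nat CARD('n) * mu 0" "mu 0 <= abs_trace g" "mu 0 > 0"
proof -
 have le: "mu i <= mu 0" if "i < CARD('n)" for i
  using ev_decreasing[of 0 i] that by (cases "i = 0") (auto simp: mu_def)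
 have "(\<Sum>i<CARD('n). mu i) <= (\<Sum>i<CARD('n). mu 0)" using le by (intro sum_mono) auto
 thus "abs_trace g <= of_nat CARD('n) * mu 0" using abs_trace_eq[OF g] by simp
 show "mu 0 > 0" using mu_pos[of 0] by simp
 show "mu 0 <= abs_trace g" unfolding abs_trace_eq[OF g]
  using mu_pos by (intro member_le_sum) (auto simp: less_imp_le)
qed

text \<open>A non-zero period excludes \<open>w 0 <= 0\<close>, because the \<open>w i\<close>
  decrease and sum to 0. The largest eigenvalue then has norm above 1, and it bounds the trace from
  below.\<close>

lemma trace_valuation_neg:
 assumes k: "k \<in> {1..CARD('n) - 1}" and nz: "ln (nv (ev_low k / ev_high k)) ~= 0"
 shows "\<upsilon> (abs_trace g) < 0"
proof -
 have kn: "k <= CARD('n)" using k by auto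
 have "w 0 > 0"
 proof (rule ccontr)
  assume "\<not> w 0 > 0"
  hence np: "w i <= 0" if "i < CARD('n)" for i using w_mono[of 0 i] that by simp
  hence "\<forall>i\<in>{..<CARD('n)}. - w i = 0"
   using sum_w sum_nonneg_eq_0_iff[of "{..<CARD('n)}" "\<lambda>i. - w i"] by (simp add: sum_negf)
  hence "(\<Sum>i<k. w i - w (CARD('n) - k + i)) = 0" using kn by (intro sum.neutral) auto
  thus False using nz ln_period[OF kn] by simp
 qed
 hence "nv (mu 0) > 1" using nv_pos[OF ev_nonzero[of 0]] by (simp add: w_def mu_def)
 moreover have "nv (mu 0) <= nv (abs_trace g)" using trace_le by (intro nv_mono)
 ultimately show ?thesis by (simp add: val_neg_iff)
qed

text \<open>The trace is at most the dimension times the largest eigenvalue, whose norm is 1 here;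
  so the norm of the dimension as a field element decides.\<close>

lemma trace_valuation_nonneg:
 assumes k: "k \<in> {1..CARD('n) - 1}" and z: "ln (nv (ev_low k / ev_high k)) = 0"
  and nat: "nv (of_nat CARD('n)) <= 1"
 shows "\<not> \<upsilon> (abs_trace g) < 0"
proof -
 have "w 0 = 0" using w_eq_0[OF k z, of 0] by simp
 hence m: "nv (mu 0) = 1" using nv_pos[OF ev_nonzero[of 0]] by (simp add: w_def mu_def ln_eq_zero_iff)
 have "abs_trace g > 0" using trace_le by linarith
 hence "nv (abs_trace g) <= nv (of_nat CARD('n) * mu 0)" using trace_le by (intro nv_mono)
 thus ?thesis using m nat by (simp add: nv_mult val_neg_iff)
qed

text \<open>The first two eigenvalues already differ, so over the reals the period cannot vanish.\<close>

lemma period_pos_if_nv_strict: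
 assumes k: "k \<in> {1..CARD('n) - 1}" and strict: "\<And>x y. 0 < x ==> x < y ==> nv x < nv y"
 shows "ln (nv (ev_low k / ev_high k)) ~= 0"
proof
 assume z: "ln (nv (ev_low k / ev_high k)) = 0"
 have "nv (mu 1) < nv (mu 0)" using ev_decreasing[of 0 1] ev_nonzero[of 1] n2 by (intro strict) (auto simp: mu_def)
 moreover have "w 1 = w 0" using w_eq_0[OF k z, of 0] w_eq_0[OF k z, of 1] n2 by simp
 ultimately show False using nv_pos[OF ev_nonzero[of 0]] nv_pos[OF ev_nonzero[of 1]] n2
  by (simp add: w_def mu_def)
qed

end

section \<open>Isometries of the disc\<close>

lemma SU11_iff: "(a, b) \<in> SU11 \<longleftrightarrow> a * cnj a - b * cnj b = 1"
proof -
 have "a * cnj a - b * cnj b = complex_of_real ((cmod a)\<^sup>2 - (cmod b)\<^sup>2)"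
  by (simp only: of_real_diff complex_norm_square)
 thus ?thesis by (simp add: SU11_def del: of_real_diff of_real_power)
qed

lemma SU11_norm: "(a, b) \<in> SU11 ==> (cmod a)\<^sup>2 = 1 + (cmod b)\<^sup>2"
 by (simp add: SU11_def)

lemma SU11_less: "(a, b) \<in> SU11 ==> cmod b < cmod a" "(a, b) \<in> SU11 ==> a ~= 0" "(a, b) \<in> SU11 ==> 1 <= cmod a"
proof -
 assume s: "(a, b) \<in> SU11"
 note n = SU11_norm[OF s]
 hence "(cmod b)\<^sup>2 < (cmod a)\<^sup>2" by simp
 thus "cmod b < cmod a" by (rule power_less_imp_less_base) simp
 thus "a ~= 0" by auto
 have "1\<^sup>2 <= (cmod a)\<^sup>2" using n by simp
 thus "1 <= cmod a" by (rule power2_le_imp_le) simp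
qed

definition su_mult :: "complex \<times> complex => complex \<times> complex => complex \<times> complex" where
 "su_mult = (\<lambda>(a, b) (c, d). (a * c + b * cnj d, a * d + b * cnj c))"

definition su_inv :: "complex \<times> complex => complex \<times> complex" where
 "su_inv = (\<lambda>(a, b). (cnj a, - b))"

lemma su_mult_SU11: "p \<in> SU11 ==> q \<in> SU11 ==> su_mult p q \<in> SU11"
proof -
 assume a: "p \<in> SU11" "q \<in> SU11"
 obtain a b c d where p: "p = (a, b)" "q = (c, d)" by (cases p; cases q)
 have 1: "a * cnj a - b * cnj b = 1" "c * cnj c - d * cnj d = 1" using a by (simp_all add: p SU11_iff)
 have "(a * c + b * cnj d) * cnj (a * c + b * cnj d) - (a * d + b * cnj c) * cnj (a * d + b * cnj c) =
  (a * cnj a - b * cnj b) * (c * cnj c - d * cnj d)" by (simp add: algebra_simps)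
 thus ?thesis using 1 by (simp add: p su_mult_def SU11_iff)
qed

lemma su_inv_SU11: "p \<in> SU11 ==> su_inv p \<in> SU11"
 by (cases p) (simp add: su_inv_def SU11_def)

lemma su_neg_SU11: "(a, b) \<in> SU11 ==> (- a, - b) \<in> SU11"
 by (simp add: SU11_def)

definition mob :: "complex \<times> complex => complex => complex" where
 "mob = (\<lambda>(a, b) z. (a * z + b) / (cnj b * z + cnj a))"

lemma mob_pair: "mob (a, b) z = (a * z + b) / (cnj b * z + cnj a)"
 by (simp add: mob_def)

lemma moebius_disc_eq: "moebius_disc p = restrict (mob p) (cball 0 1)"
 by (cases p) (simp add: moebius_disc_def mob_def restrict_def fun_eq_iff)

lemma moebius_disc_apply: "z \<in> cball 0 1 ==> moebius_disc p z = mob p z"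
 by (simp add: moebius_disc_eq)

lemma mob_neg: "mob (- a, - b) = mob (a, b)"
proof
 fix z
 have "- a * z + - b = - (a * z + b)" "cnj (- b) * z + cnj (- a) = - (cnj b * z + cnj a)" by simp_all
 thus "mob (- a, - b) z = mob (a, b) z"
  unfolding mob_def prod.case by (metis minus_divide_divide)
qed

lemma denom_bound:
 assumes "(a, b) \<in> SU11" "cmod z <= r" "r <= 1"
 shows "cmod a - cmod b * r <= cmod (cnj b * z + cnj a)" "0 < cmod a - cmod b * r"
  "cmod a * (1 - r) <= cmod (cnj b * z + cnj a)"
proof -
 have r0: "0 <= r" using assms(2) norm_ge_zero[of z] by linarith
 have "cmod (cnj b * z) <= cmod b * r" using assms(2) by (simp add: norm_mult mult_left_mono)
 moreover have "cmod (cnj a) - cmod (- (cnj b * z)) <= cmod (cnj a - - (cnj b * z))" by (rule norm_triangle_ineq2)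
 ultimately show 1: "cmod a - cmod b * r <= cmod (cnj b * z + cnj a)" by (simp add: add.commute)
 have "cmod b * r <= cmod b * 1" using assms(3) by (intro mult_left_mono) auto
 thus "0 < cmod a - cmod b * r" using SU11_less(1)[OF assms(1)] by simp
 have "cmod b * r <= cmod a * r" using SU11_less(1)[OF assms(1)] r0 by (intro mult_right_mono) auto
 thus "cmod a * (1 - r) <= cmod (cnj b * z + cnj a)" using 1 by (simp add: algebra_simps)
qed

lemma denom_nonzero: "(a, b) \<in> SU11 ==> cmod z <= 1 ==> cnj b * z + cnj a ~= 0"
 using denom_bound[of a b z 1] by auto

lemma mob_diff:
 assumes "(a, b) \<in> SU11" "cmod z <= 1" "cmod w <= 1"
 shows "mob (a, b) z - mob (a, b) w = (z - w) / ((cnj b * z + cnj a) * (cnj b * w + cnj a))"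
  "1 - cnj (mob (a, b) z) * mob (a, b) w = (1 - cnj z * w) / (cnj (cnj b * z + cnj a) * (cnj b * w + cnj a))"
proof -
 have 1: "a * cnj a - b * cnj b = 1" using assms(1) by (simp add: SU11_iff)
 define D E where "D = cnj b * z + cnj a" and "E = cnj b * w + cnj a"
 have DE: "D ~= 0" "E ~= 0" using denom_nonzero[OF assms(1)] assms(2,3) by (auto simp: D_def E_def)
 have m: "mob (a, b) z = (a * z + b) / D" "mob (a, b) w = (a * w + b) / E" by (simp_all add: mob_pair D_def E_def)
 have "mob (a, b) z - mob (a, b) w = ((a * z + b) * E - (a * w + b) * D) / (D * E)"
  using DE unfolding m by (simp add: field_simps)
 also have "(a * z + b) * E - (a * w + b) * D = (a * cnj a - b * cnj b) * (z - w)"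
  by (simp add: D_def E_def algebra_simps)
 finally show "mob (a, b) z - mob (a, b) w = (z - w) / ((cnj b * z + cnj a) * (cnj b * w + cnj a))"
  using 1 by (simp add: D_def E_def)
 have "1 - cnj (mob (a, b) z) * mob (a, b) w = (cnj D * E - cnj (a * z + b) * (a * w + b)) / (cnj D * E)"
  using DE unfolding m by (simp add: field_simps)
 also have "cnj D * E - cnj (a * z + b) * (a * w + b) = (a * cnj a - b * cnj b) * (1 - cnj z * w)"
  by (simp add: D_def E_def algebra_simps)
 finally show "1 - cnj (mob (a, b) z) * mob (a, b) w = (1 - cnj z * w) / (cnj (cnj b * z + cnj a) * (cnj b * w + cnj a))"
  using 1 by (simp add: D_def E_def)
qed

lemma mob_norm:
 assumes "(a, b) \<in> SU11" "cmod z <= 1"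
 shows "1 - (cmod (mob (a, b) z))\<^sup>2 = (1 - (cmod z)\<^sup>2) / (cmod (cnj b * z + cnj a))\<^sup>2"
proof -
 have *: "complex_of_real ((cmod w)\<^sup>2) = cnj w * w" for w by (simp only: complex_norm_square mult.commute)
 have "complex_of_real (1 - (cmod (mob (a, b) z))\<^sup>2) = of_real ((1 - (cmod z)\<^sup>2) / (cmod (cnj b * z + cnj a))\<^sup>2)"
  unfolding of_real_divide of_real_diff * of_real_1 by (rule mob_diff(2)[OF assms(1,2,2)])
 thus ?thesis by (simp only: of_real_eq_iff)
qed

lemma mob_cball: "p \<in> SU11 ==> z \<in> cball 0 1 ==> mob p z \<in> cball 0 1"
 and mob_ball: "p \<in> SU11 ==> z \<in> ball 0 1 ==> mob p z \<in> ball 0 1"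
 and mob_sphere: "p \<in> SU11 ==> z \<in> sphere 0 1 ==> mob p z \<in> sphere 0 1"
proof -
 assume p: "p \<in> SU11"
 obtain a b where ab: "p = (a, b)" by (cases p)
 have n: "1 - (cmod (mob p z))\<^sup>2 = (1 - (cmod z)\<^sup>2) / (cmod (cnj b * z + cnj a))\<^sup>2" "0 < (cmod (cnj b * z + cnj a))\<^sup>2" if "cmod z <= 1"
  using mob_norm[of a b z] denom_nonzero[of a b z] p that ab by auto
 have sq: "cmod z <= 1 \<longleftrightarrow> 0 <= 1 - (cmod z)\<^sup>2" "cmod z < 1 \<longleftrightarrow> 0 < 1 - (cmod z)\<^sup>2" "cmod z = 1 \<longleftrightarrow> 1 - (cmod z)\<^sup>2 = 0" for z
  using abs_square_le_1[of "cmod z"] abs_square_less_1[of "cmod z"] abs_square_eq_1[of "cmod z"] by auto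
 show "z \<in> cball 0 1 ==> mob p z \<in> cball 0 1" "z \<in> ball 0 1 ==> mob p z \<in> ball 0 1" "z \<in> sphere 0 1 ==> mob p z \<in> sphere 0 1"
  using n by (simp_all add: sq zero_le_divide_iff zero_less_divide_iff)
qed

lemma mob_compose:
 assumes "p \<in> SU11" "q \<in> SU11" "z \<in> cball 0 1"
 shows "mob p (mob q z) = mob (su_mult p q) z"
proof -
 obtain a b c d where p: "p = (a, b)" "q = (c, d)" by (cases p; cases q)
 define D where "D = cnj d * z + cnj c"
 have D: "D ~= 0" using denom_nonzero[of c d z] assms by (simp add: p D_def)
 have q: "mob q z = (c * z + d) / D" by (simp add: p mob_def D_def)
 have "cmod (mob q z) <= 1" using mob_cball[OF assms(2,3)] by simp
 hence E: "cnj b * mob q z + cnj a ~= 0" using denom_nonzero[of a b] assms by (simp add: p)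
 have n: "a * mob q z + b = (a * (c * z + d) + b * D) / D" "cnj b * mob q z + cnj a = (cnj b * (c * z + d) + cnj a * D) / D"
  using D by (simp_all add: q field_simps)
 have "mob p (mob q z) = (a * (c * z + d) + b * D) / (cnj b * (c * z + d) + cnj a * D)"
  using D E unfolding p(1) mob_pair[of a b] n by simp
 also have "\<dots> = mob (su_mult p q) z"
  by (simp add: p su_mult_def mob_def D_def algebra_simps)
 finally show ?thesis .
qed

lemma mob_id: "mob (1, 0) = (\<lambda>z. z)" by (simp add: mob_def fun_eq_iff)

lemma su_mult_inv: "p \<in> SU11 ==> su_mult p (su_inv p) = (1, 0)" "p \<in> SU11 ==> su_mult (su_inv p) p = (1, 0)"
 by (cases p; auto simp: su_mult_def su_inv_def SU11_iff algebra_simps)+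

lemma mob_inverse:
 assumes "p \<in> SU11" "z \<in> cball 0 1"
 shows "mob p (mob (su_inv p) z) = z" "mob (su_inv p) (mob p z) = z"
 using assms by (simp_all add: mob_compose su_inv_SU11 su_mult_inv mob_id)

text \<open>The square of the hyperbolic sine of half the hyperbolic distance.\<close>

definition sd :: "complex => complex => real" where
 "sd z w = (cmod (z - w))\<^sup>2 / ((1 - (cmod z)\<^sup>2) * (1 - (cmod w)\<^sup>2))"

lemma sd_mob:
 assumes "p \<in> SU11" "z \<in> ball 0 1" "w \<in> ball 0 1"
 shows "sd (mob p z) (mob p w) = sd z w"
proof -
 obtain a b where p: "p = (a, b)" by (cases p)
 have "(a, b) \<in> SU11" "cmod z <= 1" "cmod w <= 1" using assms p by auto
 note * = mob_diff(1)[OF this] mob_norm[OF this(1,2)] mob_norm[OF this(1,3)] denom_nonzero[OF this(1,2)] denom_nonzero[OF this(1,3)]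
 show ?thesis unfolding p sd_def *(1-3) using *(4,5) by (simp add: norm_divide norm_mult power_divide power_mult_distrib)
qed

lemma sd_ge: "z \<in> ball 0 1 ==> w \<in> ball 0 1 ==> (cmod (z - w))\<^sup>2 <= sd z w"
proof -
 assume "z \<in> ball 0 1" "w \<in> ball 0 1"
 hence *: "0 < 1 - (cmod z)\<^sup>2" "0 < 1 - (cmod w)\<^sup>2" by (simp_all add: abs_square_less_1)
 hence "(1 - (cmod z)\<^sup>2) * (1 - (cmod w)\<^sup>2) <= 1" using mult_le_one[of "1 - (cmod z)\<^sup>2" "1 - (cmod w)\<^sup>2"] by simp
 thus ?thesis using * divide_left_mono[of "(1 - (cmod z)\<^sup>2) * (1 - (cmod w)\<^sup>2)" 1 "(cmod (z - w))\<^sup>2"] by (simp add: sd_def)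
qed

text \<open>A lift of the boundary action through the universal cover \<open>cis\<close> of the
  circle; with it the cyclic order of the circle becomes the order of the line.\<close>

definition is_lift :: "(complex => complex) => (real => real) => bool" where
 "is_lift f F \<longleftrightarrow> continuous_on UNIV F \<and> strict_mono F \<and> (\<forall>x. F (x + 2 * pi) = F x + 2 * pi) \<and>
   (\<forall>x. cis (F x) = f (cis x))"

lemma cis_eq_iff: "cis x = cis y \<longleftrightarrow> (\<exists>k::int. x = y + 2 * pi * k)"
proof -
 have "cis x = cis y \<longleftrightarrow> exp (\<i> * of_real x) = exp (\<i> * of_real y)" by (simp add: cis_conv_exp)
 also have "\<dots> \<longleftrightarrow> (\<exists>n::int. \<i> * of_real x = \<i> * of_real y + (of_int (2 * n) * pi) * \<i>)"
  by (simp only: exp_eq)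
 also have "\<dots> \<longleftrightarrow> (\<exists>k::int. x = y + 2 * pi * k)"
 proof -
  have "\<i> * of_real x = \<i> * of_real y + (of_int (2 * n) * pi) * \<i> \<longleftrightarrow> x = y + 2 * pi * n" for n :: int
   by (auto simp: complex_eq_iff algebra_simps)
  thus ?thesis by simp
 qed
 finally show ?thesis .
qed

lemma periodic_int:
 fixes F :: "real => real"
 assumes "\<And>x. F (x + 2 * pi) = F x + 2 * pi"
 shows "F (x + 2 * pi * of_int k) = F x + 2 * pi * of_int k"
proof -
 have nat: "F (x + 2 * pi * of_nat m) = F x + 2 * pi * of_nat m" for x m
 proof (induction m)
  case (Suc m)
  have "F (x + 2 * pi * of_nat (Suc m)) = F ((x + 2 * pi * of_nat m) + 2 * pi)" by (simp add: algebra_simps)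
  thus ?case unfolding assms Suc by (simp add: algebra_simps)
 qed simp
 show ?thesis
 proof (cases "k \<ge> 0")
  case True
  thus ?thesis using nat[of x "nat k"] by simp
 next
  case False
  thus ?thesis using nat[of "x + 2 * pi * of_int k" "nat (- k)"] by (simp add: algebra_simps)
 qed
qed

text \<open>An injective continuous map of the line is monotone, and periodicity rules out a
  decreasing one: were \<open>F y < F x\<close> with \<open>x < y\<close>, the value
  \<open>F x\<close> would be taken again between \<open>y\<close> and a far translate of
  \<open>x\<close>.\<close>

lemma is_liftI:
 assumes c: "continuous_on UNIV F" and per: "\<And>x. F (x + 2 * pi) = F x + 2 * pi"
  and cis: "\<And>x. cis (F x) = f (cis x)" and inj: "inj_on f (sphere 0 1)"
 shows "is_lift f F"
proof -
 have "inj F"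
 proof (rule injI)
  fix x y assume xy: "F x = F y"
  have "f (cis x) = f (cis y)" using cis xy by metis
  hence "cis x = cis y" using inj by (auto simp: inj_on_def)
  then obtain k :: int where k: "x = y + 2 * pi * k" by (auto simp: cis_eq_iff)
  hence "F x = F y + 2 * pi * k" using periodic_int[of F, OF per] by simp
  thus "x = y" using xy k by simp
 qed
 have "strict_mono F"
 proof -
  have "F x < F y" if xy: "x < y" for x y
  proof (rule ccontr)
   assume "\<not> F x < F y"
   hence yx: "F y < F x" using \<open>inj F\<close> xy by (metis injD linorder_neqE less_irrefl)
   obtain k :: nat where k: "y - x < 2 * pi * real k" using reals_Archimedean3[of "2 * pi"] pi_gt_zero by (metis mult.commute mult_pos_pos zero_less_numeral)
   define z where "z = x + 2 * pi * real k"
   have Fz: "F z = F x + 2 * pi * real k" using periodic_int[of F x "int k", OF per] by (simp add: z_def)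
   have "y < z" using k by (simp add: z_def)
   have "0 <= 2 * pi * real k" by simp
   hence "F y < F x" "F x <= F z" using yx Fz by auto
   have "\<exists>w\<ge>y. w <= z \<and> F w = F x"
    by (rule IVT') (use \<open>y < z\<close> \<open>F y < F x\<close> \<open>F x <= F z\<close> continuous_on_subset[OF c] in auto)
   then obtain w where "w \<ge> y" "F w = F x" by blast
   thus False using \<open>inj F\<close> xy by (metis injD not_le)
  qed
  thus ?thesis by (rule strict_monoI)
 qed
 thus ?thesis using assms by (simp add: is_lift_def)
qed

lemma inj_on_moebius_sphere: "p \<in> SU11 ==> inj_on (moebius_disc p) (sphere 0 1)"
 by (rule inj_on_inverseI[of _ "mob (su_inv p)"]) (simp add: moebius_disc_apply mob_inverse)

text \<open>On the circle the map is \<open>cis x * u / cnj u\<close> with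
  \<open>u = a + b * cis (- x)\<close>, hence the lift \<open>x + 2 * Im (Ln u)\<close>. Fixed
  points and the direction of motion are read off the sign of \<open>Im u\<close>, which is that of
  \<open>sin \<alpha> - sin (x - \<beta>)\<close>.\<close>

lemma hyperbolic_lift:
 assumes ab: "(a, b) \<in> SU11" and A: "Re a > 1"
 obtains F r s where "is_lift (moebius_disc (a, b)) F" "r < s" "s < r + 2 * pi" "F r = r" "F s = s"
  "\<And>x. r < x ==> x < s ==> x < F x" "\<And>x. s < x ==> x < r + 2 * pi ==> F x < x"
proof -
 define B where "B = cmod b"
 define \<beta> where "\<beta> = Arg b"
 have n: "B\<^sup>2 = (Re a)\<^sup>2 + (Im a)\<^sup>2 - 1" using SU11_norm[OF ab] by (simp add: B_def cmod_power2)
 have A2: "(Re a)\<^sup>2 > 1" using A by (simp add: one_less_power)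
 hence "(Im a)\<^sup>2 < B\<^sup>2" using n by simp
 moreover have B0: "0 <= B" by (simp add: B_def)
 ultimately have IB: "\<bar>Im a\<bar> < B" by (metis abs_le_square_iff abs_of_nonneg not_le)
 hence Bpos: "0 < B" by linarith
 have b: "b = of_real B * cis \<beta>" using rcis_cmod_Arg[of b] by (simp add: B_def \<beta>_def rcis_def)
 \<comment> \<open>\<open>Re a > 1\<close> gives \<open>\<bar>Im a\<bar> < cmod b\<close>, so this
   angle exists; moreover \<open>Re u\<close> is positive wherever \<open>Im u\<close> vanishes, so
   \<open>u\<close> stays off the branch cut of \<open>Ln\<close>.\<close>
 define \<alpha> where "\<alpha> = arcsin (Im a / B)"
 have q: "- 1 < Im a / B" "Im a / B < 1" using IB Bpos by (auto simp: field_simps)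
 have al: "- (pi / 2) < \<alpha>" "\<alpha> < pi / 2" "sin \<alpha> = Im a / B"
  using arcsin_lt_bounded[OF q] q by (auto simp: \<alpha>_def)
 define u where "u x = a + b * cis (- x)" for x
 have uIm: "Im (u x) = B * (sin \<alpha> - sin (x - \<beta>))" for x
 proof -
  have "B * sin \<alpha> = Im a" using al(3) Bpos by simp
  thus ?thesis unfolding right_diff_distrib sin_diff by (simp add: u_def b algebra_simps)
 qed
 have uRe: "Re (u x) = Re a + B * cos (x - \<beta>)" for x
  unfolding cos_diff by (simp add: u_def b algebra_simps)
 have pos: "0 < Re (u x)" if "Im (u x) = 0" for x
 proof -
  have "sin (x - \<beta>) = sin \<alpha>" using that uIm Bpos by simp
  hence "(B * cos (x - \<beta>))\<^sup>2 = B\<^sup>2 - (B * sin \<alpha>)\<^sup>2"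
   by (simp add: power_mult_distrib cos_squared_eq algebra_simps)
  also have "\<dots> = (Re a)\<^sup>2 - 1" using al(3) Bpos n by simp
  finally have "(B * cos (x - \<beta>))\<^sup>2 < (Re a)\<^sup>2" by simp
  hence "\<bar>B * cos (x - \<beta>)\<bar> < \<bar>Re a\<bar>" by (metis abs_le_square_iff not_le)
  thus ?thesis using uRe A by simp
 qed
 have nn: "u x \<notin> \<real>\<^sub>\<le>\<^sub>0" for x using pos[of x] by (auto simp: complex_nonpos_Reals_iff)
 have u0: "u x ~= 0" for x using nn[of x] by auto
 define F where "F x = x + 2 * Im (Ln (u x))" for x
 have cont: "continuous_on UNIV F"
  unfolding F_def using nn by (intro continuous_intros) (auto simp: u_def intro!: continuous_intros)
 have cisF: "cis (F x) = moebius_disc (a, b) (cis x)" for x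
 proof -
  have "of_real (cmod (u x)) * cis (Im (Ln (u x))) = u x"
   using exp_Ln[OF u0[of x]] exp_eq_polar[of "Ln (u x)"] u0[of x] by (simp add: Re_Ln)
  hence c: "cis (Im (Ln (u x))) = u x / of_real (cmod (u x))" using u0[of x] by (simp add: field_simps)
  have "cis (F x) = cis x * (cis (Im (Ln (u x))))\<^sup>2"
   by (simp add: F_def cis_mult[symmetric] power2_eq_square) (simp add: cis_mult)
  also have "\<dots> = cis x * ((u x)\<^sup>2 / (of_real (cmod (u x)))\<^sup>2)" by (simp add: c power_divide)
  also have "(complex_of_real (cmod (u x)))\<^sup>2 = u x * cnj (u x)" by (simp only: complex_norm_square[symmetric] of_real_power)
  also have "cis x * ((u x)\<^sup>2 / (u x * cnj (u x))) = cis x * u x / cnj (u x)"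
   using u0[of x] by (simp add: power2_eq_square)
  also have "\<dots> = mob (a, b) (cis x)"
   by (simp add: mob_pair u_def cis_cnj ring_distribs mult_ac cis_mult)
  finally show ?thesis by (simp add: moebius_disc_apply)
 qed
 have lift: "is_lift (moebius_disc (a, b)) F"
 proof (rule is_liftI[OF cont _ cisF inj_on_moebius_sphere[OF ab]])
  fix x
  have "cis (- (x + 2 * pi)) = cis (- x)" unfolding cis_eq_iff by (rule exI[of _ "- 1"]) simp
  thus "F (x + 2 * pi) = F x + 2 * pi" by (simp add: F_def u_def)
 qed
 \<comment> \<open>The two solutions of \<open>sin (x - \<beta>) = sin \<alpha>\<close>, ordered so
   that \<open>sin (x - \<beta>) < sin \<alpha>\<close> between them: \<open>r\<close> repels and
   \<open>s\<close> attracts.\<close>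
 define r where "r = \<beta> + pi - \<alpha>"
 define s where "s = \<beta> + \<alpha> + 2 * pi"
 have rs: "r < s" "s < r + 2 * pi" using al by (auto simp: r_def s_def)
 have fixed: "F x = x" if "sin (x - \<beta>) = sin \<alpha>" for x
 proof -
  have "Im (u x) = 0" using uIm that by simp
  hence "Im (u x) = 0" "0 < Re (u x)" using pos by auto
  hence "Im (Ln (u x)) = 0" by (simp add: Im_Ln_eq_0[OF u0])
  thus ?thesis by (simp add: F_def)
 qed
 have "F r = r" by (rule fixed) (simp add: r_def)
 moreover have "F s = s"
 proof (rule fixed)
  have "s - \<beta> = \<alpha> + 2 * pi" by (simp add: s_def)
  thus "sin (s - \<beta>) = sin \<alpha>" by simp
 qed
 moreover have "x < F x" if x: "r < x" "x < s" for x
 proof -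
  define y where "y = x - \<beta> - 3 * pi / 2"
  have y: "\<bar>y\<bar> < pi / 2 + \<alpha>" using x by (auto simp: y_def r_def s_def)
  have "cos (pi / 2 + \<alpha>) < cos \<bar>y\<bar>" using y al by (intro cos_monotone_0_pi) auto
  moreover have "sin (x - \<beta>) = - cos y"
  proof -
   have "x - \<beta> = y + pi + pi / 2" by (simp add: y_def)
   thus ?thesis by (simp only: sin_add cos_add) simp
  qed
  moreover have "cos (pi / 2 + \<alpha>) = - sin \<alpha>" by (simp add: cos_add)
  ultimately have "sin (x - \<beta>) < sin \<alpha>" by simp
  hence "0 < Im (u x)" using uIm Bpos by simp
  hence "0 < Im (Ln (u x))" using Im_Ln_pos_lt[OF u0[of x]] by blast
  thus ?thesis by (simp add: F_def)
 qed
 moreover have "F x < x" if x: "s < x" "x < r + 2 * pi" for x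
 proof -
  define y where "y = x - \<beta> - 2 * pi - pi / 2"
  have y: "\<bar>y\<bar> < pi / 2 - \<alpha>" using x by (auto simp: y_def r_def s_def)
  have "cos (pi / 2 - \<alpha>) < cos \<bar>y\<bar>" using y al by (intro cos_monotone_0_pi) auto
  moreover have "sin (x - \<beta>) = cos y"
  proof -
   have "x - \<beta> = (y + pi / 2) + 2 * pi" by (simp add: y_def)
   hence "sin (x - \<beta>) = sin (y + pi / 2)" by (simp only: sin_periodic)
   thus ?thesis by (simp add: sin_add)
  qed
  moreover have "cos (pi / 2 - \<alpha>) = sin \<alpha>" by (simp add: cos_diff)
  ultimately have "sin \<alpha> < sin (x - \<beta>)" by simp
  hence "Im (u x) < 0" using uIm Bpos by (simp add: mult_less_0_iff)
  hence "Im (Ln (u x)) < 0" using Im_Ln_pos_le[OF u0[of x]] Im_Ln_le_pi[OF u0[of x]] by linarith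
  thus ?thesis by (simp add: F_def)
 qed
 ultimately show ?thesis using that lift rs by blast
qed

lemma moebius_in_Bij: "p \<in> SU11 ==> moebius_disc p \<in> Bij (cball 0 1)"
proof -
 assume p: "p \<in> SU11"
 have "bij_betw (moebius_disc p) (cball 0 1) (cball 0 1)"
  by (rule bij_betw_byWitness[of _ "mob (su_inv p)"])
   (use p mob_cball[OF p] mob_cball[OF su_inv_SU11[OF p]] in \<open>auto simp: moebius_disc_apply mob_inverse\<close>)
 thus ?thesis by (simp add: Bij_def moebius_disc_eq)
qed

lemma moebius_mult:
 assumes "p \<in> SU11" "q \<in> SU11"
 shows "moebius_disc p \<otimes>\<^bsub>BijGroup (cball 0 1)\<^esub> moebius_disc q = moebius_disc (su_mult p q)"
proof -
 have "moebius_disc p \<otimes>\<^bsub>BijGroup (cball 0 1)\<^esub> moebius_disc q = compose (cball 0 1) (moebius_disc p) (moebius_disc q)"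
  using moebius_in_Bij assms by (simp add: BijGroup_def)
 also have "\<dots> = moebius_disc (su_mult p q)"
  using mob_cball[OF assms(2)] assms by (auto simp: fun_eq_iff compose_def moebius_disc_eq mob_compose restrict_def simp del: mem_cball_0)
 finally show ?thesis .
qed

lemma moebius_one: "\<one>\<^bsub>BijGroup (cball 0 1)\<^esub> = moebius_disc (1, 0)"
 by (simp add: BijGroup_def moebius_disc_eq mob_id)

locale surface =
 fixes \<Gamma> :: "(complex => complex) set"
 assumes surface: "closed_surface_group \<Gamma>"
begin

abbreviation one\<Gamma> where "one\<Gamma> \<equiv> \<one>\<^bsub>pi1 \<Gamma>\<^esub>"
abbreviation mult\<Gamma> (infixl "\<odot>" 70) where "f \<odot> g \<equiv> f \<otimes>\<^bsub>pi1 \<Gamma>\<^esub> g"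
abbreviation pow\<Gamma> (infixr "\<star>" 75) where "f \<star> n \<equiv> f [^]\<^bsub>pi1 \<Gamma>\<^esub> n"
abbreviation inv\<Gamma> where "inv\<Gamma> f \<equiv> inv\<^bsub>pi1 \<Gamma>\<^esub> f"

lemma subgroup_\<Gamma>: "subgroup \<Gamma> (BijGroup (cball 0 1))"
 using surface by (simp add: closed_surface_group_def)

lemma group_pi1: "group (pi1 \<Gamma>)" unfolding pi1_def
 using subgroup.subgroup_is_group[OF subgroup_\<Gamma> group_BijGroup] .

lemma carrier_pi1 [simp]: "carrier (pi1 \<Gamma>) = \<Gamma>" by (simp add: pi1_def)

lemma rep: "f \<in> \<Gamma> ==> \<exists>p\<in>SU11. f = moebius_disc p"
 using surface by (auto simp: closed_surface_group_def disc_isometries_def)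

lemma one_eq: "one\<Gamma> = moebius_disc (1, 0)" by (simp add: pi1_def moebius_one)

lemma mult_eq: "p \<in> SU11 ==> q \<in> SU11 ==> moebius_disc p \<odot> moebius_disc q = moebius_disc (su_mult p q)"
 by (simp add: pi1_def moebius_mult)

lemma one_in: "one\<Gamma> \<in> \<Gamma>" and mult_in: "f \<in> \<Gamma> ==> g \<in> \<Gamma> ==> f \<odot> g \<in> \<Gamma>" and inv_in: "f \<in> \<Gamma> ==> inv\<Gamma> f \<in> \<Gamma>"
 using group.is_monoid[OF group_pi1] monoid.one_closed[of "pi1 \<Gamma>"] monoid.m_closed[of "pi1 \<Gamma>" f g] group.inv_closed[OF group_pi1, of f] by auto

lemma one_apply: "z \<in> cball 0 1 ==> one\<Gamma> z = z"
 by (simp add: one_eq moebius_disc_apply mob_id)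

lemma mult_apply:
 assumes "f \<in> \<Gamma>" "g \<in> \<Gamma>" "z \<in> cball 0 1"
 shows "(f \<odot> g) z = f (g z)"
proof -
 obtain p q where pq: "p \<in> SU11" "f = moebius_disc p" "q \<in> SU11" "g = moebius_disc q" using rep assms by meson
 show ?thesis using assms(3) mob_cball[OF pq(3) assms(3)] pq
  by (simp add: mult_eq moebius_disc_apply mob_compose)
qed

lemma maps:
 assumes "f \<in> \<Gamma>"
 shows "z \<in> cball 0 1 ==> f z \<in> cball 0 1" "z \<in> ball 0 1 ==> f z \<in> ball 0 1" "z \<in> sphere 0 1 ==> f z \<in> sphere 0 1"
proof -
 obtain p where p: "p \<in> SU11" "f = moebius_disc p" using rep assms by blast
 show "z \<in> cball 0 1 ==> f z \<in> cball 0 1" using mob_cball[OF p(1)] by (simp add: p moebius_disc_apply)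
 show "z \<in> ball 0 1 ==> f z \<in> ball 0 1" using mob_ball[OF p(1), of z] by (simp add: p moebius_disc_apply)
 show "z \<in> sphere 0 1 ==> f z \<in> sphere 0 1" using mob_sphere[OF p(1), of z] by (simp add: p moebius_disc_apply)
qed

lemma inv_apply:
 assumes "f \<in> \<Gamma>" "z \<in> cball 0 1"
 shows "f (inv\<Gamma> f z) = z" "inv\<Gamma> f (f z) = z"
 using mult_apply[OF assms(1) inv_in[OF assms(1)] assms(2)] mult_apply[OF inv_in[OF assms(1)] assms(1) assms(2)]
  group.r_inv[OF group_pi1, of f] group.l_inv[OF group_pi1, of f] assms one_apply[OF assms(2)] by simp_all

lemma sd_invariant: "f \<in> \<Gamma> ==> z \<in> ball 0 1 ==> w \<in> ball 0 1 ==> sd (f z) (f w) = sd z w"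
 using rep[of f] sd_mob by (auto simp: moebius_disc_apply)

lemma free: "f \<in> \<Gamma> ==> z \<in> ball 0 1 ==> f z = z ==> f = one\<Gamma>"
 using surface by (auto simp: closed_surface_group_def pi1_def)

lemma properly_discontinuous: "compact K ==> K \<subseteq> ball 0 1 ==> finite {f \<in> \<Gamma>. f ` K \<inter> K ~= {}}"
 using surface unfolding closed_surface_group_def by blast

lemma cocompact: "\<exists>R. 0 <= R \<and> R < 1 \<and> (\<forall>z\<in>ball 0 1. \<exists>f\<in>\<Gamma>. \<exists>w\<in>cball 0 R. f w = z)"
proof -
 have "\<exists>K. compact K \<and> K \<subseteq> ball 0 1 \<and> (\<Union>f\<in>\<Gamma>. f ` K) = ball 0 1"
  using surface unfolding closed_surface_group_def by (elim conjE)
 then obtain K where K: "compact K" "K \<subseteq> ball 0 1" "(\<Union>f\<in>\<Gamma>. f ` K) = ball 0 1" by (elim exE conjE)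
 have "(0::complex) \<in> ball 0 1" by simp
 hence ne: "K ~= {}" using K(3) by blast
 have "continuous_on K cmod" by (intro continuous_intros)
 then obtain x where x: "x \<in> K" "\<And>y. y \<in> K ==> cmod y <= cmod x"
  using continuous_attains_sup[OF K(1) ne, of cmod] by metis
 have 1: "\<exists>f\<in>\<Gamma>. \<exists>w\<in>cball 0 (cmod x). f w = z" if "z \<in> ball 0 1" for z
 proof -
  have "z \<in> (\<Union>f\<in>\<Gamma>. f ` K)" using that K(3) by simp
  then obtain f w where f: "f \<in> \<Gamma>" "w \<in> K" "z = f w" unfolding UN_iff image_iff by metis
  have "w \<in> cball 0 (cmod x)" using x(2)[OF f(2)] by simp
  thus ?thesis using f by metis
 qed
 have 2: "cmod x < 1" using subsetD[OF K(2) x(1)] by (simp only: mem_ball_0)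
 show ?thesis by (rule exI[of _ "cmod x"], intro conjI ballI norm_ge_zero 2 1)
qed

lemma conj_eq_one: "f \<in> \<Gamma> ==> h \<in> \<Gamma> ==> inv\<Gamma> h \<odot> f \<odot> h = one\<Gamma> ==> f = one\<Gamma>"
proof -
 interpret group "pi1 \<Gamma>" by (rule group_pi1)
 assume a: "f \<in> \<Gamma>" "h \<in> \<Gamma>" "inv\<Gamma> h \<odot> f \<odot> h = one\<Gamma>"
 hence "inv\<Gamma> h = inv\<Gamma> h \<odot> f" by (intro inv_equality) (auto simp: mult_in inv_in)
 thus "f = one\<Gamma>" using a r_cancel_one'[of "inv\<Gamma> h" f] by (metis carrier_pi1 inv_closed l_cancel_one')
qed

text \<open>Some group element moves the point into \<open>cball 0 R\<close>, and conjugation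
  preserves \<open>sd\<close>. From there only finitely many elements reach into the larger ball
  \<open>K\<close>, each with a positive least displacement by freeness; all others jump over the
  gap between the two radii.\<close>

lemma displacement_bound: "\<exists>\<delta>>0. \<forall>f\<in>\<Gamma>. f ~= one\<Gamma> \<longrightarrow> (\<forall>z\<in>ball 0 1. \<delta>\<^sup>2 <= sd (f z) z)"
proof -
 obtain R where R: "0 <= R" "R < 1" "\<And>z. z \<in> ball 0 1 ==> \<exists>f\<in>\<Gamma>. \<exists>w\<in>cball 0 R. f w = z" using cocompact by blast
 define K where "K = cball (0::complex) ((1 + R) / 2)"
 have K: "compact K" "K \<subseteq> ball 0 1" using R by (auto simp: K_def)
 define \<Phi> where "\<Phi> = {f \<in> \<Gamma>. f ` K \<inter> K ~= {}} - {one\<Gamma>}"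
 have fin: "finite \<Phi>" using properly_discontinuous[OF K] by (simp add: \<Phi>_def)
 have "\<exists>d>0. \<forall>w\<in>cball 0 R. d <= cmod (g w - w)" if "g \<in> \<Phi>" for g
 proof -
  have g: "g \<in> \<Gamma>" "g ~= one\<Gamma>" using that by (auto simp: \<Phi>_def)
  obtain a b where ab: "(a, b) \<in> SU11" "g = moebius_disc (a, b)" using rep[OF g(1)] by auto
  have "continuous_on (cball 0 R) (\<lambda>w. mob (a, b) w - w)"
   unfolding mob_pair using denom_nonzero[OF ab(1)] R by (intro continuous_intros) auto
  hence "continuous_on (cball 0 R) (\<lambda>w. cmod (g w - w))"
   by (intro continuous_on_norm, elim continuous_on_eq) (use R in \<open>simp add: ab(2) moebius_disc_apply\<close>)
  then obtain w0 where w0: "w0 \<in> cball 0 R" "\<forall>w\<in>cball 0 R. cmod (g w0 - w0) <= cmod (g w - w)"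
   using continuous_attains_inf[of "cball (0::complex) R" "\<lambda>w. cmod (g w - w)"] R by auto
  have "cmod (g w0 - w0) > 0" using free[OF g(1), of w0] g(2) w0(1) R by auto
  thus ?thesis using w0 by blast
 qed
 then obtain d where d: "\<And>g. g \<in> \<Phi> ==> d g > 0" "\<And>g w. g \<in> \<Phi> ==> w \<in> cball 0 R ==> d g <= cmod (g w - w)" by metis
 define \<delta> where "\<delta> = Min (insert ((1 - R) / 2) (d ` \<Phi>))"
 have "0 < \<delta>" using fin d(1) R by (simp add: \<delta>_def)
 moreover have "\<delta> <= (1 - R) / 2" "\<And>g. g \<in> \<Phi> ==> \<delta> <= d g"
  unfolding \<delta>_def by (intro Min_le; use fin in simp)+
 ultimately have \<delta>: "0 < \<delta>" "\<delta> <= (1 - R) / 2" "\<And>g. g \<in> \<Phi> ==> \<delta> <= d g" by blast+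
 have "\<delta>\<^sup>2 <= sd (f z) z" if f: "f \<in> \<Gamma>" "f ~= one\<Gamma>" and z: "z \<in> ball 0 1" for f z
 proof -
  obtain h w where h: "h \<in> \<Gamma>" "w \<in> cball 0 R" "h w = z" using R(3)[OF z] by blast
  have w: "w \<in> ball 0 1" "w \<in> cball 0 1" using h(2) R by auto
  define g where "g = inv\<Gamma> h \<odot> f \<odot> h"
  have g: "g \<in> \<Gamma>" "g ~= one\<Gamma>" using f h conj_eq_one[OF f(1) h(1)] by (auto simp: g_def mult_in inv_in)
  have gw: "h (g w) = f z"
  proof -
   have zc: "z \<in> cball 0 1" using z by auto
   have "g w = inv\<Gamma> h (f z)"
    unfolding g_def using mult_apply[OF mult_in[OF inv_in[OF h(1)] f(1)] h(1) w(2)] mult_apply[OF inv_in[OF h(1)] f(1) zc] h(3) by simp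
   thus ?thesis using inv_apply(1)[OF h(1) maps(1)[OF f(1) zc]] by simp
  qed
  have gb: "g w \<in> ball 0 1" using maps(2)[OF g(1) w(1)] .
  have "sd (f z) z = sd (g w) w" using sd_invariant[OF h(1) gb w(1)] gw h(3) by simp
  also have "\<dots> \<ge> (cmod (g w - w))\<^sup>2" using sd_ge[OF gb w(1)] .
  finally have 1: "(cmod (g w - w))\<^sup>2 <= sd (f z) z" .
  have "\<delta> <= cmod (g w - w)"
  proof (cases "g \<in> \<Phi>")
   case True
   thus ?thesis using d(2)[OF True h(2)] \<delta>(3)[OF True] by linarith
  next
   case False
   have "w \<in> K" using h(2) R by (auto simp: K_def)
   hence "g w \<notin> K" using False g by (auto simp: \<Phi>_def)
   hence "(1 + R) / 2 < cmod (g w)" by (auto simp: K_def)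
   moreover have "cmod (g w) <= cmod (g w - w) + cmod w" using norm_triangle_ineq[of "g w - w" w] by simp
   moreover have "cmod w <= R" using h(2) by simp
   ultimately show ?thesis using \<delta>(2) by (simp add: field_simps)
  qed
  thus ?thesis using 1 \<delta>(1) by (intro order_trans[OF power_mono[of \<delta> "cmod (g w - w)" 2]]) auto
 qed
 thus ?thesis using \<delta>(1) by blast
qed

end

section \<open>Non-trivial elements of the group are hyperbolic\<close>

context surface
begin

lemma moebius_neg: "moebius_disc (- a, - b) = moebius_disc (a, b)"
 by (simp add: moebius_disc_eq mob_neg)

lemma mob_fixed_point:
 assumes "p \<in> SU11"
 shows "\<exists>z\<in>cball 0 1. mob p z = z"
proof -
 obtain a b where p: "p = (a, b)" by (cases p)
 have "continuous_on (cball 0 1) (mob p)"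
  unfolding p mob_def prod.case using denom_nonzero[of a b] assms p by (intro continuous_intros) auto
 thus ?thesis using brouwer_ball[of 1 0 "mob p"] mob_cball[OF assms] by (metis Pi_I zero_less_one)
qed

text \<open>The denominator at a fixed point on the circle is an eigenvalue of the matrix.\<close>

lemma boundary_fixed_point:
 assumes ab: "(a, b) \<in> SU11" and z: "cmod z = 1" "mob (a, b) z = z"
 obtains D where "cnj b * z + cnj a = of_real D" "(D - Re a)\<^sup>2 = (Re a)\<^sup>2 - 1" "a * z + b = z * of_real D"
proof -
 define D where "D = cnj b * z + cnj a"
 have zz: "cnj z * z = 1" using complex_norm_square[of z] z(1) by (simp add: mult.commute)
 have e: "a * z + b = z * D" using z denom_nonzero[OF ab, of z] by (simp add: D_def mob_pair divide_eq_eq)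
 have "cnj D = cnj z * (a * z + b)" using zz by (simp add: D_def algebra_simps)
 also have "\<dots> = D" using zz by (simp add: e mult.assoc[symmetric])
 finally have D: "D = of_real (Re D)" by (simp add: complex_eq_iff)
 have "(cmod (cnj b * z))\<^sup>2 = (cmod a)\<^sup>2 - 1" using SU11_norm[OF ab] z by (simp add: norm_mult)
 moreover have "cnj b * z = of_real (Re D) - cnj a" unfolding D[symmetric] by (simp add: D_def)
 ultimately have "(Re D - Re a)\<^sup>2 = (Re a)\<^sup>2 - 1" by (simp add: cmod_power2)
 thus ?thesis using that[of "Re D"] D e by (simp add: D_def)
qed

text \<open>On the radius towards its fixed point a parabolic element displaces less and less: at
  \<open>r * z\<close> the value of \<open>sd\<close> is the square of
  \<open>cmod b * (1 - r) / (1 + r)\<close>. This contradicts the uniform lower bound on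
  displacements, which rests on cocompactness.\<close>

lemma no_parabolic:
 assumes ab: "(a, b) \<in> SU11" "moebius_disc (a, b) \<in> \<Gamma>" "moebius_disc (a, b) ~= one\<Gamma>"
  and z: "cmod z = 1" "cnj b * z + cnj a = 1" "a * z + b = z" and A: "Re a = 1"
 shows False
proof -
 have zz: "cnj z * z = 1" using complex_norm_square[of z] z(1) by (simp add: mult.commute)
 obtain \<delta> where d: "\<delta> > 0" "\<And>z. z \<in> ball 0 1 ==> \<delta>\<^sup>2 <= sd (moebius_disc (a, b) z) z"
  using displacement_bound ab(2,3) by blast
 have "cnj b * z + b * cnj z = 0"
 proof -
  have "cnj b * z = 1 - cnj a" using z(2) by (simp add: algebra_simps)
  moreover have "b * cnj z = 1 - a" using arg_cong[OF z(2), of cnj] by (simp add: algebra_simps)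
  ultimately show ?thesis using A by (simp add: complex_eq_iff)
 qed
 moreover have "cnj b * z\<^sup>2 + b * (cnj z * z) = (cnj b * z + b * cnj z) * z" by (simp add: algebra_simps power2_eq_square)
 ultimately have b: "cnj b * z\<^sup>2 = - b" using zz by (simp add: eq_neg_iff_add_eq_0)
 have le: "\<delta> <= cmod b * (1 - r)" if r: "0 < r" "r < 1" for r :: real
 proof -
  define w where "w = of_real r * z"
  define D where "D = cnj b * w + cnj a"
  have w: "cmod w = r" using z(1) r by (simp add: w_def norm_mult)
  have D: "D ~= 0" using denom_nonzero[OF ab(1), of w] w r by (simp add: D_def)
  have az: "a * z = z - b" "cnj a = 1 - cnj b * z" using z(2,3) by (simp_all add: algebra_simps)
  have "a * w + b - w * D = of_real r * (a * z) + b - of_real r * z * (of_real r * (cnj b * z) + cnj a)" by (simp add: w_def D_def)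
  also have "\<dots> = of_real (1 - r) * (b + of_real r * (cnj b * z\<^sup>2))" unfolding az by (simp add: algebra_simps power2_eq_square)
  also have "\<dots> = of_real ((1 - r)\<^sup>2) * b" unfolding b by (simp add: algebra_simps power2_eq_square)
  finally have "mob (a, b) w - w = of_real ((1 - r)\<^sup>2) * b / D"
   using D by (simp add: mob_pair D_def[symmetric] divide_diff_eq_iff)
  hence "sd (moebius_disc (a, b) w) w = (cmod b * (1 - r)\<^sup>2 / cmod D)\<^sup>2 / ((1 - r\<^sup>2) / (cmod D)\<^sup>2 * (1 - r\<^sup>2))"
   using mob_norm[OF ab(1), of w] w r by (simp add: sd_def moebius_disc_apply D_def norm_mult norm_divide del: of_real_diff of_real_power)
  also have "\<dots> = (cmod b * ((1 - r)\<^sup>2 / (1 - r\<^sup>2)))\<^sup>2" using D by (simp add: power_divide power2_eq_square)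
  also have "(1 - r)\<^sup>2 / (1 - r\<^sup>2) = (1 - r) / (1 + r)"
  proof -
   have "1 - r\<^sup>2 = (1 - r) * (1 + r)" by (simp add: algebra_simps power2_eq_square)
   thus ?thesis using r by (simp add: power2_eq_square)
  qed
  finally have "\<delta>\<^sup>2 <= (cmod b * ((1 - r) / (1 + r)))\<^sup>2" using d(2)[of w] w r by simp
  hence "\<delta> <= cmod b * ((1 - r) / (1 + r))" using r by (intro power2_le_imp_le[of \<delta>]) auto
  also have "\<dots> <= cmod b * ((1 - r) / 1)" using r by (intro mult_left_mono divide_left_mono) auto
  finally show ?thesis by simp
 qed
 \<comment> \<open>\<open>c\<close> is a positive bound for \<open>cmod b\<close>, and
   \<open>r\<close> is so close to 1 that \<open>c * (1 - r)\<close> is at most half of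
   \<delta>.\<close>
 define c r where "c = cmod b + 1" and "r = max (1 / 2) (1 - \<delta> / (2 * c))"
 have c: "0 < c" "cmod b <= c" using norm_ge_zero[of b] unfolding c_def by linarith+
 have r: "0 < r" "r < 1" "1 - r <= \<delta> / (2 * c)" using d(1) c by (auto simp: r_def max_def)
 have "\<delta> <= c * (\<delta> / (2 * c))"
  using le[OF r(1,2)] mult_mono[OF c(2) r(3)] r c by simp
 thus False using d(1) c by simp
qed

text \<open>Brouwer gives a fixed point in the closed disc, and freeness puts it on the circle.
  There the real denominator \<open>D\<close> satisfies
  \<open>(D - Re a)\<^sup>2 = (Re a)\<^sup>2 - 1\<close>, so \<open>\<bar>Re a\<bar> <= 1\<close>
  leaves only the parabolic case, up to the sign of the matrix.\<close>

lemma hyperbolic: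
 assumes "(a, b) \<in> SU11" "moebius_disc (a, b) \<in> \<Gamma>" "moebius_disc (a, b) ~= one\<Gamma>"
 shows "1 < \<bar>Re a\<bar>"
proof (rule ccontr)
 assume A: "\<not> 1 < \<bar>Re a\<bar>"
 obtain z where z: "z \<in> cball 0 1" "mob (a, b) z = z" using mob_fixed_point[OF assms(1)] by blast
 have "z \<notin> ball 0 1" using free[OF assms(2), of z] z assms(3) by (auto simp: moebius_disc_apply)
 hence z1: "cmod z = 1" using z(1) by auto
 obtain D where D: "cnj b * z + cnj a = of_real D" "(D - Re a)\<^sup>2 = (Re a)\<^sup>2 - 1" "a * z + b = z * of_real D"
  by (rule boundary_fixed_point[OF assms(1) z1 z(2)])
 have "(Re a)\<^sup>2 <= 1" using A by (simp add: abs_square_le_1)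
 hence "(D - Re a)\<^sup>2 = 0" "(Re a)\<^sup>2 = 1" using D(2) zero_le_power2[of "D - Re a"] by linarith+
 then consider "D = 1" "Re a = 1" | "D = - 1" "Re (- a) = 1" by (auto simp: power2_eq_1_iff)
 thus False
 proof cases
  case 1
  thus False using no_parabolic[OF assms z1] D by simp
 next
  case 2
  have "cnj (- b) * z + cnj (- a) = - (cnj b * z + cnj a)" "- a * z + - b = - (a * z + b)" by simp_all
  thus False using no_parabolic[of "- a" "- b" z] su_neg_SU11[OF assms(1)] assms moebius_neg z1 2 D by auto
 qed
qed

lemma lift_package:
 assumes f: "f \<in> \<Gamma>" "f ~= one\<Gamma>"
 obtains F r s where "is_lift f F" "r < s" "s < r + 2 * pi" "F r = r" "F s = s"
  "\<And>x. r < x ==> x < s ==> x < F x" "\<And>x. s < x ==> x < r + 2 * pi ==> F x < x"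
proof -
 obtain a b where ab: "(a, b) \<in> SU11" "f = moebius_disc (a, b)" using rep[OF f(1)] by auto
 have "1 < \<bar>Re a\<bar>" using hyperbolic ab f by blast
 then consider "Re a > 1" | "Re (- a) > 1" by (auto simp: abs_if split: if_splits)
 thus ?thesis
 proof cases
  case 1
  thus ?thesis using hyperbolic_lift[OF ab(1) 1] that ab(2) by metis
 next
  case 2
  thus ?thesis using hyperbolic_lift[OF su_neg_SU11[OF ab(1)] 2] that ab(2) moebius_neg by metis
 qed
qed

end

section \<open>Geodesics and their endpoints\<close>

text \<open>Up to non-zero denominators this is the sum of \<open>(x - z) / (1 - cnj z * x)\<close>
  and \<open>(y - z) / (1 - cnj z * y)\<close>, the images of the endpoints under the isometry
  taking \<open>z\<close> to 0. It vanishes iff they are antipodal, that is, iff \<open>z\<close>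
  lies on the geodesic from \<open>x\<close> to \<open>y\<close>.\<close>

definition geo_form :: "complex => complex => complex => complex" where
 "geo_form x y z = (x - z) * (1 - cnj z * y) + (y - z) * (1 - cnj z * x)"

definition geo :: "complex => complex => complex set" where
 "geo x y = {z \<in> ball 0 1. geo_form x y z = 0}"

lemma geo_sym: "geo x y = geo y x"
 by (simp add: geo_def geo_form_def add.commute)

lemma geo_form_mob:
 assumes ab: "(a, b) \<in> SU11" and "cmod x <= 1" "cmod y <= 1" "cmod z <= 1"
 shows "geo_form x y z = geo_form (mob (a, b) x) (mob (a, b) y) (mob (a, b) z) *
  ((cnj b * x + cnj a) * (cnj b * y + cnj a) * of_real ((cmod (cnj b * z + cnj a))\<^sup>2))"
proof -
 define X Y Z where "X = cnj b * x + cnj a" and "Y = cnj b * y + cnj a" and "Z = cnj b * z + cnj a"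
 have nz: "X ~= 0" "Y ~= 0" "Z ~= 0" using denom_nonzero[OF ab] assms by (auto simp: X_def Y_def Z_def)
 have "geo_form (mob (a, b) x) (mob (a, b) y) (mob (a, b) z) =
  (x - z) / (X * Z) * ((1 - cnj z * y) / (cnj Z * Y)) + (y - z) / (Y * Z) * ((1 - cnj z * x) / (cnj Z * X))"
  unfolding geo_form_def mob_diff[OF ab assms(2,4)] mob_diff[OF ab assms(3,4)] mob_diff[OF ab assms(4,2)] mob_diff[OF ab assms(4,3)]
  by (simp add: X_def Y_def Z_def)
 also have "\<dots> = geo_form x y z / (X * Y * (Z * cnj Z))"
  using nz by (simp add: geo_form_def field_simps)
 finally show ?thesis using nz unfolding X_def[symmetric] Y_def[symmetric] Z_def[symmetric]
  by (simp add: complex_norm_square del: of_real_power)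
qed

lemma mob_geo:
 assumes p: "p \<in> SU11" and xy: "x \<in> sphere 0 1" "y \<in> sphere 0 1"
 shows "mob p ` geo x y = geo (mob p x) (mob p y)"
proof -
 obtain a b where ab: "p = (a, b)" by (cases p)
 have iff: "mob p z \<in> geo (mob p x) (mob p y) \<longleftrightarrow> z \<in> geo x y" if z: "z \<in> ball 0 1" for z
 proof -
  have "cnj b * w + cnj a ~= 0" if "cmod w <= 1" for w using denom_nonzero[of a b w] p ab that by simp
  thus ?thesis
   using geo_form_mob[of a b x y z] p ab xy z mob_ball[OF p z] unfolding geo_def by auto
 qed
 have "z \<in> mob p ` geo x y" if z: "z \<in> geo (mob p x) (mob p y)" for z
 proof -
  have zb: "z \<in> ball 0 1" using z by (simp add: geo_def)
  define w where "w = mob (su_inv p) z"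
  have w: "w \<in> ball 0 1" "mob p w = z" using mob_ball[OF su_inv_SU11[OF p] zb] mob_inverse(1)[OF p, of z] zb by (auto simp: w_def)
  thus ?thesis using iff[OF w(1)] z by force
 qed
 moreover have "mob p z \<in> geo (mob p x) (mob p y)" if "z \<in> geo x y" for z
  using iff[of z] that by (simp add: geo_def)
 ultimately show ?thesis by blast
qed

lemma geo_diameter: "geo 1 (- 1) = of_real ` {-1<..<1}"
proof -
 have *: "geo_form 1 (- 1) z = - 4 * \<i> * of_real (Im z)" for z
  by (simp add: geo_form_def complex_eq_iff algebra_simps)
 have "z \<in> geo 1 (- 1) \<longleftrightarrow> z \<in> of_real ` {-1<..<1}" for z
 proof
  assume "z \<in> geo 1 (- 1)"
  hence z: "cmod z < 1" "Im z = 0" by (auto simp: geo_def *)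
  hence "z = of_real (Re z)" by (simp add: complex_eq_iff)
  moreover have "\<bar>Re z\<bar> < 1" using z(1) abs_Re_le_cmod[of z] by linarith
  ultimately show "z \<in> of_real ` {-1<..<1}" by (auto simp: abs_less_iff image_iff intro!: bexI[of _ "Re z"])
 qed (auto simp: geo_def *)
 thus ?thesis by blast
qed

lemma geodesic_of_eq: "p \<in> SU11 ==> geodesic_of p = geo (mob p 1) (mob p (- 1))"
proof -
 assume p: "p \<in> SU11"
 have "moebius_disc p z = mob p z" if "z \<in> of_real ` {-1<..<1}" for z
  using that by (auto simp: moebius_disc_apply)
 hence "geodesic_of p = mob p ` geo 1 (- 1)" unfolding geodesic_of_def geo_diameter by (rule image_cong[OF refl])
 thus ?thesis using mob_geo[OF p, of 1 "- 1"] by simp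
qed

lemma cis_sum: "cis u + cis v = 2 * of_real (cos ((u - v) / 2)) * cis ((u + v) / 2)"
 and cis_diff': "cis u - cis v = 2 * \<i> * of_real (sin ((u - v) / 2)) * cis ((u + v) / 2)"
proof -
 have e: "cis u = cis ((u + v) / 2) * cis ((u - v) / 2)" "cis v = cis ((u + v) / 2) * cis (- ((u - v) / 2))"
  unfolding cis_mult by (simp_all add: field_simps)
 have s: "cis x + cis (- x) = 2 * of_real (cos x)" "cis x - cis (- x) = 2 * \<i> * of_real (sin x)" for x
  by (simp_all add: complex_eq_iff)
 show "cis u + cis v = 2 * of_real (cos ((u - v) / 2)) * cis ((u + v) / 2)"
  unfolding e(1) e(2) distrib_left[symmetric] s by simp
 show "cis u - cis v = 2 * \<i> * of_real (sin ((u - v) / 2)) * cis ((u + v) / 2)"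
  unfolding e(1) e(2) right_diff_distrib[symmetric] s by simp
qed

lemma sphere_cis: "x \<in> sphere 0 1 ==> \<exists>u. x = cis u"
 using rcis_cmod_Arg[of x] by (metis mem_sphere_0 mult_1 of_real_1 rcis_def)

text \<open>At a real \<open>z\<close> the form becomes, up to a unit factor, a multiple of the
  quadratic \<open>(1 + z\<^sup>2) * C - 2 * z * D\<close>. It has a root of modulus below 1 iff
  \<open>\<bar>C\<bar> < \<bar>D\<bar>\<close> or \<open>C = D = 0\<close>, and the latter is the
  diameter itself. Finally \<open>Im x * Im y\<close> equals
  \<open>C\<^sup>2 - D\<^sup>2\<close>.\<close>

lemma geo_diameter_meet:
 assumes xy: "x \<in> sphere 0 1" "y \<in> sphere 0 1"
 shows "geo 1 (- 1) \<inter> geo x y ~= {} \<and> {x, y} ~= {1, - 1} \<longleftrightarrow> Im x * Im y < 0"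
proof -
 obtain u v where uv: "x = cis u" "y = cis v" using sphere_cis xy by metis
 define C D where "C = cos ((u - v) / 2)" and "D = cos ((u + v) / 2)"
 have Q: "geo_form x y (of_real z) = 2 * of_real ((1 + z\<^sup>2) * C - 2 * z * D) * cis ((u + v) / 2)" for z :: real
 proof -
  have "geo_form x y (of_real z) = of_real (1 + z\<^sup>2) * (x + y) - 2 * of_real z * (1 + x * y)"
   by (simp add: geo_form_def algebra_simps power2_eq_square)
  also have "x + y = 2 * of_real C * cis ((u + v) / 2)" by (simp add: uv cis_sum C_def)
  also have "1 + x * y = 2 * of_real D * cis ((u + v) / 2)"
   using cis_sum[of "u + v" 0] by (simp add: uv cis_mult D_def add.commute)
  finally show ?thesis by (simp add: algebra_simps)
 qed
 have CD: "Im x * Im y = C\<^sup>2 - D\<^sup>2"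
 proof -
  have "u = (u + v) / 2 + (u - v) / 2" "v = (u + v) / 2 - (u - v) / 2" by (simp_all add: field_simps)
  hence "sin u * sin v = sin ((u + v) / 2 + (u - v) / 2) * sin ((u + v) / 2 - (u - v) / 2)" by metis
  also have "\<dots> = (sin ((u + v) / 2))\<^sup>2 * C\<^sup>2 - D\<^sup>2 * (sin ((u - v) / 2))\<^sup>2"
   unfolding sin_add sin_diff by (simp add: C_def D_def algebra_simps power2_eq_square)
  also have "\<dots> = (1 - D\<^sup>2) * C\<^sup>2 - D\<^sup>2 * (1 - C\<^sup>2)" by (simp add: C_def D_def sin_squared_eq)
  finally show ?thesis by (simp add: uv algebra_simps)
 qed
 have meet: "geo 1 (- 1) \<inter> geo x y ~= {} \<longleftrightarrow> (\<exists>z. \<bar>z\<bar> < 1 \<and> (1 + z\<^sup>2) * C = 2 * z * D)"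
 proof -
  have "geo 1 (- 1) \<inter> geo x y = of_real ` {z::real. \<bar>z\<bar> < 1 \<and> geo_form x y (of_real z) = 0}"
   unfolding geo_diameter by (auto simp: geo_def abs_less_iff)
  hence "geo 1 (- 1) \<inter> geo x y ~= {} \<longleftrightarrow> (\<exists>z::real. \<bar>z\<bar> < 1 \<and> geo_form x y (of_real z) = 0)" by auto
  also have "\<dots> \<longleftrightarrow> (\<exists>z. \<bar>z\<bar> < 1 \<and> (1 + z\<^sup>2) * C = 2 * z * D)"
   unfolding Q by (simp del: of_real_mult of_real_diff of_real_add of_real_power)
  finally show ?thesis .
 qed
 show ?thesis
 proof
  assume l: "Im x * Im y < 0"
  hence "C\<^sup>2 < D\<^sup>2" using CD by simp
  \<comment> \<open>The root carries the sign of \<open>D\<close> to prevent cancellation in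
    \<open>D + w\<close>, so that \<open>C / (D + w)\<close> is the smaller solution.\<close>
  define w where "w = (if D > 0 then sqrt (D\<^sup>2 - C\<^sup>2) else - sqrt (D\<^sup>2 - C\<^sup>2))"
  have w: "w\<^sup>2 = D\<^sup>2 - C\<^sup>2" using \<open>C\<^sup>2 < D\<^sup>2\<close> by (simp add: w_def)
  have "\<bar>C\<bar> < \<bar>D\<bar>" using \<open>C\<^sup>2 < D\<^sup>2\<close> by (metis power2_abs power_less_imp_less_base abs_ge_zero)
  moreover have "sqrt (D\<^sup>2 - C\<^sup>2) > 0" using \<open>C\<^sup>2 < D\<^sup>2\<close> by simp
  hence "\<bar>D\<bar> <= \<bar>D + w\<bar>" unfolding w_def by (split if_split) linarith
  ultimately have Dw: "\<bar>C\<bar> < \<bar>D + w\<bar>" by linarith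
  hence nz: "D + w ~= 0" by auto
  define z where "z = C / (D + w)"
  have "\<bar>z\<bar> < 1" using Dw nz by (simp add: z_def abs_divide)
  moreover have "(1 + z\<^sup>2) * C = 2 * z * D"
  proof -
   have "(1 + z\<^sup>2) * C = C * ((D + w)\<^sup>2 + C\<^sup>2) / (D + w)\<^sup>2" using nz by (simp add: z_def power_divide field_simps)
   also have "(D + w)\<^sup>2 + C\<^sup>2 = (D + w) * (2 * D)" using w by (simp add: power2_eq_square algebra_simps)
   finally show ?thesis using nz by (simp add: z_def power2_eq_square)
  qed
  ultimately have "geo 1 (- 1) \<inter> geo x y ~= {}" using meet by blast
  moreover have "{x, y} ~= {1, - 1}" using l by (auto simp: doubleton_eq_iff)
  ultimately show "geo 1 (- 1) \<inter> geo x y ~= {} \<and> {x, y} ~= {1, - 1}" by blast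
 next
  assume m: "geo 1 (- 1) \<inter> geo x y ~= {} \<and> {x, y} ~= {1, - 1}"
  then obtain z where z: "\<bar>z\<bar> < 1" "(1 + z\<^sup>2) * C = 2 * z * D" using meet by blast
  show "Im x * Im y < 0"
  proof (rule ccontr)
   assume "\<not> Im x * Im y < 0"
   hence "D\<^sup>2 <= C\<^sup>2" using CD by simp
   hence DC: "\<bar>D\<bar> <= \<bar>C\<bar>" by (simp add: abs_le_square_iff)
   have "(1 + z\<^sup>2) * \<bar>C\<bar> = 2 * \<bar>z\<bar> * \<bar>D\<bar>" using arg_cong[OF z(2), of abs] by (simp add: abs_mult)
   also have "\<dots> <= 2 * \<bar>z\<bar> * \<bar>C\<bar>" using DC by (intro mult_left_mono) auto
   finally have "(1 - \<bar>z\<bar>)\<^sup>2 * \<bar>C\<bar> <= 0" by (simp add: power2_eq_square algebra_simps)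
   moreover have "(1 - \<bar>z\<bar>)\<^sup>2 > 0" using z(1) by simp
   ultimately have C: "C = 0" by (simp add: mult_le_0_iff)
   hence D: "D = 0" using DC by simp
   have "x + y = 0" using C by (simp add: uv cis_sum C_def[symmetric])
   hence y: "y = - x" by (simp add: add_eq_0_iff)
   have "1 + x * y = 0" using cis_sum[of "u + v" 0] D by (simp add: uv cis_mult D_def add.commute)
   hence "x\<^sup>2 = 1" using y by (simp add: power2_eq_square)
   hence "x = 1 \<or> x = - 1" by (simp add: power2_eq_1_iff)
   thus False using m y by auto
  qed
 qed
qed

lemma geo_eq_diameter:
 assumes "geo 1 (- 1) = geo x y"
 shows "{x, y} = {1, - 1}"
proof -
 have z: "geo_form x y (of_real z) = 0" if "\<bar>z\<bar> < 1" for z :: real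
 proof -
  have "of_real z \<in> geo 1 (- 1)" using that unfolding geo_diameter by (auto simp: abs_less_iff)
  hence "of_real z \<in> geo x y" using assms by simp
  thus ?thesis by (simp add: geo_def)
 qed
 have "x + y = 0" using z[of 0] by (simp add: geo_form_def)
 hence y: "y = - x" by (simp add: add_eq_0_iff)
 have "(x - 1/2) * (1 + x/2) + (- x - 1/2) * (1 - x/2) = 0" using z[of "1/2"] by (simp add: geo_form_def y)
 hence "x\<^sup>2 = 1" by (simp add: algebra_simps power2_eq_square)
 hence "x = 1 \<or> x = - 1" by (simp add: power2_eq_1_iff)
 thus ?thesis using y by auto
qed

text \<open>The isometry taking \<open>1\<close> and \<open>-1\<close> to the endpoints \<open>cis s\<close> and \<open>cis t\<close>.\<close>

definition axis_su :: "real => real => complex \<times> complex" where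
 "axis_su s t = ((cis (s / 2) - \<i> * of_real (inverse (sin ((t - s) / 2))) * cis (t / 2)) / 2,
   (cis (s / 2) + \<i> * of_real (inverse (sin ((t - s) / 2))) * cis (t / 2)) / 2)"

lemma axis_su:
 assumes "s < t" "t < s + 2 * pi"
 shows "axis_su s t \<in> SU11" "mob (axis_su s t) 1 = cis s" "mob (axis_su s t) (- 1) = cis t"
  "cnj (snd (axis_su s t)) + cnj (fst (axis_su s t)) = cis (- (s / 2))"
  "- cnj (snd (axis_su s t)) + cnj (fst (axis_su s t)) = \<i> * of_real (inverse (sin ((t - s) / 2))) * cis (- (t / 2))"
  "0 < sin ((t - s) / 2)"
proof -
 define \<rho> where "\<rho> = inverse (sin ((t - s) / 2))"
 define a b where "a = fst (axis_su s t)" and "b = snd (axis_su s t)"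
 show sp: "0 < sin ((t - s) / 2)" using assms by (intro sin_gt_zero) auto
 have su: "axis_su s t = (a, b)" by (simp add: a_def b_def)
 have ab: "a + b = cis (s / 2)" "a - b = - \<i> * of_real \<rho> * cis (t / 2)"
  unfolding a_def b_def axis_su_def by (simp_all add: \<rho>_def add_divide_distrib[symmetric] diff_divide_distrib[symmetric])
 have cab: "cnj b + cnj a = cis (- (s / 2))" "- cnj b + cnj a = \<i> * of_real \<rho> * cis (- (t / 2))"
 proof -
  have "cnj (a + b) = cis (- (s / 2))" unfolding ab by (simp add: cis_cnj)
  thus "cnj b + cnj a = cis (- (s / 2))" by (simp add: add.commute)
  have "cnj (a - b) = \<i> * of_real \<rho> * cis (- (t / 2))" unfolding ab by (simp add: cis_cnj)
  thus "- cnj b + cnj a = \<i> * of_real \<rho> * cis (- (t / 2))" by simp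
 qed
 thus "cnj (snd (axis_su s t)) + cnj (fst (axis_su s t)) = cis (- (s / 2))"
  "- cnj (snd (axis_su s t)) + cnj (fst (axis_su s t)) = \<i> * of_real (inverse (sin ((t - s) / 2))) * cis (- (t / 2))"
  by (simp_all add: a_def b_def \<rho>_def)
 have "(cmod a)\<^sup>2 - (cmod b)\<^sup>2 = Re ((a - b) * (cnj b + cnj a))"
  by (simp add: cmod_power2) (simp add: algebra_simps power2_eq_square)
 also have "\<dots> = Re (- \<i> * of_real \<rho> * cis ((t - s) / 2))"
  unfolding ab cab by (simp add: cis_mult mult.assoc diff_divide_distrib)
 also have "\<dots> = 1" using sp by (simp add: \<rho>_def power2_eq_square)
 finally show "axis_su s t \<in> SU11" by (simp add: su SU11_def)
 have c: "cis x = cis (x / 2) / cis (- (x / 2))" for x by (simp add: cis_divide)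
 show "mob (axis_su s t) 1 = cis s" using ab cab by (simp add: su mob_pair c[of s])
 have "mob (axis_su s t) (- 1) = (- (a - b)) / (- cnj b + cnj a)" by (simp add: su mob_pair)
 also have "\<dots> = cis t" unfolding ab cab using sp by (simp add: c[of t] \<rho>_def)
 finally show "mob (axis_su s t) (- 1) = cis t" .
qed

text \<open>Its sign tells on which side of the geodesic from \<open>cis r\<close> to
  \<open>cis s\<close> the boundary point \<open>cis \<theta>\<close> lies: positive between
  \<open>r\<close> and \<open>s\<close>, negative on the other arc. Up to a positive factor it is
  the imaginary part after the geodesic has been moved to the diameter.\<close>

definition sep :: "real => real => real => real" where
 "sep r s \<theta> = sin ((\<theta> - r) / 2) * sin ((s - \<theta>) / 2)"

text \<open>Both quantities are values of \<open>geo_form\<close>: for the diameter at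
  \<open>z\<close> it is \<open>- 4 * \<i> * Im z\<close>, for the given geodesic at
  \<open>cis \<theta>\<close> it is a multiple of \<open>sep\<close>. Covariance under the isometry
  compares them, and the phases cancel.\<close>

lemma axis_su_Im:
 assumes rs: "r < s" "s < r + 2 * pi" and z: "cmod z = 1" "mob (axis_su r s) z = cis \<theta>"
 shows "\<exists>k>0. Im z = k * sep r s \<theta>"
proof -
 obtain a b where ab: "axis_su r s = (a, b)" by (cases "axis_su r s")
 note ax = axis_su[OF rs, unfolded ab fst_conv snd_conv]
 define \<rho> where "\<rho> = inverse (sin ((s - r) / 2))"
 define N where "N = (cmod (cnj b * z + cnj a))\<^sup>2"
 have N: "N > 0" using denom_nonzero[OF ax(1)] z by (simp add: N_def)
 have "geo_form 1 (- 1) z = geo_form (cis r) (cis s) (cis \<theta>) * (cis (- (r / 2)) * (\<i> * of_real \<rho> * cis (- (s / 2))) * of_real N)"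
 proof -
  have e: "cnj b * 1 + cnj a = cis (- (r / 2))" "cnj b * (- 1) + cnj a = \<i> * of_real \<rho> * cis (- (s / 2))"
   using ax(4,5) by (simp_all add: \<rho>_def)
  have "geo_form 1 (- 1) z = geo_form (mob (a, b) 1) (mob (a, b) (- 1)) (mob (a, b) z) *
   ((cnj b * 1 + cnj a) * (cnj b * (- 1) + cnj a) * of_real N)"
   unfolding N_def by (rule geo_form_mob[OF ax(1)]) (use z in auto)
  thus ?thesis unfolding e ax(2,3) using z(2) ab by simp
 qed
 also have "geo_form (cis r) (cis s) (cis \<theta>) = - 8 * of_real (sep r s \<theta>) * cis ((r + s) / 2)"
 proof -
  have cc: "cnj (cis \<theta>) * cis \<theta> = 1" by (simp add: cis_cnj cis_mult)
  have "geo_form (cis r) (cis s) (cis \<theta>) = 2 * ((cis r - cis \<theta>) * (cnj (cis \<theta>) * (cis \<theta> - cis s)))"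
   using cc by (simp add: geo_form_def algebra_simps)
  also have "\<dots> = 2 * ((2 * \<i> * of_real (sin ((r - \<theta>) / 2)) * cis ((r + \<theta>) / 2)) *
    (cnj (cis \<theta>) * (2 * \<i> * of_real (sin ((\<theta> - s) / 2)) * cis ((\<theta> + s) / 2))))" by (simp only: cis_diff')
  also have "\<dots> = - 8 * of_real (sin ((r - \<theta>) / 2) * sin ((\<theta> - s) / 2)) * (cis ((r + \<theta>) / 2) * cis (- \<theta>) * cis ((\<theta> + s) / 2))"
  proof -
   have "2 * ((2 * \<i> * A * P) * (Q * (2 * \<i> * B * R))) = - 8 * (A * B) * (P * Q * R)" for A B P Q R
    using i_squared by algebra
   thus ?thesis by (simp only: cis_cnj of_real_mult)
  qed
  also have "cis ((r + \<theta>) / 2) * cis (- \<theta>) * cis ((\<theta> + s) / 2) = cis ((r + s) / 2)"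
   unfolding cis_mult by (rule arg_cong[of _ _ cis]) (simp add: field_simps)
  also have "sin ((r - \<theta>) / 2) * sin ((\<theta> - s) / 2) = sep r s \<theta>"
  proof -
   have "(r - \<theta>) / 2 = - ((\<theta> - r) / 2)" "(\<theta> - s) / 2 = - ((s - \<theta>) / 2)" by (simp_all add: field_simps)
   thus ?thesis unfolding sep_def by (simp only: sin_minus minus_mult_minus)
  qed
  finally show ?thesis .
 qed
 also have "- 8 * of_real (sep r s \<theta>) * cis ((r + s) / 2) * (cis (- (r / 2)) * (\<i> * of_real \<rho> * cis (- (s / 2))) * of_real N)
  = - 8 * \<i> * of_real (sep r s \<theta> * \<rho> * N) * (cis ((r + s) / 2) * cis (- (r / 2)) * cis (- (s / 2)))" by simp
 also have "cis ((r + s) / 2) * cis (- (r / 2)) * cis (- (s / 2)) = 1" by (simp add: cis_mult add_divide_distrib)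
 also have "geo_form 1 (- 1) z = - 4 * \<i> * of_real (Im z)"
  by (simp add: geo_form_def complex_eq_iff algebra_simps)
 finally have "Im z = 2 * \<rho> * N * sep r s \<theta>" by (simp add: complex_eq_iff)
 thus ?thesis using N ax(6) by (intro exI[of _ "2 * \<rho> * N"]) (simp add: \<rho>_def)
qed

lemma geo_via_diameter:
 assumes rs: "r < s" "s < r + 2 * pi" and xy: "x \<in> sphere 0 1" "y \<in> sphere 0 1"
 obtains x' y' where "x' \<in> sphere 0 1" "y' \<in> sphere 0 1" "mob (axis_su r s) x' = x" "mob (axis_su r s) y' = y"
  "mob (axis_su r s) ` geo x' y' = geo x y" "mob (axis_su r s) ` geo 1 (- 1) = geo (cis r) (cis s)"
proof -
 note p = axis_su(1)[OF rs]
 define x' y' where "x' = mob (su_inv (axis_su r s)) x" and "y' = mob (su_inv (axis_su r s)) y"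
 have s: "x' \<in> sphere 0 1" "y' \<in> sphere 0 1" using mob_sphere[OF su_inv_SU11[OF p]] xy by (simp_all add: x'_def y'_def)
 have m: "mob (axis_su r s) x' = x" "mob (axis_su r s) y' = y" using mob_inverse(1)[OF p] xy by (simp_all add: x'_def y'_def)
 show ?thesis using that[OF s m] mob_geo[OF p s] mob_geo[OF p, of 1 "- 1"] m axis_su[OF rs] by simp
qed

lemma mob_inj: "p \<in> SU11 ==> inj_on (mob p) (cball 0 1)"
 by (rule inj_on_inverseI[of _ "mob (su_inv p)"]) (simp add: mob_inverse)

lemma circle_param:
 fixes a s :: real
 obtains s' where "cis s = cis s'" "a <= s'" "s' < a + 2 * pi"
proof -
 define k where "k = \<lfloor>(s - a) / (2 * pi)\<rfloor>"
 have "of_int k <= (s - a) / (2 * pi)" "(s - a) / (2 * pi) < of_int k + 1" by (auto simp: k_def)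
 hence "2 * pi * of_int k <= s - a" "s - a < 2 * pi * of_int k + 2 * pi" by (simp_all add: field_simps)
 moreover have "cis s = cis (s - 2 * pi * of_int k)" unfolding cis_eq_iff by (intro exI[of _ k]) simp
 ultimately show ?thesis using that[of "s - 2 * pi * of_int k"] by auto
qed

lemma two_points:
 assumes "x \<in> sphere 0 1" "y \<in> sphere 0 1" "x ~= y"
 obtains s t where "x = cis s" "y = cis t" "s < t" "t < s + 2 * pi" "0 <= s" "s < 2 * pi"
proof -
 obtain u v where uv: "x = cis u" "y = cis v" using sphere_cis assms by metis
 obtain s where s: "cis u = cis s" "0 <= s" "s < 0 + 2 * pi" by (rule circle_param)
 obtain t where t: "cis v = cis t" "s <= t" "t < s + 2 * pi" by (rule circle_param)
 have "s ~= t" using s t uv assms(3) by auto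
 thus ?thesis using that uv s t by fastforce
qed

lemma geo_eq_iff:
 assumes "x \<in> sphere 0 1" "y \<in> sphere 0 1" "x ~= y" "x' \<in> sphere 0 1" "y' \<in> sphere 0 1"
 shows "geo x y = geo x' y' \<longleftrightarrow> {x, y} = {x', y'}"
proof
 assume e: "geo x y = geo x' y'"
 obtain r s where rs: "x = cis r" "y = cis s" "r < s" "s < r + 2 * pi" using two_points[OF assms(1-3)] by metis
 note p = axis_su[OF rs(3,4)]
 obtain u v where uv: "u \<in> sphere 0 1" "v \<in> sphere 0 1" "mob (axis_su r s) u = x'" "mob (axis_su r s) v = y'"
  "mob (axis_su r s) ` geo u v = geo x' y'" "mob (axis_su r s) ` geo 1 (- 1) = geo x y"
  using geo_via_diameter[OF rs(3,4) assms(4,5)] rs(1,2) by metis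
 have sub: "geo x y \<subseteq> cball 0 1" for x y by (auto simp: geo_def)
 have "geo u v = geo 1 (- 1)" using e uv(5,6) inj_on_image_eq_iff[OF mob_inj[OF p(1)] sub sub, of u v 1 "- 1"] by simp
 hence "{u, v} = {1, - 1}" using geo_eq_diameter by metis
 thus "{x, y} = {x', y'}" using uv(3,4) p(2,3) rs(1,2) by (auto simp: doubleton_eq_iff)
next
 assume "{x, y} = {x', y'}"
 thus "geo x y = geo x' y'" using geo_sym by (auto simp: doubleton_eq_iff)
qed

lemma geodesics_eq: "geodesics = {geo x y | x y. x \<in> sphere 0 1 \<and> y \<in> sphere 0 1 \<and> x ~= y}"
proof -
 have "l \<in> geodesics \<longleftrightarrow> (\<exists>x y. l = geo x y \<and> x \<in> sphere 0 1 \<and> y \<in> sphere 0 1 \<and> x ~= y)" for l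
 proof
  assume "l \<in> geodesics"
  then obtain p where p: "p \<in> SU11" "l = geodesic_of p" by (auto simp: geodesics_def)
  have "mob p 1 ~= mob p (- 1)" using inj_onD[OF mob_inj[OF p(1)], of 1 "- 1"] by auto
  thus "\<exists>x y. l = geo x y \<and> x \<in> sphere 0 1 \<and> y \<in> sphere 0 1 \<and> x ~= y"
   using p geodesic_of_eq[OF p(1)] mob_sphere[OF p(1), of 1] mob_sphere[OF p(1), of "- 1"] by auto
 next
  assume "\<exists>x y. l = geo x y \<and> x \<in> sphere 0 1 \<and> y \<in> sphere 0 1 \<and> x ~= y"
  then obtain x y where xy: "l = geo x y" "x \<in> sphere 0 1" "y \<in> sphere 0 1" "x ~= y" by blast
  obtain r s where rs: "x = cis r" "y = cis s" "r < s" "s < r + 2 * pi" using two_points[OF xy(2-4)] by metis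
  note p = axis_su[OF rs(3,4)]
  have "l = geodesic_of (axis_su r s)" using geodesic_of_eq[OF p(1)] p(2,3) rs xy(1) by simp
  thus "l \<in> geodesics" using p(1) by (auto simp: geodesics_def)
 qed
 thus ?thesis by blast
qed

text \<open>The isometry \<open>axis_su r s\<close> reduces the question to the diameter, which a
  different geodesic meets iff its endpoints have imaginary parts of opposite sign.\<close>

lemma geo_transverse_iff:
 assumes rs: "r < s" "s < r + 2 * pi" and ne: "cis \<alpha> ~= cis \<beta>"
 shows "geo (cis \<alpha>) (cis \<beta>) ~= geo (cis r) (cis s) \<and> geo (cis \<alpha>) (cis \<beta>) \<inter> geo (cis r) (cis s) ~= {} \<longleftrightarrow> sep r s \<alpha> * sep r s \<beta> < 0"
proof -
 note p = axis_su[OF rs]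
 obtain x y where xy: "x \<in> sphere 0 1" "y \<in> sphere 0 1" "mob (axis_su r s) x = cis \<alpha>" "mob (axis_su r s) y = cis \<beta>"
  "mob (axis_su r s) ` geo x y = geo (cis \<alpha>) (cis \<beta>)" "mob (axis_su r s) ` geo 1 (- 1) = geo (cis r) (cis s)"
  using geo_via_diameter[OF rs, of "cis \<alpha>" "cis \<beta>"] by auto
 have xny: "x ~= y" using ne xy(3,4) by auto
 note inj = mob_inj[OF p(1)]
 have sub: "geo x y \<subseteq> cball 0 1" "geo 1 (- 1) \<subseteq> cball 0 1" by (auto simp: geo_def)
 have "geo (cis \<alpha>) (cis \<beta>) ~= geo (cis r) (cis s) \<longleftrightarrow> geo x y ~= geo 1 (- 1)"
  using inj_on_image_eq_iff[OF inj sub] xy(5,6) by simp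
 also have "\<dots> \<longleftrightarrow> {x, y} ~= {1, - 1}" using geo_eq_iff[OF xy(1,2) xny, of 1 "- 1"] by simp
 finally have 1: "geo (cis \<alpha>) (cis \<beta>) ~= geo (cis r) (cis s) \<longleftrightarrow> {x, y} ~= {1, - 1}" .
 have "geo (cis \<alpha>) (cis \<beta>) \<inter> geo (cis r) (cis s) = mob (axis_su r s) ` (geo x y \<inter> geo 1 (- 1))"
  using inj_on_image_Int[OF inj sub] xy(5,6) by simp
 hence 2: "geo (cis \<alpha>) (cis \<beta>) \<inter> geo (cis r) (cis s) ~= {} \<longleftrightarrow> geo 1 (- 1) \<inter> geo x y ~= {}" by (simp add: Int_commute)
 obtain k where k: "k > 0" "Im x = k * sep r s \<alpha>" using axis_su_Im[OF rs _ xy(3)] xy(1) by auto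
 obtain m where m: "m > 0" "Im y = m * sep r s \<beta>" using axis_su_Im[OF rs _ xy(4)] xy(2) by auto
 have "Im x * Im y = (k * m) * (sep r s \<alpha> * sep r s \<beta>)" by (simp add: k m)
 hence "Im x * Im y < 0 \<longleftrightarrow> sep r s \<alpha> * sep r s \<beta> < 0" using k(1) m(1) by (simp add: mult_less_0_iff)
 thus ?thesis using 1 2 geo_diameter_meet[OF xy(1,2)] by blast
qed

section \<open>The action of the surface group on the circle\<close>

lemma cis_inj_interval:
 assumes "cis u = cis v" "\<bar>u - v\<bar> < 2 * pi"
 shows "u = v"
proof -
 obtain k :: int where k: "u = v + 2 * pi * k" using assms(1) cis_eq_iff by blast
 hence "\<bar>real_of_int k\<bar> < 1" using assms(2) by (simp add: abs_mult)
 hence "k = 0" by linarith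
 thus ?thesis using k by simp
qed

text \<open>Two lifts differ by a continuous function with values in the multiples of
  \<open>2 * pi\<close>, hence by a constant, which is 0 at \<open>r\<close>.\<close>

lemma is_lift_unique:
 assumes F: "is_lift f F" and G: "is_lift f G" and r: "F r = G r"
 shows "F = G"
proof
 fix x
 have c: "continuous_on UNIV (\<lambda>x. G x - F x)" using F G unfolding is_lift_def by (intro continuous_intros) auto
 have k: "\<exists>k::int. G x - F x = 2 * pi * k" for x
 proof -
  have "cis (G x) = cis (F x)" using F G by (simp add: is_lift_def)
  then obtain k :: int where "G x = F x + 2 * pi * k" using cis_eq_iff by blast
  thus ?thesis by (intro exI[of _ k]) simp
 qed
 have "(\<lambda>x. G x - F x) constant_on UNIV"
 proof (rule continuous_discrete_range_constant[OF connected_UNIV c])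
  fix x :: real
  have "2 * pi <= norm ((G y - F y) - (G x - F x))" if "G y - F y ~= G x - F x" for y
  proof -
   obtain i j :: int where ij: "G y - F y = 2 * pi * i" "G x - F x = 2 * pi * j" using k by metis
   hence "i ~= j" using that by auto
   hence "1 <= \<bar>real_of_int (i - j)\<bar>" by linarith
   hence "2 * pi * 1 <= 2 * pi * \<bar>real_of_int (i - j)\<bar>" by (intro mult_left_mono) auto
   also have "\<dots> = norm ((G y - F y) - (G x - F x))" unfolding ij real_norm_def by (simp add: abs_mult right_diff_distrib[symmetric])
   finally show ?thesis by simp
  qed
  thus "\<exists>e>0. \<forall>y. y \<in> UNIV \<and> G y - F y ~= G x - F x \<longrightarrow> e <= norm (G y - F y - (G x - F x))"
   by (intro exI[of _ "2 * pi"]) auto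
 qed
 then obtain c where "\<And>x. G x - F x = c" unfolding constant_on_def by auto
 from this[of r] this[of x] show "F x = G x" using r by simp
qed

lemma is_lift_shift:
 assumes "is_lift f F"
 shows "is_lift f (\<lambda>x. F x + 2 * pi * of_int k)"
proof -
 have "cis (F x + 2 * pi * of_int k) = cis (F x)" for x unfolding cis_eq_iff by blast
 thus ?thesis using assms by (auto simp: is_lift_def strict_mono_def intro!: continuous_intros)
qed

lemma is_lift_at:
 assumes F: "is_lift f F" and r: "f (cis r) = cis r'"
 obtains G where "is_lift f G" "G r = r'"
proof -
 have "cis (F r) = cis r'" using F r by (simp add: is_lift_def)
 then obtain k :: int where k: "r' = F r + 2 * pi * k" using cis_eq_iff by metis
 thus ?thesis using that[OF is_lift_shift[OF F, of k]] by simp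
qed

text \<open>A smallest positive element exists by finiteness, and the remainder of any element
  modulo it must be 0.\<close>

lemma discrete_subgroup_cyclic:
 fixes T :: "real set"
 assumes u: "u \<in> T" "u ~= 0" and diff: "\<And>x y. x \<in> T ==> y \<in> T ==> x - y \<in> T"
  and fin: "\<And>M. finite {x \<in> T. \<bar>x\<bar> <= M}"
 obtains \<tau> where "\<tau> > 0" "T = range (\<lambda>k::int. of_int k * \<tau>)"
proof -
 have 0: "0 \<in> T" using diff[OF u(1) u(1)] by simp
 have minus: "- x \<in> T" if "x \<in> T" for x using diff[OF 0 that] by simp
 define P where "P = {x \<in> T. 0 < x \<and> x <= \<bar>u\<bar>}"
 have "finite P" by (rule finite_subset[OF _ fin[of "\<bar>u\<bar>"]]) (auto simp: P_def)
 moreover have "\<bar>u\<bar> \<in> P" using u minus by (auto simp: P_def abs_if)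
 ultimately have "Min P \<in> P" "\<And>x. x \<in> P ==> Min P <= x" using Min_in[of P] Min_le[of P] by blast+
 then obtain \<tau> where t: "\<tau> \<in> T" "0 < \<tau>" "\<tau> <= \<bar>u\<bar>" "\<And>x. x \<in> T ==> 0 < x ==> x <= \<bar>u\<bar> ==> \<tau> <= x"
  unfolding P_def by auto
 have nat: "of_nat k * \<tau> \<in> T" for k :: nat
 proof (induction k)
  case (Suc k)
  have "of_nat k * \<tau> - - \<tau> \<in> T" by (rule diff[OF Suc minus[OF t(1)]])
  thus ?case by (simp add: algebra_simps)
 qed (simp add: 0)
 have int: "of_int k * \<tau> \<in> T" for k :: int
 proof (cases k)
  case (nonneg n)
  thus ?thesis using nat[of n] by simp
 next
  case (neg n)
  have "of_int k * \<tau> = - (of_nat (Suc n) * \<tau>)" by (simp add: neg algebra_simps)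
  thus ?thesis using minus[OF nat[of "Suc n"]] by (simp only:)
 qed
 have "x \<in> range (\<lambda>k::int. of_int k * \<tau>)" if x: "x \<in> T" for x
 proof -
  define k where "k = \<lfloor>x / \<tau>\<rfloor>"
  define y where "y = x - of_int k * \<tau>"
  have "of_int k <= x / \<tau>" "x / \<tau> < of_int k + 1" by (auto simp: k_def)
  hence y: "0 <= y" "y < \<tau>" using t(2) by (auto simp: y_def field_simps)
  have "y \<in> T" using diff[OF x int[of k]] by (simp add: y_def)
  hence "y = 0" using y t(3) t(4)[of y] by force
  thus ?thesis by (auto simp: y_def)
 qed
 thus ?thesis using that[OF t(2)] int by blast
qed

context surface
begin

lemma action_geo:
 assumes "f \<in> \<Gamma>" "x \<in> sphere 0 1" "y \<in> sphere 0 1"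
 shows "f ` geo x y = geo (f x) (f y)"
proof -
 obtain p where p: "p \<in> SU11" "f = moebius_disc p" using rep assms(1) by blast
 have "f ` geo x y = mob p ` geo x y" by (rule image_cong) (auto simp: p(2) moebius_disc_apply geo_def)
 thus ?thesis using mob_geo[OF p(1) assms(2,3)] assms by (simp add: p(2) moebius_disc_apply)
qed

lemma ex_lift:
 assumes "f \<in> \<Gamma>"
 shows "\<exists>F. is_lift f F"
proof (cases "f = one\<Gamma>")
 case True
 have "is_lift one\<Gamma> (\<lambda>x. x)" by (auto simp: is_lift_def one_apply strict_mono_def)
 thus ?thesis using True by blast
next
 case False
 thus ?thesis using lift_package[OF assms] by metis
qed

lemma is_lift_mult:
 assumes "f \<in> \<Gamma>" "g \<in> \<Gamma>" "is_lift f F" "is_lift g G"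
 shows "is_lift (f \<odot> g) (F \<circ> G)"
proof -
 have "continuous_on UNIV (F \<circ> G)" using assms(3,4) unfolding is_lift_def
  by (intro continuous_on_compose) (auto intro: continuous_on_subset)
 moreover have "strict_mono (F \<circ> G)" using assms(3,4) by (simp add: is_lift_def strict_mono_def)
 ultimately show ?thesis using assms mult_apply[OF assms(1,2)] by (simp add: is_lift_def)
qed

lemma nontrivial: "\<exists>f\<in>\<Gamma>. f ~= one\<Gamma>"
proof (rule ccontr)
 assume "\<not> (\<exists>f\<in>\<Gamma>. f ~= one\<Gamma>)"
 hence all: "\<And>f. f \<in> \<Gamma> ==> f = one\<Gamma>" by blast
 obtain R where R: "0 <= R" "R < 1" "\<And>z. z \<in> ball 0 1 ==> \<exists>f\<in>\<Gamma>. \<exists>w\<in>cball 0 R. f w = z" using cocompact by blast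
 have "complex_of_real ((1 + R) / 2) \<in> ball 0 1" using R(1,2) by (simp del: of_real_divide of_real_add)
 then obtain f w where f: "f \<in> \<Gamma>" "w \<in> cball 0 R" "f w = complex_of_real ((1 + R) / 2)" using R(3) by metis
 hence "w = complex_of_real ((1 + R) / 2)" using all[OF f(1)] one_apply[of w] R by auto
 hence "\<bar>(1 + R) / 2\<bar> <= R" using f(2) by (metis mem_cball_0 norm_of_real)
 thus False using R by auto
qed

lemma countable_\<Gamma>: "countable \<Gamma>"
proof -
 define K where "K n = cball (0::complex) (1 - 1 / (real n + 1))" for n :: nat
 have fin: "finite {f \<in> \<Gamma>. f ` K n \<inter> K n ~= {}}" for n
 proof (rule properly_discontinuous)
  show "K n \<subseteq> ball 0 1"
  proof
   fix x assume "x \<in> K n"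
   hence "cmod x <= 1 - 1 / (real n + 1)" unfolding K_def mem_cball_0 .
   moreover have "0 < 1 / (real n + 1)" by simp
   ultimately show "x \<in> ball 0 1" unfolding mem_ball_0 by linarith
  qed
 qed (simp add: K_def)
 have "\<exists>n. f ` K n \<inter> K n ~= {}" if f: "f \<in> \<Gamma>" for f
 proof -
  have "cmod (f 0) < 1" using maps(2)[OF f, of 0] by simp
  then obtain n where n: "1 / (real n + 1) < 1 - cmod (f 0)"
   using reals_Archimedean[of "1 - cmod (f 0)"] by (auto simp: inverse_eq_divide add.commute)
  moreover have "1 / (real n + 1) <= 1" by simp
  ultimately have "0 \<in> K n" "f 0 \<in> K n" unfolding K_def mem_cball_0 by simp_all
  thus ?thesis by blast
 qed
 hence "\<Gamma> \<subseteq> (\<Union>n. {f \<in> \<Gamma>. f ` K n \<inter> K n ~= {}})"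
  by (intro subsetI) (simp only: UN_iff mem_Collect_eq UNIV_I bex_simps simp_thms)
 thus ?thesis by (rule countable_subset) (use fin in \<open>auto intro: countable_finite\<close>)
qed

lemma fixed_points:
 assumes F: "is_lift f F" "r < s" "s < r + 2 * pi" "F r = r" "F s = s"
  "\<And>x. r < x ==> x < s ==> x < F x" "\<And>x. s < x ==> x < r + 2 * pi ==> F x < x"
 shows "f (cis r) = cis r" "f (cis s) = cis s" "x \<in> sphere 0 1 ==> f x = x \<longleftrightarrow> x = cis r \<or> x = cis s"
proof -
 have c: "cis (F x) = f (cis x)" for x using F(1) by (simp add: is_lift_def)
 show r: "f (cis r) = cis r" and s: "f (cis s) = cis s" using c[of r] c[of s] F(4,5) by auto
 have mono: "x < y ==> F x < F y" for x y using F(1) by (simp add: is_lift_def strict_mono_def)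
 have per: "F (r + 2 * pi) = r + 2 * pi" using F(1,4) by (simp add: is_lift_def)
 show "f x = x \<longleftrightarrow> x = cis r \<or> x = cis s" if x: "x \<in> sphere 0 1"
 proof
  assume fx: "f x = x"
  obtain u where u: "x = cis u" using sphere_cis x by blast
  obtain v where v: "cis u = cis v" "r <= v" "v < r + 2 * pi" by (rule circle_param)
  show "x = cis r \<or> x = cis s"
  proof (rule ccontr)
   assume ne: "\<not> (x = cis r \<or> x = cis s)"
   hence "r < v" "v ~= s" using u v by (auto simp: less_le)
   hence "F v ~= v" using F(6)[of v] F(7)[of v] v(3) by fastforce
   moreover have "r < F v" "F v < r + 2 * pi" using mono[OF \<open>r < v\<close>] mono[OF v(3)] F(4) per by auto
   moreover have "cis (F v) = cis v" using c[of v] fx u v(1) by simp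
   ultimately show False using cis_inj_interval[of "F v" v] v by auto
  qed
 qed (use r s in auto)
qed

lemma Fix_eq: "Fix \<Gamma> = {x \<in> sphere 0 1. \<exists>f\<in>\<Gamma> - {one\<Gamma>}. f x = x}"
 by (auto simp: Fix_def)

lemma Fix_sphere: "x \<in> Fix \<Gamma> ==> x \<in> sphere 0 1"
 by (simp add: Fix_def)

lemma countable_Fix: "countable (Fix \<Gamma>)"
proof -
 have "finite {x \<in> sphere 0 1. f x = x}" if f: "f \<in> \<Gamma> - {one\<Gamma>}" for f
 proof -
  obtain F r s where P: "is_lift f F" "r < s" "s < r + 2 * pi" "F r = r" "F s = s"
   "\<And>x. r < x ==> x < s ==> x < F x" "\<And>x. s < x ==> x < r + 2 * pi ==> F x < x"
   using lift_package[of f] f by auto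
  have "{x \<in> sphere 0 1. f x = x} \<subseteq> {cis r, cis s}" using fixed_points(3)[OF P] by blast
  thus ?thesis by (rule finite_subset) simp
 qed
 hence "countable (\<Union>f\<in>\<Gamma> - {one\<Gamma>}. {x \<in> sphere 0 1. f x = x})"
  using countable_\<Gamma> by (intro countable_UN) (auto intro: countable_finite)
 moreover have "Fix \<Gamma> = (\<Union>f\<in>\<Gamma> - {one\<Gamma>}. {x \<in> sphere 0 1. f x = x})" unfolding Fix_eq by blast
 ultimately show ?thesis by simp
qed

lemma conj_fixes_iff:
 assumes d: "d \<in> \<Gamma>" and g: "g \<in> \<Gamma>" and z: "z \<in> sphere 0 1"
 shows "(d \<odot> g \<odot> inv\<Gamma> d) z = z \<longleftrightarrow> g (inv\<Gamma> d z) = inv\<Gamma> d z"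
proof -
 note e = inv_in[OF d]
 have c: "z \<in> cball 0 1" "inv\<Gamma> d z \<in> cball 0 1" using z maps(1)[OF e, of z] by auto
 have "(d \<odot> g \<odot> inv\<Gamma> d) z = d (g (inv\<Gamma> d z))"
  using mult_apply[OF mult_in[OF d g] e c(1)] mult_apply[OF d g c(2)] by simp
 thus ?thesis using inv_apply[OF d c(1)] inv_apply(2)[OF d maps(1)[OF g c(2)]] by metis
qed

lemma Fix_invariant:
 assumes f: "f \<in> \<Gamma>" and x: "x \<in> Fix \<Gamma>"
 shows "f x \<in> Fix \<Gamma>"
proof -
 obtain g where g: "g \<in> \<Gamma>" "g ~= one\<Gamma>" "g x = x" and xs: "x \<in> sphere 0 1" using x by (auto simp: Fix_def)
 have "(f \<odot> g \<odot> inv\<Gamma> f) (f x) = f x"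
  using conj_fixes_iff[OF f g(1) maps(3)[OF f xs]] inv_apply(2)[OF f, of x] xs g(3) by simp
 moreover have "f \<odot> g \<odot> inv\<Gamma> f ~= one\<Gamma>"
  using conj_eq_one[OF g(1) inv_in[OF f]] g(2) group.inv_inv[OF group_pi1, of f] f by auto
 ultimately show ?thesis using mult_in[OF mult_in[OF f g(1)] inv_in[OF f]] maps(3)[OF f xs] by (auto simp: Fix_def)
qed

text \<open>A deck transformation bringing the central part of the disc close to \<open>cis \<mu>\<close> also brings one of two
 given fixed points close to \<open>cis \<mu>\<close>.\<close>

lemma Fix_dense:
 assumes ab: "\<alpha> < \<beta>"
 shows "\<exists>\<theta>. \<alpha> < \<theta> \<and> \<theta> < \<beta> \<and> cis \<theta> \<in> Fix \<Gamma>"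
proof -
 obtain f where f: "f \<in> \<Gamma>" "f ~= one\<Gamma>" using nontrivial by blast
 obtain F r s where P: "is_lift f F" "r < s" "s < r + 2 * pi" "F r = r" "F s = s"
  "\<And>x. r < x ==> x < s ==> x < F x" "\<And>x. s < x ==> x < r + 2 * pi ==> F x < x"
  using lift_package[OF f] by metis
 define x y where "x = cis r" and "y = cis s"
 have xy: "x \<in> Fix \<Gamma>" "y \<in> Fix \<Gamma>" "x ~= y" using fixed_points(1,2)[OF P] f cis_inj_interval[of r s] P(2,3) by (auto simp: Fix_def x_def y_def)
 define \<delta> where "\<delta> = cmod (x - y)"
 have \<delta>: "\<delta> > 0" using xy(3) by (simp add: \<delta>_def)
 obtain R where R: "0 <= R" "R < 1" "\<And>z. z \<in> ball 0 1 ==> \<exists>f\<in>\<Gamma>. \<exists>w\<in>cball 0 R. f w = z" using cocompact by blast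
 define \<mu> d where "\<mu> = (\<alpha> + \<beta>) / 2" and "d = min pi ((\<beta> - \<alpha>) / 2)"
 have d: "0 < d" "d <= pi" "d <= (\<beta> - \<alpha>) / 2" using ab unfolding d_def by (simp, simp only: min.cobounded1, simp only: min.cobounded2)
 define \<epsilon> where "\<epsilon> = 2 * sin (d / 2)"
 have \<epsilon>: "\<epsilon> > 0" unfolding \<epsilon>_def using d pi_gt_zero by (intro mult_pos_pos sin_gt_zero) (auto simp: field_simps)
 \<comment> \<open>\<open>C * e\<close> will bound the distance from the image point to
   \<open>z\<close>: the factors of \<open>C\<close> come from the distance \<delta> of the two
   fixed points, from the denominator at \<open>w\<close>, and from the lower bound
   \<open>q / (8 * e)\<close> on \<open>(cmod a)\<^sup>2\<close>.\<close>
 define q C where "q = 1 - R\<^sup>2" and "C = 64 / (\<delta> * (1 - R) * q)"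
 have q: "0 < q" "q <= 1" using R by (simp_all add: q_def abs_square_less_1)
 have "C > 0" using q R \<delta> by (simp add: C_def)
 define c where "c = C + 1"
 have C: "c > 0" using \<open>C > 0\<close> by (simp add: c_def)
 define e where "e = min (q / 32) (\<epsilon> / (2 * c))"
 have e: "0 < e" "e <= q / 32" "e <= \<epsilon> / (2 * c)" using q C \<epsilon> unfolding e_def by (simp, simp only: min.cobounded1, simp only: min.cobounded2)
 define z where "z = of_real (1 - e) * cis \<mu>"
 have cz: "cmod z = 1 - e" using e q by (simp add: z_def norm_mult del: of_real_diff)
 hence "z \<in> ball 0 1" using e by simp
 then obtain h w where h: "h \<in> \<Gamma>" "w \<in> cball 0 R" "h w = z" using R(3) by blast
 obtain a b where p: "(a, b) \<in> SU11" "h = moebius_disc (a, b)" using rep[OF h(1)] by auto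
 have w: "cmod w <= R" "cmod w <= 1" using h(2) R by auto
 have hm: "h v = mob (a, b) v" if "cmod v <= 1" for v using that by (simp add: p(2) moebius_disc_apply)
 define W where "W = cmod (cnj b * w + cnj a)"
 have W: "0 < W" "W <= 2 * cmod a" "cmod a * (1 - R) <= W"
 proof -
  show "0 < W" using denom_nonzero[OF p(1) w(2)] by (simp add: W_def)
  show "cmod a * (1 - R) <= W" unfolding W_def using denom_bound(3)[OF p(1) w(1)] R by simp
  have "W <= cmod b * cmod w + cmod a" unfolding W_def using norm_triangle_ineq[of "cnj b * w" "cnj a"] by (simp add: norm_mult)
  also have "cmod b * cmod w <= cmod a * 1" using SU11_less(1)[OF p(1)] w by (intro mult_mono) auto
  finally show "W <= 2 * cmod a" by simp
 qed
 have a1: "cmod a \<ge> 1" by (rule SU11_less(3)[OF p(1)])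
 \<comment> \<open>As \<open>w\<close> stays in \<open>cball 0 R\<close> while its image
   \<open>z\<close> is close to the circle, the leading coefficient of the isometry must be
   large.\<close>
 have A: "q / (8 * e) <= (cmod a)\<^sup>2"
 proof -
  have "q <= 1 - (cmod w)\<^sup>2" using power_mono[OF w(1), of 2] by (simp add: q_def)
  also have "\<dots> = W\<^sup>2 * (1 - (cmod z)\<^sup>2)" using mob_norm[OF p(1) w(2)] h(3) hm[OF w(2)] W(1) by (simp add: W_def)
  also have "1 - (cmod z)\<^sup>2 = e * (2 - e)" by (simp add: cz power2_eq_square algebra_simps)
  also have "W\<^sup>2 * \<dots> <= (2 * cmod a)\<^sup>2 * (e * 2)"
   using W e q by (intro mult_mono power_mono mult_left_mono) auto
  finally show ?thesis using e(1) by (simp add: field_simps power2_eq_square)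
 qed
 have "4 <= q / (8 * e)" using e by (simp add: field_simps)
 hence a4: "4 <= (cmod a)\<^sup>2" using A by simp
 have ba: "cmod a <= 2 * cmod b"
 proof (rule power2_le_imp_le)
  show "(cmod a)\<^sup>2 <= (2 * cmod b)\<^sup>2" using SU11_norm[OF p(1)] a4 by (simp add: power_mult_distrib)
 qed simp
 define D where "D v = cmod (cnj b * v + cnj a)" for v
 \<comment> \<open>The denominators at \<open>x\<close> and \<open>y\<close> differ by
   \<open>cnj b * (x - y)\<close>, so at least one of the two is large, and that fixed point is
   thrown close to \<open>z\<close>.\<close>
 have "cmod b * \<delta> = cmod (cnj b * (x - y))" by (simp add: \<delta>_def norm_mult)
 also have "\<dots> = cmod ((cnj b * x + cnj a) - (cnj b * y + cnj a))" by (simp add: algebra_simps)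
 also have "\<dots> <= D x + D y" unfolding D_def by (rule norm_triangle_ineq4)
 finally have "cmod a * \<delta> / 4 <= D x \<or> cmod a * \<delta> / 4 <= D y" using mult_right_mono[OF ba, of \<delta>] \<delta> by linarith
 then obtain v where v: "v \<in> Fix \<Gamma>" "cmod v = 1" "cmod a * \<delta> / 4 <= D v" using xy by (auto simp: x_def y_def)
 have "cmod (h v - z) = cmod (v - w) / (D v * W)"
  using mob_diff(1)[OF p(1), of v w] v(2) w(2) hm[of v] hm[of w] h(3) by (simp add: norm_divide norm_mult D_def W_def)
 also have "\<dots> <= 2 / ((cmod a * \<delta> / 4) * (cmod a * (1 - R)))"
 proof (rule frac_le)
  have "0 < cmod a" using a1 by linarith
  thus "0 < cmod a * \<delta> / 4 * (cmod a * (1 - R))" using R \<delta> by simp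
  show "cmod a * \<delta> / 4 * (cmod a * (1 - R)) <= D v * W" using v(3) W R by (intro mult_mono) (auto simp: D_def)
  show "cmod (v - w) <= 2" using norm_triangle_ineq4[of v w] v(2) w(2) by simp
 qed simp
 also have "\<dots> = 8 / (\<delta> * (1 - R)) / (cmod a)\<^sup>2" by (simp add: power2_eq_square field_simps)
 also have "\<dots> <= 8 / (\<delta> * (1 - R)) / (q / (8 * e))" using A \<delta> R q e a4 by (intro divide_left_mono mult_pos_pos divide_pos_pos) auto
 also have "\<dots> = C * e" by (simp add: C_def)
 finally have "cmod (h v - z) <= C * e" .
 moreover have "z - cis \<mu> = - (of_real e * cis \<mu>)" by (simp add: z_def algebra_simps)
 hence "cmod (z - cis \<mu>) = e" using e(1) by (simp add: norm_mult)
 ultimately have "cmod (h v - cis \<mu>) <= c * e"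
  using norm_triangle_ineq[of "h v - z" "z - cis \<mu>"] by (simp add: c_def algebra_simps)
 also have "\<dots> <= c * (\<epsilon> / (2 * c))" using e(3) C by (intro mult_left_mono) auto
 also have "\<dots> < \<epsilon>" using \<epsilon> C by simp
 finally have close: "cmod (h v - cis \<mu>) < \<epsilon>" .
 have hv: "h v \<in> Fix \<Gamma>" by (rule Fix_invariant[OF h(1) v(1)])
 obtain u where u: "h v = cis u" using sphere_cis Fix_sphere[OF hv] by blast
 obtain \<theta> where th: "cis u = cis \<theta>" "\<mu> - pi <= \<theta>" "\<theta> < (\<mu> - pi) + 2 * pi" by (rule circle_param)
 have "\<bar>\<theta> - \<mu>\<bar> < d"
 proof (rule ccontr)
  assume "\<not> \<bar>\<theta> - \<mu>\<bar> < d"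
  hence "sin (d / 2) <= sin (\<bar>\<theta> - \<mu>\<bar> / 2)" using d th(2,3) by (intro sin_monotone_2pi_le) auto
  also have "\<dots> = \<bar>sin ((\<theta> - \<mu>) / 2)\<bar>"
  proof -
   have "0 <= sin (\<bar>\<theta> - \<mu>\<bar> / 2)" using th(2,3) by (intro sin_ge_zero) auto
   moreover have "(\<theta> - \<mu>) / 2 = \<bar>\<theta> - \<mu>\<bar> / 2 \<or> (\<theta> - \<mu>) / 2 = - (\<bar>\<theta> - \<mu>\<bar> / 2)" by (auto simp: abs_if)
   ultimately show ?thesis by (metis abs_minus_cancel abs_of_nonneg sin_minus)
  qed
  also have "2 * \<dots> = cmod (cis \<theta> - cis \<mu>)" by (simp add: cis_diff' norm_mult)
  finally have "\<epsilon> <= cmod (h v - cis \<mu>)" using u th(1) by (simp add: \<epsilon>_def)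
  thus False using close by simp
 qed
 hence "\<alpha> < \<theta>" "\<theta> < \<beta>" using d(3) by (auto simp: \<mu>_def abs_less_iff field_simps)
 thus ?thesis using hv u th(1) by auto
qed

end

section \<open>Powers, translation lengths and stabilisers of axes\<close>

context surface
begin

lemma pow_in: "f \<in> \<Gamma> ==> f \<star> (m::nat) \<in> \<Gamma>" "f \<in> \<Gamma> ==> f \<star> (k::int) \<in> \<Gamma>"
 using group.is_monoid[OF group_pi1] monoid.nat_pow_closed[of "pi1 \<Gamma>" f m] group.int_pow_closed[OF group_pi1, of f k] by auto

lemma lift_pow:
 assumes t: "t \<in> \<Gamma>" and G: "is_lift t G"
 shows "is_lift (t \<star> (n::nat)) (G ^^ n)"
proof (induction n)
 case 0
 have "is_lift one\<Gamma> (\<lambda>x. x)" by (auto simp: is_lift_def one_apply strict_mono_def)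
 thus ?case by (simp add: id_def)
next
 case (Suc n)
 have "is_lift ((t \<star> n) \<odot> t) ((G ^^ n) \<circ> G)" by (rule is_lift_mult[OF pow_in(1)[OF t] t Suc G])
 thus ?case by (simp only: nat_pow_Suc funpow_Suc_right)
qed

text \<open>Between its fixed points the lift moves every point in a constant direction without
  reaching the next fixed point, so iteration creates no new fixed points.\<close>

lemma pow_fixes_iff:
 assumes f: "f \<in> \<Gamma>" "f ~= one\<Gamma>" and m: "m > 0" and x: "x \<in> sphere 0 1"
 shows "(f \<star> (m::nat)) x = x \<longleftrightarrow> f x = x"
proof -
 obtain F r s where P: "is_lift f F" "r < s" "s < r + 2 * pi" "F r = r" "F s = s"
  "\<And>x. r < x ==> x < s ==> x < F x" "\<And>x. s < x ==> x < r + 2 * pi ==> F x < x"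
  using lift_package[OF f] by metis
 have mono: "x < y ==> F x < F y" for x y using P(1) by (simp add: is_lift_def strict_mono_def)
 obtain k where k: "m = Suc k" using m by (cases m) auto
 have "(F ^^ n) r = r" "(F ^^ n) s = s" for n by (induction n) (simp_all add: P(4,5))
 moreover have "x < (F ^^ Suc n) x \<and> (F ^^ Suc n) x < s" if "r < x" "x < s" for x n
 proof (induction n)
  case (Suc n)
  thus ?case using P(6)[of "(F ^^ Suc n) x"] mono[of "(F ^^ Suc n) x" s] P(5) that by auto
 qed (use P(6)[OF that] mono[OF that(2)] P(5) in auto)
 moreover have "(F ^^ Suc n) x < x \<and> s < (F ^^ Suc n) x" if "s < x" "x < r + 2 * pi" for x n
 proof (induction n)
  case (Suc n)
  thus ?case using P(7)[of "(F ^^ Suc n) x"] mono[of s "(F ^^ Suc n) x"] P(5) that by auto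
 qed (use P(7)[OF that] mono[OF that(1)] P(5) in auto)
 ultimately have "(f \<star> m) x = x \<longleftrightarrow> x = cis r \<or> x = cis s"
  unfolding k by (intro fixed_points(3)[OF lift_pow[OF f(1) P(1)] P(2,3) _ _ _ _ x]) blast+
 thus ?thesis using fixed_points(3)[OF P x] by blast
qed

text \<open>The square has the same fixed points as the element itself, so no element exchanges two
  boundary points.\<close>

lemma no_swap:
 assumes f: "f \<in> \<Gamma>" and x: "x \<in> sphere 0 1" "f x ~= x"
 shows "f (f x) ~= x"
proof -
 have c: "x \<in> cball 0 1" using x(1) by simp
 have "f \<star> (2::nat) = f \<odot> f" using f monoid.nat_pow_Suc group.is_monoid[OF group_pi1] monoid.l_one[of "pi1 \<Gamma>" f]
  by (simp add: numeral_2_eq_2)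
 thus ?thesis using pow_fixes_iff[OF f, of 2 x] x mult_apply[OF f f c] one_apply[OF c] by auto
qed

lemma geo_invariant_iff:
 assumes f: "f \<in> \<Gamma>" and xy: "x \<in> sphere 0 1" "y \<in> sphere 0 1" "x ~= y"
 shows "f ` geo x y = geo x y \<longleftrightarrow> f x = x \<and> f y = y"
proof -
 have "f ` geo x y = geo x y \<longleftrightarrow> {x, y} = {f x, f y}"
  using action_geo[OF f xy(1,2)] geo_eq_iff[OF xy maps(3)[OF f xy(1)] maps(3)[OF f xy(2)]] by metis
 thus ?thesis using no_swap[OF f xy(1)] xy(3) unfolding doubleton_eq_iff by metis
qed

text \<open>Minus the logarithm of the derivative of \<open>f\<close> at its fixed point \<open>x\<close>.\<close>

definition ell :: "complex => (complex => complex) => real" where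
 "ell x f = ln ((1 - (cmod (f 0))\<^sup>2) / (cmod (x - f 0))\<^sup>2)"

lemma ell_eq:
 assumes ab: "(a, b) \<in> SU11" and x: "cmod x = 1" "mob (a, b) x = x"
 shows "ell x (moebius_disc (a, b)) = 2 * ln (cmod (cnj b * x + cnj a))"
proof -
 define D where "D = cmod (cnj b * x + cnj a)"
 have D: "D > 0" using denom_nonzero[OF ab, of x] x by (simp add: D_def)
 have a: "a ~= 0" by (rule SU11_less(2)[OF ab])
 have "cmod (x - mob (a, b) 0) = 1 / (D * cmod a)"
  using mob_diff(1)[OF ab, of x 0] x by (simp add: D_def norm_divide norm_mult)
 moreover have "1 - (cmod (mob (a, b) 0))\<^sup>2 = 1 / (cmod a)\<^sup>2" using mob_norm[OF ab, of 0] by simp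
 ultimately have "ell x (moebius_disc (a, b)) = ln (D\<^sup>2)"
  using a by (simp add: ell_def moebius_disc_apply power_divide power_mult_distrib)
 thus ?thesis using D by (simp add: D_def ln_realpow)
qed

text \<open>The chain rule: the denominators at a common fixed point multiply.\<close>

lemma ell_mult:
 assumes fg: "f \<in> \<Gamma>" "g \<in> \<Gamma>" and x: "x \<in> sphere 0 1" "f x = x" "g x = x"
 shows "ell x (f \<odot> g) = ell x f + ell x g"
proof -
 obtain a b c d where p: "(a, b) \<in> SU11" "f = moebius_disc (a, b)" "(c, d) \<in> SU11" "g = moebius_disc (c, d)"
  using rep[OF fg(1)] rep[OF fg(2)] by fastforce
 have x1: "cmod x = 1" using x by simp
 have fx: "mob (a, b) x = x" "mob (c, d) x = x" using x p x1 by (simp_all add: moebius_disc_apply)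
 define D E where "D = cnj b * x + cnj a" and "E = cnj d * x + cnj c"
 have DE: "D ~= 0" "E ~= 0" using denom_nonzero[OF p(1), of x] denom_nonzero[OF p(3), of x] x1 by (simp_all add: D_def E_def)
 have "c * x + d = x * E" using fx(2) DE(2) by (simp add: mob_pair E_def divide_eq_eq)
 moreover have "cnj (a * d + b * cnj c) * x + cnj (a * c + b * cnj d) = cnj b * (c * x + d) + cnj a * E"
  by (simp add: E_def algebra_simps)
 ultimately have "cnj (a * d + b * cnj c) * x + cnj (a * c + b * cnj d) = D * E" by (simp add: D_def algebra_simps)
 moreover have "su_mult (a, b) (c, d) = (a * c + b * cnj d, a * d + b * cnj c)" by (simp add: su_mult_def)
 moreover have "mob (su_mult (a, b) (c, d)) x = x" using mob_compose[OF p(1,3), of x] x1 fx by simp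
 ultimately have "ell x (f \<odot> g) = 2 * ln (cmod (D * E))"
  unfolding p(2,4) mult_eq[OF p(1,3)] using ell_eq[of "a * c + b * cnj d" "a * d + b * cnj c" x] su_mult_SU11[OF p(1,3)] x1 by simp
 thus ?thesis using ell_eq[OF p(1) x1 fx(1)] ell_eq[OF p(3) x1 fx(2)] DE
  by (simp add: p(2,4) norm_mult ln_mult D_def E_def)
qed

text \<open>A real denominator \<open>D\<close> of modulus 1 forces
  \<open>\<bar>Re a\<bar> = 1\<close>, which is excluded for non-trivial elements.\<close>

lemma ell_zero:
 assumes f: "f \<in> \<Gamma>" and x: "x \<in> sphere 0 1" "f x = x" "ell x f = 0"
 shows "f = one\<Gamma>"
proof -
 obtain a b where ab: "(a, b) \<in> SU11" "f = moebius_disc (a, b)" using rep[OF f] by auto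
 have x1: "cmod x = 1" "mob (a, b) x = x" using x ab(2) by (auto simp: moebius_disc_apply)
 obtain D where D: "cnj b * x + cnj a = of_real D" "(D - Re a)\<^sup>2 = (Re a)\<^sup>2 - 1" by (rule boundary_fixed_point[OF ab(1) x1])
 have "D ~= 0" using denom_nonzero[OF ab(1), of x] x1 D(1) by auto
 hence "\<bar>D\<bar> = 1" using ell_eq[OF ab(1) x1] x(3) ab(2) D(1) by simp
 hence "D * D = 1" by (simp add: abs_square_eq_1[symmetric] power2_eq_square)
 hence "D * Re a = 1" using D(2) by (simp add: power2_eq_square algebra_simps)
 hence "\<bar>D\<bar> * \<bar>Re a\<bar> = 1" by (metis abs_mult abs_one)
 hence "\<bar>Re a\<bar> = 1" using \<open>\<bar>D\<bar> = 1\<close> by simp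
 thus ?thesis using hyperbolic[OF ab(1)] f ab(2) by auto
qed

text \<open>A bound on \<open>ell\<close> bounds the denominator \<open>D\<close> at
  \<open>x\<close> and its inverse; the denominator \<open>E\<close> at \<open>y\<close> is one of
  these two, and \<open>D - E\<close> bounds \<open>b\<close>. So the matrix is bounded, 0 is moved
  within a compact ball, and proper discontinuity applies.\<close>

lemma ell_finite:
 assumes xy: "x \<in> sphere 0 1" "y \<in> sphere 0 1" "x ~= y"
 shows "finite {f \<in> \<Gamma>. f x = x \<and> f y = y \<and> \<bar>ell x f\<bar> <= M}"
proof -
 define N Q where "N = exp (M / 2)" and "Q = N + 2 * N / cmod (x - y)"
 have Q: "Q > 0" using xy by (simp add: N_def Q_def add_pos_pos)
 define R where "R = sqrt (1 - 1 / Q\<^sup>2)"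
 have K: "f 0 \<in> cball 0 R" if f: "f \<in> \<Gamma>" "f x = x" "f y = y" "\<bar>ell x f\<bar> <= M" for f
 proof -
  obtain a b where ab: "(a, b) \<in> SU11" "f = moebius_disc (a, b)" using rep[OF f(1)] by auto
  have x1: "cmod x = 1" "mob (a, b) x = x" "cmod y = 1" "mob (a, b) y = y" using xy f ab(2) by (auto simp: moebius_disc_apply)
  obtain D where D: "cnj b * x + cnj a = of_real D" "(D - Re a)\<^sup>2 = (Re a)\<^sup>2 - 1" by (rule boundary_fixed_point[OF ab(1) x1(1,2)])
  obtain E where E: "cnj b * y + cnj a = of_real E" "(E - Re a)\<^sup>2 = (Re a)\<^sup>2 - 1" by (rule boundary_fixed_point[OF ab(1) x1(3,4)])
  have D0: "D ~= 0" using denom_nonzero[OF ab(1), of x] x1 D(1) by auto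
  have l: "\<bar>ln \<bar>D\<bar>\<bar> <= M / 2" using f(4) ell_eq[OF ab(1) x1(1,2)] ab(2) D(1) by (simp add: abs_mult)
  hence "exp (ln \<bar>D\<bar>) <= N" "exp (- ln \<bar>D\<bar>) <= N" unfolding N_def exp_le_cancel_iff by linarith+
  hence DN: "\<bar>D\<bar> <= N" "inverse \<bar>D\<bar> <= N" using D0 by (simp_all add: exp_minus)
  have "(E - D) * (E - (2 * Re a - D)) = 0" "D * (2 * Re a - D) = 1" using D(2) E(2) by (simp_all add: power2_eq_square algebra_simps)
  hence "E = D \<or> E = inverse D" by (metis eq_iff_diff_eq_0 inverse_unique mult_eq_0_iff)
  hence EN: "\<bar>E\<bar> <= N" using DN by (auto simp: abs_inverse)
  have "cmod b * cmod (x - y) = cmod (cnj b * (x - y))" by (simp add: norm_mult)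
  also have "cnj b * (x - y) = (cnj b * x + cnj a) - (cnj b * y + cnj a)" by (simp add: algebra_simps)
  also have "cmod \<dots> = \<bar>D - E\<bar>" unfolding D(1) E(1) by (simp flip: of_real_diff)
  also have "\<dots> <= 2 * N" using DN EN by linarith
  finally have "cmod b <= 2 * N / cmod (x - y)" using xy by (simp add: field_simps)
  moreover have "cnj a = of_real D - cnj b * x" using D(1) by (simp add: algebra_simps)
  hence "cmod a <= \<bar>D\<bar> + cmod b" using norm_triangle_ineq4[of "of_real D" "cnj b * x"] x1 by (metis complex_mod_cnj norm_mult norm_of_real mult.right_neutral)
  ultimately have "cmod a <= Q" using DN by (simp add: Q_def)
  hence "1 / Q\<^sup>2 <= 1 / (cmod a)\<^sup>2" using SU11_less(2)[OF ab(1)] Q by (intro frac_le power_mono) auto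
  also have "\<dots> = 1 - (cmod (f 0))\<^sup>2" using mob_norm[OF ab(1), of 0] ab(2) by (simp add: moebius_disc_apply)
  finally have "cmod (f 0) <= R" unfolding R_def by (intro real_le_rsqrt) simp
  thus ?thesis by simp
 qed
 have "finite {f \<in> \<Gamma>. f ` cball 0 R \<inter> cball 0 R ~= {}}"
 proof (rule properly_discontinuous)
  have "R < 1" unfolding R_def using Q by (subst real_sqrt_lt_1_iff) simp
  thus "cball 0 R \<subseteq> ball 0 1" by auto
 qed simp
 moreover have "{f \<in> \<Gamma>. f x = x \<and> f y = y \<and> \<bar>ell x f\<bar> <= M} \<subseteq> {f \<in> \<Gamma>. f ` cball 0 R \<inter> cball 0 R ~= {}}"
 proof
  fix f assume f: "f \<in> {f \<in> \<Gamma>. f x = x \<and> f y = y \<and> \<bar>ell x f\<bar> <= M}"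
  hence "cmod (f 0) <= R" using K by simp
  hence "0 \<in> cball 0 R" "f 0 \<in> cball 0 R" using norm_ge_zero[of "f 0"] by (simp_all del: norm_ge_zero)
  thus "f \<in> {f \<in> \<Gamma>. f ` cball 0 R \<inter> cball 0 R ~= {}}" using f by blast
 qed
 ultimately show ?thesis by (rule finite_subset[rotated])
qed

end

context surface
begin

text \<open>\<open>ell x\<close> embeds the common stabiliser of the endpoints as a discrete
  subgroup of the reals: it is additive, has trivial kernel, and only finitely many elements have
  values in a bounded range. So the stabiliser is infinite cyclic, and a generator \<open>t\<close>
  is a primitive root of \<gamma>.\<close>

lemma axis_stabilizer:
 assumes g: "\<gamma> \<in> \<Gamma>" "\<gamma> ~= one\<Gamma>" and xy: "x \<in> sphere 0 1" "y \<in> sphere 0 1" "x ~= y" "\<gamma> x = x" "\<gamma> y = y"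
 shows "\<exists>t (m::nat). t \<in> \<Gamma> \<and> t ~= one\<Gamma> \<and> m > 0 \<and> \<gamma> = t \<star> m \<and> power_multiplicity \<Gamma> \<gamma> = m \<and> t x = x \<and> t y = y \<and>
  (\<forall>f\<in>\<Gamma>. f x = x \<longrightarrow> f y = y \<longrightarrow> (\<exists>k::int. f = t \<star> k))"
proof -
 interpret group "pi1 \<Gamma>" by (rule group_pi1)
 have c: "x \<in> cball 0 1" "y \<in> cball 0 1" using xy by auto
 define H where "H = {f \<in> \<Gamma>. f x = x \<and> f y = y}"
 define L where "L = ell x"
 have HG: "f \<in> \<Gamma>" if "f \<in> H" for f using that by (simp add: H_def)
 have H: "f \<odot> g \<in> H" "L (f \<odot> g) = L f + L g" if "f \<in> H" "g \<in> H" for f g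
  using that mult_apply[of f g] c ell_mult[of f g x] xy(1) by (auto simp: H_def L_def mult_in)
 have one: "one\<Gamma> \<in> H" "L one\<Gamma> = 0" using one_apply c H(2)[of "one\<Gamma>" "one\<Gamma>"] one_in by (auto simp: H_def)
 have inv: "inv\<Gamma> f \<in> H" "L (inv\<Gamma> f) = - L f" if "f \<in> H" for f
 proof -
  have f: "f \<in> \<Gamma>" "f x = x" "f y = y" using that by (simp_all add: H_def)
  show *: "inv\<Gamma> f \<in> H" using inv_apply(2)[OF f(1) c(1)] inv_apply(2)[OF f(1) c(2)] inv_in[OF f(1)] by (simp add: f H_def)
  have "inv\<Gamma> f \<odot> f = one\<Gamma>" using f(1) by (intro l_inv) simp
  thus "L (inv\<Gamma> f) = - L f" using H(2)[OF * that] one(2) by simp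
 qed
 have inj: "f = g" if "f \<in> H" "g \<in> H" "L f = L g" for f g
 proof -
  have "f \<odot> inv\<Gamma> g \<in> H" by (rule H(1)[OF that(1) inv(1)[OF that(2)]])
  moreover have "L (f \<odot> inv\<Gamma> g) = 0" using H(2)[OF that(1) inv(1)[OF that(2)]] inv(2)[OF that(2)] that(3) by linarith
  ultimately have "f \<odot> inv\<Gamma> g \<in> H" "L (f \<odot> inv\<Gamma> g) = 0" by blast+
  hence "f \<odot> inv\<Gamma> g = one\<Gamma>" by (intro ell_zero[OF _ xy(1)]) (simp_all add: H_def L_def)
  hence "inv\<Gamma> (inv\<Gamma> g) = f" by (rule inv_equality) (simp_all add: HG that inv_in)
  thus ?thesis using HG[OF that(2)] by simp
 qed
 have pow: "f \<star> n \<in> H" "L (f \<star> n) = of_nat n * L f" if "f \<in> H" for f and n :: nat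
  by (induction n) (use that H one in \<open>auto simp: algebra_simps\<close>)
 have ipow: "f \<star> k \<in> H" "L (f \<star> k) = of_int k * L f" if "f \<in> H" for f and k :: int
  using pow[OF that] inv[OF pow(1)[OF that]] HG[OF that] by (cases k rule: int_cases2; simp add: int_pow_int int_pow_neg)+
 obtain \<tau> where \<tau>: "\<tau> > 0" "L ` H = range (\<lambda>k::int. of_int k * \<tau>)"
 proof (rule discrete_subgroup_cyclic[of "L \<gamma>" "L ` H"])
  have gH: "\<gamma> \<in> H" using g xy by (simp add: H_def)
  thus "L \<gamma> \<in> L ` H" "L \<gamma> ~= 0" using ell_zero[OF g(1) xy(1,4)] g(2) by (auto simp: L_def)
  show "u - v \<in> L ` H" if uv: "u \<in> L ` H" "v \<in> L ` H" for u v
  proof -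
   obtain f g where "f \<in> H" "g \<in> H" "u = L f" "v = L g" using uv by blast
   thus ?thesis using H[of f "inv\<Gamma> g"] inv[of g] by (intro image_eqI[of _ _ "f \<odot> inv\<Gamma> g"]) auto
  qed
  have "{u \<in> L ` H. \<bar>u\<bar> <= M} = L ` {f \<in> \<Gamma>. f x = x \<and> f y = y \<and> \<bar>ell x f\<bar> <= M}" for M by (auto simp: H_def L_def)
  thus "finite {u \<in> L ` H. \<bar>u\<bar> <= M}" for M using ell_finite[OF xy(1-3)] by simp
 qed
 have gH: "\<gamma> \<in> H" using g xy by (simp add: H_def)
 \<comment> \<open>Of the two generators the one whose value has the sign of
   \<open>L \<gamma>\<close>, so that \<gamma> is a positive power of it.\<close>
 define \<sigma> where "\<sigma> = (if L \<gamma> > 0 then \<tau> else - \<tau>)"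
 have \<sigma>: "\<sigma> ~= 0" using \<tau>(1) by (simp add: \<sigma>_def)
 have "\<sigma> = of_int (if L \<gamma> > 0 then 1 else - 1) * \<tau>" by (simp add: \<sigma>_def)
 hence "\<sigma> \<in> L ` H" unfolding \<tau>(2) by (rule range_eqI)
 then obtain t where t: "t \<in> H" "L t = \<sigma>" by blast
 have gen: "\<exists>k::int. f = t \<star> k" if f: "f \<in> H" for f
 proof -
  obtain k :: int where "L f = of_int k * \<tau>" using f \<tau>(2) by blast
  hence "L f = of_int (if L \<gamma> > 0 then k else - k) * \<sigma>" by (simp add: \<sigma>_def)
  thus ?thesis using inj[OF f ipow(1)[OF t(1)]] ipow(2)[OF t(1)] t(2) by metis
 qed
 obtain k :: int where k: "\<gamma> = t \<star> k" using gen[OF gH] by blast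
 have L0: "L \<gamma> ~= 0" using ell_zero[OF g(1) xy(1,4)] g(2) by (auto simp: L_def)
 have Lk: "L \<gamma> = of_int k * \<sigma>" using ipow(2)[OF t(1), of k] k t(2) by metis
 have "0 < of_int k * \<tau>"
 proof (cases "0 < L \<gamma>")
  case True
  hence "\<sigma> = \<tau>" by (simp add: \<sigma>_def)
  thus ?thesis using Lk True by metis
 next
  case False
  hence "\<sigma> = - \<tau>" by (simp add: \<sigma>_def)
  hence "of_int k * \<tau> = - L \<gamma>" unfolding Lk by simp
  thus ?thesis using False L0 by linarith
 qed
 hence "k > 0" using \<tau>(1) by (simp add: zero_less_mult_iff)
 then obtain m where m: "m > 0" "k = int m" using zero_less_imp_eq_int by blast
 have gm: "\<gamma> = t \<star> m" using k m by (simp add: int_pow_int)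
 have t1: "t ~= one\<Gamma>" using t(2) one(2) \<sigma> by auto
 have root: "\<exists>j::int. d = t \<star> j" "real n * L d = L f" "d \<in> H" if d: "d \<in> \<Gamma>" "f = d \<star> n" "f \<in> H" "f ~= one\<Gamma>" for d f and n :: nat
 proof -
  have "n ~= 0" using d(2,4) by (cases "n = 0") auto
  moreover have "d ~= one\<Gamma>" using d(2,4) nat_pow_one by auto
  ultimately show dH: "d \<in> H" using pow_fixes_iff[OF d(1), of n] xy(1,2) d by (auto simp: H_def)
  thus "\<exists>j::int. d = t \<star> j" by (rule gen)
  show "real n * L d = L f" using pow(2)[OF dH] d(2) by simp
 qed
 have prim: "primitive_elt \<Gamma> t"
  unfolding primitive_elt_def
 proof (intro conjI ballI allI impI)
  fix d and n :: nat assume d: "d \<in> \<Gamma>" "t = d \<star> n"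
  obtain j :: int where "d = t \<star> j" "real n * L d = L t" using root[OF d t(1) t1] by blast
  hence "of_int (int n * j) * \<sigma> = 1 * \<sigma>" using ipow(2)[OF t(1), of j] t(2) by (simp add: mult.assoc)
  hence "real_of_int (int n * j) = 1" using \<sigma> by simp
  hence "int n * j = 1" by linarith
  hence "int n dvd 1" by (metis dvd_triv_left)
  thus "n = 1" by simp
 qed (use HG t t1 in auto)
 \<comment> \<open>Any other primitive root is a power of \<open>t\<close> with exponent
   \<open>j > 0\<close>; being primitive it has \<open>j = 1\<close>, so the exponent of \<gamma> is
   determined.\<close>
 have "power_multiplicity \<Gamma> \<gamma> = m"
  unfolding power_multiplicity_def
 proof (rule the_equality)
  show "\<exists>d. primitive_elt \<Gamma> d \<and> \<gamma> = d \<star> m" using prim gm by blast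
  fix n :: nat assume "\<exists>d. primitive_elt \<Gamma> d \<and> \<gamma> = d \<star> n"
  then obtain d where d: "primitive_elt \<Gamma> d" "\<gamma> = d \<star> n" by blast
  hence din: "d \<in> \<Gamma>" and pd: "\<And>d' n. d' \<in> \<Gamma> ==> d = d' \<star> (n::nat) ==> n = 1" unfolding primitive_elt_def by blast+
  obtain j :: int where j: "d = t \<star> j" "real n * L d = L \<gamma>" "d \<in> H" using root[OF din d(2) gH g(2)] by blast
  have Ld: "L d = of_int j * \<sigma>" using ipow(2)[OF t(1), of j] t(2) j(1) by simp
  have "real_of_int (int n * j) * \<sigma> = real m * \<sigma>" using j(2) Ld pow(2)[OF t(1), of m] gm t(2) by (simp add: mult.assoc)
  hence "real_of_int (int n * j) = real m" using \<sigma> by simp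
  hence e: "int n * j = int m" by linarith
  hence "0 < int n * j" using m(1) by simp
  hence "j > 0" by (simp add: zero_less_mult_iff)
  have "d = t \<star> nat j" using inj[OF j(3) pow(1)[OF t(1), of "nat j"]] pow(2)[OF t(1), of "nat j"] Ld t(2) \<open>j > 0\<close> by simp
  hence "nat j = 1" by (rule pd[OF HG[OF t(1)]])
  hence "j = 1" using \<open>j > 0\<close> by linarith
  thus "n = m" using e by simp
 qed
 moreover have "t x = x" "t y = y" "\<forall>f\<in>\<Gamma>. f x = x \<longrightarrow> f y = y \<longrightarrow> (\<exists>k::int. f = t \<star> k)" using t(1) gen by (auto simp: H_def)
 ultimately show ?thesis using HG[OF t(1)] t1 m(1) gm by blast
qed

end

context surface
begin

lemma lift_surj: "is_lift f F ==> surj F"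
proof -
 assume F: "is_lift f F"
 have per: "\<And>x. F (x + 2 * pi) = F x + 2 * pi" and c: "continuous_on UNIV F" using F by (simp_all add: is_lift_def)
 have "\<exists>x. F x = y" for y
 proof -
  define k where "k = \<lfloor>(y - F 0) / (2 * pi)\<rfloor>"
  have "of_int k <= (y - F 0) / (2 * pi)" "(y - F 0) / (2 * pi) < of_int k + 1" by (auto simp: k_def)
  hence k: "F 0 + 2 * pi * of_int k <= y" "y <= F 0 + 2 * pi * of_int (k + 1)" by (simp_all add: field_simps)
  have "F (2 * pi * of_int k) <= y" "y <= F (2 * pi * of_int (k + 1))"
   using k periodic_int[of F 0 k, OF per] periodic_int[of F 0 "k + 1", OF per] by (simp_all only: add_0)
  hence "\<exists>x\<ge>2 * pi * of_int k. x <= 2 * pi * of_int (k + 1) \<and> F x = y"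
   by (intro IVT' continuous_on_subset[OF c]) auto
  thus ?thesis by blast
 qed
 thus ?thesis by (metis surjI)
qed

text \<open>It is the primitive root \<open>t\<close>, not \<gamma>, that generates the stabiliser
  of the axis; a period of its lift \<open>G\<close> will be a fundamental domain, and the exponent
  \<open>m\<close> comes back as the multiplicity of the current. \<open>G\<close> moves points
  towards \<open>s\<close> because its \<open>m\<close>-th iterate, a lift of \<gamma>,
  does.\<close>

lemma axis_data:
 assumes g: "\<gamma> \<in> \<Gamma>" "\<gamma> ~= one\<Gamma>"
 obtains t m G r s where "t \<in> \<Gamma>" "t ~= one\<Gamma>" "m > 0" "\<gamma> = t \<star> (m::nat)" "power_multiplicity \<Gamma> \<gamma> = m"
  "is_lift t G" "r < s" "s < r + 2 * pi" "G r = r" "G s = s" "cis r \<in> Fix \<Gamma>" "cis s \<in> Fix \<Gamma>"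
  "\<And>x. r < x ==> x < s ==> x < G x"
  "\<And>f. f \<in> \<Gamma> ==> f ` geo (cis r) (cis s) = geo (cis r) (cis s) ==> \<exists>k::int. f = t \<star> k"
  "geodesic_lifts \<Gamma> \<gamma> = (\<lambda>f. f ` geo (cis r) (cis s)) ` \<Gamma>"
proof -
 interpret group "pi1 \<Gamma>" by (rule group_pi1)
 obtain F r s where F: "is_lift \<gamma> F" "r < s" "s < r + 2 * pi" "F r = r" "F s = s"
  "\<And>x. r < x ==> x < s ==> x < F x" "\<And>x. s < x ==> x < r + 2 * pi ==> F x < x"
  using lift_package[OF g] by metis
 have fp: "\<gamma> (cis r) = cis r" "\<gamma> (cis s) = cis s" "\<And>x. x \<in> sphere 0 1 ==> \<gamma> x = x \<longleftrightarrow> x = cis r \<or> x = cis s"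
  by (rule fixed_points[OF F]; assumption)+
 have cne: "cis r ~= cis s" using cis_inj_interval[of r s] F(2,3) by auto
 have sph: "cis r \<in> sphere 0 1" "cis s \<in> sphere 0 1" by simp_all
 obtain t m where t: "t \<in> \<Gamma>" "t ~= one\<Gamma>" "m > 0" "\<gamma> = t \<star> (m::nat)" "power_multiplicity \<Gamma> \<gamma> = m"
  "t (cis r) = cis r" "t (cis s) = cis s"
  "\<forall>f\<in>\<Gamma>. f (cis r) = cis r \<longrightarrow> f (cis s) = cis s \<longrightarrow> (\<exists>k::int. f = t \<star> k)"
  using axis_stabilizer[OF g sph cne fp(1,2)] by (elim exE conjE)
 obtain G0 where "is_lift t G0" using ex_lift[OF t(1)] by blast
 then obtain G where G: "is_lift t G" "G r = r" using is_lift_at[of t G0 r r] t(6) by metis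
 have mono: "x < y ==> G x < G y" for x y using G(1) by (simp add: is_lift_def strict_mono_def)
 have "G s = s"
 proof -
  have "cis (G s) = cis s" using G(1) t(7) by (simp add: is_lift_def)
  moreover have "r < G s" using mono[OF F(2)] G(2) by simp
  moreover have "G s < r + 2 * pi" using mono[OF F(3)] G by (simp add: is_lift_def)
  ultimately show ?thesis using F(2,3) by (intro cis_inj_interval) auto
 qed
 have Gm: "G ^^ m = F"
 proof (rule is_lift_unique[OF _ F(1)])
  show "is_lift \<gamma> (G ^^ m)" unfolding t(4) by (rule lift_pow[OF t(1) G(1)])
  have "(G ^^ n) r = r" for n by (induction n) (simp_all add: G(2))
  thus "(G ^^ m) r = F r" using F(4) by simp
 qed
 have up: "x < G x" if x: "r < x" "x < s" for x
 proof (rule ccontr)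
  assume "\<not> x < G x"
  hence "G x <= x" by simp
  have "(G ^^ n) x <= x" for n
  proof (induction n)
   case (Suc n)
   have "G ((G ^^ n) x) <= G x" using mono[of "(G ^^ n) x" x] Suc by (cases "(G ^^ n) x = x") auto
   thus ?case using \<open>G x <= x\<close> by simp
  qed simp
  thus False using F(6)[OF x] Gm by (metis not_le)
 qed
 have conj: "(d \<odot> \<gamma> \<odot> inv\<Gamma> d) ` geo x y = geo x y \<longleftrightarrow> \<gamma> (inv\<Gamma> d x) = inv\<Gamma> d x \<and> \<gamma> (inv\<Gamma> d y) = inv\<Gamma> d y"
  if "d \<in> \<Gamma>" "x \<in> sphere 0 1" "y \<in> sphere 0 1" "x ~= y" for d x y
  using geo_invariant_iff[OF mult_in[OF mult_in[OF that(1) g(1)] inv_in[OF that(1)]] that(2-4)]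
   conj_fixes_iff[OF that(1) g(1) that(2)] conj_fixes_iff[OF that(1) g(1) that(3)] by simp
 have lifts: "geodesic_lifts \<Gamma> \<gamma> = (\<lambda>f. f ` geo (cis r) (cis s)) ` \<Gamma>"
 proof (intro Set.set_eqI iffI)
  fix l assume "l \<in> (\<lambda>f. f ` geo (cis r) (cis s)) ` \<Gamma>"
  then obtain d where d: "d \<in> \<Gamma>" "l = d ` geo (cis r) (cis s)" by blast
  have i: "inv\<Gamma> d (d (cis r)) = cis r" "inv\<Gamma> d (d (cis s)) = cis s" using inv_apply(2)[OF d(1)] by simp_all
  have l: "l = geo (d (cis r)) (d (cis s))" using d action_geo[OF d(1) sph] by simp
  have dn: "d (cis r) \<in> sphere 0 1" "d (cis s) \<in> sphere 0 1" "d (cis r) ~= d (cis s)" using maps(3)[OF d(1)] sph i cne by metis+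
  have "l \<in> geodesics" unfolding geodesics_eq using l dn by blast
  moreover have "(d \<odot> \<gamma> \<odot> inv\<Gamma> d) ` l = l" unfolding l conj[OF d(1) dn] i using fp by simp
  ultimately show "l \<in> geodesic_lifts \<Gamma> \<gamma>" using d(1) unfolding geodesic_lifts_def by (intro CollectI conjI bexI[of _ d])
 next
  fix l assume "l \<in> geodesic_lifts \<Gamma> \<gamma>"
  then obtain d where d: "l \<in> geodesics" "d \<in> \<Gamma>" "(d \<odot> \<gamma> \<odot> inv\<Gamma> d) ` l = l"
   unfolding geodesic_lifts_def by (elim CollectE conjE bexE)
  obtain x y where xy: "l = geo x y" "x \<in> sphere 0 1" "y \<in> sphere 0 1" "x ~= y" using d(1) unfolding geodesics_eq by blast
  note ex = maps(3)[OF inv_in[OF d(2)] xy(2)] maps(3)[OF inv_in[OF d(2)] xy(3)]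
  have de: "d (inv\<Gamma> d x) = x" "d (inv\<Gamma> d y) = y" using inv_apply(1)[OF d(2)] xy by simp_all
  have "\<gamma> (inv\<Gamma> d x) = inv\<Gamma> d x" "\<gamma> (inv\<Gamma> d y) = inv\<Gamma> d y" using conj[OF d(2) xy(2-4)] d(3) xy(1) by simp_all
  hence "inv\<Gamma> d x = cis r \<or> inv\<Gamma> d x = cis s" "inv\<Gamma> d y = cis r \<or> inv\<Gamma> d y = cis s"
   using fp(3)[OF ex(1)] fp(3)[OF ex(2)] by blast+
  hence "geo (inv\<Gamma> d x) (inv\<Gamma> d y) = geo (cis r) (cis s)" using de xy(4) geo_sym by metis
  hence "d ` geo (cis r) (cis s) = l" using action_geo[OF d(2) ex] de xy(1) by simp
  thus "l \<in> (\<lambda>f. f ` geo (cis r) (cis s)) ` \<Gamma>" using d(2) by blast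
 qed
 have FX: "cis r \<in> Fix \<Gamma>" "cis s \<in> Fix \<Gamma>" using fp(1,2) g by (auto simp: Fix_def)
 show ?thesis
 proof (rule that[OF t(1-5) G(1) F(2,3) G(2) \<open>G s = s\<close> FX up _ lifts])
  fix f assume "f \<in> \<Gamma>" "f ` geo (cis r) (cis s) = geo (cis r) (cis s)"
  thus "\<exists>k::int. f = t \<star> k" using geo_invariant_iff[OF _ sph cne] t(8) by blast
 qed
qed

end

section \<open>A measure from a content of boxes\<close>

definition clamp1 :: "real => real => real => real" where
 "clamp1 a b x = max a (min x b)"

text \<open>The first entry is the left end of a real interval, the others bound a box
  \<open>{x1..x2} \<times> {y1..y2}\<close>; the length of the interval is the content of the
  box.\<close>

type_synonym box_state = "real \<times> real \<times> real \<times> real \<times> real"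

locale box_content =
 fixes X :: "real set" and c :: "real => real => real => real => real" and A1 A2 B1 B2 :: real
 assumes X_countable: "countable X"
  and corners: "A1 \<in> X" "A2 \<in> X" "B1 \<in> X" "B2 \<in> X" "A1 <= A2" "B1 <= B2"
  and nonneg: "\<lbrakk>{x1, x2, y1, y2} \<subseteq> X; A1 <= x1; x1 <= x2; x2 <= A2; B1 <= y1; y1 <= y2; y2 <= B2\<rbrakk> \<Longrightarrow> 0 <= c x1 x2 y1 y2"
  and addx: "c x1 x2 y1 y2 + c x2 x3 y1 y2 = c x1 x3 y1 y2"
  and addy: "c x1 x2 y1 y2 + c x1 x2 y2 y3 = c x1 x2 y1 y3"
begin

lemma degenerate [simp]: "c x x y1 y2 = 0" "c x1 x2 y y = 0"
 using addx[of x x y1 y2 x] addy[of x1 x2 y y y] by simp_all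

text \<open>One cut of the box, vertical or horizontal. The interval is divided in the proportion of
  the contents of the two halves, and the number \<omega> selects the half whose interval contains
  it. A cut that misses the box is clamped to an edge and splits off content 0.\<close>

definition step :: "bool \<times> real => real => box_state => box_state" where
 "step = (\<lambda>(v, p) \<omega> (a, x1, x2, y1, y2).
   if v then (let q = clamp1 x1 x2 p; m = a + c x1 q y1 y2 in
    if \<omega> < m then (a, x1, q, y1, y2) else (m, q, x2, y1, y2))
   else (let q = clamp1 y1 y2 p; m = a + c x1 x2 y1 q in
    if \<omega> < m then (a, x1, x2, y1, q) else (m, x1, x2, q, y2)))"

primrec run :: "(bool \<times> real) list => real => box_state => box_state" where
 "run [] \<omega> s = s"
| "run (p # ps) \<omega> s = run ps \<omega> (step p \<omega> s)"

definition good :: "box_state => bool" where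
 "good = (\<lambda>(a, x1, x2, y1, y2). {x1, x2, y1, y2} \<subseteq> X \<and> A1 <= x1 \<and> x1 <= x2 \<and> x2 <= A2 \<and>
   B1 <= y1 \<and> y1 <= y2 \<and> y2 <= B2)"

definition left_of :: "bool \<times> real => box_state => box_state" where
 "left_of = (\<lambda>(v, p) (a, x1, x2, y1, y2). if v then (a, x1, clamp1 x1 x2 p, y1, y2) else (a, x1, x2, y1, clamp1 y1 y2 p))"

definition right_of :: "bool \<times> real => box_state => box_state" where
 "right_of = (\<lambda>(v, p) (a, x1, x2, y1, y2). if v then (a + c x1 (clamp1 x1 x2 p) y1 y2, clamp1 x1 x2 p, x2, y1, y2)
   else (a + c x1 x2 y1 (clamp1 y1 y2 p), x1, x2, clamp1 y1 y2 p, y2))"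

definition content :: "box_state => real" where
 "content = (\<lambda>(a, x1, x2, y1, y2). c x1 x2 y1 y2)"

definition ivl :: "box_state => real set" where
 "ivl s = {fst s ..< fst s + content s}"

definition inside :: "box_state => real \<times> real \<times> real \<times> real => bool" where
 "inside = (\<lambda>(a, x1, x2, y1, y2) (r1, r2, s1, s2). r1 <= x1 \<and> x2 <= r2 \<and> s1 <= y1 \<and> y2 <= s2)"

text \<open>The content of the intersection of the box with the rectangle; an empty side is clamped
  to a degenerate one, which has content 0.\<close>

definition meet :: "box_state => real \<times> real \<times> real \<times> real => real" where
 "meet = (\<lambda>(a, x1, x2, y1, y2) (r1, r2, s1, s2).
   c (clamp1 x1 x2 r1) (clamp1 x1 x2 r2) (clamp1 y1 y2 s1) (clamp1 y1 y2 s2))"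

text \<open>The invariant of the subdivision: an edge of the rectangle that still runs through the
  interior of the box is among the cuts yet to be made.\<close>

definition cut_by :: "(bool \<times> real) list => box_state => real \<times> real \<times> real \<times> real => bool" where
 "cut_by ps = (\<lambda>(a, x1, x2, y1, y2) (r1, r2, s1, s2).
   (\<forall>r\<in>{r1, r2}. (True, r) \<in> set ps \<or> r <= x1 \<or> x2 <= r) \<and>
   (\<forall>s\<in>{s1, s2}. (False, s) \<in> set ps \<or> s <= y1 \<or> y2 <= s))"

lemma step_cases: "step p \<omega> s = (if \<omega> < fst (right_of p s) then left_of p s else right_of p s)"
 by (cases p; cases s) (auto simp: step_def left_of_def right_of_def Let_def)

lemma content_split:
 "fst (left_of p s) = fst s" "fst (right_of p s) = fst s + content (left_of p s)"
 "content (left_of p s) + content (right_of p s) = content s"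
 by (cases p; cases s; force simp: left_of_def right_of_def content_def addx addy)+

lemma clamp1_in: "x \<in> X ==> a \<in> X ==> b \<in> X ==> clamp1 a b x \<in> X"
 by (simp add: clamp1_def max_def min_def)

lemma clamp1_bounds: "a <= b ==> a <= clamp1 a b x" "a <= b ==> clamp1 a b x <= b"
 by (auto simp: clamp1_def)

lemma good_split:
 assumes "good s" "snd p \<in> X"
 shows "good (left_of p s)" "good (right_of p s)"
proof -
 obtain v q where p: "p = (v, q)" by (cases p)
 obtain a x1 x2 y1 y2 where s: "s = (a, x1, x2, y1, y2)" by (cases s)
 show "good (left_of p s)" "good (right_of p s)"
  using assms clamp1_in[of q x1 x2] clamp1_in[of q y1 y2] clamp1_bounds[of x1 x2 q] clamp1_bounds[of y1 y2 q]
  by (auto simp: p s good_def left_of_def right_of_def)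
qed

lemma content_nonneg: "good s ==> 0 <= content s"
 using nonneg by (cases s) (auto simp: good_def content_def)

lemma ivl_split:
 assumes "good s" "snd p \<in> X"
 shows "ivl s = ivl (left_of p s) \<union> ivl (right_of p s)" "ivl (left_of p s) \<inter> ivl (right_of p s) = {}"
  "\<omega> \<in> ivl (left_of p s) ==> step p \<omega> s = left_of p s" "\<omega> \<in> ivl (right_of p s) ==> step p \<omega> s = right_of p s"
 using content_split[of p s] content_nonneg[OF good_split(1)[OF assms]] content_nonneg[OF good_split(2)[OF assms]]
 by (auto simp: ivl_def step_cases)

text \<open>Clamping to a half amounts to the minimum or maximum with the cut \<open>k\<close>, so
  the sum telescopes at \<open>k\<close> or has one term \<open>f k k = 0\<close>.\<close>

lemma clamp1_split:
 fixes q :: real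
 assumes f: "\<And>u v w :: real. f u v + f v w = (f u w :: real)" and ab: "a <= b" "r <= r'"
 defines "k \<equiv> clamp1 a b q"
 shows "f (clamp1 a k r) (clamp1 a k r') + f (clamp1 k b r) (clamp1 k b r') = f (clamp1 a b r) (clamp1 a b r')"
proof -
 define u u' where "u = clamp1 a b r" and "u' = clamp1 a b r'"
 have k: "a <= k" "k <= b" using clamp1_bounds[OF ab(1)] by (auto simp: k_def)
 have "clamp1 a k r = min k u" "clamp1 k b r = max k u" "clamp1 a k r' = min k u'" "clamp1 k b r' = max k u'"
  using k by (auto simp: clamp1_def min_def max_def u_def u'_def)
 moreover have "u <= u'" using ab by (auto simp: u_def u'_def clamp1_def)
 moreover have "f k k = 0" using f[of k k k] by simp
 ultimately show ?thesis using f[of u k u'] unfolding u_def[symmetric] u'_def[symmetric]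
  by (cases "k <= u"; cases "k <= u'") (auto simp: min_def max_def)
qed

lemma meet_split:
 assumes "good s" and R: "R = (r1, r2, s1, s2)" "r1 <= r2" "s1 <= s2"
 shows "meet (left_of p s) R + meet (right_of p s) R = meet s R"
proof -
 obtain v q where p: "p = (v, q)" by (cases p)
 obtain a x1 x2 y1 y2 where s: "s = (a, x1, x2, y1, y2)" by (cases s)
 have xy: "x1 <= x2" "y1 <= y2" using assms(1) by (auto simp: s good_def)
 show ?thesis
  using clamp1_split[of "\<lambda>u v. c u v (clamp1 y1 y2 s1) (clamp1 y1 y2 s2)", OF addx xy(1) R(2), of q]
   clamp1_split[of "c (clamp1 x1 x2 r1) (clamp1 x1 x2 r2)", OF addy xy(2) R(3), of q]
  by (cases v) (simp_all add: p s R meet_def left_of_def right_of_def)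
qed

lemma cut_split:
 assumes "good s" "cut_by (p # ps) s R"
 shows "cut_by ps (left_of p s) R" "cut_by ps (right_of p s) R"
proof -
 obtain v q where p: "p = (v, q)" by (cases p)
 obtain a x1 x2 y1 y2 where s: "s = (a, x1, x2, y1, y2)" by (cases s)
 obtain r1 r2 s1 s2 where R: "R = (r1, r2, s1, s2)" by (cases R)
 have xy: "x1 <= x2" "y1 <= y2" using assms(1) by (auto simp: s good_def)
 have cl: "r <= a \<or> clamp1 a b q <= r" "r <= clamp1 a b q \<or> b <= r" if "r = q \<or> r <= a \<or> b <= r" "a <= b" for a b r
  using that by (auto simp: clamp1_def)
 have A: "(True, r) \<in> set ps \<or> (if v then r = q \<or> r <= x1 \<or> x2 <= r else r <= x1 \<or> x2 <= r)" if "r \<in> {r1, r2}" for r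
  using assms(2) that unfolding p s R cut_by_def by auto
 have B: "(False, r) \<in> set ps \<or> (if v then r <= y1 \<or> y2 <= r else r = q \<or> r <= y1 \<or> y2 <= r)" if "r \<in> {s1, s2}" for r
  using assms(2) that unfolding p s R cut_by_def by auto
 have A': "(True, r) \<in> set ps \<or> (if v then r <= x1 \<or> clamp1 x1 x2 q <= r else r <= x1 \<or> x2 <= r)"
  "(True, r) \<in> set ps \<or> (if v then r <= clamp1 x1 x2 q \<or> x2 <= r else r <= x1 \<or> x2 <= r)" if "r \<in> {r1, r2}" for r
  using A[OF that] cl[OF _ xy(1), of r] by presburger+
 have B': "(False, r) \<in> set ps \<or> (if v then r <= y1 \<or> y2 <= r else r <= y1 \<or> clamp1 y1 y2 q <= r)"
  "(False, r) \<in> set ps \<or> (if v then r <= y1 \<or> y2 <= r else r <= clamp1 y1 y2 q \<or> y2 <= r)" if "r \<in> {s1, s2}" for r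
  using B[OF that] cl[OF _ xy(2), of r] by presburger+
 show "cut_by ps (left_of p s) R" "cut_by ps (right_of p s) R"
  using A'[of r1] A'[of r2] B'[of s1] B'[of s2]
  by (auto simp: p s R cut_by_def left_of_def right_of_def split: if_splits)
qed

text \<open>Both sides are additive under a cut, which is the induction. When no cut is left, no
  edge of the rectangle runs through the cell, so the cell is inside or its intersection with the
  rectangle is degenerate.\<close>

lemma run_measure:
 assumes "good s" "snd ` set ps \<subseteq> X" "cut_by ps s R" and R: "R = (r1, r2, s1, s2)" "r1 <= r2" "s1 <= s2"
 shows "{\<omega> \<in> ivl s. inside (run ps \<omega> s) R} \<in> sets borel \<and>
  emeasure lborel {\<omega> \<in> ivl s. inside (run ps \<omega> s) R} = ennreal (meet s R) \<and> 0 <= meet s R"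
 using assms(1-3)
proof (induction ps arbitrary: s)
 case Nil
 obtain a x1 x2 y1 y2 where s: "s = (a, x1, x2, y1, y2)" by (cases s)
 have xy: "x1 <= x2" "y1 <= y2" using Nil by (auto simp: s good_def)
 show ?case
 proof (cases "inside s R")
  case True
  hence "meet s R = content s"
   using xy by (auto simp: s R meet_def content_def inside_def clamp1_def)
  moreover have "{\<omega> \<in> ivl s. inside (run [] \<omega> s) R} = {fst s ..< fst s + content s}"
   using True by (auto simp: ivl_def)
  ultimately show ?thesis using content_nonneg[OF Nil(1)] by simp
 next
  case False
  hence "clamp1 x1 x2 r1 = clamp1 x1 x2 r2 \<or> clamp1 y1 y2 s1 = clamp1 y1 y2 s2"
   using Nil(3) R xy by (auto simp: s inside_def cut_by_def clamp1_def)
  hence "meet s R = 0" by (auto simp: s R meet_def)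
  thus ?thesis using False by simp
 qed
next
 case (Cons p ps)
 have p: "snd p \<in> X" using Cons.prems by auto
 note gs = good_split[OF Cons.prems(1) p]
 note iv = ivl_split[OF Cons.prems(1) p]
 define L where "L = {\<omega> \<in> ivl (left_of p s). inside (run ps \<omega> (left_of p s)) R}"
 define M where "M = {\<omega> \<in> ivl (right_of p s). inside (run ps \<omega> (right_of p s)) R}"
 have L: "L \<in> sets borel" "emeasure lborel L = ennreal (meet (left_of p s) R)" "0 <= meet (left_of p s) R"
  using Cons.IH[OF gs(1)] cut_split[OF Cons.prems(1,3)] Cons.prems(2) by (auto simp: L_def)
 have M: "M \<in> sets borel" "emeasure lborel M = ennreal (meet (right_of p s) R)" "0 <= meet (right_of p s) R"
  using Cons.IH[OF gs(2)] cut_split[OF Cons.prems(1,3)] Cons.prems(2) by (auto simp: M_def)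
 have eq: "{\<omega> \<in> ivl s. inside (run (p # ps) \<omega> s) R} = L \<union> M"
  using iv by (auto simp: L_def M_def)
 have "emeasure lborel (L \<union> M) = emeasure lborel L + emeasure lborel M"
  using L(1) M(1) iv(2) by (intro plus_emeasure[symmetric]) (auto simp: L_def M_def)
 thus ?case unfolding eq meet_split[OF Cons.prems(1) R, of p, symmetric]
  using L M by (simp add: ennreal_plus)
qed

definition start :: box_state where "start = (0, A1, A2, B1, B2)"
definition cut :: "nat => bool \<times> real" where "cut = from_nat_into (UNIV \<times> X)"
definition cuts :: "nat => (bool \<times> real) list" where "cuts m = map cut [0..<m]"
definition cell :: "nat => real => box_state" where "cell m \<omega> = run (cuts m) \<omega> start"
definition lx where "lx m \<omega> = (case cell m \<omega> of (a, x1, x2, y1, y2) => x1)"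
definition rx where "rx m \<omega> = (case cell m \<omega> of (a, x1, x2, y1, y2) => x2)"
definition ly where "ly m \<omega> = (case cell m \<omega> of (a, x1, x2, y1, y2) => y1)"
definition ry where "ry m \<omega> = (case cell m \<omega> of (a, x1, x2, y1, y2) => y2)"
text \<open>The supremum of the left edges lies in the range of all the nested cells and depends
  measurably on \<omega>.\<close>

definition ptx where "ptx \<omega> = (SUP m. lx m \<omega>)"
definition pty where "pty \<omega> = (SUP m. ly m \<omega>)"

lemma cut_in: "snd (cut m) \<in> X" "cut m \<in> UNIV \<times> X"
proof -
 have "(UNIV :: bool set) \<times> X ~= {}" using corners by auto
 from from_nat_into[OF this, of m] show "snd (cut m) \<in> X" "cut m \<in> UNIV \<times> X" by (auto simp: cut_def mem_Times_iff)
qed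

lemma run_append: "run (ps @ [p]) \<omega> s = step p \<omega> (run ps \<omega> s)"
 by (induction ps arbitrary: s) auto

lemma cell_Suc: "cell (Suc m) \<omega> = step (cut m) \<omega> (cell m \<omega>)"
 by (simp add: cell_def cuts_def run_append)

lemma good_step: "good s ==> good (step (cut m) \<omega> s)"
 using good_split cut_in by (auto simp: step_cases)

lemma good_start: "good start"
 using corners by (auto simp: start_def good_def)

lemma good_cell: "good (cell m \<omega>)"
proof (induction m)
 case 0
 show ?case using good_start by (simp add: cell_def cuts_def)
qed (simp add: cell_Suc good_step)

lemma cell_bounds: "lx m \<omega> \<in> X" "ly m \<omega> \<in> X" "A1 <= lx m \<omega>" "lx m \<omega> <= rx m \<omega>" "rx m \<omega> <= A2"
 "B1 <= ly m \<omega>" "ly m \<omega> <= ry m \<omega>" "ry m \<omega> <= B2"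
 using good_cell[of m \<omega>] by (auto simp: good_def lx_def rx_def ly_def ry_def split: prod.splits)

lemma cell_Suc_bounds: "lx m \<omega> <= lx (Suc m) \<omega>" "rx (Suc m) \<omega> <= rx m \<omega>" "ly m \<omega> <= ly (Suc m) \<omega>" "ry (Suc m) \<omega> <= ry m \<omega>"
proof -
 obtain v p where p: "cut m = (v, p)" by (cases "cut m")
 obtain a x1 x2 y1 y2 where s: "cell m \<omega> = (a, x1, x2, y1, y2)" by (cases "cell m \<omega>")
 have xy: "x1 <= x2" "y1 <= y2" using good_cell[of m \<omega>] by (auto simp: s good_def)
 show "lx m \<omega> <= lx (Suc m) \<omega>" "rx (Suc m) \<omega> <= rx m \<omega>" "ly m \<omega> <= ly (Suc m) \<omega>" "ry (Suc m) \<omega> <= ry m \<omega>"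
  using clamp1_bounds[OF xy(1)] clamp1_bounds[OF xy(2)]
  by (auto simp: lx_def rx_def ly_def ry_def cell_Suc s p step_def Let_def)
qed

lemma lx_mono: "m <= k ==> lx m \<omega> <= lx k \<omega>" and ly_mono: "m <= k ==> ly m \<omega> <= ly k \<omega>"
 and rx_mono: "m <= k ==> rx k \<omega> <= rx m \<omega>" and ry_mono: "m <= k ==> ry k \<omega> <= ry m \<omega>"
 by (rule lift_Suc_mono_le lift_Suc_antimono_le; simp add: cell_Suc_bounds)+

lemma lx_le_rx: "lx m \<omega> <= rx k \<omega>" and ly_le_ry: "ly m \<omega> <= ry k \<omega>"
proof -
 have "lx m \<omega> <= lx (max m k) \<omega>" "rx (max m k) \<omega> <= rx k \<omega>" "ly m \<omega> <= ly (max m k) \<omega>" "ry (max m k) \<omega> <= ry k \<omega>"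
  by (auto intro: lx_mono rx_mono ly_mono ry_mono)
 thus "lx m \<omega> <= rx k \<omega>" "ly m \<omega> <= ry k \<omega>" using cell_bounds[of "max m k" \<omega>] by linarith+
qed

lemma pt_bounds: "lx m \<omega> <= ptx \<omega>" "ptx \<omega> <= rx m \<omega>" "ly m \<omega> <= pty \<omega>" "pty \<omega> <= ry m \<omega>"
proof -
 have "bdd_above (range (\<lambda>m. lx m \<omega>))" by (rule bdd_aboveI[of _ "rx 0 \<omega>"]) (use lx_le_rx in auto)
 thus "lx m \<omega> <= ptx \<omega>" unfolding ptx_def by (rule cSUP_upper[OF UNIV_I])
 have "bdd_above (range (\<lambda>m. ly m \<omega>))" by (rule bdd_aboveI[of _ "ry 0 \<omega>"]) (use ly_le_ry in auto)
 thus "ly m \<omega> <= pty \<omega>" unfolding pty_def by (rule cSUP_upper[OF UNIV_I])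
 show "ptx \<omega> <= rx m \<omega>" unfolding ptx_def by (rule cSUP_least) (auto intro: lx_le_rx)
 show "pty \<omega> <= ry m \<omega>" unfolding pty_def by (rule cSUP_least) (auto intro: ly_le_ry)
qed

lemma in_cuts: "x \<in> X ==> \<exists>m. \<forall>k\<ge>m. (v, x) \<in> set (cuts k)"
proof -
 assume "x \<in> X"
 moreover have "countable ((UNIV :: bool set) \<times> X)" using X_countable by auto
 ultimately have "range cut = UNIV \<times> X"
  unfolding cut_def by (intro range_from_nat_into) auto
 hence "(v, x) \<in> range cut" using \<open>x \<in> X\<close> by simp
 then obtain j where "cut j = (v, x)" by auto
 hence "\<forall>k\<ge>Suc j. (v, x) \<in> set (cuts k)" by (auto simp: cuts_def image_iff intro!: bexI[of _ j])
 thus ?thesis by blast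
qed

lemma ex_cut_by:
 assumes "{r1, r2, s1, s2} \<subseteq> X"
 shows "\<exists>m. \<forall>k\<ge>m. cut_by (cuts k) s (r1, r2, s1, s2)"
proof -
 obtain m1 where "\<forall>k\<ge>m1. (True, r1) \<in> set (cuts k)" using assms in_cuts[of r1 True] by blast
 moreover obtain m2 where "\<forall>k\<ge>m2. (True, r2) \<in> set (cuts k)" using assms in_cuts[of r2 True] by blast
 moreover obtain m3 where "\<forall>k\<ge>m3. (False, s1) \<in> set (cuts k)" using assms in_cuts[of s1 False] by blast
 moreover obtain m4 where "\<forall>k\<ge>m4. (False, s2) \<in> set (cuts k)" using assms in_cuts[of s2 False] by blast
 ultimately have "\<forall>k\<ge>max (max m1 m2) (max m3 m4). cut_by (cuts k) s (r1, r2, s1, s2)"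
  by (auto simp: cut_by_def)
 thus ?thesis by blast
qed

definition sub :: "nat => real \<times> real \<times> real \<times> real => real set" where
 "sub m R = {\<omega> \<in> ivl start. inside (cell m \<omega>) R}"

lemma sub_iff: "\<omega> \<in> sub m (r1, r2, s1, s2) \<longleftrightarrow>
  \<omega> \<in> ivl start \<and> r1 <= lx m \<omega> \<and> rx m \<omega> <= r2 \<and> s1 <= ly m \<omega> \<and> ry m \<omega> <= s2"
 by (auto simp: sub_def inside_def lx_def rx_def ly_def ry_def split: prod.splits)

lemma sub_measure:
 assumes "cut_by (cuts m) start (r1, r2, s1, s2)" "r1 <= r2" "s1 <= s2"
 shows "sub m (r1, r2, s1, s2) \<in> sets borel"
  "emeasure lborel (sub m (r1, r2, s1, s2)) = ennreal (meet start (r1, r2, s1, s2))"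
 using run_measure[OF good_start _ assms(1) refl assms(2,3)] cut_in
 by (auto simp: sub_def cell_def cuts_def)

text \<open>A cut at every edge of a rectangle has been made after finitely many steps, and from then on
 every cell lies inside the rectangle or has its interior outside of it.\<close>

lemma uncut_cell:
 assumes "cut_by ps s (r1, r2, s1, s2)" "good s" "\<omega> \<in> ivl s" "snd ` set ps \<subseteq> X"
 shows "cut_by [] (run ps \<omega> s) (r1, r2, s1, s2)"
 using assms
proof (induction ps arbitrary: s)
 case (Cons p ps)
 have p: "snd p \<in> X" using Cons.prems by auto
 note iv = ivl_split[OF Cons.prems(2) p]
 show ?case
  using Cons.IH[OF _ good_split(1)[OF Cons.prems(2) p]] Cons.IH[OF _ good_split(2)[OF Cons.prems(2) p]]
   cut_split[OF Cons.prems(2,1)] iv Cons.prems(3,4) by auto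
qed simp

lemma uncut:
 assumes "cut_by (cuts m) start (r1, r2, s1, s2)" "\<omega> \<in> ivl start"
 shows "r1 <= lx m \<omega> \<or> rx m \<omega> <= r1" "r2 <= lx m \<omega> \<or> rx m \<omega> <= r2"
  "s1 <= ly m \<omega> \<or> ry m \<omega> <= s1" "s2 <= ly m \<omega> \<or> ry m \<omega> <= s2"
proof -
 have "snd ` set (cuts m) \<subseteq> X" using cut_in by (auto simp: cuts_def)
 from uncut_cell[OF assms(1) good_start assms(2) this]
 show "r1 <= lx m \<omega> \<or> rx m \<omega> <= r1" "r2 <= lx m \<omega> \<or> rx m \<omega> <= r2"
  "s1 <= ly m \<omega> \<or> ry m \<omega> <= s1" "s2 <= ly m \<omega> \<or> ry m \<omega> <= s2"
 by (auto simp: cell_def cut_by_def lx_def rx_def ly_def ry_def split: prod.splits)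
qed

lemma run_measurable [measurable]: "(\<lambda>\<omega>. h (run ps \<omega> s) :: real) \<in> borel_measurable borel"
proof (induction ps arbitrary: s)
 case (Cons p ps)
 have "(\<lambda>\<omega>. h (run (p # ps) \<omega> s)) =
  (\<lambda>\<omega>. if \<omega> < fst (right_of p s) then h (run ps \<omega> (left_of p s)) else h (run ps \<omega> (right_of p s)))"
  by (auto simp: step_cases)
 thus ?case using Cons by simp
qed simp

lemma pt_measurable [measurable]: "ptx \<in> borel_measurable borel" "pty \<in> borel_measurable borel"
proof -
 have "lx m = (\<lambda>\<omega>. (\<lambda>(a, x1, x2, y1, y2). x1) (run (cuts m) \<omega> start))" "ly m = (\<lambda>\<omega>. (\<lambda>(a, x1, x2, y1, y2). y1) (run (cuts m) \<omega> start))" for m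
  by (simp_all add: lx_def ly_def cell_def fun_eq_iff case_prod_beta)
 hence [measurable]: "lx m \<in> borel_measurable borel" "ly m \<in> borel_measurable borel" for m
  using run_measurable by metis+
 show "ptx \<in> borel_measurable borel" unfolding ptx_def[abs_def]
  by (rule borel_measurable_cSUP) (auto intro: bdd_aboveI[of _ "rx 0 _"] lx_le_rx)
 show "pty \<in> borel_measurable borel" unfolding pty_def[abs_def]
  by (rule borel_measurable_cSUP) (auto intro: bdd_aboveI[of _ "ry 0 _"] ly_le_ry)
qed

definition box_measure :: "(real \<times> real) measure" where
 "box_measure = distr (restrict_space lborel (ivl start)) borel (\<lambda>\<omega>. (ptx \<omega>, pty \<omega>))"

lemma sets_box_measure [simp]: "sets box_measure = sets borel" "space box_measure = UNIV"
 by (simp_all add: box_measure_def)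

lemma emeasure_box:
 assumes [measurable]: "S \<in> sets borel"
 shows "emeasure box_measure S = emeasure lborel {\<omega> \<in> ivl start. (ptx \<omega>, pty \<omega>) \<in> S}"
  "{\<omega> \<in> ivl start. (ptx \<omega>, pty \<omega>) \<in> S} \<in> sets borel"
proof -
 have iv [measurable]: "ivl start \<in> sets borel" by (simp add: ivl_def)
 have eq: "(\<lambda>\<omega>. (ptx \<omega>, pty \<omega>)) -` S \<inter> ivl start = {\<omega> \<in> ivl start. (ptx \<omega>, pty \<omega>) \<in> S}"
  by auto
 have "(\<lambda>\<omega>. (ptx \<omega>, pty \<omega>)) \<in> measurable (restrict_space lborel (ivl start)) borel"
  by (intro measurable_restrict_space1 borel_measurable_Pair) simp_all
 thus "emeasure box_measure S = emeasure lborel {\<omega> \<in> ivl start. (ptx \<omega>, pty \<omega>) \<in> S}"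
  unfolding box_measure_def using iv
  by (simp add: emeasure_distr space_restrict_space eq) (rule emeasure_restrict_space; auto)
 have "{\<omega> \<in> space borel. \<omega> \<in> ivl start \<and> (ptx \<omega>, pty \<omega>) \<in> S} \<in> sets borel" by measurable
 thus "{\<omega> \<in> ivl start. (ptx \<omega>, pty \<omega>) \<in> S} \<in> sets borel" by simp
qed

text \<open>After enough cuts a cell lies inside the rectangle or has no interior point in it. So a
  limit point in the open rectangle comes from a cell inside, and a cell inside has its limit point
  in the closed rectangle; a limit point on an edge may come from either side.\<close>

lemma box_sandwich:
 assumes X: "{r1, r2, s1, s2} \<subseteq> X" and b: "A1 <= r1" "r1 <= r2" "r2 <= A2" "B1 <= s1" "s1 <= s2" "s2 <= B2"
 shows "emeasure box_measure ({r1<..<r2} \<times> {s1<..<s2}) <= ennreal (c r1 r2 s1 s2)"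
  "ennreal (c r1 r2 s1 s2) <= emeasure box_measure ({r1..r2} \<times> {s1..s2})"
proof -
 obtain m where m: "cut_by (cuts m) start (r1, r2, s1, s2)" using ex_cut_by[OF X] by blast
 have mt: "meet start (r1, r2, s1, s2) = c r1 r2 s1 s2"
  using b by (auto simp: meet_def start_def clamp1_def min_absorb1 max_absorb2)
 note sm = sub_measure[OF m b(2,5)]
 have o: "{r1<..<r2} \<times> {s1<..<s2} \<in> sets borel" by (intro borel_open open_Times) auto
 have cl: "{r1..r2} \<times> {s1..s2} \<in> sets borel" by (intro borel_closed closed_Times) auto
 have "{\<omega> \<in> ivl start. (ptx \<omega>, pty \<omega>) \<in> {r1<..<r2} \<times> {s1<..<s2}} \<subseteq> sub m (r1, r2, s1, s2)"
 proof
  fix \<omega> assume w: "\<omega> \<in> {\<omega> \<in> ivl start. (ptx \<omega>, pty \<omega>) \<in> {r1<..<r2} \<times> {s1<..<s2}}"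
  thus "\<omega> \<in> sub m (r1, r2, s1, s2)"
   using uncut[OF m, of \<omega>] pt_bounds[where m = m and \<omega> = \<omega>] by (auto simp: sub_iff)
 qed
 thus "emeasure box_measure ({r1<..<r2} \<times> {s1<..<s2}) <= ennreal (c r1 r2 s1 s2)"
  unfolding emeasure_box(1)[OF o] mt[symmetric] sm(2)[symmetric] using sm(1) by (intro emeasure_mono) auto
 have cells: "sub m (r1, r2, s1, s2) \<subseteq> {\<omega> \<in> ivl start. (ptx \<omega>, pty \<omega>) \<in> {r1..r2} \<times> {s1..s2}}"
 proof
  fix \<omega> assume "\<omega> \<in> sub m (r1, r2, s1, s2)"
  thus "\<omega> \<in> {\<omega> \<in> ivl start. (ptx \<omega>, pty \<omega>) \<in> {r1..r2} \<times> {s1..s2}}"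
   using pt_bounds[where m = m and \<omega> = \<omega>] by (auto simp: sub_iff)
 qed
 show "ennreal (c r1 r2 s1 s2) <= emeasure box_measure ({r1..r2} \<times> {s1..s2})"
  unfolding emeasure_box(1)[OF cl] mt[symmetric] sm(2)[symmetric]
  by (rule emeasure_mono[OF cells]) (unfold sets_lborel, rule emeasure_box(2)[OF cl])
qed

lemma finite_box: "emeasure box_measure UNIV < \<infinity>"
proof -
 have "{\<omega> \<in> ivl start. (ptx \<omega>, pty \<omega>) \<in> UNIV} = ivl start" by auto
 hence "emeasure box_measure UNIV = emeasure lborel (ivl start)"
  using emeasure_box(1)[of UNIV] by simp
 also have "\<dots> < \<infinity>" using content_nonneg[OF good_start] by (simp add: ivl_def)
 finally show ?thesis .
qed

end

section \<open>Measures on the strip that are sandwiched by the content\<close>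

definition orect :: "real => real => real => real => (real \<times> real) set" where
 "orect a b d e = {a<..<b} \<times> {d<..<e}"

definition crect :: "real => real => real => real => (real \<times> real) set" where
 "crect a b d e = {a..b} \<times> {d..e}"

lemma orect_borel [measurable, simp]: "orect a b d e \<in> sets borel" "open (orect a b d e)"
 unfolding orect_def by (auto intro!: borel_open open_Times)

lemma crect_borel [measurable, simp]: "crect a b d e \<in> sets borel" "compact (crect a b d e)"
 unfolding crect_def by (auto intro!: borel_closed closed_Times compact_Times)

lemma box_orect: "box p q = orect (fst p) (fst q) (snd p) (snd q)"
 by (auto simp: box_prod orect_def)

lemma orect_Int: "orect a b d e \<inter> orect a' b' d' e' = orect (max a a') (min b b') (max d d') (min e e')"
 by (auto simp: orect_def)

lemma orect_approx:
 assumes M: "sets M = sets borel" and le: "\<And>a' b' d' e'. a < a' ==> a' < b' ==> b' < b ==> d < d' ==> d' < e' ==> e' < e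
  ==> emeasure M (orect a' b' d' e') <= K"
 shows "emeasure M (orect a b d e) <= K"
proof (cases "a < b \<and> d < e")
 case False
 hence "orect a b d e = {}" by (auto simp: orect_def)
 thus ?thesis by simp
next
 case True
 \<comment> \<open>With \<open>n + 3\<close> the two margins together take up at most two thirds of
   a side, so the smaller rectangles are non-degenerate.\<close>
 define A where "A n = orect (a + (b - a) / (real n + 3)) (b - (b - a) / (real n + 3))
  (d + (e - d) / (real n + 3)) (e - (e - d) / (real n + 3))" for n
 have dec: "x / (real (Suc n) + 3) <= x / (real n + 3)" if "x > 0" for x :: real and n
  using that by (intro divide_left_mono) auto
 have inc: "incseq A"
 proof (rule incseq_SucI)
  fix n
  have "(b - a) / (real (Suc n) + 3) <= (b - a) / (real n + 3)" "(e - d) / (real (Suc n) + 3) <= (e - d) / (real n + 3)"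
   using dec True by auto
  thus "A n <= A (Suc n)" unfolding A_def orect_def by (intro Sigma_mono) auto
 qed
 have lim: "(\<lambda>n. x / (real n + 3)) \<longlonglongrightarrow> 0" for x :: real by real_asymp
 have U: "orect a b d e = (\<Union>n. A n)"
 proof (intro equalityI subsetI)
  fix p assume p: "p \<in> orect a b d e"
  have "eventually (\<lambda>n. (b - a) / (real n + 3) < min (fst p - a) (b - fst p)) sequentially"
   using p by (intro order_tendstoD(2)[OF lim]) (auto simp: orect_def)
  moreover have "eventually (\<lambda>n. (e - d) / (real n + 3) < min (snd p - d) (e - snd p)) sequentially"
   using p by (intro order_tendstoD(2)[OF lim]) (auto simp: orect_def)
  ultimately have "eventually (\<lambda>n. p \<in> A n) sequentially"
   by eventually_elim (auto simp: A_def orect_def mem_Times_iff)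
  then obtain n where "p \<in> A n" by (meson eventually_sequentially order_refl)
  thus "p \<in> (\<Union>n. A n)" by blast
 next
  fix p assume "p \<in> (\<Union>n. A n)"
  then obtain n where "p \<in> A n" by blast
  moreover have "0 < (b - a) / (real n + 3)" "0 < (e - d) / (real n + 3)" using True by auto
  ultimately show "p \<in> orect a b d e" unfolding A_def orect_def by (auto simp: mem_Times_iff)
 qed
 have "A n \<in> sets M" for n unfolding M A_def by (rule orect_borel(1))
 hence "range A \<subseteq> sets M" by blast
 from SUP_emeasure_incseq[OF this inc]
 have "emeasure M (orect a b d e) = (SUP n. emeasure M (A n))" using U by simp
 also have "\<dots> <= K"
 proof (rule SUP_least)
  fix n
  define u v where "u = (b - a) / (real n + 3)" and "v = (e - d) / (real n + 3)"
  have uv: "0 < u" "u * (real n + 3) = b - a" "0 < v" "v * (real n + 3) = e - d" using True by (auto simp: u_def v_def)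
  have "u * 3 <= u * (real n + 3)" by (rule mult_left_mono) (use uv(1) in simp_all)
  moreover have "v * 3 <= v * (real n + 3)" by (rule mult_left_mono) (use uv(3) in simp_all)
  ultimately have "u * 3 <= b - a" "v * 3 <= e - d" using uv by simp_all
  thus "emeasure M (A n) <= K" unfolding A_def u_def[symmetric] v_def[symmetric]
   using uv(1,3) by (intro le) linarith+
 qed
 finally show ?thesis .
qed

locale strip_content =
 fixes X :: "real set" and c :: "real => real => real => real => real"
 assumes X_countable: "countable X" and dense: "a < b ==> \<exists>x\<in>X. a < x \<and> x < b"
  and nonneg: "\<lbrakk>{x1, x2, y1, y2} \<subseteq> X; x1 <= x2; x2 < y1; y1 <= y2; y2 < x1 + 2 * pi\<rbrakk> \<Longrightarrow> 0 <= c x1 x2 y1 y2"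
  and addx: "c x1 x2 y1 y2 + c x2 x3 y1 y2 = c x1 x3 y1 y2"
  and addy: "c x1 x2 y1 y2 + c x1 x2 y2 y3 = c x1 x2 y1 y3"
begin

definition strip :: "(real \<times> real) set" where
 "strip = {(s, t). s < t \<and> t < s + 2 * pi}"

definition valid :: "real => real => real => real => bool" where
 "valid x1 x2 y1 y2 \<longleftrightarrow> {x1, x2, y1, y2} \<subseteq> X \<and> x1 <= x2 \<and> x2 < y1 \<and> y1 <= y2 \<and> y2 < x1 + 2 * pi"

definition sandwiched :: "(real \<times> real) measure => (real \<times> real) set => bool" where
 "sandwiched M W \<longleftrightarrow> sets M = sets borel \<and> (\<forall>x1 x2 y1 y2. valid x1 x2 y1 y2 \<and> crect x1 x2 y1 y2 \<subseteq> W \<longrightarrow>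
   emeasure M (orect x1 x2 y1 y2) <= ennreal (c x1 x2 y1 y2) \<and>
   ennreal (c x1 x2 y1 y2) <= emeasure M (crect x1 x2 y1 y2))"

lemma sandwiched_mono: "sandwiched M W ==> W' \<subseteq> W ==> sandwiched M W'"
 unfolding sandwiched_def by blast

text \<open>Between an open rectangle and a slightly smaller one fits a box with corners in the
  dense set \<open>X\<close>; its content bounds \<open>M\<close> of the smaller rectangle from
  above and \<open>N\<close> of the larger one from below. By symmetry two sandwiched measures agree
  on open rectangles, although neither need equal the content.\<close>

lemma sandwiched_le:
 assumes M: "sandwiched M W" and N: "sandwiched N W" and W: "W \<subseteq> strip" and U: "orect a b d e \<subseteq> W"
 shows "emeasure M (orect a b d e) <= emeasure N (orect a b d e)"
proof (rule orect_approx)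
 show "sets M = sets borel" using M by (simp add: sandwiched_def)
 fix a' b' d' e' assume h: "a < a'" "a' < b'" "b' < b" "d < d'" "d' < e'" "e' < e"
 obtain x1 where x1: "x1 \<in> X" "a < x1" "x1 < a'" using dense[OF h(1)] by blast
 obtain x2 where x2: "x2 \<in> X" "b' < x2" "x2 < b" using dense[OF h(3)] by blast
 obtain y1 where y1: "y1 \<in> X" "d < y1" "y1 < d'" using dense[OF h(4)] by blast
 obtain y2 where y2: "y2 \<in> X" "e' < y2" "y2 < e" using dense[OF h(6)] by blast
 have sub: "crect x1 x2 y1 y2 \<subseteq> orect a b d e" using x1 x2 y1 y2 by (auto simp: crect_def orect_def)
 have "(x2, y1) \<in> crect x1 x2 y1 y2" "(x1, y2) \<in> crect x1 x2 y1 y2"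
  using x1 x2 y1 y2 h by (auto simp: crect_def)
 hence "(x2, y1) \<in> strip" "(x1, y2) \<in> strip" using sub U W by blast+
 hence v: "valid x1 x2 y1 y2" using x1 x2 y1 y2 h by (auto simp: valid_def strip_def)
 have W': "crect x1 x2 y1 y2 \<subseteq> W" using sub U by blast
 have "orect a' b' d' e' \<subseteq> orect x1 x2 y1 y2" using x1 x2 y1 y2 by (auto simp: orect_def)
 hence "emeasure M (orect a' b' d' e') <= emeasure M (orect x1 x2 y1 y2)"
  using M by (intro emeasure_mono) (auto simp: sandwiched_def)
 also have "\<dots> <= ennreal (c x1 x2 y1 y2)" using M v W' by (simp add: sandwiched_def)
 also have "\<dots> <= emeasure N (crect x1 x2 y1 y2)" using N v W' by (simp add: sandwiched_def)
 also have "\<dots> <= emeasure N (orect a b d e)" using N sub by (intro emeasure_mono) (auto simp: sandwiched_def)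
 finally show "emeasure M (orect a' b' d' e') <= emeasure N (orect a b d e)" .
qed

lemma sandwiched_unique:
 assumes M: "sandwiched M (orect a b d e)" and N: "sandwiched N (orect a b d e)" and W: "orect a b d e \<subseteq> strip"
  and fin: "emeasure M (orect a b d e) < \<infinity>" and S: "S \<in> sets borel" "S \<subseteq> orect a b d e"
 shows "emeasure M S = emeasure N S"
proof -
 let ?W = "orect a b d e"
 have sM: "sets M = sets borel" and sN: "sets N = sets borel" using M N by (auto simp: sandwiched_def)
 have W': "?W \<in> sets M" "?W \<in> sets N" using sM sN by auto
 \<comment> \<open>Restriction to \<open>?W\<close> gives finite mass, so agreement on the
   intersection-stable generator of open boxes suffices.\<close>
 let ?M = "density M (indicator ?W)" and ?N = "density N (indicator ?W)"
 have "?M = ?N"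
 proof (rule measure_eqI_generator_eq)
  let ?E = "range (\<lambda>(p, q). box p q :: (real \<times> real) set)"
  show "Int_stable ?E"
  proof (rule Int_stableI_image)
   fix i j :: "(real \<times> real) \<times> (real \<times> real)"
   show "\<exists>k\<in>UNIV. (case i of (p, q) => box p q) \<inter> (case j of (p, q) => box p q) = (case k of (p, q) => box p q)"
    by (cases i; cases j) (auto simp: box_orect orect_Int)
  qed
  show "?E \<subseteq> Pow UNIV" by simp
  show "sets ?M = sigma_sets UNIV ?E" "sets ?N = sigma_sets UNIV ?E"
   using sM sN sets_measure_of[of ?E UNIV] by (simp_all add: borel_eq_box)
  show "emeasure ?M Y = emeasure ?N Y" if YE: "Y \<in> ?E" for Y
  proof -
   obtain p q where Y: "Y = box p q" using YE by auto
   then obtain a' b' d' e' where I: "?W \<inter> Y = orect a' b' d' e'" by (auto simp: box_orect orect_Int)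
   have Ys: "Y \<in> sets M" "Y \<in> sets N" using Y sM sN by auto
   have "orect a' b' d' e' \<subseteq> ?W" using I by blast
   hence "emeasure M (?W \<inter> Y) = emeasure N (?W \<inter> Y)"
    unfolding I using sandwiched_le[OF M N W] sandwiched_le[OF N M W] by (intro antisym) auto
   thus ?thesis using Ys W' by (simp add: emeasure_restricted)
  qed
  let ?A = "\<lambda>i. box (- (real i *\<^sub>R One)) (real i *\<^sub>R One) :: (real \<times> real) set"
  show "range ?A \<subseteq> ?E" by auto
  show "\<Union> (range ?A) = UNIV" using UN_box_eq_UNIV .
  show "emeasure ?M (?A i) ~= \<infinity>" for i
  proof -
   have "?A i \<in> sets M" using sM by simp
   hence "emeasure ?M (?A i) <= emeasure M ?W"
    using W' sM by (simp add: emeasure_restricted emeasure_mono)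
   thus ?thesis using fin by (auto simp: top_unique less_top)
  qed
 qed
 hence "emeasure ?M S = emeasure ?N S" by simp
 moreover have "?W \<inter> S = S" using S by blast
 ultimately show ?thesis using W' S sM sN by (simp add: emeasure_restricted)
qed

definition boxes :: "(real \<times> real \<times> real \<times> real) set" where
 "boxes = {(x1, x2, y1, y2). {x1, x2, y1, y2} \<subseteq> X \<and> x1 < x2 \<and> x2 < y1 \<and> y1 < y2 \<and> y2 < x1 + 2 * pi}"

definition obox :: "real \<times> real \<times> real \<times> real => (real \<times> real) set" where
 "obox = (\<lambda>(x1, x2, y1, y2). orect x1 x2 y1 y2)"

definition bmeas :: "real \<times> real \<times> real \<times> real => (real \<times> real) measure" where
 "bmeas = (\<lambda>(x1, x2, y1, y2). box_content.box_measure X c x1 x2 y1 y2)"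

lemma box_content_boxes: "(x1, x2, y1, y2) \<in> boxes ==> box_content X c x1 x2 y1 y2"
 by unfold_locales (use X_countable addx addy nonneg in \<open>auto simp: boxes_def\<close>)

lemma obox_strip: "R \<in> boxes ==> obox R \<subseteq> strip"
 by (auto simp: boxes_def obox_def orect_def strip_def)

lemma bmeas:
 assumes R: "R \<in> boxes"
 shows "sandwiched (bmeas R) (obox R)" "emeasure (bmeas R) UNIV < \<infinity>" "sets (bmeas R) = sets borel"
proof -
 obtain x1 x2 y1 y2 where r: "R = (x1, x2, y1, y2)" by (cases R)
 interpret box_content X c x1 x2 y1 y2 using box_content_boxes R r by simp
 show "emeasure (bmeas R) UNIV < \<infinity>" using finite_box by (simp add: bmeas_def r)
 show "sets (bmeas R) = sets borel" by (simp add: bmeas_def r)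
 thus "sandwiched (bmeas R) (obox R)"
  unfolding sandwiched_def
 proof (intro conjI allI impI)
  fix r1 r2 s1 s2 assume h: "valid r1 r2 s1 s2 \<and> crect r1 r2 s1 s2 \<subseteq> obox R"
  have "(r1, s1) \<in> crect r1 r2 s1 s2" "(r2, s2) \<in> crect r1 r2 s1 s2" using h by (auto simp: valid_def crect_def)
  hence "(r1, s1) \<in> obox R" "(r2, s2) \<in> obox R" using h by blast+
  hence "x1 <= r1" "r2 <= x2" "y1 <= s1" "s2 <= y2" by (auto simp: obox_def orect_def r)
  thus "emeasure (bmeas R) (orect r1 r2 s1 s2) <= ennreal (c r1 r2 s1 s2)"
   "ennreal (c r1 r2 s1 s2) <= emeasure (bmeas R) (crect r1 r2 s1 s2)"
   using box_sandwich[of r1 r2 s1 s2] h by (auto simp: valid_def bmeas_def r orect_def crect_def)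
 qed simp
qed

lemma bmeas_unique:
 assumes R: "R \<in> boxes" "R' \<in> boxes" and S: "S \<in> sets borel" "S \<subseteq> obox R" "S \<subseteq> obox R'"
 shows "emeasure (bmeas R) S = emeasure (bmeas R') S"
proof -
 obtain a b d e where I: "obox R \<inter> obox R' = orect a b d e"
  by (cases R; cases R') (auto simp: obox_def orect_Int)
 have "sandwiched (bmeas R) (orect a b d e)" "sandwiched (bmeas R') (orect a b d e)"
  using bmeas(1)[OF R(1)] bmeas(1)[OF R(2)] I sandwiched_mono by blast+
 moreover have "emeasure (bmeas R) (orect a b d e) <= emeasure (bmeas R) UNIV"
  using bmeas(3)[OF R(1)] by (intro emeasure_mono) auto
 hence "emeasure (bmeas R) (orect a b d e) < \<infinity>" using bmeas(2)[OF R(1)] by (rule le_less_trans)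
 ultimately show ?thesis
  using sandwiched_unique[of "bmeas R" a b d e "bmeas R'" S] obox_strip[OF R(1)] I S by blast
qed

lemma surround:
 assumes "q1 <= q2" "q2 < p1" "p1 <= p2" "p2 < q1 + 2 * pi"
 shows "\<exists>R\<in>boxes. crect q1 q2 p1 p2 \<subseteq> obox R"
proof -
 define \<epsilon> where "\<epsilon> = min (p1 - q2) (q1 + 2 * pi - p2) / 4"
 have e: "0 < \<epsilon>" "4 * \<epsilon> <= p1 - q2" "4 * \<epsilon> <= q1 + 2 * pi - p2" using assms by (auto simp: \<epsilon>_def)
 obtain x1 where "x1 \<in> X" "q1 - \<epsilon> < x1" "x1 < q1" using dense[of "q1 - \<epsilon>" q1] e by auto
 moreover obtain x2 where "x2 \<in> X" "q2 < x2" "x2 < q2 + \<epsilon>" using dense[of q2 "q2 + \<epsilon>"] e by auto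
 moreover obtain y1 where "y1 \<in> X" "p1 - \<epsilon> < y1" "y1 < p1" using dense[of "p1 - \<epsilon>" p1] e by auto
 moreover obtain y2 where "y2 \<in> X" "p2 < y2" "y2 < p2 + \<epsilon>" using dense[of p2 "p2 + \<epsilon>"] e by auto
 ultimately have "(x1, x2, y1, y2) \<in> boxes" "crect q1 q2 p1 p2 \<subseteq> obox (x1, x2, y1, y2)"
  using e assms by (auto simp: boxes_def crect_def obox_def orect_def)
 thus ?thesis by blast
qed

lemma boxes_countable: "countable boxes"
proof -
 have "boxes \<subseteq> X \<times> X \<times> X \<times> X" by (auto simp: boxes_def)
 moreover have "countable (X \<times> X \<times> X \<times> X)" using X_countable by (intro countable_SIGMA)
 ultimately show ?thesis by (rule countable_subset)
qed

lemma boxes_nonempty: "boxes ~= {}"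
 using surround[of 0 0 1 1] pi_gt3 by auto

definition nthbox :: "nat => real \<times> real \<times> real \<times> real" where "nthbox = from_nat_into boxes"

lemma nthbox: "nthbox i \<in> boxes" "range nthbox = boxes"
 unfolding nthbox_def using boxes_nonempty boxes_countable by (simp_all add: from_nat_into range_from_nat_into)

definition piece :: "nat => (real \<times> real) set" where "piece = disjointed (\<lambda>i. obox (nthbox i))"

lemma piece: "piece i \<in> sets borel" "piece i \<subseteq> obox (nthbox i)" "disjoint_family piece" "(\<Union>i. piece i) = strip"
proof -
 have ob: "range (\<lambda>i. obox (nthbox i)) \<subseteq> sets borel" by (auto simp: obox_def split: prod.splits)
 show "piece i \<in> sets borel" using sets.range_disjointed_sets[OF ob] by (auto simp: piece_def)
 show "piece i \<subseteq> obox (nthbox i)" by (auto simp: piece_def disjointed_def)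
 show "disjoint_family piece" by (simp add: piece_def disjoint_family_disjointed)
 have "strip \<subseteq> (\<Union>R\<in>boxes. obox R)"
 proof
  fix p assume "p \<in> strip"
  then obtain s t where p: "p = (s, t)" "s < t" "t < s + 2 * pi" by (auto simp: strip_def)
  then obtain R where "R \<in> boxes" "crect s s t t \<subseteq> obox R" using surround[of s s t t] by auto
  thus "p \<in> (\<Union>R\<in>boxes. obox R)" using p by (auto simp: crect_def)
 qed
 moreover have "(\<Union>R\<in>boxes. obox R) \<subseteq> strip" using obox_strip by blast
 moreover have "(\<Union>i. piece i) = (\<Union>R\<in>range nthbox. obox R)"
  unfolding piece_def UN_disjointed_eq by blast
 ultimately show "(\<Union>i. piece i) = strip" using nthbox(2) by simp
qed

text \<open>On each of countably many disjoint pieces of the strip, the measure constructed in one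
  box containing it; \<open>bmeas_unique\<close> makes overlapping boxes agree.\<close>

definition strip_measure :: "(real \<times> real) measure" where
 "strip_measure = measure_of UNIV (sets borel)
   (\<lambda>S. \<integral>\<^sup>+ i. emeasure (bmeas (nthbox i)) (S \<inter> piece i) \<partial>count_space UNIV)"

lemma sets_strip_measure [simp]: "sets strip_measure = sets borel" "space strip_measure = UNIV"
proof -
 show "sets strip_measure = sets borel" unfolding strip_measure_def
  using sets.sigma_sets_eq[of "borel :: (real \<times> real) measure"] by (simp add: sets_measure_of_conv)
 show "space strip_measure = UNIV" unfolding strip_measure_def by (simp add: space_measure_of_conv)
qed

lemma emeasure_strip:
 assumes "S \<in> sets borel"
 shows "emeasure strip_measure S = (\<integral>\<^sup>+ i. emeasure (bmeas (nthbox i)) (S \<inter> piece i) \<partial>count_space UNIV)"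
 unfolding strip_measure_def
proof (rule emeasure_measure_of_sigma)
 show "sigma_algebra UNIV (sets (borel :: (real \<times> real) measure))"
  using sets.sigma_algebra_axioms[of "borel :: (real \<times> real) measure"] by simp
 show "positive (sets borel) (\<lambda>S. \<integral>\<^sup>+ i. emeasure (bmeas (nthbox i)) (S \<inter> piece i) \<partial>count_space UNIV)"
  by (simp add: positive_def)
 show "countably_additive (sets borel) (\<lambda>S. \<integral>\<^sup>+ i. emeasure (bmeas (nthbox i)) (S \<inter> piece i) \<partial>count_space UNIV)"
 proof (rule countably_additiveI)
  fix A :: "nat => (real \<times> real) set"
  assume A: "range A \<subseteq> sets borel" "disjoint_family A" "\<Union> (range A) \<in> sets borel"
  have inner: "(\<Sum>j. emeasure (bmeas (nthbox i)) (A j \<inter> piece i)) = emeasure (bmeas (nthbox i)) (\<Union> (range A) \<inter> piece i)" for i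
  proof -
   have "range (\<lambda>j. A j \<inter> piece i) \<subseteq> sets (bmeas (nthbox i))"
    using A(1) piece(1)[of i] bmeas(3)[OF nthbox(1)] by auto
   moreover have "disjoint_family (\<lambda>j. A j \<inter> piece i)" using A(2) unfolding disjoint_family_on_def by blast
   ultimately have "(\<Sum>j. emeasure (bmeas (nthbox i)) (A j \<inter> piece i)) = emeasure (bmeas (nthbox i)) (\<Union>j. A j \<inter> piece i)"
    by (rule suminf_emeasure)
   also have "(\<Union>j. A j \<inter> piece i) = \<Union> (range A) \<inter> piece i" by blast
   finally show ?thesis .
  qed
  have "(\<Sum>j. \<integral>\<^sup>+ i. emeasure (bmeas (nthbox i)) (A j \<inter> piece i) \<partial>count_space UNIV) =
   (\<integral>\<^sup>+ i. (\<Sum>j. emeasure (bmeas (nthbox i)) (A j \<inter> piece i)) \<partial>count_space UNIV)"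
   by (rule nn_integral_suminf[symmetric]) simp
  thus "(\<Sum>j. \<integral>\<^sup>+ i. emeasure (bmeas (nthbox i)) (A j \<inter> piece i) \<partial>count_space UNIV) =
   (\<integral>\<^sup>+ i. emeasure (bmeas (nthbox i)) (\<Union> (range A) \<inter> piece i) \<partial>count_space UNIV)"
   by (simp only: inner)
 qed
qed (fact assms)

lemma pieces_sum:
 assumes M: "sets M = sets borel" and S: "S \<in> sets borel" "S \<subseteq> strip"
 shows "(\<integral>\<^sup>+ i. emeasure M (S \<inter> piece i) \<partial>count_space UNIV) = emeasure M S"
proof -
 have "(\<integral>\<^sup>+ i. emeasure M (S \<inter> piece i) \<partial>count_space UNIV) = (\<Sum>i. emeasure M (S \<inter> piece i))"
  by (rule nn_integral_count_space_nat)
 also have "\<dots> = emeasure M (\<Union>i. S \<inter> piece i)"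
 proof (rule suminf_emeasure)
  show "disjoint_family (\<lambda>i. S \<inter> piece i)" using piece(3) unfolding disjoint_family_on_def by blast
 qed (use M S piece(1) in auto)
 also have "(\<Union>i. S \<inter> piece i) = S" using S(2) piece(4) by blast
 finally show ?thesis .
qed

lemma strip_measure_box:
 assumes R: "R \<in> boxes" and S: "S \<in> sets borel" "S \<subseteq> obox R"
 shows "emeasure strip_measure S = emeasure (bmeas R) S"
proof -
 have "emeasure (bmeas (nthbox i)) (S \<inter> piece i) = emeasure (bmeas R) (S \<inter> piece i)" for i
  using S piece(1,2)[of i] by (intro bmeas_unique nthbox(1) R) auto
 hence "emeasure strip_measure S = (\<integral>\<^sup>+ i. emeasure (bmeas R) (S \<inter> piece i) \<partial>count_space UNIV)"
  using emeasure_strip[OF S(1)] by simp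
 also have "\<dots> = emeasure (bmeas R) S"
  using S obox_strip[OF R] by (intro pieces_sum bmeas(3)[OF R]) auto
 finally show ?thesis .
qed

lemma strip_measure_finite:
 assumes "q1 <= q2" "q2 < p1" "p1 <= p2" "p2 < q1 + 2 * pi"
 shows "emeasure strip_measure (crect q1 q2 p1 p2) < \<infinity>"
proof -
 obtain R where R: "R \<in> boxes" "crect q1 q2 p1 p2 \<subseteq> obox R" using surround[OF assms] by blast
 have "emeasure strip_measure (crect q1 q2 p1 p2) = emeasure (bmeas R) (crect q1 q2 p1 p2)"
  using R by (intro strip_measure_box) auto
 also have "\<dots> <= emeasure (bmeas R) UNIV" using bmeas(3)[OF R(1)] by (intro emeasure_mono) auto
 also have "\<dots> < \<infinity>" using bmeas(2)[OF R(1)] .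
 finally show ?thesis .
qed

lemma strip_measure_sandwich: "sandwiched strip_measure strip"
 unfolding sandwiched_def
proof (intro conjI allI impI)
 fix x1 x2 y1 y2 assume h: "valid x1 x2 y1 y2 \<and> crect x1 x2 y1 y2 \<subseteq> strip"
 then obtain R where R: "R \<in> boxes" "crect x1 x2 y1 y2 \<subseteq> obox R"
  using surround[of x1 x2 y1 y2] by (auto simp: valid_def)
 have "orect x1 x2 y1 y2 \<subseteq> crect x1 x2 y1 y2" by (auto simp: orect_def crect_def)
 hence "emeasure strip_measure (orect x1 x2 y1 y2) = emeasure (bmeas R) (orect x1 x2 y1 y2)"
  "emeasure strip_measure (crect x1 x2 y1 y2) = emeasure (bmeas R) (crect x1 x2 y1 y2)"
  using R by (auto intro!: strip_measure_box)
 thus "emeasure strip_measure (orect x1 x2 y1 y2) <= ennreal (c x1 x2 y1 y2)"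
  "ennreal (c x1 x2 y1 y2) <= emeasure strip_measure (crect x1 x2 y1 y2)"
  using bmeas(1)[OF R(1)] R(2) h unfolding sandwiched_def by auto
qed simp

lemma strip_measure_unique:
 assumes N: "sandwiched N strip" and S: "S \<in> sets borel" "S \<subseteq> strip"
 shows "emeasure strip_measure S = emeasure N S"
proof -
 have "emeasure (bmeas (nthbox i)) (S \<inter> piece i) = emeasure N (S \<inter> piece i)" for i
 proof -
  obtain a b d e where I: "obox (nthbox i) = orect a b d e" by (cases "nthbox i") (auto simp: obox_def)
  have "emeasure (bmeas (nthbox i)) (orect a b d e) <= emeasure (bmeas (nthbox i)) UNIV"
   using bmeas(3)[OF nthbox(1)] by (intro emeasure_mono) auto
  hence "emeasure (bmeas (nthbox i)) (orect a b d e) < \<infinity>" using bmeas(2)[OF nthbox(1)] by (rule le_less_trans)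
  note fin = this
  have st: "orect a b d e \<subseteq> strip" using obox_strip[OF nthbox(1)[of i]] I by simp
  have b: "sandwiched (bmeas (nthbox i)) (orect a b d e)" using bmeas(1)[OF nthbox(1)[of i]] I by simp
  show ?thesis
   by (rule sandwiched_unique[OF b sandwiched_mono[OF N st] st fin]) (use S piece(1,2)[of i] I in auto)
 qed
 hence "emeasure strip_measure S = (\<integral>\<^sup>+ i. emeasure N (S \<inter> piece i) \<partial>count_space UNIV)"
  using emeasure_strip[OF S(1)] by simp
 also have "\<dots> = emeasure N S" using S N by (intro pieces_sum) (auto simp: sandwiched_def)
 finally show ?thesis .
qed

text \<open>If pulling back boxes along \<open>g\<close> preserves contents, the image measure is
  again sandwiched, and uniqueness identifies it with the original. Invariance is thus inherited
  from the content.\<close>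

lemma strip_measure_transport:
 assumes g: "continuous_on UNIV g" and S: "S \<in> sets borel" "S \<subseteq> strip"
  and box: "\<And>x1 x2 y1 y2. valid x1 x2 y1 y2 ==> \<exists>u1 u2 w1 w2. valid u1 u2 w1 w2 \<and> c u1 u2 w1 w2 = c x1 x2 y1 y2 \<and>
   g -` orect x1 x2 y1 y2 = orect u1 u2 w1 w2 \<and> g -` crect x1 x2 y1 y2 = crect u1 u2 w1 w2"
 shows "emeasure strip_measure (g -` S) = emeasure strip_measure S"
proof -
 have gm: "g \<in> measurable strip_measure borel"
  using g by (simp add: borel_measurable_continuous_onI cong: measurable_cong_sets)
 have "sandwiched (distr strip_measure borel g) strip"
  unfolding sandwiched_def
 proof (intro conjI allI impI)
  fix x1 x2 y1 y2 assume "valid x1 x2 y1 y2 \<and> crect x1 x2 y1 y2 \<subseteq> strip"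
  then obtain u1 u2 w1 w2 where u: "valid u1 u2 w1 w2" "c u1 u2 w1 w2 = c x1 x2 y1 y2"
   "g -` orect x1 x2 y1 y2 = orect u1 u2 w1 w2" "g -` crect x1 x2 y1 y2 = crect u1 u2 w1 w2" using box by blast
  hence "crect u1 u2 w1 w2 \<subseteq> strip" by (auto simp: valid_def crect_def strip_def)
  thus "emeasure (distr strip_measure borel g) (orect x1 x2 y1 y2) <= ennreal (c x1 x2 y1 y2)"
   "ennreal (c x1 x2 y1 y2) <= emeasure (distr strip_measure borel g) (crect x1 x2 y1 y2)"
   using strip_measure_sandwich[unfolded sandwiched_def, THEN conjunct2, rule_format, of u1 u2 w1 w2] u gm
   by (simp_all add: emeasure_distr)
 qed simp
 hence "emeasure strip_measure S = emeasure (distr strip_measure borel g) S" using S by (intro strip_measure_unique)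
 thus ?thesis using gm S by (simp add: emeasure_distr)
qed

lemma strip_measure_invariant:
 assumes G: "continuous_on UNIV G" "strict_mono G" "surj G" "\<And>x. G (x + 2 * pi) = G x + 2 * pi"
  and GX: "\<And>x. x \<in> X ==> \<exists>y\<in>X. G y = x"
  and Gc: "\<And>x1 x2 y1 y2. valid x1 x2 y1 y2 ==> c (G x1) (G x2) (G y1) (G y2) = c x1 x2 y1 y2"
  and S: "S \<in> sets borel" "S \<subseteq> strip"
 shows "emeasure strip_measure {p. (G (fst p), G (snd p)) \<in> S} = emeasure strip_measure S"
proof -
 let ?g = "\<lambda>p. (G (fst p), G (snd p))"
 have "continuous_on UNIV ?g"
  by (intro continuous_on_Pair continuous_on_compose2[OF G(1)] continuous_on_fst continuous_on_snd continuous_on_id) auto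
 moreover have less: "G x < G y \<longleftrightarrow> x < y" "G x <= G y \<longleftrightarrow> x <= y" for x y
  using G(2) by (simp_all add: strict_mono_less strict_mono_less_eq)
 have "\<exists>u1 u2 w1 w2. valid u1 u2 w1 w2 \<and> c u1 u2 w1 w2 = c x1 x2 y1 y2 \<and>
   ?g -` orect x1 x2 y1 y2 = orect u1 u2 w1 w2 \<and> ?g -` crect x1 x2 y1 y2 = crect u1 u2 w1 w2" if v: "valid x1 x2 y1 y2" for x1 x2 y1 y2
 proof -
  obtain u1 u2 w1 w2 where u: "u1 \<in> X" "G u1 = x1" "u2 \<in> X" "G u2 = x2" "w1 \<in> X" "G w1 = y1" "w2 \<in> X" "G w2 = y2"
   using GX v unfolding valid_def by (metis insert_subset)
  have "G w2 < G (u1 + 2 * pi)" using v u G(4) by (simp add: valid_def)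
  hence "valid u1 u2 w1 w2" using v u less unfolding valid_def by auto
  moreover have "?g -` orect x1 x2 y1 y2 = orect u1 u2 w1 w2" "?g -` crect x1 x2 y1 y2 = crect u1 u2 w1 w2"
   using u less by (auto simp: orect_def crect_def)
  ultimately show ?thesis using Gc u by metis
 qed
 ultimately have "emeasure strip_measure (?g -` S) = emeasure strip_measure S" by (rule strip_measure_transport[OF _ S])
 thus ?thesis by (simp add: vimage_def)
qed

lemma strip_measure_swap:
 assumes XX: "\<And>x. x \<in> X ==> x - 2 * pi \<in> X"
  and Gc: "\<And>x1 x2 y1 y2. valid x1 x2 y1 y2 ==> c y1 y2 (x1 + 2 * pi) (x2 + 2 * pi) = c x1 x2 y1 y2"
  and S: "S \<in> sets borel" "S \<subseteq> strip"
 shows "emeasure strip_measure {p. (snd p, fst p + 2 * pi) \<in> S} = emeasure strip_measure S"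
proof -
 let ?g = "\<lambda>p::real \<times> real. (snd p, fst p + 2 * pi)"
 have "continuous_on UNIV ?g" by (intro continuous_intros)
 moreover have "\<exists>u1 u2 w1 w2. valid u1 u2 w1 w2 \<and> c u1 u2 w1 w2 = c x1 x2 y1 y2 \<and>
   ?g -` orect x1 x2 y1 y2 = orect u1 u2 w1 w2 \<and> ?g -` crect x1 x2 y1 y2 = crect u1 u2 w1 w2" if v: "valid x1 x2 y1 y2" for x1 x2 y1 y2
 proof -
  have "valid (y1 - 2 * pi) (y2 - 2 * pi) x1 x2" using v XX by (auto simp: valid_def)
  moreover from Gc[OF this] have "c (y1 - 2 * pi) (y2 - 2 * pi) x1 x2 = c x1 x2 y1 y2" by simp
  moreover have "?g -` orect x1 x2 y1 y2 = orect (y1 - 2 * pi) (y2 - 2 * pi) x1 x2"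
   "?g -` crect x1 x2 y1 y2 = crect (y1 - 2 * pi) (y2 - 2 * pi) x1 x2" by (auto simp: orect_def crect_def)
  ultimately show ?thesis by blast
 qed
 ultimately have "emeasure strip_measure (?g -` S) = emeasure strip_measure S" by (rule strip_measure_transport[OF _ S])
 thus ?thesis by (simp add: vimage_def)
qed

end

context strip_content
begin

text \<open>
 A homeomorphism that fixes \<open>r < s\<close> and pushes everything between them towards \<open>s\<close>: the sandwich
 bounds for \<open>N\<close> periods at once determine the measure of one period up to an error of order \<open>1/N\<close>.
\<close>

lemma period_measure:
 assumes G: "continuous_on UNIV G" "strict_mono G" "surj G" "\<And>x. G (x + 2 * pi) = G x + 2 * pi"
  and GX: "\<And>x. x \<in> X ==> \<exists>y\<in>X. G y = x" "\<And>x. x \<in> X ==> G x \<in> X"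
  and Gc: "\<And>x1 x2 y1 y2. valid x1 x2 y1 y2 ==> c (G x1) (G x2) (G y1) (G y2) = c x1 x2 y1 y2"
  and rs: "r \<in> X" "s \<in> X" "r + 2 * pi \<in> X" "r < s" "s < r + 2 * pi" "G r = r" "G s = s"
  and up: "\<And>x. r < x ==> x < s ==> x < G x"
  and p: "p \<in> X" "r < p" "p < s"
 shows "emeasure strip_measure ({p..<G p} \<times> {s<..<r + 2 * pi}) = ennreal (c p (G p) s (r + 2 * pi))"
  "c p ((G ^^ n) p) s (r + 2 * pi) = real n * c p (G p) s (r + 2 * pi)"
proof -
 define J where "J = {s<..<r + 2 * pi}"
 define \<nu> where "\<nu> = emeasure strip_measure"
 define P where "P n = (G ^^ n) p" for n
 define \<l> where "\<l> = c p (G p) s (r + 2 * pi)"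
 have less: "G x < G y \<longleftrightarrow> x < y" "G x <= G y \<longleftrightarrow> x <= y" "G x = G y \<longleftrightarrow> x = y" for x y
  using G(2) by (simp_all add: strict_mono_less strict_mono_less_eq strict_mono_eq)
 have Gr2: "G (r + 2 * pi) = r + 2 * pi" using G(4) rs(6) by simp
 have cmp: "G x < s \<longleftrightarrow> x < s" "s < G x \<longleftrightarrow> s < x" "r < G x \<longleftrightarrow> r < x" "G x < r + 2 * pi \<longleftrightarrow> x < r + 2 * pi"
  "G x = s \<longleftrightarrow> x = s" "G x = r + 2 * pi \<longleftrightarrow> x = r + 2 * pi" for x
  using less[of x s] less[of s x] less[of r x] less[of x "r + 2 * pi"] rs(6,7) Gr2 by auto
 have P0: "P 0 = p" "P (Suc n) = G (P n)" for n by (simp_all add: P_def)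
 have PX: "P n \<in> X" "r < P n" "P n < s" for n by (induction n) (use p GX(2) cmp in \<open>auto simp: P0\<close>)
 have Pmono: "p <= P n" for n
 proof (induction n)
  case (Suc n)
  thus ?case using up[OF PX(2,3)[of n]] by (simp add: P0)
 qed (simp add: P0)
 have Pup: "P n < P (Suc n)" for n using up[OF PX(2,3)] by (simp add: P0)
 have inv: "\<nu> {q. (G (fst q), G (snd q)) \<in> S} = \<nu> S" if "S \<in> sets borel" "S \<subseteq> strip" for S
  unfolding \<nu>_def by (rule strip_measure_invariant[OF G GX(1) Gc that])
 have bm: "A \<times> B \<in> sets borel" if "A \<in> sets borel" "B \<in> sets borel" for A B :: "real set"
  using that by (metis borel_prod pair_measureI)
 have Jb: "J \<in> sets borel" by (simp add: J_def)
 define a where "a = \<nu> ({p..<G p} \<times> J)"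
 have shift: "\<nu> ({G x..<G y} \<times> J) = \<nu> ({x..<y} \<times> J)" if "r < x" "y < s" for x y
 proof -
  have "r < G x" "G y < s" using that cmp(3)[of x] cmp(1)[of y] by blast+
  hence "{G x..<G y} \<times> J \<subseteq> strip" by (auto simp: strip_def J_def)
  moreover have "{q. (G (fst q), G (snd q)) \<in> {G x..<G y} \<times> J} = {x..<y} \<times> J" using less cmp by (auto simp: J_def)
  ultimately show ?thesis using inv[of "{G x..<G y} \<times> J"] bm Jb by simp
 qed
 have one: "\<nu> ({P n..<P (Suc n)} \<times> J) = a" for n
 proof (induction n)
  case (Suc n)
  thus ?case using shift[of "P n" "P (Suc n)"] PX(2)[of n] PX(3)[of "Suc n"] by (simp add: P0)
 qed (simp add: a_def P0)
 have many: "\<nu> ({p..<P N} \<times> J) = of_nat N * a" for N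
 proof (induction N)
  case (Suc N)
  have "{p..<P (Suc N)} \<times> J = {p..<P N} \<times> J \<union> {P N..<P (Suc N)} \<times> J" using Pmono[of N] Pup[of N] by auto
  hence "\<nu> ({p..<P (Suc N)} \<times> J) = \<nu> ({p..<P N} \<times> J) + \<nu> ({P N..<P (Suc N)} \<times> J)"
   unfolding \<nu>_def using bm Jb by (simp, intro plus_emeasure[symmetric]) auto
  thus ?case using Suc one by (simp add: distrib_right add.commute)
 qed (simp add: \<nu>_def P0)
 have cs: "c p (P n) s (r + 2 * pi) = real n * \<l>" for n
 proof (induction n)
  case 0
  show ?case using addx[of p p s "r + 2 * pi" p] by (simp add: P0)
 next
  case (Suc n)
  have "c (P n) (P (Suc n)) s (r + 2 * pi) = \<l>" for n
  proof (induction n)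
   case (Suc n)
   have "valid (P n) (P (Suc n)) s (r + 2 * pi)" using PX[of n] PX[of "Suc n"] rs Pup[of n] by (auto simp: valid_def)
   from Gc[OF this] show ?case using Suc rs Gr2 by (simp add: P0)
  qed (simp add: \<l>_def P0)
  thus ?case using Suc addx[of p "P n" s "r + 2 * pi" "P (Suc n)"] by (simp add: distrib_right)
 qed
 thus "c p ((G ^^ n) p) s (r + 2 * pi) = real n * c p (G p) s (r + 2 * pi)" by (simp add: P_def \<l>_def)
 have val: "valid p (P n) s (r + 2 * pi)" for n using PX[of n] p rs Pmono[of n] by (auto simp: valid_def)
 have sw: "\<nu> (orect p (P n) s (r + 2 * pi)) <= ennreal (real n * \<l>)" "ennreal (real n * \<l>) <= \<nu> (crect p (P n) s (r + 2 * pi))" for n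
 proof -
  have "crect p (P n) s (r + 2 * pi) \<subseteq> strip" using val[of n] by (auto simp: valid_def crect_def strip_def)
  thus "\<nu> (orect p (P n) s (r + 2 * pi)) <= ennreal (real n * \<l>)" "ennreal (real n * \<l>) <= \<nu> (crect p (P n) s (r + 2 * pi))"
   using strip_measure_sandwich[unfolded sandwiched_def, THEN conjunct2, rule_format, of p "P n" s "r + 2 * pi"] val[of n] cs[of n]
   by (simp_all add: \<nu>_def)
 qed
 have l0: "\<l> \<ge> 0" using nonneg[of p "P 1" s "r + 2 * pi"] val[of 1] cs[of 1] by (auto simp: valid_def)
 \<comment> \<open>\<open>N\<close> periods, shifted forward by one, fit into the open box of
   \<open>N + 1\<close> periods.\<close>
 have up1: "of_nat N * a <= ennreal (real (Suc N) * \<l>)" for N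
 proof -
  have "of_nat N * a = \<nu> ({G p..<G (P N)} \<times> J)" using many[of N] shift[of p "P N"] p PX(3)[of N] by simp
  also have "\<dots> <= \<nu> (orect p (P (Suc N)) s (r + 2 * pi))" unfolding \<nu>_def
  proof (rule emeasure_mono)
   show "{G p..<G (P N)} \<times> J \<subseteq> orect p (P (Suc N)) s (r + 2 * pi)" using up[OF p(2,3)] by (auto simp: orect_def J_def P0)
  qed simp
  finally show ?thesis using sw(1)[of "Suc N"] by (rule order_trans)
 qed
 have zero: "\<nu> T = 0" if T: "S \<union> T = S'" "S \<inter> T = {}" "S \<in> sets borel" "T \<in> sets borel" "\<nu> S = \<nu> S'"
  and S': "S' \<subseteq> crect x y u v" "x <= y" "y < u" "u <= v" "v < x + 2 * pi" for S S' T x y u v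
 proof -
  have "\<nu> S' <= \<nu> (crect x y u v)" unfolding \<nu>_def by (rule emeasure_mono[OF S'(1)]) simp
  also have "\<dots> < \<infinity>" unfolding \<nu>_def by (rule strip_measure_finite[OF S'(2-5)])
  finally have "\<nu> S' < \<infinity>" .
  moreover have "\<nu> S + \<nu> T = \<nu> S'" unfolding \<nu>_def using T by (subst plus_emeasure) auto
  ultimately show ?thesis using T(5) by (metis add_0_right ennreal_add_left_cancel infinity_ennreal_def less_irrefl)
 qed
 \<comment> \<open>The edges are null: by invariance nested segments of an edge have the same finite
   measure, so their difference has measure 0. The opposite edge is treated likewise below.\<close>
 have n1: "\<nu> ({p..<P N} \<times> {s}) = 0" for N
 proof (rule zero)
  have "\<nu> ({r<..<P n} \<times> {s}) = \<nu> ({r<..<p} \<times> {s})" for n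
  proof (induction n)
   case (Suc n)
   have "{r<..<P (Suc n)} \<times> {s} \<subseteq> strip" using PX[of "Suc n"] rs by (auto simp: strip_def)
   moreover have "{q. (G (fst q), G (snd q)) \<in> {r<..<P (Suc n)} \<times> {s}} = {r<..<P n} \<times> {s}" using less cmp by (auto simp: P0)
   ultimately show ?case using inv[of "{r<..<P (Suc n)} \<times> {s}"] bm Suc by simp
  qed (simp add: P0)
  thus "\<nu> ({r<..<p} \<times> {s}) = \<nu> ({r<..<P N} \<times> {s})" by simp
  show "{r<..<p} \<times> {s} \<union> {p..<P N} \<times> {s} = {r<..<P N} \<times> {s}" using Pmono[of N] p by auto
  show "{r<..<P N} \<times> {s} \<subseteq> crect r (P N) s s" by (auto simp: crect_def)
 qed (use PX[of N] rs bm in auto)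
 have n2: "\<nu> ({p..<P N} \<times> {r + 2 * pi}) = 0" for N
 proof (rule zero)
  have "\<nu> ({P n..<s} \<times> {r + 2 * pi}) = \<nu> ({p..<s} \<times> {r + 2 * pi})" for n
  proof (induction n)
   case (Suc n)
   have "{P (Suc n)..<s} \<times> {r + 2 * pi} \<subseteq> strip" using PX[of "Suc n"] rs by (auto simp: strip_def)
   moreover have "{q. (G (fst q), G (snd q)) \<in> {P (Suc n)..<s} \<times> {r + 2 * pi}} = {P n..<s} \<times> {r + 2 * pi}" using less cmp by (auto simp: P0)
   ultimately show ?case using inv[of "{P (Suc n)..<s} \<times> {r + 2 * pi}"] bm Suc by simp
  qed (simp add: P0)
  thus "\<nu> ({P N..<s} \<times> {r + 2 * pi}) = \<nu> ({p..<s} \<times> {r + 2 * pi})" .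
  show "{P N..<s} \<times> {r + 2 * pi} \<union> {p..<P N} \<times> {r + 2 * pi} = {p..<s} \<times> {r + 2 * pi}" using Pmono[of N] PX[of N] by auto
  show "{p..<s} \<times> {r + 2 * pi} \<subseteq> crect p s (r + 2 * pi) (r + 2 * pi)" by (auto simp: crect_def)
 qed (use p rs bm in auto)
 \<comment> \<open>Conversely, the closed box of \<open>N\<close> periods is covered by
   \<open>N + 1\<close> half-open periods and null edges.\<close>
 have lo1: "ennreal (real N * \<l>) <= of_nat (Suc N) * a" for N
 proof -
  have "crect p (P N) s (r + 2 * pi) \<subseteq> {p..<P (Suc N)} \<times> J \<union> ({p..<P (Suc N)} \<times> {s} \<union> {p..<P (Suc N)} \<times> {r + 2 * pi})"
   using Pup[of N] by (auto simp: crect_def J_def)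
  hence "\<nu> (crect p (P N) s (r + 2 * pi)) <= \<nu> ({p..<P (Suc N)} \<times> J \<union> ({p..<P (Suc N)} \<times> {s} \<union> {p..<P (Suc N)} \<times> {r + 2 * pi}))"
   unfolding \<nu>_def using bm Jb by (intro emeasure_mono) auto
  also have "\<dots> <= \<nu> ({p..<P (Suc N)} \<times> J) + (\<nu> ({p..<P (Suc N)} \<times> {s}) + \<nu> ({p..<P (Suc N)} \<times> {r + 2 * pi}))"
   unfolding \<nu>_def using bm Jb by (intro order_trans[OF emeasure_subadditive] add_left_mono emeasure_subadditive) auto
  also have "\<dots> = of_nat (Suc N) * a" unfolding n1 n2 many by simp
  finally show ?thesis using sw(2)[of N] by (rule order_trans[rotated])
 qed
 have "a <= ennreal (2 * \<l>)" using up1[of 1] by simp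
 then obtain a' where a': "a = ennreal a'" "0 <= a'" by (cases a) (auto simp: top_unique)
 have u: "real N * a' <= real (Suc N) * \<l>" "real N * \<l> <= real (Suc N) * a'" for N
 proof -
  have "ennreal (real N * a') <= ennreal (real (Suc N) * \<l>)" using up1[of N] a' by (simp add: ennreal_mult ennreal_of_nat_eq_real_of_nat)
  thus "real N * a' <= real (Suc N) * \<l>" using l0 by (subst (asm) ennreal_le_iff) simp_all
  have "ennreal (real N * \<l>) <= ennreal (real (Suc N) * a')"
   using lo1[of N] a' unfolding ennreal_mult[OF of_nat_0_le_iff a'(2)] ennreal_of_nat_eq_real_of_nat by simp
  thus "real N * \<l> <= real (Suc N) * a'" using a'(2) by (subst (asm) ennreal_le_iff) simp_all
 qed
 have lim: "x <= y" if "\<And>N. real N * x <= real (Suc N) * y" for x y :: real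
 proof (rule ccontr)
  assume "\<not> x <= y"
  hence "0 < x - y" by simp
  then obtain N where "y < real N * (x - y)" by (rule reals_Archimedean3[THEN spec, THEN exE])
  thus False using that[of N] by (simp add: algebra_simps)
 qed
 have "a' = \<l>" using lim[of a' \<l>] lim[of \<l> a'] u by (meson order_antisym)
 thus "emeasure strip_measure ({p..<G p} \<times> {s<..<r + 2 * pi}) = ennreal (c p (G p) s (r + 2 * pi))"
  using a'(1) by (simp add: a_def \<nu>_def J_def \<l>_def)
qed

end

section \<open>Transport of measures and regularity\<close>

text \<open>\<open>B\<close> is decomposed according to the first index that moves a point into
  \<open>A\<close>; the images of the parts are disjoint subsets of \<open>A\<close> of the same
  measures. This comparison of fundamental domains is applied to the deck group of the strip and to
  \<Gamma> acting on pairs of geodesics.\<close>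

lemma transport_le:
 fixes \<tau> :: "'i => 'a => 'a"
 assumes AB: "A \<in> sets M" "B \<in> sets M" and I: "countable I"
  and meas: "\<And>i. i \<in> I ==> {p \<in> B. \<tau> i p \<in> A} \<in> sets M"
  and pres: "\<And>i S. i \<in> I ==> S \<in> sets M ==> S \<subseteq> B ==> \<tau> i ` S \<subseteq> A ==> \<tau> i ` S \<in> sets M \<and> emeasure M (\<tau> i ` S) = emeasure M S"
  and cover: "\<And>p. p \<in> B ==> \<exists>i\<in>I. \<tau> i p \<in> A"
  and inj: "\<And>p p' i j. p \<in> B ==> p' \<in> B ==> i \<in> I ==> j \<in> I ==> \<tau> i p \<in> A ==> \<tau> i p = \<tau> j p' ==> p = p'"
 shows "emeasure M B <= emeasure M A"
proof (cases "I = {}")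
 case True
 hence "B = {}" using cover by auto
 thus ?thesis by simp
next
 case False
 define e where "e = from_nat_into I"
 have eI: "e n \<in> I" for n unfolding e_def by (rule from_nat_into[OF False])
 define Y where "Y n = {p \<in> B. \<tau> (e n) p \<in> A}" for n
 define D where "D = disjointed Y"
 have Dsub: "D n \<subseteq> Y n" for n unfolding D_def by (rule disjointed_subset)
 have DB: "D n \<subseteq> B" "\<tau> (e n) ` D n \<subseteq> A" for n using Dsub[of n] by (auto simp: Y_def)
 have dis: "disjoint_family D" unfolding D_def by (rule disjoint_family_disjointed)
 have "range Y \<subseteq> sets M" using meas[OF eI] by (auto simp: Y_def)
 hence Dm: "D n \<in> sets M" for n unfolding D_def using sets.range_disjointed_sets by blast
 have UD: "(\<Union>n. D n) = B"
 proof -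
  have "(\<Union>n. Y n) = B"
  proof
   show "B \<subseteq> (\<Union>n. Y n)"
   proof
    fix p assume p: "p \<in> B"
    then obtain i where i: "i \<in> I" "\<tau> i p \<in> A" using cover by blast
    obtain n where "e n = i" unfolding e_def using from_nat_into_surj[OF I i(1)] by blast
    hence "p \<in> Y n" using p i by (simp add: Y_def)
    thus "p \<in> (\<Union>n. Y n)" by blast
   qed
  qed (auto simp: Y_def)
  thus ?thesis unfolding D_def by (simp only: UN_disjointed_eq)
 qed
 have pr: "\<tau> (e n) ` D n \<in> sets M" "emeasure M (\<tau> (e n) ` D n) = emeasure M (D n)" for n
  using pres[OF eI Dm DB] by blast+
 have dis2: "disjoint_family (\<lambda>n. \<tau> (e n) ` D n)"
  unfolding disjoint_family_on_def
 proof (intro ballI impI)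
  fix m n :: nat assume mn: "m ~= n"
  have False if "p \<in> D m" "p' \<in> D n" "\<tau> (e m) p = \<tau> (e n) p'" for p p'
  proof -
   have "p = p'" using inj[OF _ _ eI eI _ that(3)] that DB by blast
   thus False using that(1,2) mn dis by (auto simp: disjoint_family_on_def)
  qed
  thus "\<tau> (e m) ` D m \<inter> \<tau> (e n) ` D n = {}" by blast
 qed
 have "emeasure M B = (\<Sum>n. emeasure M (D n))" unfolding UD[symmetric] using Dm dis by (intro suminf_emeasure[symmetric]) auto
 also have "\<dots> = (\<Sum>n. emeasure M (\<tau> (e n) ` D n))" by (simp only: pr(2))
 also have "\<dots> = emeasure M (\<Union>n. \<tau> (e n) ` D n)" using pr(1) dis2 by (intro suminf_emeasure) auto
 also have "\<dots> <= emeasure M A" using DB(2) AB(1) by (intro emeasure_mono) auto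
 finally show ?thesis .
qed

lemma density_indicator:
 fixes M :: "'a::topological_space measure"
 assumes M: "sets M = sets borel" and V: "V \<in> sets borel" "emeasure M V < \<infinity>"
 defines "A \<equiv> density M (indicator V)"
 shows "X \<in> sets borel ==> emeasure A X = emeasure M (V \<inter> X)" "sets A = sets borel" "emeasure A (space A) ~= \<infinity>"
proof -
 show A: "emeasure A X = emeasure M (V \<inter> X)" if "X \<in> sets borel" for X
  unfolding A_def using that V(1) M by (intro emeasure_restricted) auto
 show "sets A = sets borel" "emeasure A (space A) ~= \<infinity>"
  using A[of UNIV] V(2) sets_eq_imp_space_eq[OF M] M by (simp_all add: A_def)
qed

text \<open>Outer regularity of finite measures is applied on each \<open>V n\<close> with error
  \<open>e / 2 ^ (n + 1)\<close>; these errors add up to \<open>e\<close>.\<close>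

lemma outer_regular_cover:
 fixes M :: "'a::{second_countable_topology, complete_space} measure"
 assumes M: "sets M = sets borel" and O: "\<And>n::nat. open (V n)" "\<And>n. emeasure M (V n) < \<infinity>"
  and S: "S \<in> sets borel" "S \<subseteq> (\<Union>n. V n)" and e: "e > (0::real)"
 obtains U where "open U" "S \<subseteq> U" "U \<subseteq> (\<Union>n. V n)" "emeasure M U <= emeasure M S + ennreal e"
proof -
 have b: "X \<in> sets M \<longleftrightarrow> X \<in> sets borel" for X by (simp only: M)
 have Vb: "V n \<in> sets borel" for n using O(1) by simp
 define h where "h n = e * (1 / 2) ^ Suc n" for n
 have h0: "0 < h n" for n using e by (simp add: h_def)
 have "\<exists>U. open U \<and> V n \<inter> S \<subseteq> U \<and> U \<subseteq> V n \<and> emeasure M (U - S) <= ennreal (h n)" for n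
 proof -
  let ?A = "density M (indicator (V n))"
  note A = density_indicator[OF M Vb[of n] O(2)]
  have finS: "emeasure ?A S ~= \<infinity>" using emeasure_space[of ?A S] A(3) by (auto simp: top_unique)
  obtain w where w: "emeasure ?A S = ennreal w" "0 <= w" using finS by (cases "emeasure ?A S") auto
  have "emeasure ?A S < emeasure ?A S + ennreal (h n)"
   using w h0[of n] by (simp add: ennreal_plus[symmetric] ennreal_lessI del: ennreal_plus)
  hence "(INF U\<in>{U. S \<subseteq> U \<and> open U}. emeasure ?A U) < emeasure ?A S + ennreal (h n)"
   by (simp only: outer_regular[OF A(2,3) S(1), symmetric])
  then obtain U where U: "S \<subseteq> U" "open U" "emeasure ?A U < emeasure ?A S + ennreal (h n)" unfolding INF_less_iff by blast
  have "emeasure ?A (U - S) = emeasure ?A U - emeasure ?A S"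
   using U S finS by (intro emeasure_Diff) (auto simp: b)
  also have "\<dots> <= ennreal (h n)" using less_imp_le[OF U(3)] finS by (simp add: ennreal_minus_le_iff)
  finally have "emeasure M (V n \<inter> (U - S)) <= ennreal (h n)" using A(1)[of "U - S"] U(2) S(1) by simp
  moreover have "V n \<inter> (U - S) = V n \<inter> U - S" by blast
  ultimately show ?thesis using U O(1)[of n] by (intro exI[of _ "V n \<inter> U"]) auto
 qed
 then obtain U where U: "\<And>n. open (U n)" "\<And>n. V n \<inter> S \<subseteq> U n" "\<And>n. U n \<subseteq> V n" "\<And>n. emeasure M (U n - S) <= ennreal (h n)" by metis
 show ?thesis
 proof (rule that)
  show "open (\<Union>n. U n)" using U(1) by blast
  show SU: "S \<subseteq> (\<Union>n. U n)"
  proof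
   fix x assume x: "x \<in> S"
   then obtain n where "x \<in> V n" using S(2) by blast
   hence "x \<in> U n" using U(2)[of n] x by blast
   thus "x \<in> (\<Union>n. U n)" by blast
  qed
  show "(\<Union>n. U n) \<subseteq> (\<Union>n. V n)" using U(3) by blast
  have sb: "S \<in> sets M" "(\<Union>n. U n - S) \<in> sets M" using U(1) S(1) by (auto simp: b)
  have UU: "(\<Union>n. U n) = S \<union> (\<Union>n. U n - S)" using SU by blast
  have "emeasure M (\<Union>n. U n) <= emeasure M S + emeasure M (\<Union>n. U n - S)"
   by (subst UU) (rule emeasure_subadditive[OF sb])
  also have "emeasure M (\<Union>n. U n - S) <= (\<Sum>n. emeasure M (U n - S))"
   using U(1) S(1) by (intro emeasure_subadditive_countably) (auto simp: b)
  also have "\<dots> <= (\<Sum>n. ennreal (h n))" using U(4) by (intro suminf_le) auto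
  also have "\<dots> = ennreal (e * 1)"
   unfolding h_def using e by (intro suminf_ennreal_eq sums_mult power_half_series) auto
  finally show "emeasure M (\<Union>n. U n) <= emeasure M S + ennreal e" by simp
 qed
qed

text \<open>The increasing unions \<open>C n\<close> have finite measure, so inner regularity of
  finite measures applies to the part of \<open>S\<close> inside each of them, and these parts
  exhaust \<open>S\<close>.\<close>

lemma inner_regular_cover:
 fixes M :: "'a::{second_countable_topology, complete_space} measure"
 assumes M: "sets M = sets borel" and O: "\<And>n::nat. open (V n)" "\<And>n. emeasure M (V n) < \<infinity>"
  and S: "S \<in> sets borel" "S \<subseteq> (\<Union>n. V n)"
 shows "emeasure M S = (SUP K\<in>{K. compact K \<and> K \<subseteq> S}. emeasure M K)"
proof (rule antisym)
 have b: "X \<in> sets M \<longleftrightarrow> X \<in> sets borel" for X by (simp only: M)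
 define C where "C n = (\<Union>i\<le>n. V i)" for n
 have Cb: "C n \<in> sets borel" for n unfolding C_def using O(1) by (intro borel_open open_UN) auto
 have Cfin: "emeasure M (C n) < \<infinity>" for n
 proof -
  have "emeasure M (C n) <= (\<Sum>i\<le>n. emeasure M (V i))"
   unfolding C_def using O(1) by (intro emeasure_subadditive_finite) (auto simp: b)
  also have "\<dots> < \<infinity>" using O(2) by (induction n) (simp_all add: less_top)
  finally show ?thesis .
 qed
 have "emeasure M (S \<inter> C n) <= (SUP K\<in>{K. compact K \<and> K \<subseteq> S}. emeasure M K)" for n
 proof -
  let ?A = "density M (indicator (C n))"
  note A = density_indicator[OF M Cb[of n] Cfin]
  have "emeasure M (S \<inter> C n) = emeasure ?A S" using A(1)[OF S(1)] by (simp add: Int_commute)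
  also have "\<dots> = (SUP K\<in>{K. K \<subseteq> S \<and> compact K}. emeasure ?A K)" by (rule inner_regular[OF A(2,3) S(1)])
  also have "\<dots> <= (SUP K\<in>{K. compact K \<and> K \<subseteq> S}. emeasure M K)"
  proof (rule SUP_mono)
   fix K assume K: "K \<in> {K. K \<subseteq> S \<and> compact K}"
   hence Kb: "K \<in> sets borel" by (auto intro: borel_compact)
   have "emeasure ?A K <= emeasure M K" unfolding A(1)[OF Kb] by (rule emeasure_mono) (simp_all add: b Kb)
   thus "\<exists>m\<in>{K. compact K \<and> K \<subseteq> S}. emeasure ?A K <= emeasure M m" using K by blast
  qed
  finally show ?thesis .
 qed
 hence "(SUP n. emeasure M (S \<inter> C n)) <= (SUP K\<in>{K. compact K \<and> K \<subseteq> S}. emeasure M K)" by (rule SUP_least)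
 moreover have "(SUP n. emeasure M (S \<inter> C n)) = emeasure M (\<Union>n. S \<inter> C n)"
 proof (rule SUP_emeasure_incseq)
  show "range (\<lambda>n. S \<inter> C n) \<subseteq> sets M" using S(1) Cb by (auto simp: b)
  show "incseq (\<lambda>n. S \<inter> C n)" unfolding incseq_def C_def by (auto intro: order_trans)
 qed
 moreover have "(\<Union>n. S \<inter> C n) = S" using S(2) by (auto simp: C_def)
 ultimately show "emeasure M S <= (SUP K\<in>{K. compact K \<and> K \<subseteq> S}. emeasure M K)" by simp
 show "(SUP K\<in>{K. compact K \<and> K \<subseteq> S}. emeasure M K) <= emeasure M S"
  using S(1) by (intro SUP_least emeasure_mono) (auto simp: b)
qed

section \<open>The space of geodesics as a quotient of a strip\<close>

definition gstrip :: "(real \<times> real) set" where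
 "gstrip = {(s, t). s < t \<and> t < s + 2 * pi}"

definition gq :: "real \<times> real => complex set" where
 "gq p = geo (cis (fst p)) (cis (snd p))"

text \<open>The deck group of \<open>gq\<close> on the strip, generated by \<open>(s, t) \<mapsto> (t, s + 2 * pi)\<close>.\<close>

definition deck :: "bool \<times> int => real \<times> real => real \<times> real" where
 "deck i p = (if fst i then (snd p + 2 * pi * of_int (snd i), fst p + 2 * pi * of_int (snd i + 1))
   else (fst p + 2 * pi * of_int (snd i), snd p + 2 * pi * of_int (snd i)))"

definition gdom :: "(real \<times> real) set" where
 "gdom = {(s, t). 0 <= s \<and> s < t \<and> t < 2 * pi}"

lemma gstrip_open: "open gstrip"
proof -
 have eq: "gstrip = {p. fst p < snd p} \<inter> {p. snd p < fst p + 2 * pi}" by (auto simp: gstrip_def)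
 show ?thesis unfolding eq by (intro open_Int open_Collect_less continuous_intros)
qed

lemma cis_ne: "(s, t) \<in> gstrip ==> cis s ~= cis t"
 using cis_inj_interval[of s t] by (auto simp: gstrip_def)

lemma deck_gstrip: "p \<in> gstrip ==> deck i p \<in> gstrip"
 by (auto simp: gstrip_def deck_def algebra_simps)

lemma gq_deck: "gq (deck i p) = gq p"
proof -
 have "cis (x + 2 * pi * of_int k) = cis x" for x k unfolding cis_eq_iff by blast
 thus ?thesis unfolding gq_def deck_def by (simp del: of_int_add) (metis geo_sym)
qed

text \<open>Equal unordered pairs of endpoints leave integer shifts of the two angles; the width of
  the strip forces the shifts to agree, or to differ by one when the endpoints are
  exchanged.\<close>

lemma gq_eq_iff:
 assumes p: "p \<in> gstrip" "p' \<in> gstrip"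
 shows "gq p = gq p' \<longleftrightarrow> (\<exists>i. deck i p = p')"
proof
 obtain s t s' t' where st: "p = (s, t)" "p' = (s', t')" by (cases p; cases p')
 have l: "s < t" "t < s + 2 * pi" "s' < t'" "t' < s' + 2 * pi" using p by (auto simp: st gstrip_def)
 assume "gq p = gq p'"
 hence "{cis s, cis t} = {cis s', cis t'}"
  using geo_eq_iff[of "cis s" "cis t" "cis s'" "cis t'"] cis_ne[of s t] p by (simp add: gq_def st)
 then consider "cis s' = cis s" "cis t' = cis t" | "cis s' = cis t" "cis t' = cis s" by (auto simp: doubleton_eq_iff)
 thus "\<exists>i. deck i p = p'"
 proof cases
  case 1
  then obtain k j :: int where k: "s' = s + 2 * pi * k" "t' = t + 2 * pi * j" unfolding cis_eq_iff by blast
  have "2 * pi * real_of_int (j - k) < 2 * pi" "2 * pi * real_of_int (k - j) < 2 * pi"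
   using l unfolding k by (simp_all add: algebra_simps)
  hence "real_of_int (j - k) < 1" "real_of_int (k - j) < 1" by simp_all
  hence "j = k" by linarith
  thus ?thesis using k by (intro exI[of _ "(False, k)"]) (simp add: deck_def st)
 next
  case 2
  then obtain k j :: int where k: "s' = t + 2 * pi * k" "t' = s + 2 * pi * j" unfolding cis_eq_iff by blast
  have "2 * pi * real_of_int (j - k) = (t' - s') + (t - s)" by (simp add: k algebra_simps)
  hence "0 < 2 * pi * real_of_int (j - k)" "2 * pi * real_of_int (j - k) < 2 * pi * 2"
   using l by linarith+
  hence "0 < real_of_int (j - k)" "real_of_int (j - k) < 2" by (simp_all add: zero_less_mult_iff)
  hence "j = k + 1" by linarith
  thus ?thesis using k by (intro exI[of _ "(True, k)"]) (simp add: deck_def st)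
 qed
next
 assume "\<exists>i. deck i p = p'"
 thus "gq p = gq p'" using gq_deck by metis
qed

lemma geodesics_gq: "geodesics = gq ` gstrip"
proof (intro Set.set_eqI iffI)
 fix l assume "l \<in> geodesics"
 then obtain x y where xy: "l = geo x y" "x \<in> sphere 0 1" "y \<in> sphere 0 1" "x ~= y" unfolding geodesics_eq by blast
 obtain s t where "x = cis s" "y = cis t" "s < t" "t < s + 2 * pi" using two_points[OF xy(2-4)] by metis
 thus "l \<in> gq ` gstrip" using xy(1) by (intro image_eqI[of _ _ "(s, t)"]) (auto simp: gq_def gstrip_def)
next
 fix l assume "l \<in> gq ` gstrip"
 then obtain s t where "l = geo (cis s) (cis t)" "(s, t) \<in> gstrip" by (auto simp: gq_def)
 thus "l \<in> geodesics" unfolding geodesics_eq using cis_ne[of s t] by (intro CollectI exI[of _ "cis s"] exI[of _ "cis t"]) simp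
qed

lemma gdom_sub: "gdom \<subseteq> gstrip" by (auto simp: gdom_def gstrip_def)

lemma gdom_borel: "gdom \<in> sets borel"
proof -
 have eq: "gdom = {p. 0 <= fst p} \<inter> ({p. fst p < snd p} \<inter> {p. snd p < 2 * pi})" by (auto simp: gdom_def)
 show ?thesis unfolding eq
  by (intro sets.Int borel_closed[OF closed_Collect_le] borel_open[OF open_Collect_less] continuous_intros)
qed

lemma gdom_cover:
 assumes "p \<in> gstrip"
 shows "\<exists>i. deck i p \<in> gdom"
proof -
 obtain s t where st: "p = (s, t)" by (cases p)
 have l: "s < t" "t < s + 2 * pi" using assms by (auto simp: st gstrip_def)
 define k where "k = \<lfloor>s / (2 * pi)\<rfloor>"
 have "of_int k <= s / (2 * pi)" "s / (2 * pi) < of_int k + 1" by (auto simp: k_def)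
 hence k: "2 * pi * of_int k <= s" "s < 2 * pi * of_int k + 2 * pi" by (simp_all add: field_simps)
 show ?thesis
 proof (cases "t < 2 * pi * of_int k + 2 * pi")
  case True
  thus ?thesis using k l by (intro exI[of _ "(False, - k)"]) (simp add: deck_def gdom_def st)
 next
  case False
  thus ?thesis using k l by (intro exI[of _ "(True, - k - 1)"]) (simp add: deck_def gdom_def st algebra_simps)
 qed
qed

lemma gdom_inj: "inj_on gq gdom"
proof (rule inj_onI)
 fix p p' assume p: "p \<in> gdom" "p' \<in> gdom" "gq p = gq p'"
 then obtain b k where i: "deck (b, k) p = p'" using gq_eq_iff[of p p'] gdom_sub by auto
 obtain s t s' t' where st: "p = (s, t)" "p' = (s', t')" by (cases p; cases p')
 have l: "0 <= s" "s < t" "t < 2 * pi" "0 <= s'" "s' < t'" "t' < 2 * pi" using p by (auto simp: st gdom_def)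
 show "p = p'"
 proof (cases b)
  case True
  hence e: "s' = t + 2 * pi * k" "t' = s + 2 * pi * (real_of_int k + 1)" using i by (auto simp: deck_def st)
  have "2 * pi * (- 1) < 2 * pi * real_of_int k" "2 * pi * (real_of_int k + 1) < 2 * pi * 1" using e l by linarith+
  hence "- 1 < real_of_int k" "real_of_int k + 1 < 1" by (simp_all only: mult_less_cancel_left_pos[of "2 * pi", OF mult_pos_pos[OF zero_less_numeral pi_gt_zero]])
  hence "0 <= k" "k < 0" by linarith+
  thus ?thesis by simp
 next
  case False
  hence e: "s' = s + 2 * pi * k" "t' = t + 2 * pi * k" using i by (auto simp: deck_def st)
  have "2 * pi * (- 1) < 2 * pi * real_of_int k" "2 * pi * real_of_int k < 2 * pi * 1" using e l by linarith+
  hence "- 1 < real_of_int k" "real_of_int k < 1" by (simp_all only: mult_less_cancel_left_pos[of "2 * pi", OF mult_pos_pos[OF zero_less_numeral pi_gt_zero]])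
  hence "k = 0" by linarith
  thus ?thesis using e by (simp add: st)
 qed
qed

definition gpre :: "complex set set => (real \<times> real) set" where
 "gpre B = {p \<in> gstrip. gq p \<in> B}"

text \<open>\<open>axis_su\<close> is a continuous section of \<open>geodesic_of\<close> over the
  strip, which makes \<open>gq\<close> continuous for the quotient topology.\<close>

lemma open_gpre:
 assumes "openin geodesic_space U"
 shows "open (gpre U)"
proof -
 have "openin (top_of_set SU11) {p \<in> SU11. geodesic_of p \<in> U}" using assms by (simp only: openin_geodesic_space)
 then obtain T where T: "open T" "{p \<in> SU11. geodesic_of p \<in> U} = SU11 \<inter> T" by (auto simp: openin_open)
 have ax: "axis_su (fst p) (snd p) \<in> SU11" "geodesic_of (axis_su (fst p) (snd p)) = gq p" "sin ((snd p - fst p) / 2) ~= 0" if "p \<in> gstrip" for p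
 proof -
  have st: "fst p < snd p" "snd p < fst p + 2 * pi" using that by (auto simp: gstrip_def)
  show a: "axis_su (fst p) (snd p) \<in> SU11" "sin ((snd p - fst p) / 2) ~= 0" using axis_su(1,6)[OF st] by auto
  show "geodesic_of (axis_su (fst p) (snd p)) = gq p" using geodesic_of_eq[OF a(1)] axis_su(2,3)[OF st] by (simp add: gq_def)
 qed
 have "continuous_on gstrip (\<lambda>p. axis_su (fst p) (snd p))"
  unfolding axis_su_def using ax(3) by (intro continuous_intros) auto
 hence "open (gstrip \<inter> (\<lambda>p. axis_su (fst p) (snd p)) -` T)"
  using gstrip_open T(1) continuous_on_open_vimage by (metis Int_commute)
 moreover have "gstrip \<inter> (\<lambda>p. axis_su (fst p) (snd p)) -` T = gpre U"
 proof -
  have "axis_su (fst p) (snd p) \<in> T \<longleftrightarrow> gq p \<in> U" if "p \<in> gstrip" for p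
   using ax[OF that] T(2) by (metis (mono_tags, lifting) Int_iff mem_Collect_eq)
  thus ?thesis unfolding gpre_def by (intro Set.set_eqI) (simp only: Int_iff vimage_eq mem_Collect_eq, blast)
 qed
 ultimately show ?thesis by simp
qed

lemma close_on_circle:
 assumes z: "z \<in> sphere 0 1" and e: "0 < e" "e < pi" and c: "cos e < Re (z * cis (- s))"
 obtains u where "z = cis u" "\<bar>u - s\<bar> < e"
proof -
 obtain v where v: "z = cis v" using sphere_cis z by blast
 obtain u where u: "cis v = cis u" "s - pi <= u" "u < (s - pi) + 2 * pi" by (rule circle_param)
 have "cos e < cos \<bar>u - s\<bar>" using c unfolding v u(1) by (simp add: cis_mult)
 hence "\<bar>u - s\<bar> < e" using cos_mono_less_eq[of e "\<bar>u - s\<bar>"] e u(2,3) by auto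
 thus ?thesis using that v u(1) by simp
qed

text \<open>The endpoints of \<open>geodesic_of p\<close> depend continuously on \<open>p\<close>,
  so isometries near \<open>p1\<close> have geodesics with endpoints near the given ones. There are
  two cases because \<open>p1\<close> may carry 1 to either endpoint.\<close>

lemma open_gq:
 assumes O: "open V" "V \<subseteq> gstrip"
 shows "openin geodesic_space (gq ` V)"
 unfolding openin_geodesic_space
proof
 show "gq ` V \<subseteq> geodesics" using O(2) unfolding geodesics_gq by blast
 let ?S = "{p \<in> SU11. geodesic_of p \<in> gq ` V}"
 define N where "N s t e = {p \<in> SU11. cos e < Re (mob p 1 * cis (- s))} \<inter> {p \<in> SU11. cos e < Re (mob p (- 1) * cis (- t))}" for s t e
 have cont: "continuous_on SU11 (\<lambda>p. mob p x)" if "cmod x = 1" for x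
 proof -
  have eq: "(\<lambda>p. mob p x) = (\<lambda>p. (fst p * x + snd p) / (cnj (snd p) * x + cnj (fst p)))" by (simp add: mob_def case_prod_beta fun_eq_iff)
  show ?thesis unfolding eq
   using denom_nonzero[of _ _ x] that by (intro continuous_intros) (auto simp: prod_eq_iff)
 qed
 have half: "openin (top_of_set SU11) {p \<in> SU11. cos e < Re (mob p x * c)}" if "cmod x = 1" for x c e
 proof -
  have "continuous_on SU11 (\<lambda>p. Re (mob p x * c))" by (intro continuous_intros cont that)
  hence "openin (top_of_set SU11) (SU11 \<inter> (\<lambda>p. Re (mob p x * c)) -` {cos e<..})"
   by (rule continuous_openin_preimage_gen) simp
  moreover have "SU11 \<inter> (\<lambda>p. Re (mob p x * c)) -` {cos e<..} = {p \<in> SU11. cos e < Re (mob p x * c)}" by auto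
  ultimately show ?thesis by simp
 qed
 have Nopen: "openin (top_of_set SU11) (N s t e)" for s t e
  unfolding N_def by (intro openin_Int half) auto
 have "\<exists>T. openin (top_of_set SU11) T \<and> p1 \<in> T \<and> T \<subseteq> ?S" if p1: "p1 \<in> ?S" for p1
 proof -
  have su: "p1 \<in> SU11" using p1 by simp
  have "geodesic_of p1 \<in> gq ` V" using p1 by simp
  then obtain s t where st: "(s, t) \<in> V" "geodesic_of p1 = gq (s, t)" by (elim imageE) (metis surj_pair)
  obtain d where d: "d > 0" "ball (s, t) d \<subseteq> V" using O(1) st(1) open_contains_ball by blast
  define e where "e = min (d / 2) (pi / 2)"
  have e: "0 < e" "e < pi" "e <= d / 2" using d(1) pi_gt_zero by (auto simp: e_def min_def)
  have inV: "(s', t') \<in> V" if "\<bar>s' - s\<bar> < e" "\<bar>t' - t\<bar> < e" for s' t'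
  proof -
   have "dist (s, t) (s', t') <= dist s s' + dist t t'"
    unfolding dist_Pair_Pair by (rule sqrt_sum_squares_le_sum) simp_all
   also have "\<dots> < d" using that e(3) by (simp add: dist_real_def abs_minus_commute)
   finally show ?thesis using d(2) by auto
  qed
  have ce: "cos e < 1" using e cos_monotone_0_pi[of 0 e] by simp
  have sph: "mob p 1 \<in> sphere 0 1" "mob p (- 1) \<in> sphere 0 1" if "p \<in> SU11" for p using mob_sphere[OF that] by simp_all
  have ne: "mob p1 1 ~= mob p1 (- 1)" using inj_onD[OF mob_inj[OF su], of 1 "- 1"] by auto
  have eq: "{mob p1 1, mob p1 (- 1)} = {cis s, cis t}"
   using st(2) geodesic_of_eq[OF su] geo_eq_iff[OF sph[OF su] ne, of "cis s" "cis t"] by (simp add: gq_def)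
  have near: "N a b e \<subseteq> ?S" if V: "\<And>u v. \<bar>u - a\<bar> < e ==> \<bar>v - b\<bar> < e ==> gq (u, v) \<in> gq ` V" for a b
  proof
   fix p assume p: "p \<in> N a b e"
   hence ps: "p \<in> SU11" by (simp add: N_def)
   obtain u where u: "mob p 1 = cis u" "\<bar>u - a\<bar> < e" using close_on_circle[OF sph(1)[OF ps] e(1,2), of a] p by (auto simp: N_def)
   obtain v where v: "mob p (- 1) = cis v" "\<bar>v - b\<bar> < e" using close_on_circle[OF sph(2)[OF ps] e(1,2), of b] p by (auto simp: N_def)
   have "geodesic_of p = gq (u, v)" using geodesic_of_eq[OF ps] u v by (simp add: gq_def)
   thus "p \<in> ?S" using ps V[OF u(2) v(2)] by simp
  qed
  have g: "gq (u, v) \<in> gq ` V" if "\<bar>u - s\<bar> < e" "\<bar>v - t\<bar> < e" for u v by (rule imageI[OF inV[OF that]])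
  have g': "gq (u, v) \<in> gq ` V" if "\<bar>u - t\<bar> < e" "\<bar>v - s\<bar> < e" for u v
   using g[OF that(2,1)] by (simp add: gq_def geo_sym)
  consider "mob p1 1 = cis s" "mob p1 (- 1) = cis t" | "mob p1 1 = cis t" "mob p1 (- 1) = cis s" using eq unfolding doubleton_eq_iff by blast
  thus ?thesis
  proof cases
   case 1
   hence "p1 \<in> N s t e" using su ce by (simp add: N_def cis_mult)
   thus ?thesis using Nopen[of s t e] near[of s t, OF g] by (intro exI[of _ "N s t e"] conjI)
  next
   case 2
   hence "p1 \<in> N t s e" using su ce by (simp add: N_def cis_mult)
   thus ?thesis using Nopen[of t s e] near[of t s, OF g'] by (intro exI[of _ "N t s e"] conjI)
  qed
 qed
 thus "openin (top_of_set SU11) ?S" by (subst openin_subopen) blast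
qed

lemma geodesic_borel: "space geodesic_borel = geodesics" "openin geodesic_space U ==> U \<in> sets geodesic_borel"
proof -
 have sub: "{U. openin geodesic_space U} \<subseteq> Pow geodesics" using openin_subset topspace_geodesic_space by blast
 show "space geodesic_borel = geodesics" unfolding geodesic_borel_def by (rule space_measure_of[OF sub])
 show "openin geodesic_space U ==> U \<in> sets geodesic_borel" unfolding geodesic_borel_def sets_measure_of[OF sub] by auto
qed

lemma measurable_into_geodesics:
 assumes "\<And>x. x \<in> space M ==> f x \<in> geodesics" "\<And>U. openin geodesic_space U ==> f -` U \<inter> space M \<in> sets M"
 shows "f \<in> measurable M geodesic_borel"
 unfolding geodesic_borel_def
proof (rule measurable_measure_of)
 show "{U. openin geodesic_space U} \<subseteq> Pow geodesics" using openin_subset topspace_geodesic_space by blast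
qed (use assms in auto)

lemma gq_measurable: "gq \<in> measurable (restrict_space borel gstrip) geodesic_borel"
proof (rule measurable_into_geodesics)
 fix U assume "openin geodesic_space U"
 hence "gpre U \<in> sets borel" by (intro borel_open open_gpre)
 moreover have "gq -` U \<inter> space (restrict_space borel gstrip) = gpre U" by (auto simp: gpre_def space_restrict_space)
 ultimately show "gq -` U \<inter> space (restrict_space borel gstrip) \<in> sets (restrict_space borel gstrip)"
  using gstrip_open by (subst sets_restrict_space_iff) (simp_all add: gpre_def)
qed (auto simp: space_restrict_space geodesics_gq)

lemma gpre_borel:
 assumes "B \<in> sets geodesic_borel"
 shows "gpre B \<in> sets borel"
proof -
 have "gq -` B \<inter> space (restrict_space borel gstrip) \<in> sets (restrict_space borel gstrip)"
  using gq_measurable assms by (rule measurable_sets)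
 moreover have "gq -` B \<inter> space (restrict_space borel gstrip) = gpre B" by (auto simp: gpre_def space_restrict_space)
 ultimately show ?thesis using gstrip_open by (auto simp: sets_restrict_space_iff)
qed

section \<open>The current of an invariant measure\<close>

text \<open>Sum and product determine an unordered pair. They form a continuous map that separates
  geodesics, and this shows below that images of compact sets have open complements.\<close>

lemma gq_sep_iff:
 assumes p: "p \<in> gstrip"
 shows "gq p = gq p' \<longleftrightarrow> (cis (fst p) + cis (snd p), cis (fst p) * cis (snd p)) = (cis (fst p') + cis (snd p'), cis (fst p') * cis (snd p'))"
proof -
 have "gq p = gq p' \<longleftrightarrow> {cis (fst p), cis (snd p)} = {cis (fst p'), cis (snd p')}"
  using geo_eq_iff[of "cis (fst p)" "cis (snd p)" "cis (fst p')" "cis (snd p')"] cis_ne[of "fst p" "snd p"] p by (simp add: gq_def)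
 moreover have "{x, y} = {x', y'} \<longleftrightarrow> x + y = x' + y' \<and> x * y = x' * y'" for x y x' y' :: complex
 proof
  assume s: "x + y = x' + y' \<and> x * y = x' * y'"
  have "(x' - x) * (x' - y) = x' * x' - (x + y) * x' + x * y" by (simp add: algebra_simps)
  also have "\<dots> = 0" using s by (simp add: algebra_simps)
  finally have "x' = x \<or> x' = y" by simp
  thus "{x, y} = {x', y'}" using s by (auto simp: add.commute)
 qed (auto simp: doubleton_eq_iff)
 ultimately show ?thesis by simp
qed

lemma gq_compact:
 assumes K: "compact K" "K \<subseteq> gstrip"
 shows "gq ` K \<in> sets geodesic_borel" "compactin geodesic_space (gq ` K)"
proof -
 define e where "e p = (cis (fst p) + cis (snd p), cis (fst p) * cis (snd p))" for p :: "real \<times> real"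
 have ce: "continuous_on UNIV e" unfolding e_def by (intro continuous_intros)
 have "compact (e ` K)" by (rule compact_continuous_image[OF continuous_on_subset[OF ce] K(1)]) simp
 hence "open (- (e ` K))" by (simp add: compact_imp_closed open_Compl)
 hence "open (e -` (- (e ` K)))" using ce by (rule open_vimage)
 hence V: "open (gstrip \<inter> e -` (- (e ` K)))" using gstrip_open by (intro open_Int)
 have iff: "gq p \<in> gq ` K \<longleftrightarrow> e p \<in> e ` K" if "p \<in> gstrip" for p
  using gq_sep_iff[OF that] K(2) by (auto simp: image_iff e_def)
 have "gq ` K = geodesics - gq ` (gstrip \<inter> e -` (- (e ` K)))"
  unfolding geodesics_gq using iff K(2) by blast
 moreover have "geodesics - gq ` (gstrip \<inter> e -` (- (e ` K))) \<in> sets geodesic_borel"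
  using sets.compl_sets[OF geodesic_borel(2)[OF open_gq[OF V]]] geodesic_borel(1) by simp
 ultimately show "gq ` K \<in> sets geodesic_borel" by (simp only:)
 have "continuous_map (top_of_set gstrip) geodesic_space gq"
  unfolding continuous_map_def
 proof (intro conjI allI impI)
  show "gq \<in> topspace (top_of_set gstrip) \<rightarrow> topspace geodesic_space" unfolding topspace_geodesic_space geodesics_gq by auto
  fix U assume "openin geodesic_space U"
  hence "open (gpre U)" by (rule open_gpre)
  moreover have "{x \<in> topspace (top_of_set gstrip). gq x \<in> U} = gpre U" by (simp add: gpre_def)
  ultimately show "openin (top_of_set gstrip) {x \<in> topspace (top_of_set gstrip). gq x \<in> U}"
   by (simp add: openin_open_eq[OF gstrip_open] gpre_def)
 qed
 moreover have "compactin (top_of_set gstrip) K" using K by (simp add: compactin_subtopology)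
 ultimately show "compactin geodesic_space (gq ` K)" by (rule image_compactin[rotated])
qed

text \<open>Lindelof's theorem supplies the countable cover by open sets on which the regularity
  lemmas rest; the compact rectangles around them guarantee finite mass.\<close>

lemma gstrip_cover:
 "\<exists>V :: nat => (real \<times> real) set. (\<forall>n. open (V n)) \<and> gstrip = (\<Union>n. V n) \<and>
  (\<forall>n. \<exists>q1 q2 p1 p2. q1 <= q2 \<and> q2 < p1 \<and> p1 <= p2 \<and> p2 < q1 + 2 * pi \<and> V n \<subseteq> crect q1 q2 p1 p2)"
proof -
 define \<F> where "\<F> = {orect q1 q2 p1 p2 | q1 q2 p1 p2. q1 <= q2 \<and> q2 < p1 \<and> p1 <= p2 \<and> p2 < q1 + 2 * pi}"
 have F: "open S" "\<exists>q1 q2 p1 p2. q1 <= q2 \<and> q2 < p1 \<and> p1 <= p2 \<and> p2 < q1 + 2 * pi \<and> S \<subseteq> crect q1 q2 p1 p2" if S: "S \<in> \<F>" for S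
 proof -
  obtain q1 q2 p1 p2 where q: "S = orect q1 q2 p1 p2" "q1 <= q2" "q2 < p1" "p1 <= p2" "p2 < q1 + 2 * pi" using S unfolding \<F>_def by blast
  have "orect q1 q2 p1 p2 \<subseteq> crect q1 q2 p1 p2" by (auto simp: orect_def crect_def)
  thus "open S" "\<exists>q1 q2 p1 p2. q1 <= q2 \<and> q2 < p1 \<and> p1 <= p2 \<and> p2 < q1 + 2 * pi \<and> S \<subseteq> crect q1 q2 p1 p2"
   using q by (simp, blast)
 qed
 have U: "\<Union>\<F> = gstrip"
 proof
  show "\<Union>\<F> \<subseteq> gstrip" by (auto simp: \<F>_def orect_def gstrip_def)
  show "gstrip \<subseteq> \<Union>\<F>"
  proof
   fix p assume "p \<in> gstrip"
   then obtain s t where st: "p = (s, t)" "s < t" "t < s + 2 * pi" by (auto simp: gstrip_def)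
   define e where "e = min (t - s) (s + 2 * pi - t) / 4"
   have e: "0 < e" "4 * e <= t - s" "4 * e <= s + 2 * pi - t" using st by (auto simp: e_def)
   have "s - e <= s + e" "s + e < t - e" "t - e <= t + e" "t + e < s - e + 2 * pi" using e by linarith+
   hence "orect (s - e) (s + e) (t - e) (t + e) \<in> \<F>" unfolding \<F>_def by blast
   moreover have "p \<in> orect (s - e) (s + e) (t - e) (t + e)" using e st by (auto simp: orect_def gstrip_def)
   ultimately show "p \<in> \<Union>\<F>" by blast
  qed
 qed
 obtain \<G> where G: "\<G> \<subseteq> \<F>" "countable \<G>" "\<Union>\<G> = \<Union>\<F>" using Lindelof[of \<F>] F(1) by blast
 have "(0, 1) \<in> gstrip" using pi_gt3 by (simp add: gstrip_def)
 hence ne: "\<G> ~= {}" using G(3) U by auto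
 define V where "V = from_nat_into \<G>"
 have "V n \<in> \<F>" for n using from_nat_into[OF ne] G(1) by (auto simp: V_def)
 moreover have "gstrip = (\<Union>n. V n)" using range_from_nat_into[OF ne G(2)] G(3) U by (simp add: V_def)
 ultimately show ?thesis using F by (intro exI[of _ V]) simp
qed

text \<open>\<nu> is the lift of a current to the strip: invariance under the exchange of endpoints
  lets it descend to geodesics, invariance under all lifts of group elements makes the result
  \<Gamma>-invariant.\<close>

locale current_data = surface \<Gamma> for \<Gamma> +
 fixes \<nu> :: "(real \<times> real) measure"
 assumes sets_nu: "sets \<nu> = sets borel"
  and finite_nu: "q1 <= q2 ==> q2 < p1 ==> p1 <= p2 ==> p2 < q1 + 2 * pi ==> emeasure \<nu> (crect q1 q2 p1 p2) < \<infinity>"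
  and swap_nu: "S \<in> sets borel ==> S \<subseteq> gstrip ==> emeasure \<nu> {p. (snd p, fst p + 2 * pi) \<in> S} = emeasure \<nu> S"
  and inv_nu: "f \<in> \<Gamma> ==> is_lift f F ==> S \<in> sets borel ==> S \<subseteq> gstrip ==>
   emeasure \<nu> {p. (F (fst p), F (snd p)) \<in> S} = emeasure \<nu> S"
begin

lemma borel_preimage:
 fixes g :: "real \<times> real => real \<times> real"
 assumes "continuous_on UNIV g" "S \<in> sets borel"
 shows "{p. g p \<in> S} \<in> sets borel"
 using measurable_sets[OF borel_measurable_continuous_onI[OF assms(1)] assms(2)] by (simp add: vimage_def)

lemma lift_pair_continuous: "is_lift f F ==> continuous_on UNIV (\<lambda>p::real \<times> real. (F (fst p), F (snd p)))"
proof -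
 assume "is_lift f F"
 hence c: "continuous_on UNIV F" by (simp add: is_lift_def)
 show ?thesis
  by (intro continuous_on_Pair continuous_on_compose2[OF c continuous_on_fst[OF continuous_on_id]]
   continuous_on_compose2[OF c continuous_on_snd[OF continuous_on_id]]) simp_all
qed

text \<open>A deck transformation is a translation by a multiple of \<open>2 * pi\<close>, that is,
  a lift of the identity of \<Gamma>, possibly combined with the swap; \<nu> is invariant under
  both.\<close>

lemma deck_nu:
 assumes S: "S \<in> sets borel" "S \<subseteq> gstrip"
 shows "deck i ` S \<in> sets borel \<and> emeasure \<nu> (deck i ` S) = emeasure \<nu> S"
proof -
 obtain b k where i: "i = (b, k)" by (cases i)
 \<comment> \<open>The index of the inverse: two swaps compose to a translation by
   \<open>2 * pi\<close>, hence the extra \<open>- 1\<close>.\<close>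
 define l where "l = (if b then - k - 1 else - k)"
 have inv: "deck i (deck (b, l) p) = p" "deck (b, l) (deck i p) = p" for p
  by (auto simp: i l_def deck_def prod_eq_iff algebra_simps)
 define T where "T = {p. (fst p + 2 * pi * of_int l, snd p + 2 * pi * of_int l) \<in> S}"
 have Tb: "T \<in> sets borel" unfolding T_def by (rule borel_preimage[OF _ S(1)]) (intro continuous_intros)
 have Ts: "T \<subseteq> gstrip" using S(2) by (auto simp: T_def gstrip_def)
 have "is_lift one\<Gamma> (\<lambda>x. x)" by (auto simp: is_lift_def one_apply strict_mono_def)
 from inv_nu[OF one_in is_lift_shift[OF this, of l] S]
 have nuT: "emeasure \<nu> T = emeasure \<nu> S" by (simp add: T_def)
 have "{p. (snd p, fst p + 2 * pi) \<in> T} \<in> sets borel" by (rule borel_preimage[OF _ Tb]) (intro continuous_intros)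
 moreover have "deck i ` S = {p. deck (b, l) p \<in> S}"
  by (auto simp: inv) (metis imageI inv(1))
 moreover have "\<dots> = (if b then {p. (snd p, fst p + 2 * pi) \<in> T} else T)"
  by (simp add: deck_def T_def algebra_simps)
 ultimately show ?thesis using Tb nuT swap_nu[OF Tb Ts] by simp
qed

lemma deck_continuous: "continuous_on UNIV (deck i)"
 by (cases "fst i") (auto simp: deck_def intro!: continuous_intros)

lemma gpre_image_borel:
 assumes "R \<in> sets borel" "R \<subseteq> gstrip"
 shows "gpre (gq ` R) \<in> sets borel"
proof -
 have "gpre (gq ` R) = (\<Union>i. deck i ` R)"
 proof (intro Set.set_eqI iffI)
  fix p assume "p \<in> gpre (gq ` R)"
  then obtain u where u: "p \<in> gstrip" "u \<in> R" "gq u = gq p" by (auto simp: gpre_def)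
  then obtain i where "deck i u = p" using gq_eq_iff[of u p] assms(2) by blast
  thus "p \<in> (\<Union>i. deck i ` R)" using u(2) by blast
 next
  fix p assume "p \<in> (\<Union>i. deck i ` R)"
  then obtain i u where u: "u \<in> R" "p = deck i u" by blast
  thus "p \<in> gpre (gq ` R)" using assms(2) deck_gstrip[of u i] gq_deck[of i u] by (auto simp: gpre_def)
 qed
 moreover have "(\<Union>i. deck i ` R) \<in> sets borel" using deck_nu[OF assms] by (intro sets.countable_UN') auto
 ultimately show ?thesis by simp
qed

lemma nu_le:
 assumes R: "R \<in> sets borel" "R \<subseteq> gstrip" "inj_on gq R" and S: "S \<in> sets borel" "S \<subseteq> gstrip" "gq ` R \<subseteq> gq ` S"
 shows "emeasure \<nu> R <= emeasure \<nu> S"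
proof (rule transport_le[of _ _ _ "UNIV :: (bool \<times> int) set" deck])
 show "S \<in> sets \<nu>" "R \<in> sets \<nu>" using R S by (simp_all add: sets_nu)
 fix i
 have "{p \<in> R. deck i p \<in> S} = R \<inter> {p. deck i p \<in> S}" by blast
 thus "{p \<in> R. deck i p \<in> S} \<in> sets \<nu>"
  using R(1) borel_preimage[OF deck_continuous S(1)] by (simp add: sets_nu sets.Int)
next
 fix i T assume "T \<in> sets \<nu>" "T \<subseteq> R"
 thus "deck i ` T \<in> sets \<nu> \<and> emeasure \<nu> (deck i ` T) = emeasure \<nu> T" using deck_nu[of T i] R(2) by (auto simp: sets_nu)
next
 fix p assume p: "p \<in> R"
 then obtain u where "u \<in> S" "gq p = gq u" using S(3) by blast
 thus "\<exists>i\<in>UNIV. deck i p \<in> S" using gq_eq_iff[of p u] p R(2) S(2) by (metis UNIV_I subsetD)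
next
 fix p p' i j assume "p \<in> R" "p' \<in> R" "deck i p = deck j p'"
 thus "p = p'" using gq_deck[of i p] gq_deck[of j p'] inj_onD[OF R(3), of p p'] by simp
qed auto

lemma gq_gdom: "A \<subseteq> geodesics ==> gq ` (gdom \<inter> gpre A) = A"
proof
 assume A: "A \<subseteq> geodesics"
 show "A \<subseteq> gq ` (gdom \<inter> gpre A)"
 proof
  fix l assume l: "l \<in> A"
  then obtain p where p: "p \<in> gstrip" "l = gq p" using A unfolding geodesics_gq by blast
  obtain i where "deck i p \<in> gdom" using gdom_cover[OF p(1)] by blast
  hence "deck i p \<in> gdom \<inter> gpre A" using l p deck_gstrip[OF p(1)] by (simp add: gpre_def gq_deck)
  thus "l \<in> gq ` (gdom \<inter> gpre A)" using p(2) gq_deck[of i p] by (metis imageI)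
 qed
qed (auto simp: gpre_def)

text \<open>A Borel set on which \<open>gq\<close> is injective measures its image as correctly as
  the fundamental domain does; without injectivity it can only overcount.\<close>

lemma nu_quotient:
 assumes R: "R \<in> sets borel" "R \<subseteq> gstrip"
 shows nu_outer: "emeasure \<nu> (gdom \<inter> gpre (gq ` R)) <= emeasure \<nu> R"
  and "inj_on gq R ==> emeasure \<nu> (gdom \<inter> gpre (gq ` R)) = emeasure \<nu> R"
proof -
 let ?Q = "gdom \<inter> gpre (gq ` R)"
 have Q: "?Q \<in> sets borel" "?Q \<subseteq> gstrip" using gdom_borel gpre_image_borel[OF R] gdom_sub by auto
 have e: "gq ` ?Q = gq ` R" by (rule gq_gdom) (use R(2) in \<open>auto simp: geodesics_gq\<close>)
 show le: "emeasure \<nu> ?Q <= emeasure \<nu> R" using Q R e inj_on_subset[OF gdom_inj] by (intro nu_le) auto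
 show "emeasure \<nu> ?Q = emeasure \<nu> R" if "inj_on gq R" using nu_le[OF R that Q] e le by simp
qed

definition gcur :: "complex set measure" where
 "gcur = distr (restrict_space \<nu> gdom) geodesic_borel gq"

lemma gcur: "sets gcur = sets geodesic_borel" "space gcur = geodesics"
 "B \<in> sets geodesic_borel ==> emeasure gcur B = emeasure \<nu> (gdom \<inter> gpre B)"
proof -
 show "sets gcur = sets geodesic_borel" "space gcur = geodesics" by (simp_all add: gcur_def geodesic_borel(1))
 have gd: "gdom \<inter> space \<nu> \<in> sets \<nu>" using gdom_borel sets_eq_imp_space_eq[OF sets_nu] by (simp add: sets_nu)
 have pre: "gq -` B \<inter> space (restrict_space \<nu> gdom) = gdom \<inter> gpre B" for B
  using gdom_sub sets_eq_imp_space_eq[OF sets_nu] by (auto simp: gpre_def space_restrict_space)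
 have m: "gq \<in> measurable (restrict_space \<nu> gdom) geodesic_borel"
 proof (rule measurable_into_geodesics)
  fix U assume "openin geodesic_space U"
  hence "gdom \<inter> gpre U \<in> sets \<nu>" using gdom_borel borel_open[OF open_gpre] by (simp add: sets_nu sets.Int)
  thus "gq -` U \<inter> space (restrict_space \<nu> gdom) \<in> sets (restrict_space \<nu> gdom)"
   unfolding pre using gd by (simp add: sets_restrict_space_iff)
 qed (use gdom_sub in \<open>auto simp: space_restrict_space geodesics_gq\<close>)
 assume B: "B \<in> sets geodesic_borel"
 have "emeasure gcur B = emeasure (restrict_space \<nu> gdom) (gdom \<inter> gpre B)"
  unfolding gcur_def using emeasure_distr[OF m B] pre by simp
 also have "\<dots> = emeasure \<nu> (gdom \<inter> gpre B)" using gd by (intro emeasure_restrict_space) auto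
 finally show "emeasure gcur B = emeasure \<nu> (gdom \<inter> gpre B)" .
qed

lemma gq_lift: "f \<in> \<Gamma> ==> is_lift f F ==> gq (F (fst p), F (snd p)) = f ` gq p"
 using action_geo[of f "cis (fst p)" "cis (snd p)"] by (simp add: gq_def is_lift_def)

lemma lift_gstrip: "is_lift f F ==> (F (fst p), F (snd p)) \<in> gstrip \<longleftrightarrow> p \<in> gstrip"
proof -
 assume F: "is_lift f F"
 have sm: "strict_mono F" and per: "F (x + 2 * pi) = F x + 2 * pi" for x using F by (simp_all add: is_lift_def)
 have "F (fst p) < F (snd p) \<longleftrightarrow> fst p < snd p" "F (snd p) < F (fst p) + 2 * pi \<longleftrightarrow> snd p < fst p + 2 * pi"
  unfolding per[symmetric] by (simp_all add: strict_mono_less[OF sm])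
 thus ?thesis by (simp add: gstrip_def case_prod_beta)
qed

lemma action_bij:
 assumes f: "f \<in> \<Gamma>" and l: "l \<in> geodesics"
 shows "f ` inv\<Gamma> f ` l = l" "inv\<Gamma> f ` f ` l = l" "f ` l \<in> geodesics"
proof -
 have sub: "l \<subseteq> cball 0 1" using l unfolding geodesics_eq by (auto simp: geo_def)
 show "f ` inv\<Gamma> f ` l = l" "inv\<Gamma> f ` f ` l = l"
  unfolding image_image using inv_apply[OF f] sub by (simp_all add: subset_iff)
 obtain p where p: "p \<in> gstrip" "l = gq p" using l unfolding geodesics_gq by blast
 obtain F where F: "is_lift f F" using ex_lift[OF f] by blast
 show "f ` l \<in> geodesics" unfolding geodesics_gq p(2) gq_lift[OF f F, symmetric] using lift_gstrip[OF F] p(1) by (intro imageI) simp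
qed

lemma action_measurable:
 assumes f: "f \<in> \<Gamma>"
 shows "(`) f \<in> measurable geodesic_borel geodesic_borel"
proof (rule measurable_into_geodesics)
 fix U assume U: "openin geodesic_space U"
 obtain F where F: "is_lift f F" using ex_lift[OF f] by blast
 define V where "V = {p. (F (fst p), F (snd p)) \<in> gpre U}"
 have "open V" unfolding V_def using open_vimage[OF open_gpre[OF U] lift_pair_continuous[OF F]] by (simp add: vimage_def)
 moreover have Vs: "V \<subseteq> gstrip" unfolding V_def gpre_def using lift_gstrip[OF F] by auto
 ultimately have "openin geodesic_space (gq ` V)" by (rule open_gq)
 moreover have "(`) f -` U \<inter> space geodesic_borel = gq ` V"
 proof -
  have "f ` gq p \<in> U \<longleftrightarrow> p \<in> V" if "p \<in> gstrip" for p
   using gq_lift[OF f F, of p] lift_gstrip[OF F, of p] that by (simp add: V_def gpre_def)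
  thus ?thesis using Vs unfolding geodesic_borel(1) geodesics_gq by blast
 qed
 ultimately show "(`) f -` U \<inter> space geodesic_borel \<in> sets geodesic_borel" by (simp add: geodesic_borel(2))
qed (use action_bij[OF f] geodesic_borel(1) in auto)

lemma action_sets:
 assumes f: "f \<in> \<Gamma>" and B: "B \<in> sets geodesic_borel"
 shows "(`) f ` B \<in> sets geodesic_borel"
proof -
 have Bs: "B \<subseteq> geodesics" using sets.sets_into_space[OF B] geodesic_borel(1) by simp
 have "(`) f ` B = (`) (inv\<Gamma> f) -` B \<inter> space geodesic_borel"
 proof (intro Set.set_eqI iffI)
  fix l assume "l \<in> (`) (inv\<Gamma> f) -` B \<inter> space geodesic_borel"
  hence "inv\<Gamma> f ` l \<in> B" "l = f ` inv\<Gamma> f ` l" using action_bij(1)[OF f, of l] geodesic_borel(1) by auto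
  thus "l \<in> (`) f ` B" by (metis imageI)
 next
  fix l assume "l \<in> (`) f ` B"
  then obtain m where m: "m \<in> B" "l = f ` m" by blast
  thus "l \<in> (`) (inv\<Gamma> f) -` B \<inter> space geodesic_borel"
   using action_bij(2,3)[OF f, of m] Bs geodesic_borel(1) by auto
 qed
 thus ?thesis using measurable_sets[OF action_measurable[OF inv_in[OF f]] B] by simp
qed

text \<open>The preimage \<open>R\<close> of a fundamental piece for \<open>B\<close> under a lift
  of the inverse of \<open>f\<close> represents the image of \<open>B\<close> injectively. \<nu>
  gives it the same mass, and the current may be computed from any injective representative.\<close>

lemma gcur_invariant:
 assumes f: "f \<in> \<Gamma>" and B: "B \<in> sets geodesic_borel"
 shows "emeasure gcur ((`) f ` B) = emeasure gcur B"
proof -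
 have Bs: "B \<subseteq> geodesics" using sets.sets_into_space[OF B] geodesic_borel(1) by simp
 obtain F where F: "is_lift (inv\<Gamma> f) F" using ex_lift[OF inv_in[OF f]] by blast
 define S where "S = gdom \<inter> gpre B"
 have S: "S \<in> sets borel" "S \<subseteq> gstrip" using gdom_borel gpre_borel[OF B] gdom_sub by (auto simp: S_def)
 define R where "R = {p. (F (fst p), F (snd p)) \<in> S}"
 have Rb: "R \<in> sets borel" unfolding R_def by (rule borel_preimage[OF lift_pair_continuous[OF F] S(1)])
 have Rs: "R \<subseteq> gstrip" using S(2) lift_gstrip[OF F] by (auto simp: R_def)
 have injF: "x = y" if "F x = F y" for x y using that F by (simp add: is_lift_def strict_mono_eq)
 have gF: "gq (F (fst p), F (snd p)) = inv\<Gamma> f ` gq p" for p by (rule gq_lift[OF inv_in[OF f] F])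
 have inj: "inj_on gq R"
 proof (rule inj_onI)
  fix p p' assume p: "p \<in> R" "p' \<in> R" "gq p = gq p'"
  hence "gq (F (fst p), F (snd p)) = gq (F (fst p'), F (snd p'))" using gF by simp
  hence "(F (fst p), F (snd p)) = (F (fst p'), F (snd p'))" using p inj_onD[OF gdom_inj, of "(F (fst p), F (snd p))" "(F (fst p'), F (snd p'))"] by (simp add: R_def S_def)
  thus "p = p'" using injF by (simp add: prod_eq_iff)
 qed
 have im: "gq ` R = (`) f ` B"
 proof (intro Set.set_eqI iffI)
  fix l assume "l \<in> gq ` R"
  then obtain p where p: "p \<in> R" "l = gq p" by blast
  hence "inv\<Gamma> f ` l \<in> B" using gF[of p] by (simp add: R_def S_def gpre_def)
  moreover have "l = f ` inv\<Gamma> f ` l" using action_bij(1)[OF f, of l] p Rs unfolding geodesics_gq by blast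
  ultimately show "l \<in> (`) f ` B" by (metis imageI)
 next
  fix l assume "l \<in> (`) f ` B"
  then obtain m where m: "m \<in> B" "l = f ` m" by blast
  then obtain u where u: "u \<in> S" "m = gq u" using gq_gdom[OF Bs] unfolding S_def by blast
  obtain x y where xy: "F x = fst u" "F y = snd u" using lift_surj[OF F] by (metis surjD)
  hence R: "(x, y) \<in> R" using u(1) by (simp add: R_def)
  have "inv\<Gamma> f ` gq (x, y) = m" using gF[of "(x, y)"] xy u(2) by simp
  hence "l = gq (x, y)" using action_bij(1)[OF f, of "gq (x, y)"] m(2) R Rs unfolding geodesics_gq by blast
  thus "l \<in> gq ` R" using R by blast
 qed
 have "emeasure gcur ((`) f ` B) = emeasure \<nu> (gdom \<inter> gpre (gq ` R))" using gcur(3)[OF action_sets[OF f B]] im by simp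
 also have "\<dots> = emeasure \<nu> R" by (rule nu_quotient(2)[OF Rb Rs inj])
 also have "\<dots> = emeasure \<nu> S" unfolding R_def by (rule inv_nu[OF inv_in[OF f] F S])
 also have "\<dots> = emeasure gcur B" using gcur(3)[OF B] by (simp add: S_def)
 finally show ?thesis .
qed

lemma gcur_current: "geodesic_current \<Gamma> gcur"
proof -
 obtain V :: "nat => (real \<times> real) set" where V0: "\<forall>n. open (V n)" "gstrip = (\<Union>n. V n)"
  "\<forall>n. \<exists>q1 q2 p1 p2. q1 <= q2 \<and> q2 < p1 \<and> p1 <= p2 \<and> p2 < q1 + 2 * pi \<and> V n \<subseteq> crect q1 q2 p1 p2"
  using gstrip_cover by (elim exE conjE)
 note V = spec[OF V0(1)] V0(2) spec[OF V0(3)]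
 have Vfin: "emeasure \<nu> (V n) < \<infinity>" for n
 proof -
  obtain q1 q2 p1 p2 where q: "q1 <= q2" "q2 < p1" "p1 <= p2" "p2 < q1 + 2 * pi" "V n \<subseteq> crect q1 q2 p1 p2" using V(3) by blast
  have "emeasure \<nu> (V n) <= emeasure \<nu> (crect q1 q2 p1 p2)" using q(5) by (rule emeasure_mono) (simp add: sets_nu)
  also have "\<dots> < \<infinity>" by (rule finite_nu[OF q(1-4)])
  finally show ?thesis .
 qed
 have Vs: "V n \<subseteq> gstrip" for n using V(2) by blast
 have Sb: "gdom \<inter> gpre B \<in> sets borel" if "B \<in> sets geodesic_borel" for B using gdom_borel gpre_borel[OF that] by auto
 \<comment> \<open>\<open>gq\<close> is open and mass is only lost by identifications, so open
   neighbourhoods in the strip yield open neighbourhoods of no greater mass.\<close>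
 have outer: "emeasure gcur (gq ` U) <= emeasure \<nu> U" if "open U" "U \<subseteq> gstrip" for U
  using nu_outer[of U] that gcur(3)[OF geodesic_borel(2)[OF open_gq[OF that]]] by simp
 show ?thesis
  unfolding geodesic_current_def
 proof (intro conjI ballI)
  show "sets gcur = sets geodesic_borel" by (rule gcur)
 next
  fix l assume "l \<in> geodesics"
  then obtain p where p: "p \<in> gstrip" "l = gq p" unfolding geodesics_gq by blast
  then obtain n where n: "p \<in> V n" using V(2) by blast
  have "openin geodesic_space (gq ` V n)" by (rule open_gq[OF V(1) Vs])
  moreover have "l \<in> gq ` V n" using n p by blast
  moreover have "emeasure gcur (gq ` V n) < \<infinity>" using outer[OF V(1) Vs] Vfin[of n] by (rule le_less_trans)
  ultimately show "\<exists>U. openin geodesic_space U \<and> l \<in> U \<and> emeasure gcur U < \<infinity>" by blast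
 next
  fix f B assume "f \<in> \<Gamma>" "B \<in> sets gcur"
  thus "emeasure gcur ((`) f ` B) = emeasure gcur B" using gcur_invariant by (simp add: gcur(1))
 next
  fix B assume "B \<in> sets gcur"
  hence B: "B \<in> sets geodesic_borel" by (simp add: gcur(1))
  have Bs: "B \<subseteq> geodesics" using sets.sets_into_space[OF B] geodesic_borel(1) by simp
  define S where "S = gdom \<inter> gpre B"
  have S: "S \<in> sets borel" "S \<subseteq> (\<Union>n. V n)" using Sb[OF B] gdom_sub V(2) by (auto simp: S_def)
  have eB: "emeasure gcur B = emeasure \<nu> S" using gcur(3)[OF B] by (simp add: S_def)
  show "emeasure gcur B = (INF U\<in>{U. openin geodesic_space U \<and> B \<subseteq> U}. emeasure gcur U)"
  proof (rule antisym)
   show "emeasure gcur B <= (INF U\<in>{U. openin geodesic_space U \<and> B \<subseteq> U}. emeasure gcur U)"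
    by (intro INF_greatest emeasure_mono) (auto simp: gcur(1) geodesic_borel(2))
   show "(INF U\<in>{U. openin geodesic_space U \<and> B \<subseteq> U}. emeasure gcur U) <= emeasure gcur B"
   proof (rule ennreal_le_epsilon)
    fix e :: real assume e: "0 < e"
    obtain U where U: "open U" "S \<subseteq> U" "U \<subseteq> (\<Union>n. V n)" "emeasure \<nu> U <= emeasure \<nu> S + ennreal e"
     by (rule outer_regular_cover[OF sets_nu V(1) Vfin S e])
    have Us: "U \<subseteq> gstrip" using U(3) V(2) by simp
    have "B \<subseteq> gq ` U"
    proof
     fix l assume l: "l \<in> B"
     then obtain u0 where u0: "u0 \<in> gstrip" "l = gq u0" using Bs unfolding geodesics_gq by blast
     obtain i where "deck i u0 \<in> gdom" using gdom_cover[OF u0(1)] by blast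
     hence "deck i u0 \<in> S" using u0 l deck_gstrip[OF u0(1)] by (auto simp: S_def gpre_def gq_deck)
     thus "l \<in> gq ` U" using U(2) u0(2) gq_deck[of i u0] by (intro image_eqI[of _ _ "deck i u0"]) auto
    qed
    hence "(INF U\<in>{U. openin geodesic_space U \<and> B \<subseteq> U}. emeasure gcur U) <= emeasure gcur (gq ` U)"
     using open_gq[OF U(1) Us] by (intro INF_lower) blast
    also have "\<dots> <= emeasure \<nu> U" by (rule outer[OF U(1) Us])
    finally show "(INF U\<in>{U. openin geodesic_space U \<and> B \<subseteq> U}. emeasure gcur U) <= emeasure gcur B + ennreal e"
     using U(4) eB by simp
   qed
  qed
  show "emeasure gcur B = (SUP K\<in>{K. compactin geodesic_space K \<and> K \<subseteq> B}. emeasure gcur K)"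
  proof (rule antisym)
   have "emeasure gcur B = (SUP K\<in>{K. compact K \<and> K \<subseteq> S}. emeasure \<nu> K)"
    unfolding eB by (rule inner_regular_cover[OF sets_nu V(1) Vfin S])
   also have "\<dots> <= (SUP K\<in>{K. compactin geodesic_space K \<and> K \<subseteq> B}. emeasure gcur K)"
   proof (rule SUP_mono)
    fix K assume "K \<in> {K. compact K \<and> K \<subseteq> S}"
    hence K: "compact K" "K \<subseteq> S" by auto
    have Ks: "K \<subseteq> gstrip" using K(2) gdom_sub by (auto simp: S_def)
    have "K \<subseteq> gdom \<inter> gpre (gq ` K)" using K(2) Ks by (auto simp: S_def gpre_def)
    hence "emeasure \<nu> K <= emeasure \<nu> (gdom \<inter> gpre (gq ` K))"
     using Sb[OF gq_compact(1)[OF K(1) Ks]] by (intro emeasure_mono) (simp_all add: sets_nu)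
    hence "emeasure \<nu> K <= emeasure gcur (gq ` K)" using gcur(3)[OF gq_compact(1)[OF K(1) Ks]] by simp
    moreover have "gq ` K \<subseteq> B" using K(2) by (auto simp: S_def gpre_def)
    ultimately show "\<exists>L\<in>{K. compactin geodesic_space K \<and> K \<subseteq> B}. emeasure \<nu> K <= emeasure gcur L"
     using gq_compact(2)[OF K(1) Ks] by blast
   qed
   finally show "emeasure gcur B <= (SUP K\<in>{K. compactin geodesic_space K \<and> K \<subseteq> B}. emeasure gcur K)" .
   show "(SUP K\<in>{K. compactin geodesic_space K \<and> K \<subseteq> B}. emeasure gcur K) <= emeasure gcur B"
    using B by (intro SUP_least emeasure_mono) (auto simp: gcur(1))
  qed
 qed
qed

end

section \<open>Intersection with a closed geodesic\<close>

lemma transverse_gq: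
 assumes "p \<in> gstrip" "p' \<in> gstrip"
 shows "(gq p', gq p) \<in> transverse_pairs \<longleftrightarrow>
  sep (fst p) (snd p) (fst p') * sep (fst p) (snd p) (snd p') < 0"
proof -
 have st: "fst p < snd p" "snd p < fst p + 2 * pi" using assms(1) by (auto simp: gstrip_def)
 have ne: "cis (fst p') ~= cis (snd p')" using cis_ne[of "fst p'" "snd p'"] assms(2) by simp
 have "gq p \<in> geodesics" "gq p' \<in> geodesics" using assms unfolding geodesics_gq by blast+
 thus ?thesis using geo_transverse_iff[OF st ne] unfolding transverse_pairs_def gq_def by simp
qed

text \<open>The product sigma-algebra is generated by measurable rectangles, so countably many of
  these must exhaust the set: the open condition on the endpoints is covered by rectangles from a
  countable basis, and the open map \<open>gq\<close> carries their sides to open sets.\<close>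

lemma transverse_pairs_sets: "transverse_pairs \<in> sets (geodesic_borel \<Otimes>\<^sub>M geodesic_borel)"
proof -
 define Tr where "Tr = (gstrip \<times> gstrip) \<inter> {w. sep (fst (fst w)) (snd (fst w)) (fst (snd w)) * sep (fst (fst w)) (snd (fst w)) (snd (snd w)) < 0}"
 have oT: "open Tr" unfolding Tr_def sep_def
  by (intro open_Int open_Times gstrip_open open_Collect_less continuous_intros) simp_all
 obtain \<B> :: "(real \<times> real) set set" where B: "countable \<B>" "topological_basis \<B>" using ex_countable_basis by blast
 have bas: "topological_basis ((\<lambda>(a, b). a \<times> b) ` (\<B> \<times> \<B>))" by (rule topological_basis_prod[OF B(2) B(2)])
 define P where "P = {AB \<in> \<B> \<times> \<B>. fst AB \<times> snd AB \<subseteq> Tr}"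
 have cP: "countable P" unfolding P_def using B(1) by (intro countable_subset[OF _ countable_SIGMA[of \<B> "\<lambda>_. \<B>"]]) auto
 have Trs: "w \<in> Tr ==> fst w \<in> gstrip \<and> snd w \<in> gstrip" for w by (auto simp: Tr_def)
 have Tiff: "(gq p', gq p) \<in> transverse_pairs \<longleftrightarrow> (p, p') \<in> Tr" if "p \<in> gstrip" "p' \<in> gstrip" for p p'
  using transverse_gq[OF that] that by (simp add: Tr_def)
 have eq: "transverse_pairs = (\<Union>AB\<in>P. gq ` (snd AB \<inter> gstrip) \<times> gq ` (fst AB \<inter> gstrip))"
 proof (intro Set.set_eqI iffI)
  fix z assume z: "z \<in> transverse_pairs"
  hence "fst z \<in> geodesics" "snd z \<in> geodesics" by (auto simp: transverse_pairs_def)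
  then obtain p p' where p: "p \<in> gstrip" "snd z = gq p" "p' \<in> gstrip" "fst z = gq p'" unfolding geodesics_gq by blast
  hence "(p, p') \<in> Tr" using Tiff[OF p(1,3)] z by (metis prod.collapse)
  then obtain W where W: "W \<in> (\<lambda>(a, b). a \<times> b) ` (\<B> \<times> \<B>)" "(p, p') \<in> W" "W \<subseteq> Tr" by (rule topological_basisE[OF bas oT])
  from W(1) obtain A C where AC: "A \<in> \<B>" "C \<in> \<B>" "W = A \<times> C" by auto
  have "(A, C) \<in> P" using AC W(3) by (simp add: P_def)
  moreover have "z \<in> gq ` (C \<inter> gstrip) \<times> gq ` (A \<inter> gstrip)"
  proof -
   have "p \<in> A" "p' \<in> C" using W(2) AC(3) by auto
   hence "gq p' \<in> gq ` (C \<inter> gstrip)" "gq p \<in> gq ` (A \<inter> gstrip)" using p by blast+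
   thus ?thesis using p by (metis mem_Times_iff)
  qed
  ultimately show "z \<in> (\<Union>AB\<in>P. gq ` (snd AB \<inter> gstrip) \<times> gq ` (fst AB \<inter> gstrip))" by force
 next
  fix z assume "z \<in> (\<Union>AB\<in>P. gq ` (snd AB \<inter> gstrip) \<times> gq ` (fst AB \<inter> gstrip))"
  then obtain A C p p' where h: "(A, C) \<in> P" "p' \<in> C" "p' \<in> gstrip" "p \<in> A" "p \<in> gstrip" "z = (gq p', gq p)" by auto
  hence "(p, p') \<in> Tr" by (auto simp: P_def)
  thus "z \<in> transverse_pairs" using Tiff[OF h(5,3)] h(6) by simp
 qed
 have m: "gq ` (snd AB \<inter> gstrip) \<times> gq ` (fst AB \<inter> gstrip) \<in> sets (geodesic_borel \<Otimes>\<^sub>M geodesic_borel)" if "AB \<in> P" for AB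
 proof -
  have "open (fst AB)" "open (snd AB)" using that B(2) by (auto simp: P_def topological_basis_open)
  thus ?thesis using gstrip_open by (intro pair_measureI geodesic_borel(2) open_gq) auto
 qed
 show ?thesis unfolding eq by (intro sets.countable_UN' cP) (use m in blast)
qed

lemma singleton_geodesic: "l \<in> geodesics ==> {l} \<in> sets geodesic_borel"
proof -
 assume "l \<in> geodesics"
 then obtain p where p: "p \<in> gstrip" "l = gq p" unfolding geodesics_gq by blast
 thus ?thesis using gq_compact(1)[of "{p}"] by simp
qed

lemma sep_pos: "r < \<alpha> ==> \<alpha> < s ==> s < r + 2 * pi ==> 0 < sep r s \<alpha>"
 unfolding sep_def by (intro mult_pos_pos sin_gt_zero) auto

lemma sep_neg: "r < s ==> s < \<beta> ==> \<beta> < r + 2 * pi ==> sep r s \<beta> < 0"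
proof -
 assume h: "r < s" "s < \<beta>" "\<beta> < r + 2 * pi"
 have "0 < sin ((\<beta> - r) / 2)" "0 < sin ((\<beta> - s) / 2)" using h by (intro sin_gt_zero; simp)+
 moreover have "(s - \<beta>) / 2 = - ((\<beta> - s) / 2)" by (simp add: field_simps)
 ultimately show ?thesis unfolding sep_def by (simp only: sin_minus) (simp add: mult_pos_neg)
qed

text \<open>Both sines acquire the factor \<open>cos (pi * of_int k)\<close>, whose square is
  1.\<close>

lemma sep_shift: "sep r s (\<theta> + 2 * pi * of_int k) = sep r s \<theta>"
proof -
 define C where "C = cos (pi * of_int k)"
 have e: "(\<theta> + 2 * pi * of_int k - r) / 2 = (\<theta> - r) / 2 + pi * of_int k" "(s - (\<theta> + 2 * pi * of_int k)) / 2 = (s - \<theta>) / 2 - pi * of_int k"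
  by (simp_all add: field_simps)
 have z: "sin (pi * of_int k) = 0" by (simp add: sin_zero_iff_int2 mult.commute)
 hence "C * C = 1" unfolding C_def using sin_cos_squared_add3[of "pi * of_int k"] by simp
 hence "x * C * (y * C) = x * y" for x y by (metis mult.assoc mult.left_commute mult.right_neutral)
 thus ?thesis unfolding sep_def e sin_add sin_diff z C_def[symmetric] by simp
qed

text \<open>The two endpoints have values of \<open>sep\<close> of opposite sign. Reduced to the
  window from \<open>r\<close> to \<open>r + 2 * pi\<close>, the positive one lies before
  \<open>s\<close> and the negative one after it.\<close>

lemma crossing_coordinates:
 assumes rs: "r < s" "s < r + 2 * pi" and x: "(x, geo (cis r) (cis s)) \<in> transverse_pairs"
 obtains \<alpha> \<beta> where "r < \<alpha>" "\<alpha> < s" "s < \<beta>" "\<beta> < r + 2 * pi" "x = gq (\<alpha>, \<beta>)"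
proof -
 have "x \<in> geodesics" using x by (auto simp: transverse_pairs_def)
 then obtain p where p: "p \<in> gstrip" "x = gq p" unfolding geodesics_gq by blast
 have rsg: "(r, s) \<in> gstrip" using rs by (simp add: gstrip_def)
 have neg: "sep r s (fst p) * sep r s (snd p) < 0" using transverse_gq[OF rsg p(1)] x p(2) by (simp add: gq_def)
 obtain a where a: "cis (fst p) = cis a" "r <= a" "a < r + 2 * pi" by (rule circle_param)
 obtain b where b: "cis (snd p) = cis b" "r <= b" "b < r + 2 * pi" by (rule circle_param)
 have sab: "sep r s (fst p) = sep r s a" "sep r s (snd p) = sep r s b"
  using a(1) b(1) unfolding cis_eq_iff by (auto simp: sep_shift)
 have xab: "x = gq (a, b)" "x = gq (b, a)" using p(2) a(1) b(1) geo_sym[of "cis a" "cis b"] by (simp_all add: gq_def)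
 have side: "sep r s c > 0 ==> r < c \<and> c < s" "sep r s c < 0 ==> s < c" if "r <= c" "c < r + 2 * pi" for c
 proof -
  have z: "sep r s r = 0" "sep r s s = 0" by (simp_all add: sep_def)
  show "sep r s c > 0 ==> r < c \<and> c < s" using sep_neg[of r s c] rs that z by (metis less_asym less_irrefl linorder_neqE_linordered_idom order_le_less)
  show "sep r s c < 0 ==> s < c" using sep_pos[of r c s] rs that z by (metis less_asym less_irrefl linorder_neqE_linordered_idom order_le_less)
 qed
 consider "sep r s a > 0" "sep r s b < 0" | "sep r s a < 0" "sep r s b > 0" using neg unfolding sab by (auto simp: mult_less_0_iff)
 thus ?thesis
 proof cases
  case 1
  thus ?thesis using that[of a b] side(1)[OF a(2,3)] side(2)[OF b(2,3)] b(3) xab(1) by blast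
 next
  case 2
  thus ?thesis using that[of b a] side(1)[OF b(2,3)] side(2)[OF a(2,3)] a(3) xab(2) by blast
 qed
qed

lemma gq_inj_crossing:
 assumes rs: "r < s" "s < r + 2 * pi"
 shows "inj_on gq ({r<..<s} \<times> {s<..<r + 2 * pi})"
proof (rule inj_onI)
 fix w w' assume w: "w \<in> {r<..<s} \<times> {s<..<r + 2 * pi}" "w' \<in> {r<..<s} \<times> {s<..<r + 2 * pi}" "gq w = gq w'"
 obtain a b a' b' where ab: "w = (a, b)" "w' = (a', b')" by (cases w; cases w')
 have l: "r < a" "a < s" "s < b" "b < r + 2 * pi" "r < a'" "a' < s" "s < b'" "b' < r + 2 * pi" using w by (auto simp: ab)
 have "cis a ~= cis b" using cis_inj_interval[of a b] l by auto
 hence "{cis a, cis b} = {cis a', cis b'}" using w(3) geo_eq_iff[of "cis a" "cis b" "cis a'" "cis b'"] by (simp add: gq_def ab)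
 moreover have "cis a ~= cis b'" using cis_inj_interval[of a b'] l by auto
 ultimately have "cis a = cis a'" "cis b = cis b'" unfolding doubleton_eq_iff by blast+
 thus "w = w'" using cis_inj_interval[of a a'] cis_inj_interval[of b b'] l rs by (simp add: ab)
qed

lemma crossing_gstrip: "r < s ==> {r<..<s} \<times> {s<..<r + 2 * pi} \<subseteq> gstrip"
 by (auto simp: gstrip_def)

definition pair_act :: "(complex => complex) => complex set \<times> complex set => complex set \<times> complex set" where
 "pair_act f w = (f ` fst w, f ` snd w)"

locale axis_current = current_data \<Gamma> \<nu> for \<Gamma> \<nu> +
 fixes t :: "complex => complex" and G :: "real => real" and r s :: real and m :: nat
 assumes t: "t \<in> \<Gamma>" and G: "is_lift t G" "G r = r" "G s = s" and rs: "r < s" "s < r + 2 * pi"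
  and up: "\<And>x. r < x ==> x < s ==> x < G x"
  and stab: "\<And>f. f \<in> \<Gamma> ==> f ` geo (cis r) (cis s) = geo (cis r) (cis s) ==> \<exists>k::int. f = t [^]\<^bsub>pi1 \<Gamma>\<^esub> k"
begin

definition ax where "ax = geo (cis r) (cis s)"
definition L where "L = (\<lambda>f. f ` ax) ` \<Gamma>"
definition \<eta> where "\<eta> = scale_measure (of_nat m) (distr (count_space L) geodesic_borel (\<lambda>l. l))"
definition GG where "GG = geodesic_borel \<Otimes>\<^sub>M geodesic_borel"
definition M where "M = gcur \<Otimes>\<^sub>M \<eta>"

lemma ax_geo: "ax \<in> geodesics"
 using rs imageI[of "(r, s)" gstrip gq] unfolding geodesics_gq ax_def by (simp add: gq_def gstrip_def)

lemma L_geo: "L \<subseteq> geodesics"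
 using action_bij(3)[OF _ ax_geo] by (auto simp: L_def)

lemma L_countable: "countable L"
 unfolding L_def using countable_\<Gamma> by simp

lemma L_act: "f \<in> \<Gamma> ==> l \<in> L ==> f ` l \<in> L"
proof -
 assume f: "f \<in> \<Gamma>" and "l \<in> L"
 then obtain h where h: "h \<in> \<Gamma>" "l = h ` ax" by (auto simp: L_def)
 have sub: "ax \<subseteq> cball 0 1" by (auto simp: ax_def geo_def)
 have "(f \<odot> h) ` ax = f ` h ` ax" unfolding image_image using mult_apply[OF f h(1)] sub by (intro image_cong) auto
 thus ?thesis using mult_in[OF f h(1)] h(2) unfolding L_def by (metis imageI)
qed

lemma act_mult: "f \<in> \<Gamma> ==> h \<in> \<Gamma> ==> l \<in> geodesics ==> (f \<odot> h) ` l = f ` h ` l"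
proof -
 assume f: "f \<in> \<Gamma>" "h \<in> \<Gamma>" and l: "l \<in> geodesics"
 have "z \<in> cball 0 1" if "z \<in> l" for z using l that unfolding geodesics_eq by (auto simp: geo_def)
 thus ?thesis unfolding image_image by (intro image_cong[OF refl] mult_apply[OF f])
qed

lemma eta: "sets \<eta> = sets geodesic_borel" "space \<eta> = geodesics"
 by (simp_all add: \<eta>_def geodesic_borel(1) space_scale_measure)

lemma id_measurable: "(\<lambda>l. l) \<in> measurable (count_space L) geodesic_borel"
 using L_geo by (auto simp: measurable_def geodesic_borel(1))

lemma nn_integral_eta:
 assumes "f \<in> borel_measurable geodesic_borel"
 shows "(\<integral>\<^sup>+ l. f l \<partial>\<eta>) = of_nat m * (\<integral>\<^sup>+ l. f l \<partial>count_space L)"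
proof -
 have "(\<integral>\<^sup>+ l. f l \<partial>\<eta>) = of_nat m * (\<integral>\<^sup>+ l. f l \<partial>distr (count_space L) geodesic_borel (\<lambda>l. l))"
  unfolding \<eta>_def using assms by (intro nn_integral_scale_measure) simp
 thus ?thesis using nn_integral_distr[OF id_measurable, of f] assms by simp
qed

lemma emeasure_eta: "A \<in> sets geodesic_borel ==> emeasure \<eta> A = of_nat m * emeasure (count_space L) (A \<inter> L)"
 using emeasure_distr[OF id_measurable, of A] by (simp add: \<eta>_def emeasure_scale_measure vimage_def Int_def)

lemma sigma_finite_eta: "sigma_finite_measure \<eta>"
proof
 let ?A = "insert (geodesics - L) ((\<lambda>l. {l}) ` L)"
 have sing: "{l} \<in> sets geodesic_borel" if "l \<in> L" for l using singleton_geodesic L_geo that by blast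
 have "(\<Union>l\<in>L. {l}) \<in> sets geodesic_borel" using L_countable sing by (intro sets.countable_UN') auto
 hence Lm: "L \<in> sets geodesic_borel" by simp
 have c: "geodesics - L \<in> sets geodesic_borel" using sets.compl_sets[OF Lm] geodesic_borel(1) by simp
 have "emeasure \<eta> a ~= \<infinity>" if a: "a \<in> ?A" for a
 proof (cases "a = geodesics - L")
  case True
  have "(geodesics - L) \<inter> L = {}" by blast
  thus ?thesis using emeasure_eta[OF c] True by simp
 next
  case False
  then obtain l where l: "l \<in> L" "a = {l}" using a by blast
  have "{l} \<inter> L = {l}" using l(1) by blast
  thus ?thesis using emeasure_eta[OF sing[OF l(1)]] l by (simp add: ennreal_mult_eq_top_iff)
 qed
 moreover have "countable ?A" using L_countable by simp
 moreover have "?A \<subseteq> sets \<eta>" using c sing by (auto simp: eta)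
 moreover have "\<Union> ?A = space \<eta>" using L_geo by (auto simp: eta)
 ultimately show "\<exists>A. countable A \<and> A \<subseteq> sets \<eta> \<and> \<Union> A = space \<eta> \<and> (\<forall>a\<in>A. emeasure \<eta> a ~= \<infinity>)" by blast
qed

lemma sets_M: "sets M = sets GG" "space M = geodesics \<times> geodesics"
proof -
 show "sets M = sets GG" unfolding M_def GG_def by (rule sets_pair_measure_cong) (simp_all add: gcur(1) eta)
 show "space M = geodesics \<times> geodesics" by (simp add: M_def space_pair_measure gcur(2) eta)
qed

definition slice :: "(complex set \<times> complex set) set => complex set => complex set set" where
 "slice Y l = (\<lambda>x. (x, l)) -` Y"

lemma slice_sets: "Y \<in> sets GG ==> slice Y l \<in> sets geodesic_borel"
 unfolding slice_def GG_def by (rule sets_Pair2)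

text \<open>Integration against \<eta> is \<open>m\<close> times a sum over the countably many
  lifts, so the product measure reduces to the current of the slices.\<close>

lemma emeasure_M:
 assumes Y: "Y \<in> sets GG"
 shows "emeasure M Y = of_nat m * (\<integral>\<^sup>+ l. emeasure gcur (slice Y l) \<partial>count_space L)"
proof -
 interpret sigma_finite_measure \<eta> by (rule sigma_finite_eta)
 have YM: "Y \<in> sets (gcur \<Otimes>\<^sub>M \<eta>)" using Y sets_M(1) by (simp add: M_def)
 have ind: "(\<lambda>l. indicator Y (x, l) :: ennreal) \<in> borel_measurable geodesic_borel" for x
 proof -
  have "Pair x -` Y \<in> sets geodesic_borel" using Y unfolding GG_def by (rule sets_Pair1)
  hence "(indicator (Pair x -` Y) :: _ => ennreal) \<in> borel_measurable geodesic_borel" by simp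
  moreover have "(indicator (Pair x -` Y) :: _ => ennreal) = (\<lambda>l. indicator Y (x, l))" by (auto simp: indicator_def fun_eq_iff)
  ultimately show ?thesis by (simp only:)
 qed
 have ind2: "(indicator Y (x, l) :: ennreal) = indicator (slice Y l) x" for x l by (auto simp: indicator_def slice_def)
 have "emeasure M Y = (\<integral>\<^sup>+ x. \<integral>\<^sup>+ l. indicator Y (x, l) \<partial>\<eta> \<partial>gcur)"
  unfolding M_def by (rule emeasure_pair_measure[OF YM])
 also have "\<dots> = (\<integral>\<^sup>+ x. of_nat m * (\<integral>\<^sup>+ l. indicator Y (x, l) \<partial>count_space L) \<partial>gcur)"
  by (simp only: nn_integral_eta[OF ind])
 also have "\<dots> = (\<integral>\<^sup>+ x. \<integral>\<^sup>+ l. of_nat m * indicator Y (x, l) \<partial>count_space L \<partial>gcur)"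
  by (simp add: nn_integral_cmult)
 also have "\<dots> = (\<integral>\<^sup>+ l. \<integral>\<^sup>+ x. of_nat m * indicator Y (x, l) \<partial>gcur \<partial>count_space L)"
 proof (rule nn_integral_count_space_nn_integral[OF L_countable])
  fix l
  have "slice Y l \<in> sets gcur" using slice_sets[OF Y] by (simp add: gcur(1))
  thus "(\<lambda>x. of_nat m * indicator Y (x, l) :: ennreal) \<in> borel_measurable gcur"
   unfolding ind2 by (intro borel_measurable_times_ennreal borel_measurable_const borel_measurable_indicator)
 qed
 also have "\<dots> = (\<integral>\<^sup>+ l. of_nat m * emeasure gcur (slice Y l) \<partial>count_space L)"
 proof (rule nn_integral_cong)
  fix l
  have "slice Y l \<in> sets gcur" using slice_sets[OF Y] by (simp add: gcur(1))
  thus "(\<integral>\<^sup>+ x. of_nat m * indicator Y (x, l) \<partial>gcur) = of_nat m * emeasure gcur (slice Y l)"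
   unfolding ind2 by (rule nn_integral_cmult_indicator)
 qed
 also have "\<dots> = of_nat m * (\<integral>\<^sup>+ l. emeasure gcur (slice Y l) \<partial>count_space L)"
  by (rule nn_integral_cmult) simp
 finally show ?thesis .
qed

lemma pair_act_measurable: "f \<in> \<Gamma> ==> pair_act f \<in> measurable GG GG"
proof -
 assume f: "f \<in> \<Gamma>"
 have "(\<lambda>w. (f ` fst w, f ` snd w)) \<in> measurable GG GG" unfolding GG_def
  by (intro measurable_Pair measurable_compose[OF measurable_fst action_measurable[OF f]] measurable_compose[OF measurable_snd action_measurable[OF f]])
 thus ?thesis by (simp add: pair_act_def[abs_def])
qed

lemma GG_sub: "Y \<in> sets GG ==> Y \<subseteq> geodesics \<times> geodesics"
 using sets.sets_into_space[of Y GG] by (simp add: GG_def space_pair_measure geodesic_borel(1))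

lemma pair_act_inv:
 assumes "f \<in> \<Gamma>" "w \<in> geodesics \<times> geodesics"
 shows "pair_act f (pair_act (inv\<Gamma> f) w) = w" "pair_act (inv\<Gamma> f) (pair_act f w) = w" "pair_act f w \<in> geodesics \<times> geodesics"
 using action_bij[OF assms(1), of "fst w"] action_bij[OF assms(1), of "snd w"] assms(2) by (auto simp: pair_act_def mem_Times_iff)

lemma pair_act_sets:
 assumes f: "f \<in> \<Gamma>" and Y: "Y \<in> sets GG"
 shows "pair_act f ` Y \<in> sets GG"
proof -
 have "pair_act f ` Y = pair_act (inv\<Gamma> f) -` Y \<inter> space GG"
 proof (intro Set.set_eqI iffI)
  fix w assume "w \<in> pair_act f ` Y"
  then obtain v where v: "v \<in> Y" "w = pair_act f v" by blast
  hence "v \<in> geodesics \<times> geodesics" using GG_sub[OF Y] by blast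
  thus "w \<in> pair_act (inv\<Gamma> f) -` Y \<inter> space GG"
   using pair_act_inv(2,3)[OF f, of v] v by (simp add: GG_def space_pair_measure geodesic_borel(1))
 next
  fix w assume w: "w \<in> pair_act (inv\<Gamma> f) -` Y \<inter> space GG"
  hence "w = pair_act f (pair_act (inv\<Gamma> f) w)"
   using pair_act_inv(1)[OF f, of w] by (simp add: GG_def space_pair_measure geodesic_borel(1))
  thus "w \<in> pair_act f ` Y" using w by blast
 qed
 thus ?thesis using measurable_sets[OF pair_act_measurable[OF inv_in[OF f]] Y] by simp
qed

text \<open>The group permutes the lifts and carries slices to slices, so invariance of the current
  suffices.\<close>

lemma M_invariant:
 assumes f: "f \<in> \<Gamma>" and Y: "Y \<in> sets GG"
 shows "emeasure M (pair_act f ` Y) = emeasure M Y"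
proof -
 have bij: "bij_betw ((`) f) L L"
 proof (rule bij_betw_byWitness[of _ "(`) (inv\<Gamma> f)"])
  show "\<forall>a\<in>L. inv\<Gamma> f ` f ` a = a" "\<forall>a\<in>L. f ` inv\<Gamma> f ` a = a" using action_bij[OF f] L_geo by blast+
  show "(`) f ` L \<subseteq> L" "(`) (inv\<Gamma> f) ` L \<subseteq> L" using L_act f inv_in[OF f] by blast+
 qed
 have sl: "slice (pair_act f ` Y) (f ` l) = (`) f ` slice Y l" if l: "l \<in> L" for l
 proof (intro Set.set_eqI iffI)
  fix x assume "x \<in> slice (pair_act f ` Y) (f ` l)"
  then obtain v where v: "v \<in> Y" "x = f ` fst v" "f ` l = f ` snd v" by (auto simp: slice_def pair_act_def)
  have "snd v \<in> geodesics" using v(1) GG_sub[OF Y] by auto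
  hence "snd v = l" using v(3) action_bij(2)[OF f] l L_geo by (metis subsetD)
  hence "(fst v, l) = v" by (simp add: prod_eq_iff)
  hence "fst v \<in> slice Y l" using v(1) by (simp only: slice_def vimage_eq)
  thus "x \<in> (`) f ` slice Y l" using v(2) by blast
 next
  fix x assume "x \<in> (`) f ` slice Y l"
  then obtain u where u: "(u, l) \<in> Y" "x = f ` u" by (auto simp: slice_def)
  have "(x, f ` l) = pair_act f (u, l)" using u(2) by (simp add: pair_act_def)
  thus "x \<in> slice (pair_act f ` Y) (f ` l)" using u(1) unfolding slice_def vimage_eq by blast
 qed
 have "(\<integral>\<^sup>+ l. emeasure gcur (slice (pair_act f ` Y) l) \<partial>count_space L)
   = (\<integral>\<^sup>+ l. emeasure gcur (slice (pair_act f ` Y) (f ` l)) \<partial>count_space L)"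
  by (rule nn_integral_bij_count_space[OF bij, symmetric])
 also have "\<dots> = (\<integral>\<^sup>+ l. emeasure gcur (slice Y l) \<partial>count_space L)"
  by (rule nn_integral_cong) (simp add: sl gcur_invariant[OF f slice_sets[OF Y]])
 finally show ?thesis unfolding emeasure_M[OF Y] emeasure_M[OF pair_act_sets[OF f Y]] by simp
qed

end

section \<open>A fundamental domain for the pairs that cross a lift of the closed geodesic\<close>

context axis_current
begin

definition J where "J = {s<..<r + 2 * pi}"

lemma G_less: "G x < G y \<longleftrightarrow> x < y" "G x <= G y \<longleftrightarrow> x <= y"
 using G(1) by (simp_all add: is_lift_def strict_mono_less strict_mono_less_eq)

lemma lift_n: "is_lift (t [^]\<^bsub>pi1 \<Gamma>\<^esub> n) (G ^^ (n::nat))"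
 by (rule lift_pow[OF t G(1)])

lemma Gn: "(G ^^ n) r = r" "(G ^^ n) s = s" "(G ^^ n) (r + 2 * pi) = r + 2 * pi"
proof -
 show "(G ^^ n) r = r" "(G ^^ n) s = s" by (induction n) (simp_all add: G)
 thus "(G ^^ n) (r + 2 * pi) = r + 2 * pi" using lift_n[of n] by (simp add: is_lift_def)
qed

lemma Gn_less: "(G ^^ n) x < (G ^^ n) y \<longleftrightarrow> x < y"
 using lift_n[of n] by (simp add: is_lift_def strict_mono_less)

lemma Gn_bounds: "r < (G ^^ n) x \<longleftrightarrow> r < x" "(G ^^ n) x < s \<longleftrightarrow> x < s" "s < (G ^^ n) x \<longleftrightarrow> s < x" "(G ^^ n) x < r + 2 * pi \<longleftrightarrow> x < r + 2 * pi"
 using Gn_less[of n r x] Gn_less[of n x s] Gn_less[of n s x] Gn_less[of n x "r + 2 * pi"] Gn[of n] by simp_all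

lemma Gn_step: "r < x ==> x < s ==> n < k ==> (G ^^ n) x < (G ^^ k) x"
 by (rule lift_Suc_mono_less[of "\<lambda>n. (G ^^ n) x"]) (simp_all add: up Gn_bounds)

lemma pow_gq: "(t [^]\<^bsub>pi1 \<Gamma>\<^esub> (n::nat)) ` gq (\<alpha>, \<beta>) = gq ((G ^^ n) \<alpha>, (G ^^ n) \<beta>)"
 using gq_lift[OF pow_in(1)[OF t] lift_n, of n "(\<alpha>, \<beta>)"] by simp

lemma ax_gq: "ax = gq (r, s)" by (simp add: ax_def gq_def)

lemma pow_ax: "(t [^]\<^bsub>pi1 \<Gamma>\<^esub> (n::nat)) ` ax = ax"
 unfolding ax_gq pow_gq Gn ..

text \<open>Otherwise the increasing orbit of \<open>x\<close> would converge to a fixed point of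
  \<open>G\<close> strictly between \<open>r\<close> and \<open>s\<close>.\<close>

lemma escape:
 assumes x: "r < x" "x < s" and y: "y < s"
 shows "\<exists>n. y < (G ^^ n) x"
proof (rule ccontr)
 assume "\<not> (\<exists>n. y < (G ^^ n) x)"
 hence le: "(G ^^ n) x <= y" for n by (simp add: not_less)
 define u where "u n = (G ^^ n) x" for n
 have ub: "r < u n" "u n < s" for n using Gn_bounds(1,2)[of n x] x by (simp_all add: u_def)
 have "incseq u" unfolding u_def by (rule incseq_SucI) (use up[OF ub] in \<open>simp add: u_def less_imp_le\<close>)
 then obtain l where l: "u \<longlonglongrightarrow> l" "\<And>n. u n <= l"
  using incseq_convergent[of u y] le unfolding u_def by metis
 have "isCont G l" using G(1) by (simp add: is_lift_def continuous_on_eq_continuous_at)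
 hence "(\<lambda>n. G (u n)) \<longlonglongrightarrow> G l" using l(1) by (rule isCont_tendsto_compose)
 moreover have "(\<lambda>n. G (u n)) = (\<lambda>n. u (Suc n))" by (simp add: u_def fun_eq_iff)
 ultimately have "G l = l" using LIMSEQ_Suc[OF l(1)] LIMSEQ_unique by metis
 moreover have "r < l" using ub(1)[of 0] l(2)[of 0] by linarith
 moreover have "l <= y" using l(1) le by (intro LIMSEQ_le_const2[OF l(1)]) (auto simp: u_def)
 ultimately show False using up[of l] y by simp
qed

text \<open>Iterates are formed with natural exponents only, hence the disjunction: \<alpha> is
  moved forward into the period from \<open>p\<close> to \<open>G p\<close>, or it is the forward
  image of a point there. The exponent is that of the first passage beyond \<open>p\<close> or
  \<alpha>, less one where necessary.\<close>

lemma domain: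
 assumes p: "r < p" "p < s" and a: "r < \<alpha>" "\<alpha> < s"
 shows "\<exists>n. (p <= (G ^^ n) \<alpha> \<and> (G ^^ n) \<alpha> < G p) \<or> (\<exists>\<alpha>'. (G ^^ n) \<alpha>' = \<alpha> \<and> p <= \<alpha>' \<and> \<alpha>' < G p)"
proof (cases "p <= \<alpha>")
 case True
 define n where "n = (LEAST n. \<alpha> < (G ^^ n) p)"
 have n: "\<alpha> < (G ^^ n) p" "\<And>k. k < n ==> \<not> \<alpha> < (G ^^ k) p"
  unfolding n_def using LeastI_ex[OF escape[OF p a(2)]] not_less_Least by blast+
 then obtain k where k: "n = Suc k" using True by (cases n) auto
 obtain \<alpha>' where a': "(G ^^ k) \<alpha>' = \<alpha>" using lift_surj[OF lift_n[of k]] by (metis surjD)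
 have "(G ^^ k) p <= (G ^^ k) \<alpha>'" "(G ^^ k) \<alpha>' < (G ^^ k) (G p)"
  using n(2)[of k] n(1) k a' by (simp_all add: funpow_swap1)
 hence "p <= \<alpha>'" "\<alpha>' < G p" using Gn_less[of k] by (simp_all add: not_less[symmetric])
 thus ?thesis using a' by blast
next
 case False
 define n where "n = (LEAST n. p < (G ^^ n) \<alpha>)"
 have n: "p < (G ^^ n) \<alpha>" "\<And>k. k < n ==> \<not> p < (G ^^ k) \<alpha>"
  unfolding n_def using LeastI_ex[OF escape[OF a p(2)]] not_less_Least by blast+
 then obtain k where k: "n = Suc k" using False by (cases n) auto
 show ?thesis
 proof (cases "p = (G ^^ k) \<alpha>")
  case True
  thus ?thesis using up[OF p] by (intro exI[of _ k]) simp
 next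
  case pne: False
  hence "(G ^^ k) \<alpha> < p" using n(2)[of k] k by simp
  hence "(G ^^ n) \<alpha> < G p" using G_less(1) k by simp
  thus ?thesis using n(1) by (intro exI[of _ n]) simp
 qed
qed

definition R where "R p = {p..<G p} \<times> J"
text \<open>A fundamental domain for \<Gamma> on the transverse pairs whose second geodesic is a
  lift: the second one is moved to the axis, then the stabiliser of the axis moves one endpoint of
  the first into a single period.\<close>

definition D where "D p = gq ` R p \<times> {ax}"

lemma G_s: "G x < s \<longleftrightarrow> x < s" "r < G x \<longleftrightarrow> r < x"
 using Gn_bounds(1,2)[of 1 x] by simp_all

lemma R_sub: "r < p ==> p < s ==> R p \<subseteq> {r<..<s} \<times> J"
 using G_s[of p] by (auto simp: R_def)

lemma R_borel: "R p \<in> sets borel"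
 unfolding R_def J_def by (metis borel_prod pair_measureI atLeastLessThan_borel greaterThanLessThan_borel)

text \<open>The half-open rectangle is a difference of two open ones. On the crossing region
  \<open>gq\<close> is injective, so it commutes with this difference, and it maps open sets to open
  sets.\<close>

lemma gqR_sets:
 assumes p: "r < p" "p < s"
 shows "gq ` R p \<in> sets geodesic_borel"
proof -
 have 1: "{r<..<G p} \<times> J \<subseteq> {r<..<s} \<times> J" using G_s(1)[of p] p by auto
 have 2: "{r<..<p} \<times> J \<subseteq> {r<..<G p} \<times> J" using up[OF p] by auto
 have gs: "{r<..<G p} \<times> J \<subseteq> gstrip" using 1 crossing_gstrip[OF rs(1)] by (auto simp: J_def)
 have "R p = {r<..<G p} \<times> J - {r<..<p} \<times> J" using p by (auto simp: R_def)
 also have "gq ` \<dots> = gq ` ({r<..<G p} \<times> J) - gq ` ({r<..<p} \<times> J)"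
  using inj_on_subset[OF gq_inj_crossing[OF rs]] 1 2 by (intro inj_on_image_set_diff[where C = "{r<..<G p} \<times> J"]) (auto simp: J_def)
 finally have e: "gq ` R p = gq ` ({r<..<G p} \<times> J) - gq ` ({r<..<p} \<times> J)" .
 have "openin geodesic_space (gq ` ({r<..<G p} \<times> J))" "openin geodesic_space (gq ` ({r<..<p} \<times> J))"
  using gs 2 by (intro open_gq open_Times; auto simp: J_def)+
 thus ?thesis unfolding e by (intro sets.Diff geodesic_borel(2))
qed

lemma gcur_R:
 assumes p: "r < p" "p < s"
 shows "emeasure gcur (gq ` R p) = emeasure \<nu> (R p)"
proof -
 have sub: "R p \<subseteq> gstrip" using R_sub[OF p] crossing_gstrip[OF rs(1)] by (auto simp: J_def)
 have "inj_on gq (R p)" using inj_on_subset[OF gq_inj_crossing[OF rs]] R_sub[OF p] by (simp add: J_def)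
 thus ?thesis using gcur(3)[OF gqR_sets[OF p]] nu_quotient(2)[OF R_borel sub] by simp
qed

lemma D_sets: "r < p ==> p < s ==> D p \<in> sets GG"
 unfolding D_def GG_def by (intro pair_measureI gqR_sets singleton_geodesic ax_geo)

lemma TP_sets: "transverse_pairs \<in> sets GG" unfolding GG_def by (rule transverse_pairs_sets)

lemma TP_geo: "transverse_pairs \<subseteq> geodesics \<times> geodesics" by (auto simp: transverse_pairs_def)

lemma D_TP:
 assumes p: "r < p" "p < s"
 shows "D p \<subseteq> transverse_pairs"
proof
 fix w assume "w \<in> D p"
 then obtain \<alpha> \<beta> where ab: "(\<alpha>, \<beta>) \<in> R p" "w = (gq (\<alpha>, \<beta>), gq (r, s))" by (auto simp: D_def ax_gq)
 have b: "r < \<alpha>" "\<alpha> < s" "s < \<beta>" "\<beta> < r + 2 * pi" using ab(1) R_sub[OF p] by (auto simp: J_def)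
 have g: "(r, s) \<in> gstrip" "(\<alpha>, \<beta>) \<in> gstrip" using rs b by (auto simp: gstrip_def)
 have "sep r s \<alpha> * sep r s \<beta> < 0" using sep_pos[OF b(1,2) rs(2)] sep_neg[OF rs(1) b(3,4)] by (rule mult_pos_neg)
 thus "w \<in> transverse_pairs" using transverse_gq[OF g] ab(2) by simp
qed

lemma D_cover:
 assumes p: "r < p" "p < s" and x: "(x, ax) \<in> transverse_pairs"
 shows "\<exists>f\<in>\<Gamma>. pair_act f (x, ax) \<in> D p"
proof -
 obtain \<alpha> \<beta> where ab: "r < \<alpha>" "\<alpha> < s" "s < \<beta>" "\<beta> < r + 2 * pi" "x = gq (\<alpha>, \<beta>)"
  using crossing_coordinates[OF rs, of x] x unfolding ax_def by metis
 obtain n where n: "(p <= (G ^^ n) \<alpha> \<and> (G ^^ n) \<alpha> < G p) \<or> (\<exists>\<alpha>'. (G ^^ n) \<alpha>' = \<alpha> \<and> p <= \<alpha>' \<and> \<alpha>' < G p)"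
  using domain[OF p ab(1,2)] by blast
 define h where "h = t [^]\<^bsub>pi1 \<Gamma>\<^esub> n"
 have h: "h \<in> \<Gamma>" using pow_in(1)[OF t] by (simp add: h_def)
 from n show ?thesis
 proof
  assume n: "p <= (G ^^ n) \<alpha> \<and> (G ^^ n) \<alpha> < G p"
  have "((G ^^ n) \<alpha>, (G ^^ n) \<beta>) \<in> R p" using n ab Gn_bounds[of n \<beta>] by (simp add: R_def J_def)
  hence "pair_act h (x, ax) \<in> D p" by (simp add: pair_act_def D_def h_def pow_ax ab(5) pow_gq)
  thus ?thesis using h by blast
 next
  assume "\<exists>\<alpha>'. (G ^^ n) \<alpha>' = \<alpha> \<and> p <= \<alpha>' \<and> \<alpha>' < G p"
  then obtain \<alpha>' where a': "(G ^^ n) \<alpha>' = \<alpha>" "p <= \<alpha>'" "\<alpha>' < G p" by blast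
  obtain \<beta>' where b': "(G ^^ n) \<beta>' = \<beta>" using lift_surj[OF lift_n[of n]] by (metis surjD)
  have "(\<alpha>', \<beta>') \<in> R p" using a' ab b' Gn_bounds[of n \<beta>'] by (simp add: R_def J_def)
  hence d: "(gq (\<alpha>', \<beta>'), ax) \<in> D p" by (simp add: D_def)
  have "pair_act h (gq (\<alpha>', \<beta>'), ax) = (x, ax)" by (simp add: pair_act_def h_def pow_ax ab(5) pow_gq a'(1) b')
  moreover have "(gq (\<alpha>', \<beta>'), ax) \<in> geodesics \<times> geodesics" using d D_TP[OF p] TP_geo by blast
  ultimately have "pair_act (inv\<Gamma> h) (x, ax) = (gq (\<alpha>', \<beta>'), ax)" using pair_act_inv(2)[OF h] by metis
  thus ?thesis using d inv_in[OF h] by metis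
 qed
qed

text \<open>An element relating two members of \<open>D p\<close> preserves the axis, so it is a
  power of \<open>t\<close>. A positive power moves an endpoint in \<open>{p..<G p}\<close> to
  \<open>G p\<close> or beyond; for a negative power the roles of \<open>w\<close> and
  \<open>w'\<close> are exchanged.\<close>

lemma D_inj:
 assumes p: "r < p" "p < s" and w: "w \<in> D p" "w' \<in> D p" and f: "f \<in> \<Gamma>" "pair_act f w = w'"
 shows "w = w'"
proof -
 have one_side: "v = v'" if v: "v \<in> D p" "v' \<in> D p" "pair_act (t [^]\<^bsub>pi1 \<Gamma>\<^esub> (n::nat)) v = v'" for v v' n
 proof -
  obtain \<alpha> \<beta> where ab: "(\<alpha>, \<beta>) \<in> R p" "v = (gq (\<alpha>, \<beta>), ax)" using v(1) by (auto simp: D_def)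
  obtain \<alpha>' \<beta>' where ab': "(\<alpha>', \<beta>') \<in> R p" "v' = (gq (\<alpha>', \<beta>'), ax)" using v(2) by (auto simp: D_def)
  have e: "gq ((G ^^ n) \<alpha>, (G ^^ n) \<beta>) = gq (\<alpha>', \<beta>')" using v(3) ab(2) ab'(2) by (simp add: pair_act_def pow_gq)
  have b: "r < \<alpha>" "\<alpha> < s" "s < \<beta>" "\<beta> < r + 2 * pi" "p <= \<alpha>" "\<alpha>' < G p"
   using subsetD[OF R_sub[OF p] ab(1)] ab(1) ab'(1) by (auto simp: J_def R_def)
  have "((G ^^ n) \<alpha>, (G ^^ n) \<beta>) \<in> {r<..<s} \<times> {s<..<r + 2 * pi}" using b Gn_bounds[of n] by simp
  moreover have "(\<alpha>', \<beta>') \<in> {r<..<s} \<times> {s<..<r + 2 * pi}" using ab'(1) R_sub[OF p] by (auto simp: J_def)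
  ultimately have "((G ^^ n) \<alpha>, (G ^^ n) \<beta>) = (\<alpha>', \<beta>')" using inj_onD[OF gq_inj_crossing[OF rs] e] by blast
  hence a: "(G ^^ n) \<alpha> < G p" using b(6) by simp
  have "n = 0"
  proof (rule ccontr)
   assume "n ~= 0"
   hence "G \<alpha> <= (G ^^ n) \<alpha>" using Gn_step[OF b(1,2), of 1 n] by (cases "n = 1") auto
   thus False using a b(5) G_less(2)[of p \<alpha>] by simp
  qed
  thus ?thesis using \<open>((G ^^ n) \<alpha>, (G ^^ n) \<beta>) = (\<alpha>', \<beta>')\<close> ab ab' by simp
 qed
 have wg: "w \<in> geodesics \<times> geodesics" "w' \<in> geodesics \<times> geodesics" using w D_TP[OF p] TP_geo by blast+
 have "snd w = ax" "snd w' = ax" using w by (auto simp: D_def)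
 hence "f ` ax = ax" using f(2) by (auto simp: pair_act_def)
 then obtain k :: int where k: "f = t [^]\<^bsub>pi1 \<Gamma>\<^esub> k" using stab[OF f(1)] by (auto simp: ax_def)
 show ?thesis
 proof (cases "k < 0")
  case False
  hence "(k < 0) = False" by simp
  hence "f = t [^]\<^bsub>pi1 \<Gamma>\<^esub> nat k" unfolding k int_pow_def2 by (simp only: if_False)
  thus ?thesis using one_side[OF w] f(2) by simp
 next
  case True
  hence "(k < 0) = True" by simp
  hence fk: "f = inv\<Gamma> (t [^]\<^bsub>pi1 \<Gamma>\<^esub> nat (- k))" unfolding k int_pow_def2 by (simp only: if_True)
  define h where "h = t [^]\<^bsub>pi1 \<Gamma>\<^esub> nat (- k)"
  have h: "h \<in> \<Gamma>" using pow_in(1)[OF t] by (simp add: h_def)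
  have "pair_act h w' = w" using pair_act_inv(1)[OF h wg(1)] f(2) fk by (simp add: h_def)
  hence "w' = w" using one_side[OF w(2,1), of "nat (- k)"] by (simp only: h_def)
  thus ?thesis ..
 qed
qed

lemma emeasure_D:
 assumes p: "r < p" "p < s"
 shows "emeasure M (D p) = of_nat m * emeasure \<nu> (R p)"
proof -
 have axL: "ax \<in> L"
 proof -
  have "one\<Gamma> ` ax = ax" using pow_ax[of 0] by simp
  thus ?thesis unfolding L_def using one_in by (metis imageI)
 qed
 have "slice (D p) l = (if l = ax then gq ` R p else {})" for l by (auto simp: slice_def D_def)
 hence "emeasure gcur (slice (D p) l) = emeasure gcur (gq ` R p) * indicator {ax} l" for l by simp
 hence "(\<integral>\<^sup>+ l. emeasure gcur (slice (D p) l) \<partial>count_space L) = (\<integral>\<^sup>+ l. emeasure gcur (gq ` R p) * indicator {ax} l \<partial>count_space L)"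
  by (simp only:)
 also have "\<dots> = emeasure gcur (gq ` R p) * emeasure (count_space L) {ax}" using axL by (intro nn_integral_cmult_indicator) simp
 also have "\<dots> = emeasure \<nu> (R p)" using axL gcur_R[OF p] by simp
 finally show ?thesis unfolding emeasure_M[OF D_sets[OF p]] by simp
qed

section \<open>Orbits of pairs and the quotient measure\<close>

lemma pair_orbit_eq: "pair_orbit \<Gamma> w = (\<lambda>f. pair_act f w) ` \<Gamma>"
 by (cases w) (simp add: pair_orbit_def pair_act_def)

lemma pair_act_mult: "f \<in> \<Gamma> ==> h \<in> \<Gamma> ==> w \<in> geodesics \<times> geodesics ==> pair_act (f \<odot> h) w = pair_act f (pair_act h w)"
 by (cases w) (simp add: pair_act_def act_mult)

lemma pair_act_one: "w \<in> geodesics \<times> geodesics ==> pair_act one\<Gamma> w = w"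
proof -
 assume w: "w \<in> geodesics \<times> geodesics"
 have "one\<Gamma> ` l = l" if l: "l \<in> geodesics" for l
 proof -
  have "z \<in> cball 0 1" if "z \<in> l" for z using l that unfolding geodesics_eq by (auto simp: geo_def)
  hence "one\<Gamma> ` l = (\<lambda>z. z) ` l" by (intro image_cong[OF refl] one_apply)
  thus ?thesis by simp
 qed
 thus ?thesis using w by (cases w) (simp add: pair_act_def)
qed

lemma pair_orbit_act:
 assumes w: "w \<in> geodesics \<times> geodesics" and f: "f \<in> \<Gamma>"
 shows "pair_orbit \<Gamma> (pair_act f w) = pair_orbit \<Gamma> w"
proof -
 have sub: "pair_orbit \<Gamma> (pair_act f w) \<subseteq> pair_orbit \<Gamma> w" if "w \<in> geodesics \<times> geodesics" "f \<in> \<Gamma>" for f w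
  unfolding pair_orbit_eq using pair_act_mult[OF _ that(2,1), symmetric] mult_in[OF _ that(2)] by blast
 have "pair_orbit \<Gamma> w \<subseteq> pair_orbit \<Gamma> (pair_act f w)"
  using sub[OF pair_act_inv(3)[OF f w] inv_in[OF f]] pair_act_inv(2)[OF f w] by simp
 thus ?thesis using sub[OF w f] by blast
qed

lemma pair_orbit_self: "w \<in> geodesics \<times> geodesics ==> w \<in> pair_orbit \<Gamma> w"
 unfolding pair_orbit_eq using pair_act_one[of w] one_in by (metis imageI)

lemma TP_act:
 assumes "w \<in> transverse_pairs" "f \<in> \<Gamma>"
 shows "pair_act f w \<in> transverse_pairs"
proof -
 have w: "w \<in> geodesics \<times> geodesics" using assms(1) TP_geo by blast
 have g: "fst w \<in> geodesics" "snd w \<in> geodesics" using w by (simp_all add: mem_Times_iff)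
 have ne: "fst w ~= snd w" and "fst w \<inter> snd w ~= {}" using assms(1) by (simp_all add: transverse_pairs_def case_prod_beta)
 have "f ` fst w ~= f ` snd w"
 proof
  assume "f ` fst w = f ` snd w"
  hence "inv\<Gamma> f ` f ` fst w = inv\<Gamma> f ` f ` snd w" by (rule arg_cong)
  thus False using ne unfolding action_bij(2)[OF assms(2) g(1)] action_bij(2)[OF assms(2) g(2)] by (rule notE[rotated])
 qed
 moreover obtain z where "z \<in> fst w" "z \<in> snd w" using \<open>fst w \<inter> snd w ~= {}\<close> by blast
 hence "f ` fst w \<inter> f ` snd w ~= {}" by blast
 moreover have "f ` fst w \<in> geodesics" "f ` snd w \<in> geodesics" using action_bij(3)[OF assms(2)] g by blast+
 ultimately show ?thesis by (simp add: transverse_pairs_def pair_act_def)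
qed

definition orbits where "orbits = pair_orbit \<Gamma> ` transverse_pairs"

lemma orbits_union: "A \<subseteq> orbits ==> \<Union>A = {w \<in> transverse_pairs. pair_orbit \<Gamma> w \<in> A}"
proof (intro Set.set_eqI iffI)
 fix w assume A: "A \<subseteq> orbits" "w \<in> \<Union>A"
 then obtain v where v: "v \<in> transverse_pairs" "pair_orbit \<Gamma> v \<in> A" "w \<in> pair_orbit \<Gamma> v" by (auto simp: orbits_def)
 then obtain f where f: "f \<in> \<Gamma>" "w = pair_act f v" unfolding pair_orbit_eq by blast
 thus "w \<in> {w \<in> transverse_pairs. pair_orbit \<Gamma> w \<in> A}" using pair_orbit_act[of v f] TP_act[of v f] v TP_geo by auto
next
 fix w assume "w \<in> {w \<in> transverse_pairs. pair_orbit \<Gamma> w \<in> A}"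
 thus "w \<in> \<Union>A" using pair_orbit_self[of w] TP_geo by blast
qed

text \<open>\<open>D p\<close> is itself a section, so it bounds the supremum from below. For any
  other section \<open>B\<close> the pairs whose second member is not a lift have measure 0, and
  \<Gamma> moves the rest injectively and with preserved measure into \<open>D p\<close>.\<close>

lemma section_mass:
 assumes p: "r < p" "p < s" and A: "A \<subseteq> orbits" "\<Union>A \<in> sets M"
 shows "(SUP B\<in>{B \<in> sets M. B \<subseteq> \<Union>A \<and> inj_on (pair_orbit \<Gamma>) B}. emeasure M B) = emeasure M (D p \<inter> \<Union>A)"
proof (rule antisym)
 have DA: "D p \<inter> \<Union>A \<in> sets M" using D_sets[OF p] A(2) by (simp add: sets_M sets.Int)
 have inj: "inj_on (pair_orbit \<Gamma>) (D p)"
 proof (rule inj_onI)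
  fix w w' assume w: "w \<in> D p" "w' \<in> D p" "pair_orbit \<Gamma> w = pair_orbit \<Gamma> w'"
  have "w' \<in> pair_orbit \<Gamma> w" using w pair_orbit_self[of w'] D_TP[OF p] TP_geo by blast
  then obtain f where "f \<in> \<Gamma>" "pair_act f w = w'" unfolding pair_orbit_eq by blast
  thus "w = w'" by (rule D_inj[OF p w(1,2)])
 qed
 show "emeasure M (D p \<inter> \<Union>A) <= (SUP B\<in>{B \<in> sets M. B \<subseteq> \<Union>A \<and> inj_on (pair_orbit \<Gamma>) B}. emeasure M B)"
  by (rule SUP_upper) (use DA inj_on_subset[OF inj] in auto)
 show "(SUP B\<in>{B \<in> sets M. B \<subseteq> \<Union>A \<and> inj_on (pair_orbit \<Gamma>) B}. emeasure M B) <= emeasure M (D p \<inter> \<Union>A)"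
 proof (rule SUP_least)
  fix B assume "B \<in> {B \<in> sets M. B \<subseteq> \<Union>A \<and> inj_on (pair_orbit \<Gamma>) B}"
  hence B: "B \<in> sets GG" "B \<subseteq> \<Union>A" "inj_on (pair_orbit \<Gamma>) B" by (auto simp: sets_M)
  define B' where "B' = B \<inter> (geodesics \<times> L)"
  have Lm: "L \<in> sets geodesic_borel"
  proof -
   have "(\<Union>l\<in>L. {l}) \<in> sets geodesic_borel"
    using L_countable by (rule sets.countable_UN'') (use singleton_geodesic L_geo in blast)
   thus ?thesis by simp
  qed
  have "geodesics \<times> L \<in> sets GG" unfolding GG_def using sets.top[of geodesic_borel] Lm geodesic_borel(1) by (intro pair_measureI) simp_all
  hence B': "B' \<in> sets GG" using B(1) by (simp add: B'_def sets.Int)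
  have BTP: "B \<subseteq> transverse_pairs" using B(2) orbits_union[OF A(1)] by blast
  have "emeasure gcur (slice B l) = emeasure gcur (slice B' l)" if "l \<in> L" for l
  proof -
   have "slice B l = slice B' l" using that BTP TP_geo by (auto simp: slice_def B'_def)
   thus ?thesis by simp
  qed
  hence "emeasure M B = emeasure M B'" unfolding emeasure_M[OF B(1)] emeasure_M[OF B'] by (intro arg_cong2[of _ _ _ _ "(*)"] nn_integral_cong) simp_all
  also have "\<dots> <= emeasure M (D p \<inter> \<Union>A)"
  proof (rule transport_le[of _ _ _ \<Gamma> pair_act])
   show "D p \<inter> \<Union>A \<in> sets M" "B' \<in> sets M" "countable \<Gamma>" using DA B' countable_\<Gamma> by (simp_all add: sets_M)
  next
   fix f assume f: "f \<in> \<Gamma>"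
   have "{w \<in> B'. pair_act f w \<in> D p \<inter> \<Union>A} = B' \<inter> (pair_act f -` (D p \<inter> \<Union>A) \<inter> space GG)"
    using GG_sub[OF B'] by (auto simp: GG_def space_pair_measure geodesic_borel(1))
   moreover have "pair_act f -` (D p \<inter> \<Union>A) \<inter> space GG \<in> sets GG"
    using measurable_sets[OF pair_act_measurable[OF f], of "D p \<inter> \<Union>A"] DA by (simp only: sets_M)
   ultimately show "{w \<in> B'. pair_act f w \<in> D p \<inter> \<Union>A} \<in> sets M" using B' by (simp add: sets_M sets.Int)
  next
   fix f S assume f: "f \<in> \<Gamma>" "S \<in> sets M"
   thus "pair_act f ` S \<in> sets M \<and> emeasure M (pair_act f ` S) = emeasure M S"
    using pair_act_sets[OF f(1), of S] M_invariant[OF f(1), of S] by (simp add: sets_M)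
  next
   fix w assume w: "w \<in> B'"
   hence wA: "w \<in> \<Union>A" "w \<in> transverse_pairs" "snd w \<in> L" using B(2) BTP by (auto simp: B'_def)
   have wg: "w \<in> geodesics \<times> geodesics" using wA(2) TP_geo by blast
   obtain h where h: "h \<in> \<Gamma>" "snd w = h ` ax" using wA(3) by (auto simp: L_def)
   define v where "v = pair_act (inv\<Gamma> h) w"
   have v: "v \<in> transverse_pairs" "snd v = ax"
    using TP_act[OF wA(2) inv_in[OF h(1)]] h(2) action_bij(2)[OF h(1) ax_geo] by (simp_all add: v_def pair_act_def)
   hence "(fst v, ax) = v" by (simp add: prod_eq_iff)
   then obtain f where f: "f \<in> \<Gamma>" "pair_act f v \<in> D p" using D_cover[OF p, of "fst v"] v(1) by metis
   have "pair_act (f \<odot> inv\<Gamma> h) w = pair_act f v" using pair_act_mult[OF f(1) inv_in[OF h(1)] wg] by (simp add: v_def)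
   moreover have fh: "f \<odot> inv\<Gamma> h \<in> \<Gamma>" using f h by (simp add: mult_in inv_in)
   moreover have "pair_act (f \<odot> inv\<Gamma> h) w \<in> \<Union>A"
   proof -
    have "pair_orbit \<Gamma> (pair_act (f \<odot> inv\<Gamma> h) w) = pair_orbit \<Gamma> w" by (rule pair_orbit_act[OF wg fh])
    thus ?thesis using TP_act[OF wA(2) fh] wA(1) unfolding orbits_union[OF A(1)] by simp
   qed
   ultimately show "\<exists>i\<in>\<Gamma>. pair_act i w \<in> D p \<inter> \<Union>A" using f(2) by (metis IntI)
  next
   fix w w' f f' assume h: "w \<in> B'" "w' \<in> B'" "f \<in> \<Gamma>" "f' \<in> \<Gamma>" "pair_act f w = pair_act f' w'"
   have "w \<in> geodesics \<times> geodesics" "w' \<in> geodesics \<times> geodesics" using h(1,2) GG_sub[OF B'] by blast+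
   hence "pair_orbit \<Gamma> w = pair_orbit \<Gamma> w'" using pair_orbit_act[of w f] pair_orbit_act[of w' f'] h(3-5) by simp
   thus "w = w'" using inj_onD[OF B(3)] h(1,2) by (simp add: B'_def)
  qed
  finally show "emeasure M B <= emeasure M (D p \<inter> \<Union>A)" .
 qed
qed

text \<open>Once the supremum is known to be the mass of the part of \<open>D p\<close> over
  \<open>A\<close>, the set function in \<open>quotient_measure\<close> is countably additive. So
  \<open>measure_of\<close> does not fall back to its default 0, and the value at the set of all
  orbits can be read off.\<close>

lemma intersection_axis:
 assumes p: "r < p" "p < s"
 shows "intersection_form \<Gamma> gcur \<eta> = of_nat m * emeasure \<nu> ({p..<G p} \<times> {s<..<r + 2 * pi})"
proof -
 define \<A> where "\<A> = {A. A \<subseteq> orbits \<and> \<Union>A \<in> sets M}"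
 define \<mu> where "\<mu> A = (SUP B\<in>{B \<in> sets M. B \<subseteq> \<Union>A \<and> inj_on (pair_orbit \<Gamma>) B}. emeasure M B)" for A
 have mu: "\<mu> A = emeasure M (D p \<inter> \<Union>A)" if "A \<in> \<A>" for A
  using section_mass[OF p, of A] that by (simp add: \<mu>_def \<A>_def)
 have TPM: "transverse_pairs \<in> sets M" using TP_sets by (simp add: sets_M)
 have U: "\<Union>orbits = transverse_pairs" unfolding orbits_union[OF order_refl] by (auto simp: orbits_def)
 have sa: "sigma_algebra orbits \<A>"
  unfolding sigma_algebra_iff2
 proof (intro conjI ballI allI impI)
  show "\<A> \<subseteq> Pow orbits" by (auto simp: \<A>_def)
  show "{} \<in> \<A>" by (simp add: \<A>_def)
 next
  fix A assume "A \<in> \<A>"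
  hence A: "A \<subseteq> orbits" "\<Union>A \<in> sets M" by (auto simp: \<A>_def)
  have "\<Union>(orbits - A) = transverse_pairs - \<Union>A"
   unfolding orbits_union[OF A(1)] orbits_union[OF Diff_subset] by (auto simp: orbits_def)
  thus "orbits - A \<in> \<A>" using A(2) TPM by (auto simp: \<A>_def sets.Diff)
 next
  fix A :: "nat => _" assume A: "range A \<subseteq> \<A>"
  have "\<Union>(\<Union>i. A i) = (\<Union>i. \<Union>(A i))" by blast
  moreover have "(\<Union>i. \<Union>(A i)) \<in> sets M" using A by (intro sets.countable_UN) (auto simp: \<A>_def)
  ultimately show "(\<Union>i. A i) \<in> \<A>" using A by (auto simp: \<A>_def)
 qed
 have DM: "D p \<in> sets M" using D_sets[OF p] by (simp add: sets_M)
 have pos: "positive \<A> \<mu>" using mu[of "{}"] by (simp add: positive_def \<A>_def)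
 have ca: "countably_additive \<A> \<mu>"
  unfolding countably_additive_def
 proof (intro allI impI)
  fix A :: "nat => _" assume A: "range A \<subseteq> \<A>" "disjoint_family A" "(\<Union>i. A i) \<in> \<A>"
  have Ai: "A i \<subseteq> orbits" "\<Union>(A i) \<in> sets M" "A i \<in> \<A>" for i using A(1) by (auto simp: \<A>_def)
  have "(\<Sum>i. \<mu> (A i)) = (\<Sum>i. emeasure M (D p \<inter> \<Union>(A i)))" using mu Ai(3) by simp
  also have "\<dots> = emeasure M (\<Union>i. D p \<inter> \<Union>(A i))"
  proof (rule suminf_emeasure)
   show "range (\<lambda>i. D p \<inter> \<Union>(A i)) \<subseteq> sets M" using DM Ai(2) by auto
   show "disjoint_family (\<lambda>i. D p \<inter> \<Union>(A i))"
    using A(2) unfolding disjoint_family_on_def orbits_union[OF Ai(1)] by blast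
  qed
  also have "(\<Union>i. D p \<inter> \<Union>(A i)) = D p \<inter> \<Union>(\<Union>i. A i)" by blast
  also have "emeasure M \<dots> = \<mu> (\<Union>i. A i)" using mu[OF A(3)] by simp
  finally show "(\<Sum>i. \<mu> (A i)) = \<mu> (\<Union>i. A i)" .
 qed
 have oA: "orbits \<in> \<A>" using U TPM by (simp add: \<A>_def)
 have "intersection_form \<Gamma> gcur \<eta> = emeasure (measure_of orbits \<A> \<mu>) orbits"
  unfolding intersection_form_def quotient_measure_def M_def[symmetric] orbits_def[symmetric] \<A>_def \<mu>_def ..
 also have "\<dots> = \<mu> orbits" by (rule emeasure_measure_of_sigma[OF sa pos ca oA])
 also have "\<dots> = emeasure M (D p)" using mu[OF oA] U D_TP[OF p] by (simp add: Int_absorb2)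
 finally show ?thesis using emeasure_D[OF p] by (simp add: R_def J_def)
qed

end

section \<open>The current of a positive representation\<close>

lemma quadruple_wedge2_nonzero:
 fixes E F G H :: "nat => ('f::linordered_field ^ 'n::finite) set"
 assumes fl: "is_flag E" "is_flag F" "is_flag G" "is_flag H" and pos: "positive_quadruple E F G H" and k: "k <= CARD('n)"
 shows "wedge2 k E G ~= 0" "wedge2 k F H ~= 0" "wedge2 k E H ~= 0" "wedge2 k F G ~= 0"
proof -
 have m: "k + (CARD('n) - k) = CARD('n)" using k by simp
 have "quad_wedge E F G H a b c d ~= 0" if "a + b + c + d = CARD('n)" for a b c d
  using positive_quadruple_gauge[OF fl pos] that by (metis less_irrefl mult_zero_right)
 thus "wedge2 k E G ~= 0" "wedge2 k F H ~= 0" "wedge2 k E H ~= 0" "wedge2 k F G ~= 0"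
  unfolding wedge2_quad[OF fl m] using m by simp_all
qed

locale pos_rep = surface \<Gamma> + valued \<upsilon>
 for \<Gamma> and \<upsilon> :: "'f::linordered_field => ereal" +
 fixes \<rho> :: "(complex => complex) => ('f ^ 'n::finite ^ 'n) set"
  and \<xi> :: "complex => nat => ('f ^ 'n) set" and k :: nat
 assumes n: "CARD('n) \<ge> 2" and k: "k \<in> {1..CARD('n) - 1}"
  and hom: "\<rho> \<in> hom (pi1 \<Gamma>) PSL" and pm: "positive_map (Fix \<Gamma>) \<xi>"
  and equivariant: "\<And>f x. f \<in> \<Gamma> ==> x \<in> Fix \<Gamma> ==> \<xi> (f x) = flag_act (\<rho> f) (\<xi> x)"
begin

definition X where "X = {\<theta>. cis \<theta> \<in> Fix \<Gamma>}"
text \<open>With logarithms of norms of wedges, \<open>c0\<close> becomes the logarithm of the norm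
  of the cross ratio. As an alternating sum of values of \<open>V\<close> it is additive in both
  variables by its form alone.\<close>

definition V where "V b a = ln (nv (wedge2 k (\<xi> (cis b)) (\<xi> (cis a))))"
definition c0 where "c0 x1 x2 y1 y2 = V y2 x2 + V y1 x1 - V y2 x1 - V y1 x2"

text \<open>Symmetrised, because \<open>V\<close> depends on the order of its arguments while geodesics are unoriented.\<close>

definition c where "c x1 x2 y1 y2 = (c0 x1 x2 y1 y2 + c0 y1 y2 (x1 + 2 * pi) (x2 + 2 * pi)) / 2"

lemma kn: "k <= CARD('n)" using k by auto

lemma [simp]: "cis (x + 2 * pi) = cis x"
 by (simp add: cis_mult[symmetric])

lemma X_shift: "x + 2 * pi \<in> X \<longleftrightarrow> x \<in> X"
 by (simp add: X_def)

lemma V_shift: "V (b + 2 * pi) a = V b a" "V b (a + 2 * pi) = V b a"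
 by (simp_all add: V_def)

lemma flagX: "x \<in> X ==> is_flag (\<xi> (cis x))"
 using pm by (simp add: X_def positive_map_def)

text \<open>Increasing angles run counterclockwise while positivity refers to the clockwise order,
  hence the reversed list.\<close>

lemma quadX:
 assumes "{x1, x2, y1, y2} \<subseteq> X" "x1 < x2" "x2 < y1" "y1 < y2" "y2 < x1 + 2 * pi"
 shows "positive_quadruple (\<xi> (cis y2)) (\<xi> (cis y1)) (\<xi> (cis x2)) (\<xi> (cis x1))"
proof -
 have "clockwise4 (cis y2) (cis y1) (cis x2) (cis x1)"
  unfolding clockwise4_def using assms by (intro exI[of _ y2] exI[of _ y1] exI[of _ x2] exI[of _ x1]) simp
 thus ?thesis using pm assms(1) by (simp add: positive_map_def X_def)
qed

lemma c0_cross_ratio: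
 assumes x: "{x1, x2, y1, y2} \<subseteq> X" "x1 < x2" "x2 < y1" "y1 < y2" "y2 < x1 + 2 * pi"
 shows "c0 x1 x2 y1 y2 = ln (nv (cross_ratio k (\<xi> (cis y2)) (\<xi> (cis y1)) (\<xi> (cis x2)) (\<xi> (cis x1))))"
  "0 <= c0 x1 x2 y1 y2"
proof -
 have fl: "is_flag (\<xi> (cis y2))" "is_flag (\<xi> (cis y1))" "is_flag (\<xi> (cis x2))" "is_flag (\<xi> (cis x1))"
  using flagX x(1) by simp_all
 note q = quadX[OF x]
 note w = quadruple_wedge2_nonzero[OF fl q kn, THEN nv_pos]
 show e: "c0 x1 x2 y1 y2 = ln (nv (cross_ratio k (\<xi> (cis y2)) (\<xi> (cis y1)) (\<xi> (cis x2)) (\<xi> (cis x1))))"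
 proof -
  have "ln (a * b / (d * e)) = ln a + ln b - ln d - ln e" if "0 < a" "0 < b" "0 < d" "0 < e" for a b d e :: real
   using that by (simp add: ln_div ln_mult)
  thus ?thesis unfolding cross_ratio_def nv_divide nv_mult c0_def V_def using w by presburger
 qed
 show "0 <= c0 x1 x2 y1 y2" unfolding e using nv_ge_1[OF cross_ratio_ge_1[OF fl q kn]] by (rule ln_ge_zero)
qed

lemma c0_degenerate: "c0 x x y1 y2 = 0" "c0 x1 x2 y y = 0"
 by (simp_all add: c0_def)

lemma c0_nonneg:
 assumes "{x1, x2, y1, y2} \<subseteq> X" "x1 <= x2" "x2 < y1" "y1 <= y2" "y2 < x1 + 2 * pi"
 shows "0 <= c0 x1 x2 y1 y2"
 using assms c0_cross_ratio(2)[of x1 x2 y1 y2] c0_degenerate by (cases "x1 = x2 \<or> y1 = y2") auto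

lemma rho_PSL: "f \<in> \<Gamma> ==> \<rho> f \<in> carrier PSL"
 using hom by (auto simp: hom_def)

lemma rho_lift: "f \<in> \<Gamma> ==> (SOME A. A \<in> \<rho> f) \<in> \<rho> f" "f \<in> \<Gamma> ==> det (SOME A. A \<in> \<rho> f) = 1"
 using PSL_nonempty[OF rho_PSL] PSL_lift_det[OF rho_PSL] by blast+

lemma lift_X: "f \<in> \<Gamma> ==> is_lift f F ==> x \<in> X ==> F x \<in> X"
 using Fix_invariant by (simp add: X_def is_lift_def)

lemma lift_xi: "f \<in> \<Gamma> ==> is_lift f F ==> x \<in> X ==> \<xi> (cis (F x)) = mat_flag (SOME A. A \<in> \<rho> f) (\<xi> (cis x))"
 using equivariant[of f "cis x"] by (simp add: X_def is_lift_def flag_act_eq)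

lemma c0_invariant:
 assumes f: "f \<in> \<Gamma>" "is_lift f F" and x: "{x1, x2, y1, y2} \<subseteq> X" "x1 <= x2" "x2 < y1" "y1 <= y2" "y2 < x1 + 2 * pi"
 shows "c0 (F x1) (F x2) (F y1) (F y2) = c0 x1 x2 y1 y2"
proof (cases "x1 = x2 \<or> y1 = y2")
 case True
 thus ?thesis using c0_degenerate by auto
next
 case False
 hence l: "x1 < x2" "x2 < y1" "y1 < y2" "y2 < x1 + 2 * pi" using x by auto
 have sm: "strict_mono F" and per: "F (x1 + 2 * pi) = F x1 + 2 * pi" using f(2) by (simp_all add: is_lift_def)
 have l': "F x1 < F x2" "F x2 < F y1" "F y1 < F y2" "F y2 < F x1 + 2 * pi"
  using l unfolding per[symmetric] by (simp_all add: strict_mono_less[OF sm])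
 have X': "{F x1, F x2, F y1, F y2} \<subseteq> X" using x(1) lift_X[OF f] by simp
 have fl: "is_flag (\<xi> (cis y2))" "is_flag (\<xi> (cis y1))" "is_flag (\<xi> (cis x2))" "is_flag (\<xi> (cis x1))"
  using flagX x(1) by simp_all
 have "det (SOME A. A \<in> \<rho> f) ~= 0" using rho_lift(2)[OF f(1)] by simp
 from cross_ratio_mat_flag[OF this fl kn] show ?thesis
  unfolding c0_cross_ratio(1)[OF x(1) l] c0_cross_ratio(1)[OF X' l'] using lift_xi[OF f] x(1) by simp
qed

lemma c_invariant:
 assumes f: "f \<in> \<Gamma>" "is_lift f F" and x: "{x1, x2, y1, y2} \<subseteq> X" "x1 <= x2" "x2 < y1" "y1 <= y2" "y2 < x1 + 2 * pi"
 shows "c (F x1) (F x2) (F y1) (F y2) = c x1 x2 y1 y2"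
proof -
 have per: "F (x + 2 * pi) = F x + 2 * pi" for x using f(2) by (simp add: is_lift_def)
 have "{y1, y2, x1 + 2 * pi, x2 + 2 * pi} \<subseteq> X" using x(1) X_shift by simp
 hence "c0 (F y1) (F y2) (F (x1 + 2 * pi)) (F (x2 + 2 * pi)) = c0 y1 y2 (x1 + 2 * pi) (x2 + 2 * pi)"
  using x by (intro c0_invariant[OF f]) auto
 thus ?thesis using c0_invariant[OF f x] by (simp add: c_def per)
qed

lemma c_add: "c x1 x2 y1 y2 + c x2 x3 y1 y2 = c x1 x3 y1 y2" "c x1 x2 y1 y2 + c x1 x2 y2 y3 = c x1 x2 y1 y3"
proof -
 have "c0 x1 x2 y1 y2 + c0 x2 x3 y1 y2 = c0 x1 x3 y1 y2" "c0 x1 x2 y1 y2 + c0 x1 x2 y2 y3 = c0 x1 x2 y1 y3" for x1 x2 x3 y1 y2 y3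
  by (simp_all add: c0_def)
 from this(1)[of x1 x2 y1 y2 x3] this(2)[of y1 y2 "x1 + 2 * pi" "x2 + 2 * pi" "x3 + 2 * pi"]
  this(2)[of x1 x2 y1 y2 y3] this(1)[of y1 y2 "x1 + 2 * pi" "x2 + 2 * pi" y3]
 show "c x1 x2 y1 y2 + c x2 x3 y1 y2 = c x1 x3 y1 y2" "c x1 x2 y1 y2 + c x1 x2 y2 y3 = c x1 x2 y1 y3"
  unfolding c_def by (simp_all add: field_simps)
qed

sublocale SC: strip_content X c
proof
 have "X = (\<Union>x\<in>Fix \<Gamma>. {\<theta>. cis \<theta> = x})" by (auto simp: X_def)
 moreover have "countable {\<theta>. cis \<theta> = x}" for x
 proof (cases "\<exists>u. x = cis u")
  case True
  then obtain u where "x = cis u" by blast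
  hence "{\<theta>. cis \<theta> = x} \<subseteq> range (\<lambda>k::int. u + 2 * pi * k)" using cis_eq_iff by auto
  thus ?thesis by (rule countable_subset) simp
 next
  case False
  hence e: "{\<theta>. cis \<theta> = x} = {}" by auto
  show ?thesis unfolding e by simp
 qed
 ultimately show "countable X" using countable_Fix by simp
 show "\<exists>x\<in>X. a < x \<and> x < b" if "a < b" for a b using Fix_dense[OF that] by (auto simp: X_def)
 show "c x1 x2 y1 y2 + c x2 x3 y1 y2 = c x1 x3 y1 y2" for x1 x2 x3 y1 y2 by (rule c_add(1))
 show "c x1 x2 y1 y2 + c x1 x2 y2 y3 = c x1 x2 y1 y3" for x1 x2 y1 y2 y3 by (rule c_add(2))
 fix x1 x2 y1 y2 assume x: "{x1, x2, y1, y2} \<subseteq> X" "x1 <= x2" "x2 < y1" "y1 <= y2" "y2 < x1 + 2 * pi"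
 have "{y1, y2, x1 + 2 * pi, x2 + 2 * pi} \<subseteq> X" using x(1) X_shift by simp
 hence "0 <= c0 y1 y2 (x1 + 2 * pi) (x2 + 2 * pi)" using x by (intro c0_nonneg) auto
 thus "0 <= c x1 x2 y1 y2" using c0_nonneg[OF x] by (simp add: c_def)
qed

lemma validD: "SC.valid x1 x2 y1 y2 ==> {x1, x2, y1, y2} \<subseteq> X \<and> x1 <= x2 \<and> x2 < y1 \<and> y1 <= y2 \<and> y2 < x1 + 2 * pi"
 by (simp add: SC.valid_def)

lemma lift_preimage: "f \<in> \<Gamma> ==> is_lift f F ==> x \<in> X ==> \<exists>y\<in>X. F y = x"
proof -
 assume f: "f \<in> \<Gamma>" "is_lift f F" and x: "x \<in> X"
 obtain y where y: "F y = x" using lift_surj[OF f(2)] by (metis surjD)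
 have "f (cis y) = cis x" using f(2) y unfolding is_lift_def by metis
 hence "cis y = inv\<Gamma> f (cis x)" using inv_apply(2)[OF f(1), of "cis y"] by simp
 hence "y \<in> X" using Fix_invariant[OF inv_in[OF f(1)], of "cis x"] x by (simp add: X_def)
 thus ?thesis using y by blast
qed

lemma strip_gstrip: "SC.strip = gstrip"
 by (simp add: SC.strip_def gstrip_def)

lemma current_data: "current_data \<Gamma> SC.strip_measure"
proof
 show "sets SC.strip_measure = sets borel" by simp
 show "emeasure SC.strip_measure (crect q1 q2 p1 p2) < \<infinity>"
  if "q1 <= q2" "q2 < p1" "p1 <= p2" "p2 < q1 + 2 * pi" for q1 q2 p1 p2 using SC.strip_measure_finite[OF that] .
 show "emeasure SC.strip_measure {p. (snd p, fst p + 2 * pi) \<in> S} = emeasure SC.strip_measure S"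
  if S: "S \<in> sets borel" "S \<subseteq> gstrip" for S
 proof (rule SC.strip_measure_swap)
  show "x - 2 * pi \<in> X" if "x \<in> X" for x using that X_shift[of "x - 2 * pi"] by simp
  show "c y1 y2 (x1 + 2 * pi) (x2 + 2 * pi) = c x1 x2 y1 y2" for x1 x2 y1 y2
   by (simp add: c_def c0_def V_shift)
 qed (use S strip_gstrip in auto)
 show "emeasure SC.strip_measure {p. (F (fst p), F (snd p)) \<in> S} = emeasure SC.strip_measure S"
  if f: "f \<in> \<Gamma>" "is_lift f F" and S: "S \<in> sets borel" "S \<subseteq> gstrip" for f F S
 proof (rule SC.strip_measure_invariant)
  show "continuous_on UNIV F" "strict_mono F" "\<And>x. F (x + 2 * pi) = F x + 2 * pi" using f(2) by (simp_all add: is_lift_def)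
  show "surj F" by (rule lift_surj[OF f(2)])
  show "\<exists>y\<in>X. F y = x" if "x \<in> X" for x by (rule lift_preimage[OF f that])
  show "c (F x1) (F x2) (F y1) (F y2) = c x1 x2 y1 y2" if "SC.valid x1 x2 y1 y2" for x1 x2 y1 y2
   using validD[OF that] by (intro c_invariant[OF f]) auto
 qed (use S strip_gstrip in auto)
qed

text \<open>The attracting endpoint \<open>s\<close> supplies \<open>E\<close>, whose steps are
  spanned by the eigenvectors of the largest eigenvalues in absolute value; the repelling endpoint
  \<open>r\<close> supplies \<open>H\<close>.\<close>

lemma flag_pair:
 assumes g: "\<gamma> \<in> \<Gamma>" "is_lift \<gamma> F" and rs: "r \<in> X" "s \<in> X" "p \<in> X" "F r = r" "F s = s"
  and l: "r < p" "p < F p" "F p < s" "s < r + 2 * pi"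
 shows "valued_fixed_flag_pair \<upsilon> (SOME A. A \<in> \<rho> \<gamma>) (\<xi> (cis s)) (\<xi> (cis (F p))) (\<xi> (cis p)) (\<xi> (cis r)) (\<rho> \<gamma>)"
proof
 show "det (SOME A. A \<in> \<rho> \<gamma>) = 1" "(SOME A. A \<in> \<rho> \<gamma>) \<in> \<rho> \<gamma>" using rho_lift[OF g(1)] by auto
 show "is_flag (\<xi> (cis s))" "is_flag (\<xi> (cis p))" "is_flag (\<xi> (cis r))" using flagX rs by auto
 show "mat_flag (SOME A. A \<in> \<rho> \<gamma>) (\<xi> (cis s)) = \<xi> (cis s)" "mat_flag (SOME A. A \<in> \<rho> \<gamma>) (\<xi> (cis r)) = \<xi> (cis r)"
  "\<xi> (cis (F p)) = mat_flag (SOME A. A \<in> \<rho> \<gamma>) (\<xi> (cis p))"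
  using lift_xi[OF g rs(2)] lift_xi[OF g rs(1)] lift_xi[OF g rs(3)] rs(4,5) by simp_all
 show "positive_quadruple (\<xi> (cis s)) (\<xi> (cis (F p))) (\<xi> (cis p)) (\<xi> (cis r))"
  using quadX[of r p "F p" s] lift_X[OF g rs(3)] rs l by simp
 show "2 <= CARD('n)" by (rule n)
 show "\<rho> \<gamma> \<in> carrier PSL" by (rule rho_PSL[OF g(1)])
qed

text \<open>The intersection number is \<open>m\<close> times the mass of one period of the
  generator. Additivity turns \<open>m\<close> such periods into one period of \<gamma>, where both
  summands of the symmetrised content equal the logarithm of the norm of
  \<open>ev_low k / ev_high k\<close>. The conclusions on zero measures and zero currents come from
  the same formula.\<close>

lemma length_data:
 assumes g: "\<gamma> \<in> \<Gamma>" "\<gamma> ~= one\<Gamma>"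
 obtains A E F G H where "valued_fixed_flag_pair \<upsilon> A E F G H (\<rho> \<gamma>)"
  "\<And>\<nu>. current_data \<Gamma> \<nu> ==> emeasure \<nu> UNIV = 0 ==> intersection_form \<Gamma> (current_data.gcur \<nu>) (curve_current \<Gamma> \<gamma>) = 0"
  "enn2ereal (intersection_form \<Gamma> (current_data.gcur SC.strip_measure) (curve_current \<Gamma> \<gamma>)) = k_length \<upsilon> k (\<rho> \<gamma>)"
  "emeasure (current_data.gcur SC.strip_measure) geodesics = 0 ==> intersection_form \<Gamma> (current_data.gcur SC.strip_measure) (curve_current \<Gamma> \<gamma>) = 0"
proof -
 obtain t m G r s where d: "t \<in> \<Gamma>" "t ~= one\<Gamma>" "m > 0" "\<gamma> = t [^]\<^bsub>pi1 \<Gamma>\<^esub> (m::nat)" "power_multiplicity \<Gamma> \<gamma> = m"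
  "is_lift t G" "r < s" "s < r + 2 * pi" "G r = r" "G s = s" "cis r \<in> Fix \<Gamma>" "cis s \<in> Fix \<Gamma>"
  "\<And>x. r < x ==> x < s ==> x < G x"
  "\<And>f. f \<in> \<Gamma> ==> f ` geo (cis r) (cis s) = geo (cis r) (cis s) ==> \<exists>k::int. f = t [^]\<^bsub>pi1 \<Gamma>\<^esub> k"
  "geodesic_lifts \<Gamma> \<gamma> = (\<lambda>f. f ` geo (cis r) (cis s)) ` \<Gamma>"
  by (rule axis_data[OF g]) (rule that)
 have ac: "axis_current \<Gamma> \<nu> t G r s" if "current_data \<Gamma> \<nu>" for \<nu>
  using that d(1,6-10,13,14) by (intro axis_current.intro axis_current_axioms.intro) auto
 have curve: "curve_current \<Gamma> \<gamma> = axis_current.\<eta> \<Gamma> r s m" if "current_data \<Gamma> \<nu>" for \<nu>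
 proof -
  interpret AC: axis_current \<Gamma> \<nu> t G r s m by (rule ac[OF that])
  show ?thesis unfolding curve_current_def AC.\<eta>_def AC.L_def AC.ax_def d(5,15) ..
 qed
 have rsX: "r \<in> X" "s \<in> X" "r + 2 * pi \<in> X" using d(11,12) X_shift by (simp_all add: X_def)
 obtain p where p: "p \<in> X" "r < p" "p < s" using SC.dense[OF d(7)] by blast
 have inter: "intersection_form \<Gamma> (current_data.gcur \<nu>) (curve_current \<Gamma> \<gamma>) = of_nat m * emeasure \<nu> ({p..<G p} \<times> {s<..<r + 2 * pi})"
  "emeasure (current_data.gcur \<nu>) geodesics = 0 ==> emeasure \<nu> ({p..<G p} \<times> {s<..<r + 2 * pi}) = 0" if cd: "current_data \<Gamma> \<nu>" for \<nu>
 proof -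
  interpret AC: axis_current \<Gamma> \<nu> t G r s m by (rule ac[OF cd])
  show "intersection_form \<Gamma> (current_data.gcur \<nu>) (curve_current \<Gamma> \<gamma>) = of_nat m * emeasure \<nu> ({p..<G p} \<times> {s<..<r + 2 * pi})"
   unfolding curve[OF cd] by (rule AC.intersection_axis[OF p(2,3)])
  assume z: "emeasure (current_data.gcur \<nu>) geodesics = 0"
  have "emeasure AC.gcur (gq ` AC.R p) <= emeasure AC.gcur (space AC.gcur)" by (rule emeasure_space)
  hence "emeasure AC.gcur (gq ` AC.R p) = 0" using z AC.gcur(2) by simp
  thus "emeasure \<nu> ({p..<G p} \<times> {s<..<r + 2 * pi}) = 0"
   using AC.gcur_R[OF p(2,3)] by (simp add: AC.R_def AC.J_def)
 qed
 define F where "F = G ^^ m"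
 have Fl: "is_lift \<gamma> F" unfolding F_def d(4) by (rule lift_pow[OF d(1,6)])
 have Gcond: "continuous_on UNIV G" "strict_mono G" "surj G" "\<And>x. G (x + 2 * pi) = G x + 2 * pi"
  using d(6) lift_surj[OF d(6)] by (simp_all add: is_lift_def)
 have inv: "c (G x1) (G x2) (G y1) (G y2) = c x1 x2 y1 y2" if "SC.valid x1 x2 y1 y2" for x1 x2 y1 y2
  using validD[OF that] by (intro c_invariant[OF d(1,6)]) auto
 have period: "emeasure SC.strip_measure ({p..<G p} \<times> {s<..<r + 2 * pi}) = ennreal (c p (G p) s (r + 2 * pi))"
  "c p ((G ^^ i) p) s (r + 2 * pi) = real i * c p (G p) s (r + 2 * pi)" for i
  by (rule SC.period_measure[OF Gcond];
   (rule lift_preimage[OF d(1,6)] lift_X[OF d(1,6)] inv d(13) rsX d(7-10) p; assumption?))+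
 interpret AC: axis_current \<Gamma> SC.strip_measure t G r s m by (rule ac[OF current_data])
 have Frs: "F r = r" "F s = s" unfolding F_def by (rule AC.Gn)+
 have pF: "p < F p" "F p < s" using AC.Gn_step[OF p(2,3) d(3)] AC.Gn_bounds(2)[of m p] p(3) by (simp_all add: F_def)
 note fp = flag_pair[OF g(1) Fl rsX(1,2) p(1) Frs p(2) pF d(8)]
 interpret FP: valued_fixed_flag_pair \<upsilon> "SOME A. A \<in> \<rho> \<gamma>" "\<xi> (cis s)" "\<xi> (cis (F p))" "\<xi> (cis p)" "\<xi> (cis r)" "\<rho> \<gamma>"
  by (rule fp)
 define \<l> where "\<l> = ln (nv (FP.ev_low k / FP.ev_high k))"
 have FpX: "F p \<in> X" by (rule lift_X[OF g(1) Fl p(1)])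
 \<comment> \<open>The corners of this box carry the four flags of \<open>flag_pair\<close>, since
   \<open>cis\<close> ignores the shift of \<open>r\<close> by \<open>2 * pi\<close>; the second box
   below is its mirror image under the exchange of endpoints.\<close>
 have "c0 p (F p) s (r + 2 * pi) = \<l>"
  using c0_cross_ratio(1)[of p "F p" s "r + 2 * pi"] p rsX FpX pF d(7,8) FP.cross_ratio_period(1)[OF kn] by (simp add: \<l>_def)
 moreover have "c0 s (r + 2 * pi) (p + 2 * pi) (F p + 2 * pi) = \<l>"
  using c0_cross_ratio(1)[of s "r + 2 * pi" "p + 2 * pi" "F p + 2 * pi"] p rsX FpX pF d(7,8) FP.cross_ratio_period(2)[OF kn]
  by (simp add: \<l>_def X_shift)
 ultimately have "c p (F p) s (r + 2 * pi) = \<l>" by (simp add: c_def)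
 hence cl: "real m * c p (G p) s (r + 2 * pi) = \<l>" using period(2)[of m] by (simp add: F_def)
 have l0: "\<l> \<ge> 0" unfolding \<l>_def by (rule FP.period_nonneg[OF kn])
 have "of_nat m * emeasure SC.strip_measure ({p..<G p} \<times> {s<..<r + 2 * pi}) = ennreal \<l>"
 proof -
  have "0 <= c p (G p) s (r + 2 * pi)"
  proof (rule ccontr)
   assume "\<not> 0 <= c p (G p) s (r + 2 * pi)"
   hence "real m * c p (G p) s (r + 2 * pi) < 0" using d(3) by (simp add: mult_pos_neg)
   thus False using cl l0 by simp
  qed
  hence "of_nat m * ennreal (c p (G p) s (r + 2 * pi)) = ennreal (real m * c p (G p) s (r + 2 * pi))"
   by (simp add: ennreal_mult ennreal_of_nat_eq_real_of_nat)
  thus ?thesis unfolding period(1) cl .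
 qed
 hence main: "enn2ereal (intersection_form \<Gamma> (current_data.gcur SC.strip_measure) (curve_current \<Gamma> \<gamma>)) = k_length \<upsilon> k (\<rho> \<gamma>)"
  using inter(1)[OF current_data] FP.k_length_eq[OF k] l0 by (simp add: \<l>_def)
 show ?thesis
 proof (rule that[OF fp _ main])
  fix \<nu> assume cd: "current_data \<Gamma> \<nu>" and z: "emeasure \<nu> UNIV = 0"
  have "space \<nu> = UNIV" using sets_eq_imp_space_eq[OF current_data.sets_nu[OF cd]] by simp
  hence "emeasure \<nu> ({p..<G p} \<times> {s<..<r + 2 * pi}) = 0"
   using emeasure_space[of \<nu> "{p..<G p} \<times> {s<..<r + 2 * pi}"] z by simp
  thus "intersection_form \<Gamma> (current_data.gcur \<nu>) (curve_current \<Gamma> \<gamma>) = 0" using inter(1)[OF cd] by simp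
 next
  assume "emeasure (current_data.gcur SC.strip_measure) geodesics = 0"
  thus "intersection_form \<Gamma> (current_data.gcur SC.strip_measure) (curve_current \<Gamma> \<gamma>) = 0"
   using inter[OF current_data] by simp
 qed
qed

end

section \<open>The field as an extension of the reals\<close>

lemma of_real_strict_mono:
 assumes "a < b"
 shows "(of_real a :: 'f::{linordered_field, real_algebra_1}) < of_real b"
proof -
 \<comment> \<open>A positive real is a square, so its image in the field is a non-zero square and
   hence positive.\<close>
 define d where "d = sqrt (b - a)"
 have d: "b - a = d * d" "d ~= 0" using assms by (simp_all add: d_def)
 have "(of_real b :: 'f) - of_real a = of_real d * of_real d" using d(1) by (simp only: of_real_diff[symmetric] of_real_mult)
 also have "\<dots> > 0" using d(2) by (simp add: zero_less_mult_iff linorder_neq_iff[symmetric])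
 finally show ?thesis by simp
qed

lemma of_real_less_iff: "(of_real a :: 'f::{linordered_field, real_algebra_1}) < of_real b \<longleftrightarrow> a < b"
 using of_real_strict_mono[of a b, where 'f = 'f] of_real_strict_mono[of b a, where 'f = 'f] by (cases a b rule: linorder_cases) auto

text \<open>In an Archimedean field every element is the image of the supremum of the reals below
  it: the difference is smaller than every positive real, hence 0. Without an infinite element the
  reals would therefore be the whole field.\<close>

lemma infinite_element:
 assumes "\<not> surj (of_real :: real => 'f::{linordered_field, real_algebra_1})"
 shows "\<exists>y::'f. \<forall>n::nat. of_nat n < y"
proof (rule ccontr)
 assume "\<not> (\<exists>y::'f. \<forall>n::nat. of_nat n < y)"
 hence arch: "\<exists>n::nat. y <= of_nat n" for y :: 'f by (auto simp: not_less)
 note mono = of_real_less_iff[where 'f = 'f]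
 have "x \<in> range of_real" for x :: 'f
 proof -
  define S where "S = {r::real. of_real r <= x}"
  obtain n where n: "x <= of_nat n" using arch by blast
  obtain m where m: "- x <= of_nat m" using arch by blast
  have "- real m \<in> S" using m by (simp add: S_def minus_le_iff)
  hence ne: "S ~= {}" by blast
  have "r <= real n" if "r \<in> S" for r
  proof (rule ccontr)
   assume "\<not> r <= real n"
   hence "(of_real (real n) :: 'f) < of_real r" by (simp only: mono not_le)
   thus False using that n by (simp add: S_def)
  qed
  hence bd: "bdd_above S" by (rule bdd_aboveI)
  define s where "s = Sup S"
  have up: "of_real (s - e) <= x" if "e > 0" for e
  proof -
   have "s - e < Sup S" using that by (simp add: s_def)
   then obtain r where "r \<in> S" "s - e < r" using less_cSup_iff[OF ne bd] by blast
   thus ?thesis using mono[of "s - e" r] by (simp add: S_def del: of_real_diff)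
  qed
  have dn: "x <= of_real (s + e)" if "e > 0" for e
  proof (rule ccontr)
   assume "\<not> x <= of_real (s + e)"
   hence "s + e \<in> S" by (simp add: S_def)
   hence "s + e <= s" unfolding s_def by (rule cSup_upper[OF _ bd])
   thus False using that by simp
  qed
  have "x = of_real s"
  proof (rule ccontr)
   assume "x ~= of_real s"
   hence d: "0 < \<bar>x - of_real s\<bar>" by simp
   obtain j where j: "inverse \<bar>x - of_real s\<bar> <= of_nat j" using arch by blast
   have small: "\<bar>x - of_real s\<bar> <= of_real e" if "e > 0" for e
    using up[OF that] dn[OF that] by (simp add: abs_le_iff algebra_simps)
   have j1: "(of_nat j :: 'f) < of_real (real j + 1)" by simp
   have "inverse \<bar>x - of_real s\<bar> < of_real (real j + 1)" using j j1 by (rule le_less_trans)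
   hence "inverse (of_real (real j + 1)) < \<bar>x - of_real s\<bar>"
    using d by (metis inverse_inverse_eq inverse_less_imp_less inverse_positive_iff_positive less_imp_inverse_less)
   moreover have "\<bar>x - of_real s\<bar> <= of_real (inverse (real j + 1))" by (rule small) simp
   ultimately have "inverse (of_real (real j + 1)) < (of_real (inverse (real j + 1)) :: 'f)" by (rule less_le_trans)
   moreover have "of_real (real j + 1) * of_real (inverse (real j + 1)) = (1 :: 'f)"
    unfolding of_real_mult[symmetric] by simp
   hence e: "inverse (of_real (real j + 1)) = (of_real (inverse (real j + 1)) :: 'f)" by (rule inverse_unique)
   ultimately show False by simp
  qed
  thus ?thesis by blast
 qed
 thus False using assms by blast
qed

text \<open>All powers of \<open>N\<close> stay below the infinite element \<open>y\<close>, so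
  their norms are bounded by that of \<open>y\<close>; a norm above 1 would have unbounded
  powers.\<close>

lemma (in valued) nv_nat_le_1:
 fixes y :: 'f
 assumes "\<And>n::nat. of_nat n < y" and "N > 0"
 shows "nv (of_nat N) <= 1"
proof (rule ccontr)
 assume "\<not> nv (of_nat N) <= 1"
 then obtain j where j: "nv y < nv (of_nat N) ^ j" using real_arch_pow[of "nv (of_nat N)" "nv y"] by auto
 have "(0::'f) < of_nat (N ^ j)" using assms(2) by simp
 hence "nv (of_nat (N ^ j)) <= nv y" by (rule nv_mono) (rule less_imp_le[OF assms(1)])
 thus False using j by (simp add: nv_power)
qed

context pos_rep
begin

text \<open>The identity has no axis, so its trace is computed directly: a lift \<open>A\<close>
  satisfies \<open>A ** A = A\<close> or \<open>A ** A = - A\<close>, hence is plus or minus the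
  identity.\<close>

lemma abs_trace_one: "abs_trace (\<rho> one\<Gamma>) = of_nat CARD('n)"
proof -
 define A where "A = (SOME A. A \<in> \<rho> one\<Gamma>)"
 have A: "A \<in> \<rho> one\<Gamma>" "det A = 1" using rho_lift[OF one_in] by (simp_all add: A_def)
 interpret group "pi1 \<Gamma>" by (rule group_pi1)
 have "\<rho> (one\<Gamma> \<odot> one\<Gamma>) = \<rho> one\<Gamma> \<otimes>\<^bsub>PSL\<^esub> \<rho> one\<Gamma>" using one_in by (intro hom_mult[OF hom]) simp_all
 moreover have "one\<Gamma> \<odot> one\<Gamma> = one\<Gamma>" using one_in by (intro r_one) simp
 ultimately have "\<rho> one\<Gamma> = \<rho> one\<Gamma> \<otimes>\<^bsub>PSL\<^esub> \<rho> one\<Gamma>" by (simp only:)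
 hence "\<rho> one\<Gamma> = \<rho> one\<Gamma> <#>\<^bsub>SL\<^esub> \<rho> one\<Gamma>" by (simp add: PSL_def FactGroup_def)
 hence "A ** A \<in> \<rho> one\<Gamma>" using A(1) by (auto simp: set_mult_def SL_def)
 hence "A ** A = A \<or> A ** A = - A" using PSL_lift_unique[OF rho_PSL[OF one_in] n A(1)] by blast
 moreover have "invertible A" using A(2) by (simp add: invertible_det_nz)
 then obtain B where B: "A ** B = mat 1" by (auto simp: invertible_def)
 have "A = (A ** A) ** B" by (simp add: matrix_mul_assoc[symmetric] B)
 ultimately have "A = A ** B \<or> A = (- A) ** B" by metis
 moreover have "(- A) ** B = - (A ** B)" by (simp add: vec_eq_iff matrix_matrix_mult_def sum_negf)
 ultimately have "A = mat 1 \<or> A = - mat 1" by (simp add: B)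
 hence "trace A = of_nat CARD('n) \<or> trace A = - of_nat CARD('n)" by (auto simp: trace_def mat_def sum_negf)
 thus ?thesis unfolding abs_trace_def A_def[symmetric] by auto
qed

lemma null_current_data: "current_data \<Gamma> (null_measure borel)"
 by unfold_locales simp_all

end

theorem theorem1p9:
  fixes \<Gamma> :: "(complex \<Rightarrow> complex) set"
    and \<upsilon> :: "'f::{real_closed_field, real_algebra_1} \<Rightarrow> ereal"
    and \<rho> :: "(complex \<Rightarrow> complex) \<Rightarrow> ('f ^ 'n::finite ^ 'n) set"
  assumes n: "CARD('n) \<ge> 2"
    and surface: "closed_surface_group \<Gamma>"
    and val: "valuation \<upsilon>" "order_compatible \<upsilon>"
    and real_case: "surj (of_real :: real \<Rightarrow> 'f) \<Longrightarrow>
      \<forall>r::real. r \<noteq> 0 \<longrightarrow> \<upsilon> (of_real r) = ereal (- ln \<bar>r\<bar>)"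
    and pos: "positive_representation \<Gamma> \<rho>"
  shows "\<forall>k\<in>{1..CARD('n) - 1}. \<exists>\<mu>. geodesic_current \<Gamma> \<mu> \<and>
      (\<forall>\<gamma>\<in>\<Gamma>. \<gamma> \<noteq> \<one>\<^bsub>pi1 \<Gamma>\<^esub> \<longrightarrow>
        enn2ereal (intersection_form \<Gamma> \<mu> (curve_current \<Gamma> \<gamma>)) = k_length \<upsilon> k (\<rho> \<gamma>)) \<and>
      (emeasure \<mu> (space \<mu>) \<noteq> 0 \<longleftrightarrow> (\<exists>\<gamma>\<in>\<Gamma>. \<upsilon> (abs_trace (\<rho> \<gamma>)) < 0))"
proof
 fix k assume k: "k \<in> {1..CARD('n) - 1}"
 obtain \<xi> where \<xi>: "positive_map (Fix \<Gamma>) \<xi>" "\<And>f x. f \<in> \<Gamma> ==> x \<in> Fix \<Gamma> ==> \<xi> (f x) = flag_act (\<rho> f) (\<xi> x)"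
  and hom: "\<rho> \<in> hom (pi1 \<Gamma>) PSL"
  using pos unfolding positive_representation_def by blast
 interpret PR: pos_rep \<Gamma> \<upsilon> \<rho> \<xi> k
  by unfold_locales (use n surface val k \<xi> hom in auto)
 show "\<exists>\<mu>. geodesic_current \<Gamma> \<mu> \<and>
   (\<forall>\<gamma>\<in>\<Gamma>. \<gamma> ~= \<one>\<^bsub>pi1 \<Gamma>\<^esub> \<longrightarrow>
    enn2ereal (intersection_form \<Gamma> \<mu> (curve_current \<Gamma> \<gamma>)) = k_length \<upsilon> k (\<rho> \<gamma>)) \<and>
   (emeasure \<mu> (space \<mu>) ~= 0 \<longleftrightarrow> (\<exists>\<gamma>\<in>\<Gamma>. \<upsilon> (abs_trace (\<rho> \<gamma>)) < 0))"
 \<comment> \<open>The split by lengths decides which current is taken; in each case the trace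
   criterion is then compared with its total mass.\<close>
 proof (cases "\<exists>\<gamma>\<in>\<Gamma>. \<gamma> ~= \<one>\<^bsub>pi1 \<Gamma>\<^esub> \<and> k_length \<upsilon> k (\<rho> \<gamma>) ~= 0")
  case True
  then obtain \<gamma>0 where g0: "\<gamma>0 \<in> \<Gamma>" "\<gamma>0 ~= \<one>\<^bsub>pi1 \<Gamma>\<^esub>" "k_length \<upsilon> k (\<rho> \<gamma>0) ~= 0" by blast
  interpret CD: current_data \<Gamma> PR.SC.strip_measure by (rule PR.current_data)
  have inter: "enn2ereal (intersection_form \<Gamma> CD.gcur (curve_current \<Gamma> \<gamma>)) = k_length \<upsilon> k (\<rho> \<gamma>)"
   if "\<gamma> \<in> \<Gamma>" "\<gamma> ~= \<one>\<^bsub>pi1 \<Gamma>\<^esub>" for \<gamma> using PR.length_data[OF that] by metis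
  have "emeasure CD.gcur (space CD.gcur) ~= 0"
  proof
   assume "emeasure CD.gcur (space CD.gcur) = 0"
   hence "intersection_form \<Gamma> CD.gcur (curve_current \<Gamma> \<gamma>0) = 0"
    using PR.length_data[OF g0(1,2)] CD.gcur(2) by metis
   thus False using inter[OF g0(1,2)] g0(3) by (simp add: zero_ennreal.rep_eq)
  qed
  moreover have "\<upsilon> (abs_trace (\<rho> \<gamma>0)) < 0"
  proof -
   obtain A E F G H where fp: "valued_fixed_flag_pair \<upsilon> A E F G H (\<rho> \<gamma>0)" using PR.length_data[OF g0(1,2)] by metis
   interpret FP: valued_fixed_flag_pair \<upsilon> A E F G H "\<rho> \<gamma>0" by (rule fp)
   show ?thesis using FP.trace_valuation_neg[OF k] FP.k_length_eq[OF k] g0(3) by auto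
  qed
  ultimately show ?thesis using CD.gcur_current inter g0(1) by blast
 next
  case False
  interpret CD: current_data \<Gamma> "null_measure borel" by (rule PR.null_current_data)
  have fp0: "\<exists>A E F G H. valued_fixed_flag_pair \<upsilon> A E F G H (\<rho> \<gamma>)" "intersection_form \<Gamma> CD.gcur (curve_current \<Gamma> \<gamma>) = 0"
   if "\<gamma> \<in> \<Gamma>" "\<gamma> ~= \<one>\<^bsub>pi1 \<Gamma>\<^esub>" for \<gamma>
  proof -
   show "\<exists>A E F G H. valued_fixed_flag_pair \<upsilon> A E F G H (\<rho> \<gamma>)" using PR.length_data[OF that] by metis
   have "emeasure (null_measure borel) (UNIV :: (real \<times> real) set) = 0" by simp
   thus "intersection_form \<Gamma> CD.gcur (curve_current \<Gamma> \<gamma>) = 0"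
    using PR.length_data[OF that] PR.null_current_data by metis
  qed
  \<comment> \<open>Over the reals the bound is obtained from a contradiction: there the norm is
    strictly monotone, so strictly decreasing eigenvalues give non-trivial elements non-zero length,
    against the case assumption.\<close>
  have nat: "PR.nv (of_nat CARD('n)) <= 1"
  proof (cases "surj (of_real :: real => 'f)")
   case True
   have nr: "PR.nv (of_real r) = \<bar>r\<bar>" if "r ~= 0" for r :: real
    using real_case[OF True] that by (simp add: valuation_norm_def)
   have strict: "PR.nv x < PR.nv y" if xy: "0 < x" "x < y" for x y
   proof -
    obtain a b where ab: "x = of_real a" "y = of_real b" using True by (metis surjD)
    have "0 < a" "a < b"
     using xy of_real_less_iff[of 0 a, where 'f = 'f] of_real_less_iff[of a b, where 'f = 'f] by (simp_all add: ab)
    thus ?thesis using nr[of a] nr[of b] by (simp add: ab)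
   qed
   obtain \<gamma> where g: "\<gamma> \<in> \<Gamma>" "\<gamma> ~= \<one>\<^bsub>pi1 \<Gamma>\<^esub>" using PR.nontrivial by blast
   obtain A E F G H where fp: "valued_fixed_flag_pair \<upsilon> A E F G H (\<rho> \<gamma>)" using fp0(1)[OF g] by blast
   interpret FP: valued_fixed_flag_pair \<upsilon> A E F G H "\<rho> \<gamma>" by (rule fp)
   have "k_length \<upsilon> k (\<rho> \<gamma>) ~= 0"
    using FP.period_pos_if_nv_strict[OF k strict] FP.k_length_eq[OF k] by simp
   thus ?thesis using False g by blast
  next
   case False
   then obtain y :: 'f where "\<forall>n::nat. of_nat n < y" using infinite_element by blast
   thus ?thesis by (intro PR.nv_nat_le_1[of y]) auto
  qed
  have "\<not> \<upsilon> (abs_trace (\<rho> \<gamma>)) < 0" if g: "\<gamma> \<in> \<Gamma>" for \<gamma>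
  proof (cases "\<gamma> = \<one>\<^bsub>pi1 \<Gamma>\<^esub>")
   case True
   thus ?thesis using PR.abs_trace_one nat by (simp add: PR.val_neg_iff)
  next
   case ne: False
   obtain A E F G H where fp: "valued_fixed_flag_pair \<upsilon> A E F G H (\<rho> \<gamma>)" using fp0(1)[OF g ne] by blast
   interpret FP: valued_fixed_flag_pair \<upsilon> A E F G H "\<rho> \<gamma>" by (rule fp)
   have "k_length \<upsilon> k (\<rho> \<gamma>) = 0" using False g ne by blast
   hence "ln (PR.nv (FP.ev_low k / FP.ev_high k)) = 0" using FP.k_length_eq[OF k] by simp
   thus ?thesis by (rule FP.trace_valuation_nonneg[OF k _ nat])
  qed
  moreover have "emeasure CD.gcur (space CD.gcur) = 0"
   using CD.gcur(3)[of geodesics] CD.gcur(2) sets.top[of geodesic_borel] geodesic_borel(1) by simp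
  moreover have "enn2ereal (intersection_form \<Gamma> CD.gcur (curve_current \<Gamma> \<gamma>)) = k_length \<upsilon> k (\<rho> \<gamma>)"
   if "\<gamma> \<in> \<Gamma>" "\<gamma> ~= \<one>\<^bsub>pi1 \<Gamma>\<^esub>" for \<gamma>
   using fp0(2)[OF that] False that by (metis zero_ennreal.rep_eq)
  ultimately show ?thesis using CD.gcur_current by blast
 qed
qed

end
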